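(* Let $\Bbbk$ be a field. Let $A$ be an augmented differential graded $\Bbbk$-algebra with augmentation $\varepsilon:A\to\Bbbk$. Suppose that $A$ is non-negatively upper graded and that $H^0(\varepsilon):H^0(A)\to\Bbbk$ is an isomorphism. Let $c\in HH_d(A,A)$ and let $[m]\in\mathrm{Tor}^A_d(\Bbbk,\Bbbk)$ be the image of $c$ under $HH_d(A,\varepsilon):HH_d(A,A)\to HH_d(A,\Bbbk)=\mathrm{Tor}^A_d(\Bbbk,\Bbbk)$. Suppose that - there exists a positive integer $n$ such that $\mathrm{Tor}^A_i(\Bbbk,\Bbbk)=0$ for all $i\le -n$ and all $i\ge n$; - each $\mathrm{Tor}^A_i(\Bbbk,\Bbbk)$, $i\in\mathbb Z$, is of finite type; - the morphism of right $\mathrm{Ext}_A^*(\Bbbk,\Bbbk)$-modules $\mathrm{Ext}^p_A(\Bbbk,\Bbbk)\to\mathrm{Tor}^A_{d-p}(\Bbbk,\Bbbk)$, $a\mapsto[m]\cap a$, is an isomorphism. Then for any non-negatively upper graded differential graded $A$-bimodule $N$, the morphism $$\mathbb{D}^{-1}:HH^p(A,N)\to HH_{d-p}(A,N),\quad a\mapsto c\cap a,$$ is an isomorphism.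
   Context: An element of lower degree $i$ has upper degree $-i$; differentials have lower degree $-1$. $\mathcal C_*(A,N)=N\otimes_{A^e}B(A;A;A)=(N\otimes T(sA),d_0+d_1)$ is the Hochschild chain complex, with elements $m[a_1|\dots|a_n]$, $(sA)_i=A_{i-1}$ (lower degrees); $\mathcal C^*(A,N)=\mathrm{Hom}_{A^e}(B(A;A;A),N)\cong(\mathrm{Hom}(T(sA),N),D_0+D_1)$ is the Hochschild cochain complex; here $B(A;A;A)$ is the bar resolution. $HH_*(A,N)$ (indexed by lower degree) and $HH^*(A,N)$ (indexed by upper degree) are their homologies; $\mathrm{Tor}^A_*(\Bbbk,\Bbbk)=HH_*(A,\Bbbk)$ and $\mathrm{Ext}^*_A(\Bbbk,\Bbbk)=HH^*(A,\Bbbk)$ (differential graded Tor and Ext), with $\Bbbk$ a bimodule via $\varepsilon$. For $B'=A$ or $B'=\Bbbk$ and $N$ a $B'$-bimodule, the cap product $\mathcal C_*(A,B')\otimes\mathcal C^*(A,N)\to\mathcal C_*(A,N)$ is $$(m[a_1|\dots|a_n])\cap f=\sum_{p=0}^n(-1)^{|f|(|a_1|+\dots+|a_n|+n)}\,m\cdot f([a_1|\dots|a_p])[a_{p+1}|\dots|a_n].$$ *)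

theory Defs
  imports Complex_Main "HOL-Library.Poly_Mapping" "HOL-Library.Function_Algebras"
begin

text \<open>
  All degrees are lower degrees (differentials have degree \<open>-1\<close>); an element of lower degree
  \<open>i\<close> has upper degree \<open>-i\<close>, so upper degree \<open>p\<close> is written \<open>- p\<close>.
\<close>

section \<open>Homology of complexes presented by generators and relations\<close>

text \<open>
  A complex of vector spaces is given by subspaces \<open>part C i\<close> of an ambient vector space and a
  subspace \<open>rel C\<close> of relations: the space of degree \<open>i\<close> elements is the image of \<open>part C i\<close> in
  the quotient by \<open>rel C\<close>, so equality in the complex means that the difference lies in \<open>rel C\<close>.
  The differential \<open>bd C i\<close> leaves degree \<open>i\<close>; it may depend on \<open>i\<close> because the Hochschild
  codifferential has signs involving the degree of the cochain.
\<close>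

record ('k, 'v) pcomplex =
  csc :: "'k \<Rightarrow> 'v \<Rightarrow> 'v"
  part :: "int \<Rightarrow> 'v set"
  rel :: "'v set"
  bd :: "int \<Rightarrow> 'v \<Rightarrow> 'v"

definition cycles :: "('k, 'v::ab_group_add) pcomplex \<Rightarrow> int \<Rightarrow> 'v set" where
  "cycles C i = {x \<in> part C i. bd C i x \<in> rel C}"

definition homologous :: "('k, 'v::ab_group_add) pcomplex \<Rightarrow> int \<Rightarrow> ('v \<times> 'v) set" where
  "homologous C i = {(x, y). x \<in> cycles C i \<and> y \<in> cycles C i \<and>
     (\<exists>z \<in> part C (i + 1). x - y - bd C (i + 1) z \<in> rel C)}"

definition homology :: "('k, 'v::ab_group_add) pcomplex \<Rightarrow> int \<Rightarrow> 'v set set" where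
  "homology C i = cycles C i // homologous C i"

definition hzero :: "('k, 'v::ab_group_add) pcomplex \<Rightarrow> int \<Rightarrow> 'v set" where
  "hzero C i = homologous C i `` {0}"

definition hadd :: "('k, 'v::ab_group_add) pcomplex \<Rightarrow> int \<Rightarrow> 'v set \<Rightarrow> 'v set \<Rightarrow> 'v set" where
  "hadd C i \<alpha> \<beta> = (\<Union>x\<in>\<alpha>. \<Union>y\<in>\<beta>. homologous C i `` {x + y})"

definition hscale :: "('k, 'v::ab_group_add) pcomplex \<Rightarrow> int \<Rightarrow> 'k \<Rightarrow> 'v set \<Rightarrow> 'v set" where
  "hscale C i r \<alpha> = (\<Union>x\<in>\<alpha>. homologous C i `` {csc C r x})"

definition homology_zero :: "('k, 'v::ab_group_add) pcomplex \<Rightarrow> int \<Rightarrow> bool" where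
  "homology_zero C i \<longleftrightarrow> homology C i = {hzero C i}"

definition homology_finite_dim :: "('k::field, 'v::ab_group_add) pcomplex \<Rightarrow> int \<Rightarrow> bool" where
  "homology_finite_dim C i \<longleftrightarrow>
     (\<exists>S. finite S \<and> S \<subseteq> cycles C i \<and>
        (\<forall>z \<in> cycles C i. \<exists>y \<in> module.span (csc C) S. (z, y) \<in> homologous C i))"

definition homology_iso ::
  "('k, 'v::ab_group_add) pcomplex \<Rightarrow> int \<Rightarrow> ('k, 'w::ab_group_add) pcomplex \<Rightarrow> int \<Rightarrow>
     ('v set \<Rightarrow> 'w set) \<Rightarrow> bool" where
  "homology_iso C i C' j \<Phi> \<longleftrightarrow>
     bij_betw \<Phi> (homology C i) (homology C' j) \<and>
     (\<forall>\<alpha> \<in> homology C i. \<forall>\<beta> \<in> homology C i.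
        \<Phi> (hadd C i \<alpha> \<beta>) = hadd C' j (\<Phi> \<alpha>) (\<Phi> \<beta>)) \<and>
     (\<forall>r. \<forall>\<alpha> \<in> homology C i. \<Phi> (hscale C i r \<alpha>) = hscale C' j r (\<Phi> \<alpha>))"

text \<open>The map on homology classes induced by a map \<open>\<phi>\<close> into \<open>C'\<close>: \<open>[x] \<mapsto> [\<phi> x]\<close>.\<close>

definition hmap ::
  "('w \<Rightarrow> 'v) \<Rightarrow> ('k, 'v::ab_group_add) pcomplex \<Rightarrow> int \<Rightarrow> 'w set \<Rightarrow> 'v set" where
  "hmap \<phi> C' j \<alpha> = (\<Union>x\<in>\<alpha>. homologous C' j `` {\<phi> x})"


section \<open>Differential graded algebras and bimodules\<close>

record ('k, 'v) dg =
  scl :: "'k \<Rightarrow> 'v \<Rightarrow> 'v"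
  gr :: "int \<Rightarrow> 'v set"
  dif :: "'v \<Rightarrow> 'v"

record ('k, 'a, 'v) dg_bimod = "('k, 'v) dg" +
  lact :: "'a \<Rightarrow> 'v \<Rightarrow> 'v"
  ract :: "'v \<Rightarrow> 'a \<Rightarrow> 'v"

locale dg_space = vector_space "scl V"
  for V :: "('k::field, 'v::ab_group_add, 'z) dg_scheme" +
  assumes gr_subspace: "subspace (gr V i)"
    and gr_direct_sum: "\<exists>!f :: int \<Rightarrow> 'v.
      finite {i. f i \<noteq> 0} \<and> (\<forall>i. f i \<in> gr V i) \<and> x = (\<Sum>i | f i \<noteq> 0. f i)"
    and dif_linear: "Vector_Spaces.linear (scl V) (scl V) (dif V)"
    and dif_degree: "x \<in> gr V i \<Longrightarrow> dif V x \<in> gr V (i - 1)"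
    and dif_dif: "dif V (dif V x) = 0"

text \<open>Multiplication and unit of the algebra are those of the type \<open>'a\<close>.\<close>

locale dg_algebra = dg_space A for A :: "('k::field, 'a::ring_1) dg" +
  assumes scl_mult_left: "scl A r a * b = scl A r (a * b)"
    and scl_mult_right: "a * scl A r b = scl A r (a * b)"
    and one_degree: "1 \<in> gr A 0"
    and mult_degree: "a \<in> gr A i \<Longrightarrow> b \<in> gr A j \<Longrightarrow> a * b \<in> gr A (i + j)"
    and dif_mult: "a \<in> gr A i \<Longrightarrow> dif A (a * b) = dif A a * b + scl A ((-1) powi i) (a * dif A b)"

locale augmented_dg_algebra = dg_algebra A
  for A :: "('k::field, 'a::ring_1) dg" and \<epsilon> :: "'a \<Rightarrow> 'k" +
  assumes aug_linear: "Vector_Spaces.linear (scl A) (*) \<epsilon>"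
    and aug_mult: "\<epsilon> (a * b) = \<epsilon> a * \<epsilon> b"
    and aug_one: "\<epsilon> 1 = 1"
    and aug_degree: "a \<in> gr A i \<Longrightarrow> i \<noteq> 0 \<Longrightarrow> \<epsilon> a = 0"
    and aug_dif: "\<epsilon> (dif A a) = 0"

locale dg_bimodule = A: dg_algebra A + dg_space M
  for A :: "('k::field, 'a::ring_1) dg" and M :: "('k, 'a, 'm::ab_group_add) dg_bimod" +
  assumes lact_linear: "Vector_Spaces.linear (scl M) (scl M) (lact M a)"
    and lact_linear': "Vector_Spaces.linear (scl A) (scl M) (\<lambda>a. lact M a x)"
    and ract_linear: "Vector_Spaces.linear (scl M) (scl M) (\<lambda>x. ract M x a)"
    and ract_linear': "Vector_Spaces.linear (scl A) (scl M) (ract M x)"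
    and lact_one: "lact M 1 x = x"
    and ract_one: "ract M x 1 = x"
    and lact_mult: "lact M (a * b) x = lact M a (lact M b x)"
    and ract_mult: "ract M x (a * b) = ract M (ract M x a) b"
    and lact_ract: "lact M a (ract M x b) = ract M (lact M a x) b"
    and lact_degree: "a \<in> gr A i \<Longrightarrow> x \<in> gr M j \<Longrightarrow> lact M a x \<in> gr M (i + j)"
    and ract_degree: "x \<in> gr M j \<Longrightarrow> a \<in> gr A i \<Longrightarrow> ract M x a \<in> gr M (j + i)"
    and dif_lact: "a \<in> gr A i \<Longrightarrow>
      dif M (lact M a x) = lact M (dif A a) x + scl M ((-1) powi i) (lact M a (dif M x))"
    and dif_ract: "x \<in> gr M j \<Longrightarrow>
      dif M (ract M x a) = ract M (dif M x) a + scl M ((-1) powi j) (ract M x (dif A a))"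

definition nonneg_upper_graded :: "('k, 'v::zero, 'z) dg_scheme \<Rightarrow> bool" where
  "nonneg_upper_graded V \<longleftrightarrow> (\<forall>i > 0. gr V i = {0})"

definition underlying_complex :: "('k, 'v::zero, 'z) dg_scheme \<Rightarrow> ('k, 'v) pcomplex" where
  "underlying_complex V = \<lparr>csc = scl V, part = gr V, rel = {0}, bd = (\<lambda>_. dif V)\<rparr>"

definition regular_bimod :: "('k, 'a::ring_1) dg \<Rightarrow> ('k, 'a, 'a) dg_bimod" where
  "regular_bimod A = \<lparr>scl = scl A, gr = gr A, dif = dif A, lact = (*), ract = (*)\<rparr>"

text \<open>The ground field, concentrated in degree \<open>0\<close>, as a bimodule via the augmentation.\<close>

definition trivial_bimod :: "('a \<Rightarrow> 'k::field) \<Rightarrow> ('k, 'a, 'k) dg_bimod" where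
  "trivial_bimod \<epsilon> = \<lparr>scl = (*), gr = (\<lambda>i. if i = 0 then UNIV else {0}), dif = (\<lambda>_. 0),
     lact = (\<lambda>a x. \<epsilon> a * x), ract = (\<lambda>x a. x * \<epsilon> a)\<rparr>"


section \<open>Hochschild chains\<close>

text \<open>
  A homogeneous element is recorded together with its degree, since degrees enter the signs.
  A list \<open>[(a\<^sub>1, i\<^sub>1), \<dots>, (a\<^sub>n, i\<^sub>n)]\<close> stands for \<open>[a\<^sub>1|\<dots>|a\<^sub>n] \<in> T(sA)\<close>, and
  \<open>((m, j), [(a\<^sub>1, i\<^sub>1), \<dots>])\<close> for \<open>m[a\<^sub>1|\<dots>|a\<^sub>n] \<in> N \<otimes> T(sA)\<close>. The tensor product is the free
  vector space on these symbols modulo the multilinearity relations \<open>chain_relations\<close>.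
\<close>

type_synonym 'a word = "('a \<times> int) list"
type_synonym ('m, 'a) bar_gen = "('m \<times> int) \<times> 'a word"
type_synonym ('k, 'm, 'a) chain = "('m, 'a) bar_gen \<Rightarrow>\<^sub>0 'k"

definition is_word :: "('k, 'a, 'z) dg_scheme \<Rightarrow> 'a word \<Rightarrow> bool" where
  "is_word A w \<longleftrightarrow> (\<forall>(a, i) \<in> set w. a \<in> gr A i)"

text \<open>The degree of \<open>[a\<^sub>1|\<dots>|a\<^sub>n]\<close>, with \<open>a\<close> of degree \<open>i\<close> having degree \<open>i + 1\<close> in \<open>sA\<close>.\<close>

definition sdeg :: "'a word \<Rightarrow> int" where
  "sdeg w = (\<Sum>(a, i)\<leftarrow>w. i + 1)"

definition pure :: "'m \<times> int \<Rightarrow> 'a word \<Rightarrow> ('k::field, 'm, 'a) chain" where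
  "pure m w = Poly_Mapping.single (m, w) 1"

definition chain_scale :: "'k::field \<Rightarrow> ('k, 'm, 'a) chain \<Rightarrow> ('k, 'm, 'a) chain" where
  "chain_scale r x = Poly_Mapping.map ((*) r) x"

definition chain_relations ::
  "('k::field, 'a::ring_1) dg \<Rightarrow> ('k, 'a, 'm::ab_group_add) dg_bimod \<Rightarrow>
     ('k, 'm, 'a) chain set" where
  "chain_relations A N = module.span chain_scale
     ({pure (x + y, j) w - pure (x, j) w - pure (y, j) w | x y j w.
         x \<in> gr N j \<and> y \<in> gr N j \<and> is_word A w} \<union>
      {pure (scl N r x, j) w - chain_scale r (pure (x, j) w) | r x j w.
         x \<in> gr N j \<and> is_word A w} \<union>
      {pure (x, j) (u @ (a + b, i) # w) - pure (x, j) (u @ (a, i) # w)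
         - pure (x, j) (u @ (b, i) # w) | x j u a b i w.
         x \<in> gr N j \<and> a \<in> gr A i \<and> b \<in> gr A i \<and> is_word A u \<and> is_word A w} \<union>
      {pure (x, j) (u @ (scl A r a, i) # w) - chain_scale r (pure (x, j) (u @ (a, i) # w))
         | r x j u a i w.
         x \<in> gr N j \<and> a \<in> gr A i \<and> is_word A u \<and> is_word A w})"

definition chain_part ::
  "('k::field, 'a::ring_1) dg \<Rightarrow> ('k, 'a, 'm::ab_group_add) dg_bimod \<Rightarrow> int \<Rightarrow>
     ('k, 'm, 'a) chain set" where
  "chain_part A N i = module.span chain_scale
     {pure (x, j) w | x j w. x \<in> gr N j \<and> is_word A w \<and> j + sdeg w = i}"

definition chain_lin ::
  "(('m, 'a) bar_gen \<Rightarrow> ('k::field, 'n, 'b) chain) \<Rightarrow> ('k, 'm, 'a) chain \<Rightarrow> ('k, 'n, 'b) chain" where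
  "chain_lin \<phi> x = (\<Sum>g \<in> Poly_Mapping.keys x. chain_scale (Poly_Mapping.lookup x g) (\<phi> g))"

text \<open>
  With \<open>\<epsilon>\<^sub>i = |m| + |sa\<^sub>1| + \<dots> + |sa\<^sub>i\<^sub>-\<^sub>1|\<close>, the differential of \<open>m[a\<^sub>1|\<dots>|a\<^sub>n]\<close> obtained from that
  of the bar resolution is the sum of
  \<open>dm[a\<^sub>1|\<dots>|a\<^sub>n] - \<Sum>\<^sub>i (-1)^\<epsilon>\<^sub>i m[a\<^sub>1|\<dots>|da\<^sub>i|\<dots>|a\<^sub>n]\<close> and, for \<open>n > 0\<close>,
  \<open>(-1)^|m| ma\<^sub>1[a\<^sub>2|\<dots>|a\<^sub>n] + \<Sum>\<^sub>i\<^sub>\<ge>\<^sub>2 (-1)^\<epsilon>\<^sub>i m[a\<^sub>1|\<dots>|a\<^sub>i\<^sub>-\<^sub>1a\<^sub>i|\<dots>|a\<^sub>n]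
    - (-1)^(|sa\<^sub>n|\<epsilon>\<^sub>n) a\<^sub>nm[a\<^sub>1|\<dots>|a\<^sub>n\<^sub>-\<^sub>1]\<close>.
  In the code positions in the word are counted from \<open>0\<close>.
\<close>

fun chain_d0 ::
  "('k::field, 'a::ring_1) dg \<Rightarrow> ('k, 'a, 'm::ab_group_add) dg_bimod \<Rightarrow>
     ('m, 'a) bar_gen \<Rightarrow> ('k, 'm, 'a) chain" where
  "chain_d0 A N ((x, j), w) =
     pure (dif N x, j - 1) w
     - (\<Sum>t < length w. chain_scale ((-1) powi (j + sdeg (take t w)))
          (pure (x, j) (w[t := (dif A (fst (w ! t)), snd (w ! t) - 1)])))"

fun chain_d1 ::
  "('k::field, 'a::ring_1) dg \<Rightarrow> ('k, 'a, 'm::ab_group_add) dg_bimod \<Rightarrow>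
     ('m, 'a) bar_gen \<Rightarrow> ('k, 'm, 'a) chain" where
  "chain_d1 A N ((x, j), w) =
     (if w = [] then 0 else
        chain_scale ((-1) powi j) (pure (ract N x (fst (hd w)), j + snd (hd w)) (tl w))
        + (\<Sum>t < length w - 1. chain_scale ((-1) powi (j + sdeg (take (t + 1) w)))
             (pure (x, j) (take t w
                @ (fst (w ! t) * fst (w ! (t + 1)), snd (w ! t) + snd (w ! (t + 1)))
                # drop (t + 2) w)))
        - chain_scale ((-1) powi ((snd (last w) + 1) * (j + sdeg (butlast w))))
            (pure (lact N (fst (last w)) x, snd (last w) + j) (butlast w)))"

definition hochschild_chains ::
  "('k::field, 'a::ring_1) dg \<Rightarrow> ('k, 'a, 'm::ab_group_add) dg_bimod \<Rightarrow>
     ('k, ('k, 'm, 'a) chain) pcomplex" where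
  "hochschild_chains A N = \<lparr>csc = chain_scale, part = chain_part A N, rel = chain_relations A N,
     bd = (\<lambda>_. chain_lin (\<lambda>g. chain_d0 A N g + chain_d1 A N g))\<rparr>"

text \<open>The chain map \<open>m[a\<^sub>1|\<dots>|a\<^sub>n] \<mapsto> h(m)[a\<^sub>1|\<dots>|a\<^sub>n]\<close> for a degree \<open>0\<close> map \<open>h\<close> of coefficients.\<close>

definition chain_coeff_map ::
  "('m \<Rightarrow> 'n) \<Rightarrow> ('k::field, 'm, 'a) chain \<Rightarrow> ('k, 'n, 'a) chain" where
  "chain_coeff_map h = chain_lin (\<lambda>((x, j), w). pure (h x, j) w)"


section \<open>Hochschild cochains\<close>

text \<open>
  By the universal property of \<open>T(sA)\<close>, a homogeneous element of \<open>Hom(T(sA), N)\<close> is a function on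
  the symbols \<open>[a\<^sub>1|\<dots>|a\<^sub>n]\<close>, \<open>n \<ge> 0\<close>, linear in every entry. Values on lists that are not words
  carry no information and are set to \<open>0\<close>, so that equality of functions is equality of cochains.
\<close>

definition cochain_part ::
  "('k::field, 'a::ring_1) dg \<Rightarrow> ('k, 'a, 'm::ab_group_add) dg_bimod \<Rightarrow> int \<Rightarrow>
     ('a word \<Rightarrow> 'm) set" where
  "cochain_part A N i = {f.
     (\<forall>w. is_word A w \<longrightarrow> f w \<in> gr N (i + sdeg w)) \<and>
     (\<forall>w. \<not> is_word A w \<longrightarrow> f w = 0) \<and>
     (\<forall>u w a b l. is_word A u \<and> is_word A w \<and> a \<in> gr A l \<and> b \<in> gr A l \<longrightarrow>
        f (u @ (a + b, l) # w) = f (u @ (a, l) # w) + f (u @ (b, l) # w)) \<and>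
     (\<forall>u w a r l. is_word A u \<and> is_word A w \<and> a \<in> gr A l \<longrightarrow>
        f (u @ (scl A r a, l) # w) = scl N r (f (u @ (a, l) # w)))}"

text \<open>
  The differential \<open>D f = d \<circ> f - (-1)^|f| f \<circ> d\<close> of bilinear maps out of the bar resolution,
  restricted to \<open>T(sA)\<close>, for \<open>f\<close> of degree \<open>i\<close>.
\<close>

definition cochain_D0 ::
  "('k::field, 'a::ring_1) dg \<Rightarrow> ('k, 'a, 'm::ab_group_add) dg_bimod \<Rightarrow> int \<Rightarrow>
     ('a word \<Rightarrow> 'm) \<Rightarrow> 'a word \<Rightarrow> 'm" where
  "cochain_D0 A N i f w =
     dif N (f w)
     + (\<Sum>t < length w. scl N ((-1) powi (i + sdeg (take t w)))
          (f (w[t := (dif A (fst (w ! t)), snd (w ! t) - 1)])))"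

definition cochain_D1 ::
  "('k::field, 'a::ring_1) dg \<Rightarrow> ('k, 'a, 'm::ab_group_add) dg_bimod \<Rightarrow> int \<Rightarrow>
     ('a word \<Rightarrow> 'm) \<Rightarrow> 'a word \<Rightarrow> 'm" where
  "cochain_D1 A N i f w =
     (if w = [] then 0 else
        - scl N ((-1) powi (i * (snd (hd w) + 1))) (lact N (fst (hd w)) (f (tl w)))
        - (\<Sum>t < length w - 1. scl N ((-1) powi (i + sdeg (take (t + 1) w)))
             (f (take t w
                @ (fst (w ! t) * fst (w ! (t + 1)), snd (w ! t) + snd (w ! (t + 1)))
                # drop (t + 2) w)))
        + scl N ((-1) powi (i + sdeg (butlast w))) (ract N (f (butlast w)) (fst (last w))))"

definition hochschild_cochains ::
  "('k::field, 'a::ring_1) dg \<Rightarrow> ('k, 'a, 'm::ab_group_add) dg_bimod \<Rightarrow>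
     ('k, 'a word \<Rightarrow> 'm) pcomplex" where
  "hochschild_cochains A N = \<lparr>csc = (\<lambda>r f w. scl N r (f w)), part = cochain_part A N, rel = {0},
     bd = (\<lambda>i f w. if is_word A w then cochain_D0 A N i f w + cochain_D1 A N i f w else 0)\<rparr>"


section \<open>Cap product\<close>

text \<open>
  \<open>act\<close> is the left action \<open>m \<cdot> n\<close> on \<open>N\<close> of the algebra \<open>B'\<close> (the dg algebra itself or the ground
  field) in which the chains have coefficients; the cochain \<open>f\<close> has lower degree \<open>i\<close>. Parities of
  lower and upper degrees agree.
\<close>

definition cap ::
  "('b \<Rightarrow> 'm \<Rightarrow> 'm) \<Rightarrow> int \<Rightarrow> ('k::field, 'b, 'a) chain \<Rightarrow> ('a word \<Rightarrow> 'm) \<Rightarrow>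
     ('k, 'm, 'a) chain" where
  "cap act i z f = chain_lin (\<lambda>((x, j), w).
     (\<Sum>q \<le> length w. chain_scale ((-1) powi (i * sdeg w))
        (pure (act x (f (take q w)), j + (i + sdeg (take q w))) (drop q w)))) z"

text \<open>\<open>\<gamma> \<inter> \<alpha>\<close> for \<open>\<gamma> \<in> HH\<^sub>d(A, B')\<close> and \<open>\<alpha> \<in> HH\<^sup>p(A, N)\<close>; the result is in degree \<open>d - p\<close>.\<close>

definition hcap ::
  "('b \<Rightarrow> 'm \<Rightarrow> 'm) \<Rightarrow> ('k::field, 'a::ring_1) dg \<Rightarrow> ('k, 'a, 'm::ab_group_add) dg_bimod \<Rightarrow>
     int \<Rightarrow> int \<Rightarrow> ('k, 'b, 'a) chain set \<Rightarrow> ('a word \<Rightarrow> 'm) set \<Rightarrow> ('k, 'm, 'a) chain set" where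
  "hcap act A N d p \<gamma> \<alpha> =
     (\<Union>z\<in>\<gamma>. \<Union>f\<in>\<alpha>. homologous (hochschild_chains A N) (d - p) `` {cap act (- p) z f})"


section \<open>Tor and Ext of the ground field\<close>

definition tor_complex ::
  "('k::field, 'a::ring_1) dg \<Rightarrow> ('a \<Rightarrow> 'k) \<Rightarrow> ('k, ('k, 'k, 'a) chain) pcomplex" where
  "tor_complex A \<epsilon> = hochschild_chains A (trivial_bimod \<epsilon>)"

definition ext_complex ::
  "('k::field, 'a::ring_1) dg \<Rightarrow> ('a \<Rightarrow> 'k) \<Rightarrow> ('k, 'a word \<Rightarrow> 'k) pcomplex" where
  "ext_complex A \<epsilon> = hochschild_cochains A (trivial_bimod \<epsilon>)"

end

theory Submission
  imports Defs
begin

text \<open>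
  In lower degrees \<open>A\<close> is concentrated in degrees \<open>\<le> 0\<close>, and since \<open>H\<^sub>0(A)\<close> is the ground field, \<open>A\<close>
  contracts to a subalgebra that is the ground field in degree \<open>0\<close>. After normalization, Hochschild
  chains and cochains may be computed with words whose letters have negative degrees, hence elements
  of \<open>sA\<close> of degree \<open>\<le> 0\<close>; for cochains this is an explicit homotopy, for chains it follows by duality.
  The cap product with a cycle \<open>z\<close> representing \<open>c\<close>, whose coefficients may be taken in the same
  subalgebra, respects the filtration of \<open>N\<close> by degree. In the associated graded, negative letters
  act by zero, so linear functionals and coordinates on \<open>N\<^sub>-\<^sub>p\<close> reduce the graded piece of degree
  \<open>-p\<close> of the mapping cone to the cone for trivial coefficients, which is acyclic because
  \<open>a \<mapsto> [m] \<inter> a\<close> is an isomorphism.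
  Eliminating the degrees \<open>0, -1, -2, \<dots>\<close> of the coefficients one after the other shows that the cone
  for \<open>N\<close> is acyclic.
\<close>

text \<open>Tensor products appear as free spaces modulo relations, so exactness of chain complexes
  is hard to reach directly. Over a field it can be dualized: a chain is a boundary up to relations
  once every cocycle with values in the dual of the coefficients vanishes on it. Each homotopy is
  therefore built once, for cochains, over coefficients weak enough to include duals.

  In the elimination of one degree of \<open>N\<close>, cochains and chains behave differently.
  Cochains with values in an infinite dimensional piece of \<open>N\<close> are in general not
  scalar cochains tensored with that piece, and primitives of \<open>l \<circ> f\<close> chosen for
  single functionals \<open>l\<close> need not fit together. The functionals only serve to show that
  \<open>f\<close> vanishes on cycles over the ground field; a linear factorization through the
  differential then gives one primitive for all of them. A chain involves finitely many basis
  vectors of the coefficients, so there coordinates suffice.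

  The cone is used because its exactness carries injectivity and surjectivity in all degrees at
  once: the chain component of a cocycle bounds the cap product of the cochain component, which is
  what forces the leading part of the latter to be a coboundary.\<close>

definition sg :: "int \<Rightarrow> 'v::ab_group_add \<Rightarrow> 'v" where
  "sg i x = (if even i then x else - x)"

lemma sg_simps [simp]:
  "sg i (0::'v::ab_group_add) = 0"
  "sg i (x + y) = sg i x + sg i (y::'v)"
  "sg i (x - y) = sg i x - sg i (y::'v)"
  "sg i (- x) = - sg i (x::'v)"
  "sg i (sg j x) = sg (i + j) (x::'v)"
  "sg 0 x = (x::'v)"
  by (auto simp: sg_def)

lemma sg_sum: "sg i (sum f S) = (\<Sum>x\<in>S. sg i (f x))"
  by (auto simp: sg_def sum_negf)

lemma sg_hom: "(\<And>x y. h (x + y) = h x + h y) \<Longrightarrow> h (sg i x) = sg i (h x)"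
proof -
  assume h: "\<And>x y. h (x + y) = h x + h y"
  have "h 0 = 0" using h[of 0 0] by simp
  then have "h (- x) = - h x" using h[of x "- x"] by (simp add: eq_neg_iff_add_eq_0 add.commute)
  then show ?thesis by (simp add: sg_def)
qed

lemma sg_mult: "sg i x * y = sg i (x * y)" "x * sg i y = sg i (x * (y::'r::ring))"
  by (auto simp: sg_def)

lemma sg_eq_iff [simp]: "sg i x = sg i y \<longleftrightarrow> x = (y::'v::ab_group_add)"
  by (auto simp: sg_def)

lemma sg_eq_0_iff [simp]: "sg i x = 0 \<longleftrightarrow> x = (0::'v::ab_group_add)"
  by (auto simp: sg_def)

lemma power_int_sg: "(-1::'k::field) powi i = sg i 1"
  by (auto simp: sg_def power_int_minus_left)

text \<open>The scalars \<open>(-1) powi i\<close> of the definitions become \<open>sg i\<close>,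
  which exists in every additive group and turns sign identities into case splits on
  parities.\<close>

lemma (in vector_space) scale_sg: "scale ((-1) powi i) x = sg i x"
  by (auto simp: sg_def power_int_sg)

lemma (in vector_space) scale_of_sg: "scale (sg i r) x = sg i (scale r x)" "scale r (sg i x) = sg i (scale r x)"
  by (auto simp: sg_def)

lemma (in vector_space) subspace_sg: "subspace S \<Longrightarrow> x \<in> S \<Longrightarrow> sg i x \<in> S"
  by (auto simp: sg_def subspace_neg)

lemma is_word_simps [simp]:
  "is_word A []"
  "is_word A (l # w) \<longleftrightarrow> fst l \<in> gr A (snd l) \<and> is_word A w"
  "is_word A (u @ w) \<longleftrightarrow> is_word A u \<and> is_word A w"
  by (auto simp: is_word_def)

lemma sdeg_simps [simp]:
  "sdeg [] = 0" "sdeg (l # w) = snd l + 1 + sdeg w" "sdeg (u @ w) = sdeg u + sdeg w"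
  by (auto simp: sdeg_def case_prod_unfold)

section \<open>Operators on multilinear functions of words\<close>

text \<open>A function of words is evaluated at a sum over the letters of a word: \<open>e\<close>
  acts at one letter, \<open>\<theta>\<close> on all letters to its left, and the sign is that of
  moving an odd operator past those letters of \<open>T(sA)\<close>. With \<open>\<theta>\<close>
  the identity this gives the bar differential, with a projection the usual extension of a
  contraction of \<open>A\<close> to words.\<close>

fun opr :: "(('a word \<Rightarrow> 'm::ab_group_add) \<Rightarrow> 'a \<Rightarrow> int \<Rightarrow> 'a word \<Rightarrow> 'm) \<Rightarrow> ('a \<Rightarrow> 'a) \<Rightarrow>
    ('a word \<Rightarrow> 'm) \<Rightarrow> 'a word \<Rightarrow> 'm" where
  "opr e \<theta> F [] = 0"
| "opr e \<theta> F ((a, i) # w) = e F a i w + sg (i + 1) (opr e \<theta> (\<lambda>v. F ((\<theta> a, i) # v)) w)"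

text \<open>Operators change the word only, so additive maps of the values pass through
  them.\<close>

lemma opr_hom:
  assumes L: "\<And>x y. L (x + y) = L x + L y"
    and e: "\<And>F a i w. L (e F a i w) = e' (\<lambda>v. L (F v)) a i w"
  shows "L (opr e \<theta> F w) = opr e' \<theta> (\<lambda>v. L (F v)) w"
proof (induction w arbitrary: F)
  case Nil
  then show ?case using L[of 0 0] by simp
next
  case (Cons l w)
  then show ?case by (cases l) (simp add: L e sg_hom[of L, OF L])
qed

lemma opr_add_e:
  assumes "\<And>F a i w. e F a i w = e1 F a i w + e2 F a i w"
  shows "opr e \<theta> F w = opr e1 \<theta> F w + opr e2 \<theta> F w"
proof (induction w arbitrary: F)
  case (Cons l w)
  then show ?case by (cases l) (simp add: assms)
qed simp

definition bd0E :: "('k, 'a::ring_1) dg \<Rightarrow> ('a word \<Rightarrow> 'm::ab_group_add) \<Rightarrow> 'a \<Rightarrow> int \<Rightarrow> 'a word \<Rightarrow> 'm" where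
  "bd0E A F a i w = - F ((dif A a, i - 1) # w)"

definition bd1E :: "('a::ring_1 word \<Rightarrow> 'm::ab_group_add) \<Rightarrow> 'a \<Rightarrow> int \<Rightarrow> 'a word \<Rightarrow> 'm" where
  "bd1E F a i w = (case w of [] \<Rightarrow> 0 | (b, j) # v \<Rightarrow> sg (i + 1) (F ((a * b, i + j) # v)))"

text \<open>
  \<open>bdel A F w\<close> is the value of \<open>F\<close>, extended linearly, at the differential of \<open>w\<close> in the bar
  construction, i.e. without the terms involving the actions on the coefficients.
\<close>

definition bd0 :: "('k, 'a::ring_1) dg \<Rightarrow> ('a word \<Rightarrow> 'm::ab_group_add) \<Rightarrow> 'a word \<Rightarrow> 'm" where
  "bd0 A = opr (bd0E A) (\<lambda>a. a)"

definition bd1 :: "('a::ring_1 word \<Rightarrow> 'm::ab_group_add) \<Rightarrow> 'a word \<Rightarrow> 'm" where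
  "bd1 = opr bd1E (\<lambda>a. a)"

definition bdel :: "('k, 'a::ring_1) dg \<Rightarrow> ('a word \<Rightarrow> 'm::ab_group_add) \<Rightarrow> 'a word \<Rightarrow> 'm" where
  "bdel A = opr (\<lambda>F a i w. bd0E A F a i w + bd1E F a i w) (\<lambda>a. a)"

lemma bd_split: "bdel A F w = bd0 A F w + bd1 F w"
  unfolding bdel_def bd0_def bd1_def by (rule opr_add_e) simp

lemma bd_Nil [simp]: "bdel A F [] = 0" "bd0 A F [] = 0" "bd1 F [] = 0"
  by (simp_all add: bdel_def bd0_def bd1_def)

lemma bd_Cons:
  "bdel A F ((a, i) # w) = - F ((dif A a, i - 1) # w)
     + (case w of [] \<Rightarrow> 0 | (b, j) # v \<Rightarrow> sg (i + 1) (F ((a * b, i + j) # v)))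
     + sg (i + 1) (bdel A (\<lambda>v. F ((a, i) # v)) w)"
  by (simp add: bdel_def bd0E_def bd1E_def)

lemma bd0_Cons: "bd0 A F ((a, i) # w) = - F ((dif A a, i - 1) # w)
     + sg (i + 1) (bd0 A (\<lambda>v. F ((a, i) # v)) w)"
  by (simp add: bd0_def bd0E_def)

lemma bd1_Cons: "bd1 F ((a, i) # w) =
     (case w of [] \<Rightarrow> 0 | (b, j) # v \<Rightarrow> sg (i + 1) (F ((a * b, i + j) # v)))
     + sg (i + 1) (bd1 (\<lambda>v. F ((a, i) # v)) w)"
  by (simp add: bd1_def bd1E_def)

lemma bd_hom:
  assumes L: "\<And>x y. L (x + y) = L x + L y"
  shows "L (bdel A F w) = bdel A (\<lambda>v. L (F v)) w"
proof -
  have 0: "L 0 = 0" using L[of 0 0] by simp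
  have m: "L (- x) = - L x" for x
    using L[of x "- x"] 0 by (simp add: eq_neg_iff_add_eq_0 add.commute)
  have d: "L (x - y) = L x - L y" for x y
    using L[of x "- y"] m by simp
  show ?thesis
    unfolding bdel_def
    by (rule opr_hom[OF L]) (auto simp: L m d 0 bd0E_def bd1E_def sg_hom[of L, OF L] split: list.splits)
qed

text \<open>Every word in the bar differential of \<open>w\<close> has degree
  \<open>sdeg w - 1\<close>, so a sign or label computed from the degree of the word may be replaced
  by a constant.\<close>

lemma bd_sdeg: "bdel A (\<lambda>v. F (sdeg v) v) w = bdel A (F (sdeg w - 1)) w"
proof (induction w arbitrary: F)
  case (Cons l w)
  obtain a i where l: "l = (a, i)" by force
  have "bdel A (\<lambda>v. F (sdeg ((a, i) # v)) ((a, i) # v)) w = bdel A (\<lambda>v. F (sdeg (l # w) - 1) ((a, i) # v)) w"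
    using Cons.IH[of "\<lambda>n v. F (i + 1 + n) ((a, i) # v)"] by (simp add: l algebra_simps)
  then show ?case
    by (auto simp: l bd_Cons algebra_simps split: list.splits)
qed simp

section \<open>Cochains with weak coefficients\<close>

text \<open>
  Only homogeneous elements are required to behave as in a differential graded bimodule, and no
  direct sum decomposition is assumed. This makes the linear dual of a bimodule an instance.
\<close>

locale weak_bimodule = A: dg_algebra A + M: vector_space "scl M"
  for A :: "('k::field, 'a::ring_1) dg" and M :: "('k, 'a, 'm::ab_group_add) dg_bimod" +
  assumes gr_sub: "M.subspace (gr M i)"
    and dif_add: "dif M (x + y) = dif M x + dif M y"
    and dif_scl: "dif M (scl M r x) = scl M r (dif M x)"
    and dif_gr: "x \<in> gr M j \<Longrightarrow> dif M x \<in> gr M (j - 1)"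
    and dif_dif: "x \<in> gr M j \<Longrightarrow> dif M (dif M x) = 0"
    and lact_add: "lact M a (x + y) = lact M a x + lact M a y"
    and lact_scl: "lact M a (scl M r x) = scl M r (lact M a x)"
    and ract_add: "ract M (x + y) a = ract M x a + ract M y a"
    and ract_scl: "ract M (scl M r x) a = scl M r (ract M x a)"
    and lact_add': "a \<in> gr A i \<Longrightarrow> b \<in> gr A i \<Longrightarrow> x \<in> gr M j \<Longrightarrow> lact M (a + b) x = lact M a x + lact M b x"
    and lact_scl': "a \<in> gr A i \<Longrightarrow> x \<in> gr M j \<Longrightarrow> lact M (scl A r a) x = scl M r (lact M a x)"
    and ract_add': "a \<in> gr A i \<Longrightarrow> b \<in> gr A i \<Longrightarrow> x \<in> gr M j \<Longrightarrow> ract M x (a + b) = ract M x a + ract M x b"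
    and ract_scl': "a \<in> gr A i \<Longrightarrow> x \<in> gr M j \<Longrightarrow> ract M x (scl A r a) = scl M r (ract M x a)"
    and lact_one: "x \<in> gr M j \<Longrightarrow> lact M 1 x = x"
    and ract_one: "x \<in> gr M j \<Longrightarrow> ract M x 1 = x"
    and lact_mult: "a \<in> gr A i \<Longrightarrow> b \<in> gr A l \<Longrightarrow> x \<in> gr M j \<Longrightarrow> lact M (a * b) x = lact M a (lact M b x)"
    and ract_mult: "a \<in> gr A i \<Longrightarrow> b \<in> gr A l \<Longrightarrow> x \<in> gr M j \<Longrightarrow> ract M x (a * b) = ract M (ract M x a) b"
    and lact_ract: "a \<in> gr A i \<Longrightarrow> b \<in> gr A l \<Longrightarrow> x \<in> gr M j \<Longrightarrow>
      lact M a (ract M x b) = ract M (lact M a x) b"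
    and lact_gr: "a \<in> gr A i \<Longrightarrow> x \<in> gr M j \<Longrightarrow> lact M a x \<in> gr M (i + j)"
    and ract_gr: "x \<in> gr M j \<Longrightarrow> a \<in> gr A i \<Longrightarrow> ract M x a \<in> gr M (j + i)"
    and dif_lact: "a \<in> gr A i \<Longrightarrow> x \<in> gr M j \<Longrightarrow>
      dif M (lact M a x) = lact M (dif A a) x + sg i (lact M a (dif M x))"
    and dif_ract: "x \<in> gr M j \<Longrightarrow> a \<in> gr A i \<Longrightarrow>
      dif M (ract M x a) = ract M (dif M x) a + sg j (ract M x (dif A a))"

text \<open>Unlike \<open>cochain_part\<close>, this does not prescribe zero on lists that are not
  words, so the operators below preserve it without case distinctions. The normalization off words
  is restored only when homology is formed.\<close>

definition coch :: "('k::field, 'a::ring_1) dg \<Rightarrow> ('k, 'a, 'm::ab_group_add) dg_bimod \<Rightarrow> int \<Rightarrow>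
    ('a word \<Rightarrow> 'm) \<Rightarrow> bool" where
  "coch A M i f \<longleftrightarrow> (\<forall>w. is_word A w \<longrightarrow> f w \<in> gr M (i + sdeg w)) \<and>
     (\<forall>u w a b l. is_word A u \<and> is_word A w \<and> a \<in> gr A l \<and> b \<in> gr A l \<longrightarrow>
        f (u @ (a + b, l) # w) = f (u @ (a, l) # w) + f (u @ (b, l) # w)) \<and>
     (\<forall>u w a r l. is_word A u \<and> is_word A w \<and> a \<in> gr A l \<longrightarrow>
        f (u @ (scl A r a, l) # w) = scl M r (f (u @ (a, l) # w)))"

lemma cochain_part_iff:
  "f \<in> cochain_part A M i \<longleftrightarrow> coch A M i f \<and> (\<forall>w. \<not> is_word A w \<longrightarrow> f w = 0)"
  by (auto simp: cochain_part_def coch_def)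

lemma cochI:
  assumes "\<And>w. is_word A w \<Longrightarrow> f w \<in> gr M (i + sdeg w)"
    and "\<And>u w a b l. is_word A u \<Longrightarrow> is_word A w \<Longrightarrow> a \<in> gr A l \<Longrightarrow> b \<in> gr A l \<Longrightarrow>
        f (u @ (a + b, l) # w) = f (u @ (a, l) # w) + f (u @ (b, l) # w)"
    and "\<And>u w a r l. is_word A u \<Longrightarrow> is_word A w \<Longrightarrow> a \<in> gr A l \<Longrightarrow>
        f (u @ (scl A r a, l) # w) = scl M r (f (u @ (a, l) # w))"
  shows "coch A M i f"
  using assms by (auto simp: coch_def)

lemma cochD:
  assumes "coch A M i f"
  shows "is_word A w \<Longrightarrow> f w \<in> gr M (i + sdeg w)"
    and "is_word A u \<Longrightarrow> is_word A w \<Longrightarrow> a \<in> gr A l \<Longrightarrow> b \<in> gr A l \<Longrightarrow>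
        f (u @ (a + b, l) # w) = f (u @ (a, l) # w) + f (u @ (b, l) # w)"
    and "is_word A u \<Longrightarrow> is_word A w \<Longrightarrow> a \<in> gr A l \<Longrightarrow>
        f (u @ (scl A r a, l) # w) = scl M r (f (u @ (a, l) # w))"
  using assms by (auto simp: coch_def)

lemma coch_hd:
  assumes "coch A M i f"
  shows "is_word A w \<Longrightarrow> a \<in> gr A l \<Longrightarrow> b \<in> gr A l \<Longrightarrow>
        f ((a + b, l) # w) = f ((a, l) # w) + f ((b, l) # w)"
    and "is_word A w \<Longrightarrow> a \<in> gr A l \<Longrightarrow>
        f ((scl A r a, l) # w) = scl M r (f ((a, l) # w))"
  using cochD(2,3)[OF assms, of "[]"] by auto

lemma coch_Cons:
  assumes "coch A M i f" "fst x \<in> gr A (snd x)"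
  shows "coch A M (i + snd x + 1) (\<lambda>v. f (x # v))"
proof (rule cochI)
  fix w assume "is_word A w"
  then show "f (x # w) \<in> gr M (i + snd x + 1 + sdeg w)"
    using cochD(1)[OF assms(1), of "x # w"] assms(2) by (simp add: algebra_simps)
qed (use cochD(2,3)[OF assms(1), of "x # _"] assms(2) in auto)

lemma coch_cong:
  assumes "coch A M i f" "\<And>w. is_word A w \<Longrightarrow> f w = g w" 
    and "\<And>l r a. a \<in> gr A l \<Longrightarrow> scl A r a \<in> gr A l" "\<And>l a b. a \<in> gr A l \<Longrightarrow> b \<in> gr A l \<Longrightarrow> a + b \<in> gr A l"
  shows "coch A M i g"
proof (rule cochI)
  fix w assume "is_word A w" then show "g w \<in> gr M (i + sdeg w)"
    using cochD(1)[OF assms(1)] assms(2) by metis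
next
  fix u w a b l assume *: "is_word A u" "is_word A w" "a \<in> gr A l" "b \<in> gr A l"
  have "f (u @ (a + b, l) # w) = f (u @ (a, l) # w) + f (u @ (b, l) # w)"
    using * by (rule cochD(2)[OF assms(1)])
  moreover have "f (u @ (a + b, l) # w) = g (u @ (a + b, l) # w)"
    "f (u @ (a, l) # w) = g (u @ (a, l) # w)" "f (u @ (b, l) # w) = g (u @ (b, l) # w)"
    by (rule assms(2); use * assms(4) in simp)+
  ultimately show "g (u @ (a + b, l) # w) = g (u @ (a, l) # w) + g (u @ (b, l) # w)" by metis
next
  fix u w a r l assume *: "is_word A u" "is_word A w" "a \<in> gr A l"
  have "f (u @ (scl A r a, l) # w) = scl M r (f (u @ (a, l) # w))"
    using * by (rule cochD(3)[OF assms(1)])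
  moreover have "f (u @ (scl A r a, l) # w) = g (u @ (scl A r a, l) # w)"
    "f (u @ (a, l) # w) = g (u @ (a, l) # w)"
    by (rule assms(2); use * assms(3) in simp)+
  ultimately show "g (u @ (scl A r a, l) # w) = scl M r (g (u @ (a, l) # w))" by metis
qed

context dg_space begin

lemma gr_intros [simp, intro]:
  "0 \<in> gr V i" "x \<in> gr V i \<Longrightarrow> y \<in> gr V i \<Longrightarrow> x + y \<in> gr V i" "x \<in> gr V i \<Longrightarrow> y \<in> gr V i \<Longrightarrow> x - y \<in> gr V i"
  "x \<in> gr V i \<Longrightarrow> - x \<in> gr V i" "x \<in> gr V i \<Longrightarrow> scl V r x \<in> gr V i"
  "x \<in> gr V i \<Longrightarrow> sg j x \<in> gr V i"
  by (simp_all add: subspace_0 subspace_add subspace_diff subspace_neg subspace_scale subspace_sg gr_subspace)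

lemma dif_simps [simp]:
  "dif V 0 = 0" "dif V (x + y) = dif V x + dif V y" "dif V (x - y) = dif V x - dif V y" "dif V (- x) = - dif V x"
  "dif V (scl V r x) = scl V r (dif V x)" "dif V (sg j x) = sg j (dif V x)"
proof -
  interpret d: Vector_Spaces.linear "scl V" "scl V" "dif V" by (rule dif_linear)
  show "dif V 0 = 0" "dif V (x + y) = dif V x + dif V y" "dif V (x - y) = dif V x - dif V y" "dif V (- x) = - dif V x"
  "dif V (scl V r x) = scl V r (dif V x)"
    by (simp_all add: d.zero d.add d.diff d.neg d.scale)
  show "dif V (sg j x) = sg j (dif V x)" by (rule sg_hom) (simp add: d.add)
qed

end

context dg_algebra begin

lemma dif_mult_sg: "a \<in> gr A i \<Longrightarrow> dif A (a * b) = dif A a * b + sg i (a * dif A b)"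
  using dif_mult scale_sg by simp

lemma dif_one [simp]: "dif A 1 = 0"
  using dif_mult_sg[OF one_degree, of 1] by simp

lemmas coch_congA = coch_cong[of A, OF _ _ gr_intros(5) gr_intros(2)]

end

context weak_bimodule begin

lemma gr_intros [simp, intro]:
  "0 \<in> gr M i" "x \<in> gr M i \<Longrightarrow> y \<in> gr M i \<Longrightarrow> x + y \<in> gr M i" "x \<in> gr M i \<Longrightarrow> y \<in> gr M i \<Longrightarrow> x - y \<in> gr M i"
  "x \<in> gr M i \<Longrightarrow> - x \<in> gr M i" "x \<in> gr M i \<Longrightarrow> scl M r x \<in> gr M i"
  "x \<in> gr M i \<Longrightarrow> sg j x \<in> gr M i"
  by (simp_all add: M.subspace_0 M.subspace_add M.subspace_diff M.subspace_neg M.subspace_scale M.subspace_sg gr_sub)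

lemma hom_simps [simp]:
  "dif M 0 = 0" "dif M (x - y) = dif M x - dif M y" "dif M (- x) = - dif M x" "dif M (sg j x) = sg j (dif M x)"
  "lact M a 0 = 0" "lact M a (x - y) = lact M a x - lact M a y" "lact M a (- x) = - lact M a x" "lact M a (sg j x) = sg j (lact M a x)"
  "ract M 0 a = 0" "ract M (x - y) a = ract M x a - ract M y a" "ract M (- x) a = - ract M x a" "ract M (sg j x) a = sg j (ract M x a)"
proof -
  have *: "h 0 = 0 \<and> h (x - y) = h x - h y \<and> h (- x) = - h x \<and> h (sg j x) = sg j (h x)"
    if h: "\<And>x y. h (x + y) = h x + h y" for h :: "'m \<Rightarrow> 'm"
  proof -
    have 0: "h 0 = 0" using h[of 0 0] by simp
    have m: "h (- x) = - h x" for x using h[of x "- x"] 0 by (simp add: eq_neg_iff_add_eq_0 add.commute)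
    show ?thesis using 0 m h[of x "- y"] sg_hom[of h, OF h] by simp
  qed
  show "dif M 0 = 0" "dif M (x - y) = dif M x - dif M y" "dif M (- x) = - dif M x" "dif M (sg j x) = sg j (dif M x)"
    using *[of "dif M", OF dif_add] by blast+
  show "lact M a 0 = 0" "lact M a (x - y) = lact M a x - lact M a y" "lact M a (- x) = - lact M a x" "lact M a (sg j x) = sg j (lact M a x)"
    using *[of "lact M a", OF lact_add] by blast+
  show "ract M 0 a = 0" "ract M (x - y) a = ract M x a - ract M y a" "ract M (- x) a = - ract M x a" "ract M (sg j x) a = sg j (ract M x a)"
    using *[of "\<lambda>x. ract M x a", OF ract_add] by blast+
qed

lemmas add_simps [simp] = dif_add dif_scl lact_add lact_scl ract_add ract_scl

lemma coch_closed:
  "coch A M i (\<lambda>w. 0)"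
  "coch A M i f \<Longrightarrow> coch A M i g \<Longrightarrow> coch A M i (\<lambda>w. f w + g w)"
  "coch A M i f \<Longrightarrow> coch A M i g \<Longrightarrow> coch A M i (\<lambda>w. f w - g w)"
  "coch A M i f \<Longrightarrow> coch A M i (\<lambda>w. - f w)"
  "coch A M i f \<Longrightarrow> coch A M i (\<lambda>w. scl M r (f w))"
  "coch A M i f \<Longrightarrow> coch A M i (\<lambda>w. sg n (f w))"
  by (auto simp: coch_def M.scale_right_distrib M.scale_right_diff_distrib M.scale_of_sg mult.commute)

lemma coch_zero_letter:
  assumes "coch A M i f" "is_word A u" "is_word A w"
  shows "f (u @ (0, l) # w) = 0"
  using cochD(3)[OF assms(1-3), of 0 l 0] by simp

lemma coch_zero_hd: "coch A M i f \<Longrightarrow> is_word A w \<Longrightarrow> f ((0, l) # w) = 0"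
  using coch_zero_letter[of i f "[]"] by simp

lemma coch_neg_letter:
  assumes "coch A M i f" "is_word A u" "is_word A w" "a \<in> gr A l"
  shows "f (u @ (- a, l) # w) = - f (u @ (a, l) # w)"
  using cochD(3)[OF assms, of "-1"] by simp

lemma coch_diff_letter:
  assumes "coch A M i f" "is_word A u" "is_word A w" "a \<in> gr A l" "b \<in> gr A l"
  shows "f (u @ (a - b, l) # w) = f (u @ (a, l) # w) - f (u @ (b, l) # w)"
  using cochD(2)[OF assms(1-4), of "-b"] coch_neg_letter[OF assms(1-3,5)] assms(5) by simp

lemma coch_sg_letter:
  assumes "coch A M i f" "is_word A u" "is_word A w" "a \<in> gr A l"
  shows "f (u @ (sg n a, l) # w) = sg n (f (u @ (a, l) # w))"
  using coch_neg_letter[OF assms] by (simp add: sg_def)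

lemmas coch_letter_hd =
  coch_neg_letter[of _ _ "[]", simplified] coch_diff_letter[of _ _ "[]", simplified]
  coch_sg_letter[of _ _ "[]", simplified] coch_zero_letter[of _ _ "[]", simplified]

text \<open>A local operation \<open>e\<close> of degree \<open>\<delta>\<close> on multilinear functions, natural enough for \<open>opr e \<theta>\<close>
  to be again such an operation.\<close>

definition local_op :: "(('a word \<Rightarrow> 'm) \<Rightarrow> 'a \<Rightarrow> int \<Rightarrow> 'a word \<Rightarrow> 'm) \<Rightarrow> int \<Rightarrow> bool" where
  "local_op e \<delta> \<longleftrightarrow>
     (\<forall>F G a l w. (\<forall>v. is_word A v \<longrightarrow> F v = G v) \<longrightarrow> is_word A ((a, l) # w) \<longrightarrow> e F a l w = e G a l w) \<and>
     (\<forall>F G a l w. e (\<lambda>v. F v + G v) a l w = e F a l w + e G a l w) \<and>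
     (\<forall>F r a l w. e (\<lambda>v. scl M r (F v)) a l w = scl M r (e F a l w)) \<and>
     (\<forall>i F a l. coch A M i F \<longrightarrow> a \<in> gr A l \<longrightarrow> coch A M (i + l + 1 + \<delta>) (e F a l)) \<and>
     (\<forall>i F a b l w. coch A M i F \<longrightarrow> a \<in> gr A l \<longrightarrow> b \<in> gr A l \<longrightarrow> is_word A w \<longrightarrow>
        e F (a + b) l w = e F a l w + e F b l w) \<and>
     (\<forall>i F a r l w. coch A M i F \<longrightarrow> a \<in> gr A l \<longrightarrow> is_word A w \<longrightarrow>
        e F (scl A r a) l w = scl M r (e F a l w))"

lemma local_opD:
  assumes e: "local_op e \<delta>"
  shows "(\<And>v. is_word A v \<Longrightarrow> F v = G v) \<Longrightarrow> is_word A ((a, l) # w) \<Longrightarrow> e F a l w = e G a l w"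
    and "e (\<lambda>v. F v + G v) a l w = e F a l w + e G a l w"
    and "e (\<lambda>v. scl M r (F v)) a l w = scl M r (e F a l w)"
    and "coch A M i F \<Longrightarrow> a \<in> gr A l \<Longrightarrow> coch A M (i + l + 1 + \<delta>) (e F a l)"
    and "coch A M i F \<Longrightarrow> a \<in> gr A l \<Longrightarrow> b \<in> gr A l \<Longrightarrow> is_word A w \<Longrightarrow>
        e F (a + b) l w = e F a l w + e F b l w"
    and "coch A M i F \<Longrightarrow> a \<in> gr A l \<Longrightarrow> is_word A w \<Longrightarrow>
        e F (scl A r a) l w = scl M r (e F a l w)"
proof -
  note c = e[unfolded local_op_def]
  show "(\<And>v. is_word A v \<Longrightarrow> F v = G v) \<Longrightarrow> is_word A ((a, l) # w) \<Longrightarrow> e F a l w = e G a l w"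
    by (rule c[THEN conjunct1, rule_format])
  show "e (\<lambda>v. F v + G v) a l w = e F a l w + e G a l w"
    by (rule c[THEN conjunct2, THEN conjunct1, rule_format])
  show "e (\<lambda>v. scl M r (F v)) a l w = scl M r (e F a l w)"
    by (rule c[THEN conjunct2, THEN conjunct2, THEN conjunct1, rule_format])
  show "coch A M i F \<Longrightarrow> a \<in> gr A l \<Longrightarrow> coch A M (i + l + 1 + \<delta>) (e F a l)"
    by (rule c[THEN conjunct2, THEN conjunct2, THEN conjunct2, THEN conjunct1, rule_format])
  show "coch A M i F \<Longrightarrow> a \<in> gr A l \<Longrightarrow> b \<in> gr A l \<Longrightarrow> is_word A w \<Longrightarrow>
        e F (a + b) l w = e F a l w + e F b l w"
    by (rule c[THEN conjunct2, THEN conjunct2, THEN conjunct2, THEN conjunct2, THEN conjunct1, rule_format])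
  show "coch A M i F \<Longrightarrow> a \<in> gr A l \<Longrightarrow> is_word A w \<Longrightarrow>
        e F (scl A r a) l w = scl M r (e F a l w)"
    by (rule c[THEN conjunct2, THEN conjunct2, THEN conjunct2, THEN conjunct2, THEN conjunct2, rule_format])
qed

definition letter_map :: "('a \<Rightarrow> 'a) \<Rightarrow> bool" where
  "letter_map \<theta> \<longleftrightarrow> (\<forall>a b. \<theta> (a + b) = \<theta> a + \<theta> b) \<and> (\<forall>r a. \<theta> (scl A r a) = scl A r (\<theta> a)) \<and>
     (\<forall>a l. a \<in> gr A l \<longrightarrow> \<theta> a \<in> gr A l)"

lemma letter_map_id: "letter_map (\<lambda>a. a)"
  by (simp add: letter_map_def)

context
  fixes e :: "('a word \<Rightarrow> 'm) \<Rightarrow> 'a \<Rightarrow> int \<Rightarrow> 'a word \<Rightarrow> 'm" and \<delta> and \<theta> :: "'a \<Rightarrow> 'a"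
  assumes e: "local_op e \<delta>" and \<theta>: "letter_map \<theta>"
begin

lemma opr_cong:
  "is_word A w \<Longrightarrow> (\<And>v. is_word A v \<Longrightarrow> F v = G v) \<Longrightarrow> opr e \<theta> F w = opr e \<theta> G w"
proof (induction w arbitrary: F G)
  case (Cons x w)
  obtain a l where x: "x = (a, l)" by force
  have al: "a \<in> gr A l" "is_word A w" "\<theta> a \<in> gr A l" using Cons.prems(1) \<theta> by (auto simp: x letter_map_def)
  have "e F a l w = e G a l w" using Cons.prems al by (intro local_opD(1)[OF e]) auto
  moreover have "opr e \<theta> (\<lambda>v. F ((\<theta> a, l) # v)) w = opr e \<theta> (\<lambda>v. G ((\<theta> a, l) # v)) w"
    using al Cons.prems by (intro Cons.IH) auto
  ultimately show ?case by (simp add: x)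
qed simp

lemma opr_add: "opr e \<theta> (\<lambda>v. F v + G v) w = opr e \<theta> F w + opr e \<theta> G w"
proof (induction w arbitrary: F G)
  case (Cons x w)
  have "\<And>a l. e (\<lambda>v. F v + G v) a l w = e F a l w + e G a l w"
    by (rule local_opD(2)[OF e])
  then show ?case by (cases x) (simp add: Cons.IH)
qed simp

lemma opr_scl: "opr e \<theta> (\<lambda>v. scl M r (F v)) w = scl M r (opr e \<theta> F w)"
proof (induction w arbitrary: F)
  case (Cons x w)
  have "\<And>a l. e (\<lambda>v. scl M r (F v)) a l w = scl M r (e F a l w)"
    by (rule local_opD(3)[OF e])
  then show ?case by (cases x) (simp add: Cons.IH M.scale_right_distrib M.scale_of_sg)
qed simp

lemma opr_neg: "opr e \<theta> (\<lambda>v. - F v) w = - opr e \<theta> F w"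
  using opr_scl[of "-1" F w] by simp

lemma opr_diff: "opr e \<theta> (\<lambda>v. F v - G v) w = opr e \<theta> F w - opr e \<theta> G w"
  using opr_add[of F "\<lambda>v. - G v" w] by (simp add: opr_neg)

lemma opr_sg: "opr e \<theta> (\<lambda>v. sg n (F v)) w = sg n (opr e \<theta> F w)"
  by (simp add: sg_def opr_neg)

text \<open>Induction on the prefix \<open>u\<close>. A marked letter inside \<open>u\<close> is
  covered because \<open>local_op\<close> makes \<open>e F c m\<close> a cochain in the rest of the
  word; at the changed letter itself the linearity of \<open>e\<close> and of
  \<open>\<theta>\<close> is used.\<close>

lemma opr_letter:
  assumes F: "coch A M i F"
  shows "is_word A u \<Longrightarrow> is_word A w \<Longrightarrow> a \<in> gr A l \<Longrightarrow> b \<in> gr A l \<Longrightarrow>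
      opr e \<theta> F (u @ (a + b, l) # w) = opr e \<theta> F (u @ (a, l) # w) + opr e \<theta> F (u @ (b, l) # w)"
    and "is_word A u \<Longrightarrow> is_word A w \<Longrightarrow> a \<in> gr A l \<Longrightarrow>
      opr e \<theta> F (u @ (scl A r a, l) # w) = scl M r (opr e \<theta> F (u @ (a, l) # w))"
proof -
  show "opr e \<theta> F (u @ (a + b, l) # w) = opr e \<theta> F (u @ (a, l) # w) + opr e \<theta> F (u @ (b, l) # w)"
    if "is_word A u" "is_word A w" "a \<in> gr A l" "b \<in> gr A l"
    using that F
  proof (induction u arbitrary: i F)
    case Nil
    have "\<theta> a \<in> gr A l" "\<theta> b \<in> gr A l" "\<theta> (a + b) = \<theta> a + \<theta> b" using \<theta> Nil by (auto simp: letter_map_def)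
    then have "opr e \<theta> (\<lambda>v. F ((\<theta> (a + b), l) # v)) w
        = opr e \<theta> (\<lambda>v. F ((\<theta> a, l) # v) + F ((\<theta> b, l) # v)) w"
      by (intro opr_cong) (use Nil in \<open>auto intro: coch_hd\<close>)
    moreover have "e F (a + b) l w = e F a l w + e F b l w"
      using Nil by (intro local_opD(5)[OF e]) auto
    ultimately show ?case by (simp add: opr_add)
  next
    case (Cons x u)
    obtain c m where x: "x = (c, m)" by force
    have c: "c \<in> gr A m" "is_word A u" "\<theta> c \<in> gr A m" using Cons.prems \<theta> by (auto simp: x letter_map_def)
    have 1: "coch A M (i + m + 1) (\<lambda>v. F ((\<theta> c, m) # v))"
      using coch_Cons[OF Cons.prems(5), of "(\<theta> c, m)"] c by simp
    have "coch A M (i + m + 1 + \<delta>) (e F c m)" using Cons.prems c by (intro local_opD(4)[OF e])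
    then have "e F c m (u @ (a + b, l) # w) = e F c m (u @ (a, l) # w) + e F c m (u @ (b, l) # w)"
      using Cons.prems c by (intro cochD(2)) auto
    then show ?case using Cons.IH[OF c(2) Cons.prems(2-4) 1] by (simp add: x)
  qed
  show "opr e \<theta> F (u @ (scl A r a, l) # w) = scl M r (opr e \<theta> F (u @ (a, l) # w))"
    if "is_word A u" "is_word A w" "a \<in> gr A l"
    using that F
  proof (induction u arbitrary: i F)
    case Nil
    have "\<theta> a \<in> gr A l" "\<theta> (scl A r a) = scl A r (\<theta> a)" using \<theta> Nil by (auto simp: letter_map_def)
    then have "opr e \<theta> (\<lambda>v. F ((\<theta> (scl A r a), l) # v)) w
        = opr e \<theta> (\<lambda>v. scl M r (F ((\<theta> a, l) # v))) w"
      by (intro opr_cong) (use Nil in \<open>auto intro: coch_hd\<close>)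
    moreover have "e F (scl A r a) l w = scl M r (e F a l w)"
      using Nil by (intro local_opD(6)[OF e]) auto
    ultimately show ?case by (simp add: opr_scl M.scale_right_distrib M.scale_of_sg)
  next
    case (Cons x u)
    obtain c m where x: "x = (c, m)" by force
    have c: "c \<in> gr A m" "is_word A u" "\<theta> c \<in> gr A m" using Cons.prems \<theta> by (auto simp: x letter_map_def)
    have 1: "coch A M (i + m + 1) (\<lambda>v. F ((\<theta> c, m) # v))"
      using coch_Cons[OF Cons.prems(4), of "(\<theta> c, m)"] c by simp
    have "coch A M (i + m + 1 + \<delta>) (e F c m)" using Cons.prems c by (intro local_opD(4)[OF e])
    then have "e F c m (u @ (scl A r a, l) # w) = scl M r (e F c m (u @ (a, l) # w))"
      using Cons.prems c by (intro cochD(3)) auto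
    then show ?case using Cons.IH[OF c(2) Cons.prems(2-3) 1]
      by (simp add: x M.scale_right_distrib M.scale_of_sg)
  qed
qed

lemma opr_gr: "coch A M i F \<Longrightarrow> is_word A w \<Longrightarrow> opr e \<theta> F w \<in> gr M (i + \<delta> + sdeg w)"
proof (induction w arbitrary: i F)
  case (Cons x w)
  obtain c m where x: "x = (c, m)" by force
  have c: "c \<in> gr A m" "is_word A w" "\<theta> c \<in> gr A m" using Cons.prems \<theta> by (auto simp: x letter_map_def)
  have "coch A M (i + m + 1) (\<lambda>v. F ((\<theta> c, m) # v))"
    using coch_Cons[OF Cons.prems(1), of "(\<theta> c, m)"] c by simp
  from Cons.IH[OF this c(2)]
  have 1: "opr e \<theta> (\<lambda>v. F ((\<theta> c, m) # v)) w \<in> gr M (i + m + 1 + \<delta> + sdeg w)" .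
  have "coch A M (i + m + 1 + \<delta>) (e F c m)" using Cons.prems c by (intro local_opD(4)[OF e])
  from cochD(1)[OF this c(2)] 1
  have "e F c m w + sg (m + 1) (opr e \<theta> (\<lambda>v. F ((\<theta> c, m) # v)) w) \<in> gr M (i + m + 1 + \<delta> + sdeg w)"
    by blast
  then show ?case by (simp add: x algebra_simps)
qed simp

lemma coch_opr: "coch A M i F \<Longrightarrow> coch A M (i + \<delta>) (opr e \<theta> F)"
  by (rule cochI) (auto intro: opr_gr opr_letter)

end

lemma local_op_add:
  assumes "local_op e1 \<delta>" "local_op e2 \<delta>"
  shows "local_op (\<lambda>F a i w. e1 F a i w + e2 F a i w) \<delta>"
proof -
  note 1 = local_opD[OF assms(1)] and 2 = local_opD[OF assms(2)]
  show ?thesis unfolding local_op_def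
  proof (intro conjI allI impI)
    fix F G :: "'a word \<Rightarrow> 'm" and a l w
    assume "\<forall>v. is_word A v \<longrightarrow> F v = G v" "is_word A ((a, l) # w)"
    then show "e1 F a l w + e2 F a l w = e1 G a l w + e2 G a l w" using 1(1)[of F G a l w] 2(1)[of F G a l w] by simp
  next
    fix F G :: "'a word \<Rightarrow> 'm" and a l w
    have "e1 (\<lambda>v. F v + G v) a l w = e1 F a l w + e1 G a l w" by (rule 1)
    moreover have "e2 (\<lambda>v. F v + G v) a l w = e2 F a l w + e2 G a l w" by (rule 2)
    ultimately show "e1 (\<lambda>v. F v + G v) a l w + e2 (\<lambda>v. F v + G v) a l w = e1 F a l w + e2 F a l w + (e1 G a l w + e2 G a l w)"
      by simp
  next
    fix F :: "'a word \<Rightarrow> 'm" and r a l w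
    have "e1 (\<lambda>v. scl M r (F v)) a l w = scl M r (e1 F a l w)" by (rule 1)
    moreover have "e2 (\<lambda>v. scl M r (F v)) a l w = scl M r (e2 F a l w)" by (rule 2)
    ultimately show "e1 (\<lambda>v. scl M r (F v)) a l w + e2 (\<lambda>v. scl M r (F v)) a l w = scl M r (e1 F a l w + e2 F a l w)"
      by (simp add: M.scale_right_distrib)
  next
    fix i F a l assume F: "coch A M i F" and a: "a \<in> gr A l"
    have "coch A M (i + l + 1 + \<delta>) (e1 F a l)" using F a by (intro 1)
    moreover have "coch A M (i + l + 1 + \<delta>) (e2 F a l)" using F a by (intro 2)
    ultimately show "coch A M (i + l + 1 + \<delta>) (\<lambda>w. e1 F a l w + e2 F a l w)" by (rule coch_closed(2))
  next
    fix i F a b l w assume F: "coch A M i F" and a: "a \<in> gr A l" "b \<in> gr A l" "is_word A w"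
    have "e1 F (a + b) l w = e1 F a l w + e1 F b l w" using F a by (intro 1)
    moreover have "e2 F (a + b) l w = e2 F a l w + e2 F b l w" using F a by (intro 2)
    ultimately show "e1 F (a + b) l w + e2 F (a + b) l w = e1 F a l w + e2 F a l w + (e1 F b l w + e2 F b l w)" by simp
  next
    fix i F a r l w assume F: "coch A M i F" and a: "a \<in> gr A l" "is_word A w"
    have "e1 F (scl A r a) l w = scl M r (e1 F a l w)" using F a by (intro 1)
    moreover have "e2 F (scl A r a) l w = scl M r (e2 F a l w)" using F a by (intro 2)
    ultimately show "e1 F (scl A r a) l w + e2 F (scl A r a) l w = scl M r (e1 F a l w + e2 F a l w)"
      by (simp add: M.scale_right_distrib)
  qed
qed

lemma local_op_bd0: "local_op (bd0E A) (-1)"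
  unfolding local_op_def bd0E_def
proof (intro conjI allI impI)
  fix i F a l assume F: "coch A M i F" and a: "a \<in> gr A l"
  have "coch A M (i + (l - 1) + 1) (\<lambda>w. F ((dif A a, l - 1) # w))"
    using coch_Cons[OF F, of "(dif A a, l - 1)"] a A.dif_degree by simp
  then show "coch A M (i + l + 1 + - 1) (\<lambda>w. - F ((dif A a, l - 1) # w))"
    by (intro coch_closed) (simp add: algebra_simps)
qed (auto simp: A.dif_degree coch_hd)

lemma local_op_bd1: "local_op bd1E (-1)"
  unfolding local_op_def
proof (intro conjI allI impI)
  fix F G :: "'a word \<Rightarrow> 'm" and a l w
  assume "\<forall>v. is_word A v \<longrightarrow> F v = G v" "is_word A ((a, l) # w)"
  then show "bd1E F a l w = bd1E G a l w" by (auto simp: bd1E_def A.mult_degree split: list.splits)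
next
  fix i F a l assume F: "coch A M i F" and a: "a \<in> gr A l"
  show "coch A M (i + l + 1 + - 1) (bd1E F a l)"
  proof (rule cochI)
    fix w assume w: "is_word A w"
    show "bd1E F a l w \<in> gr M (i + l + 1 + - 1 + sdeg w)"
    proof (cases w)
      case (Cons x v)
      then have "F ((a * fst x, l + snd x) # v) \<in> gr M (i + sdeg ((a * fst x, l + snd x) # v))"
        using a w by (intro cochD(1)[OF F]) (simp add: A.mult_degree)
      then show ?thesis by (auto simp: bd1E_def Cons algebra_simps split: prod.splits)
    qed (simp add: bd1E_def)
  next
    fix u w b b' m assume *: "is_word A u" "is_word A w" "b \<in> gr A m" "b' \<in> gr A m"
    show "bd1E F a l (u @ (b + b', m) # w) = bd1E F a l (u @ (b, m) # w) + bd1E F a l (u @ (b', m) # w)"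
    proof (cases u)
      case Nil
      then show ?thesis using * a by (simp add: bd1E_def algebra_simps coch_hd[OF F] A.mult_degree)
    next
      case (Cons x u')
      obtain c n where "x = (c, n)" by force
      then show ?thesis using * a cochD(2)[OF F, of "(a * c, l + n) # u'" w b m b']
        by (simp add: bd1E_def Cons A.mult_degree)
    qed
  next
    fix u w b r m assume *: "is_word A u" "is_word A w" "b \<in> gr A m"
    show "bd1E F a l (u @ (scl A r b, m) # w) = scl M r (bd1E F a l (u @ (b, m) # w))"
    proof (cases u)
      case Nil
      then show ?thesis using * a
        by (simp add: bd1E_def A.scl_mult_right coch_hd[OF F] A.mult_degree M.scale_of_sg)
    next
      case (Cons x u')
      obtain c n where "x = (c, n)" by force
      then show ?thesis using * a cochD(3)[OF F, of "(a * c, l + n) # u'" w b m r]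
        by (simp add: bd1E_def Cons A.mult_degree M.scale_of_sg)
    qed
  qed
next
  fix i F a b l w assume F: "coch A M i F" and a: "a \<in> gr A l" "b \<in> gr A l" "is_word A w"
  then show "bd1E F (a + b) l w = bd1E F a l w + bd1E F b l w"
    by (auto simp: bd1E_def distrib_right coch_hd[OF F] A.mult_degree split: list.splits)
next
  fix i F a r l w assume F: "coch A M i F" and a: "a \<in> gr A l" "is_word A w"
  then show "bd1E F (scl A r a) l w = scl M r (bd1E F a l w)"
    by (auto simp: bd1E_def A.scl_mult_left coch_hd[OF F] A.mult_degree M.scale_of_sg split: list.splits)
qed (auto simp: bd1E_def M.scale_of_sg split: list.splits)

lemmas local_op_bd = local_op_add[OF local_op_bd0 local_op_bd1]

lemmas bd_cong = opr_cong[OF local_op_bd letter_map_id, folded bdel_def]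
lemmas bd_add = opr_add[OF local_op_bd letter_map_id, folded bdel_def]
lemmas bd_diff = opr_diff[OF local_op_bd letter_map_id, folded bdel_def]
lemmas bd_neg = opr_neg[OF local_op_bd letter_map_id, folded bdel_def]
lemmas bd_sg = opr_sg[OF local_op_bd letter_map_id, folded bdel_def]
lemmas bd_scl = opr_scl[OF local_op_bd letter_map_id, folded bdel_def]

lemma coch_bd: "coch A M i F \<Longrightarrow> coch A M (i - 1) (bdel A F)"
  using coch_opr[OF local_op_bd letter_map_id] by (simp add: bdel_def)

text \<open>Induction on the word, peeling off the first letter. Terms that touch only the tail
  cancel by induction; those that involve the first letter cancel by \<open>dif_dif\<close>, the
  Leibniz rule of \<open>A\<close> and associativity.\<close>

lemma bd_bd: "coch A M i F \<Longrightarrow> is_word A w \<Longrightarrow> bdel A (bdel A F) w = 0"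
proof (induction w arbitrary: i F)
  case (Cons x w)
  obtain a l where x: "x = (a, l)" by force
  note F = Cons.prems(1)
  have a: "a \<in> gr A l" "is_word A w" using Cons.prems by (auto simp: x)
  have da: "dif A a \<in> gr A (l - 1)" using a A.dif_degree by blast
  have IH: "bdel A (bdel A (\<lambda>v. F ((a, l) # v))) w = 0"
    using Cons.IH[OF coch_Cons[OF F, of "(a, l)"]] a by simp
  have dd: "F ((dif A (dif A a), l - 1 - 1) # w) = 0"
    using coch_zero_hd[OF F a(2)] by (simp add: A.dif_dif)
  show ?case
  proof (cases w)
    case Nil
    then show ?thesis using dd by (simp add: x bd_Cons)
  next
    case (Cons y v)
    obtain b m where y: "y = (b, m)" by force
    have b: "b \<in> gr A m" "is_word A v" using a by (auto simp: Cons y)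
    have db: "dif A b \<in> gr A (m - 1)" using b A.dif_degree by blast
    let ?m = "\<lambda>F w. case w of [] \<Rightarrow> 0 | (b, j) # v \<Rightarrow> F ((a * b, l + j) # v)"
    have 1: "bdel A (\<lambda>v. bdel A F ((a, l) # v)) w =
        - bdel A (\<lambda>v. F ((dif A a, l - 1) # v)) w + sg (l + 1) (bdel A (?m F) w) +
        sg (l + 1) (bdel A (bdel A (\<lambda>v. F ((a, l) # v))) w)"
    proof -
      have "bdel A (\<lambda>v. bdel A F ((a, l) # v)) w =
        bdel A (\<lambda>v. - F ((dif A a, l - 1) # v) + sg (l + 1) (?m F v) + sg (l + 1) (bdel A (\<lambda>v. F ((a, l) # v)) v)) w"
        by (intro bd_cong a) (auto simp: bd_Cons split: list.splits)
      then show ?thesis by (simp add: bd_add bd_diff bd_neg bd_sg)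
    qed
    have 2: "bdel A (?m F) w = - F ((a * dif A b, l + m - 1) # v) +
       (case v of [] \<Rightarrow> 0 | (c, n) # v' \<Rightarrow> sg (m + 1) (F ((a * (b * c), l + (m + n)) # v'))) +
       sg (m + 1) (bdel A (\<lambda>v. F ((a * b, l + m) # v)) v)"
      by (auto simp: Cons y bd_Cons algebra_simps split: list.splits)
    have 3: "F ((dif A (a * b), l + m - 1) # v) = F ((dif A a * b, l + m - 1) # v) + sg l (F ((a * dif A b, l + m - 1) # v))"
    proof -
      have m: "dif A a * b \<in> gr A (l + m - 1)" "a * dif A b \<in> gr A (l + m - 1)"
        using A.mult_degree[OF da b(1)] A.mult_degree[OF a(1) db] by (simp_all add: algebra_simps)
      then show ?thesis
        using coch_hd(1)[OF F b(2) m(1), of "sg l (a * dif A b)"] coch_letter_hd(3)[OF F b(2) m(2)]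
        by (simp add: A.dif_mult_sg[OF a(1)])
    qed
    have "bdel A (bdel A F) (x # w) =
      - bdel A F ((dif A a, l - 1) # w) + sg (l + 1) (bdel A F ((a * b, l + m) # v))
      + sg (l + 1) (bdel A (\<lambda>v. bdel A F ((a, l) # v)) w)"
      by (simp add: x Cons y bd_Cons[of A "bdel A F"])
    also have "\<dots> = 0"
      unfolding 1 2 IH
      using dd 3
      by (cases "even l"; cases "even m"; cases v)
         (simp_all add: Cons y bd_Cons sg_def algebra_simps split: prod.splits)
    finally show ?thesis .
  qed
qed simp

end

lemma bd_Cons':
  "bdel A F (x # w) = - F ((dif A (fst x), snd x - 1) # w)
     + (if w = [] then 0 else sg (snd x + 1) (F ((fst x * fst (hd w), snd x + snd (hd w)) # tl w)))
     + sg (snd x + 1) (bdel A (\<lambda>v. F (x # v)) w)"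
  by (cases x; cases w) (auto simp: bd_Cons)

text \<open>The bar differential never produces the empty word.\<close>

lemma bd_if_Nil: "bdel A (\<lambda>v. if v = [] then c else F v) w = bdel A F w"
  by (cases w) (auto simp: bd_Cons')

text \<open>The recursion of \<open>bdel\<close> runs from the left; this is its counterpart at the
  right end, where the right action takes place.\<close>

lemma bd_snoc:
  "bdel A F (w @ [y]) = bdel A (\<lambda>v. F (v @ [y])) w - sg (sdeg w) (F (w @ [(dif A (fst y), snd y - 1)]))
     + (if w = [] then 0 else sg (sdeg w) (F (butlast w @ [(fst (last w) * fst y, snd (last w) + snd y)])))"
proof (induction w arbitrary: F)
  case Nil
  then show ?case by (simp add: bd_Cons')
next
  case (Cons x w)
  show ?case
    unfolding append_Cons bd_Cons'[of A F x "w @ [y]"] bd_Cons'[of A _ x w] Cons.IH[of "\<lambda>v. F (x # v)"]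
    by (cases "w = []") (simp_all add: algebra_simps)
qed

text \<open>Links the sums over positions in the definitions of the differentials to the recursion
  over the word. The arbitrary initial sign \<open>i\<close> lets the induction absorb the degree of
  the first letter.\<close>

lemma bd0_sum:
  "(\<Sum>t<length w. sg (i + sdeg (take t w)) (f (w[t := (dif A (fst (w ! t)), snd (w ! t) - 1)]))) = - sg i (bd0 A f w)"
proof (induction w arbitrary: i f)
  case (Cons x w)
  show ?case
    using Cons.IH[of "i + (snd x + 1)" "\<lambda>v. f (x # v)"]
    by (cases x) (simp add: bd0_Cons sum.lessThan_Suc_shift algebra_simps del: sum.lessThan_Suc)
qed simp

lemma bd1_sum:
  "(\<Sum>t<length w - 1. sg (i + sdeg (take (t + 1) w)) (f (take t w
      @ (fst (w ! t) * fst (w ! (t + 1)), snd (w ! t) + snd (w ! (t + 1))) # drop (t + 2) w))) = sg i (bd1 f w)"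
proof (induction w arbitrary: i f)
  case (Cons x w)
  show ?case
  proof (cases w)
    case Nil
    then show ?thesis by (cases x) (simp add: bd1_Cons)
  next
    case (Cons y v)
    show ?thesis
      using Cons.IH[of "i + (snd x + 1)" "\<lambda>v. f (x # v)"]
      by (cases x; cases y) (simp add: Cons bd1_Cons sum.lessThan_Suc_shift algebra_simps del: sum.lessThan_Suc)
  qed
qed simp

section \<open>The Hochschild codifferential and the two-sided bar construction\<close>

definition cD :: "('k::field, 'a::ring_1) dg \<Rightarrow> ('k, 'a, 'm::ab_group_add) dg_bimod \<Rightarrow> int \<Rightarrow>
     ('a word \<Rightarrow> 'm) \<Rightarrow> 'a word \<Rightarrow> 'm" where
  "cD A M i f w = dif M (f w) - sg i (bdel A f w)
     - (if w = [] then 0 else sg (i * (snd (hd w) + 1)) (lact M (fst (hd w)) (f (tl w))))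
     + (if w = [] then 0 else sg (i + sdeg (butlast w)) (ract M (f (butlast w)) (fst (last w))))"

text \<open>The extension of \<open>f\<close> to the two-sided bar construction, whose words have the coefficients on
  both sides as additional letters. It turns the action terms of \<open>cD\<close> into inner products.\<close>

definition xt :: "('k, 'a::ring_1, 'm::ab_group_add) dg_bimod \<Rightarrow> int \<Rightarrow> ('a word \<Rightarrow> 'm) \<Rightarrow> 'a word \<Rightarrow> 'm" where
  "xt M i f w = (if length w < 2 then 0 else
     sg (i * snd (hd w) + snd (last w)) (lact M (fst (hd w)) (ract M (f (butlast (tl w))) (fst (last w)))))"

lemma xt_eq [simp]: "xt M i f (x # u @ [y]) = sg (i * snd x + snd y) (lact M (fst x) (ract M (f u) (fst y)))"
  by (simp add: xt_def butlast_append)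

lemma xt_eq2 [simp]: "xt M i f [x, y] = sg (i * snd x + snd y) (lact M (fst x) (ract M (f []) (fst y)))"
  by (simp add: xt_def)

lemma xt_short [simp]: "xt M i f [] = 0" "xt M i f [x] = 0"
  by (simp_all add: xt_def)

lemma word_cases:
  obtains "w = []" | x where "w = [x]" | x u y where "w = x # u @ [y]"
  by (metis append_butlast_last_id list.exhaust)

context weak_bimodule begin

lemma cochain_D_eq: "cochain_D0 A M i f w + cochain_D1 A M i f w = cD A M i f w"
  unfolding cochain_D0_def cochain_D1_def cD_def M.scale_sg bd0_sum bd1_sum bd_split by (simp add: algebra_simps)

lemma coch_xt:
  assumes f: "coch A M i f" shows "coch A M (i - 2) (xt M i f)"
proof (rule cochI)
  fix w assume w: "is_word A w"
  show "xt M i f w \<in> gr M (i - 2 + sdeg w)"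
  proof (cases w rule: word_cases)
    case (3 x u y)
    then have "lact M (fst x) (ract M (f u) (fst y)) \<in> gr M (snd x + ((i + sdeg u) + snd y))"
      using w by (intro lact_gr ract_gr cochD(1)[OF f]) auto
    then show ?thesis using 3 by (simp add: algebra_simps)
  qed auto
next
  fix u w a b l assume *: "is_word A u" "is_word A w" "a \<in> gr A l" "b \<in> gr A l"
  show "xt M i f (u @ (a + b, l) # w) = xt M i f (u @ (a, l) # w) + xt M i f (u @ (b, l) # w)"
  proof (cases u)
    case u: Nil
    show ?thesis
    proof (cases w rule: rev_cases)
      case (snoc v y)
      have "ract M (f v) (fst y) \<in> gr M ((i + sdeg v) + snd y)" 
        using * snoc by (intro ract_gr cochD(1)[OF f]) auto
      then show ?thesis using * snoc u by (simp add: lact_add')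
    qed (simp add: u)
  next
    case u: (Cons x v)
    show ?thesis
    proof (cases w rule: rev_cases)
      case Nil
      have 1: "f v \<in> gr M (i + sdeg v)" using * u by (intro cochD(1)[OF f]) auto
      show ?thesis using * u 1 Nil by (simp add: ract_add')
    next
      case (snoc w' y)
      then show ?thesis using * u cochD(2)[OF f, of v w' a l b] xt_eq[of M i f x "v @ _ # w'" y] by simp
    qed
  qed
next
  fix u w a r l assume *: "is_word A u" "is_word A w" "a \<in> gr A l"
  show "xt M i f (u @ (scl A r a, l) # w) = scl M r (xt M i f (u @ (a, l) # w))"
  proof (cases u)
    case u: Nil
    show ?thesis
    proof (cases w rule: rev_cases)
      case (snoc v y)
      have "ract M (f v) (fst y) \<in> gr M ((i + sdeg v) + snd y)" 
        using * snoc by (intro ract_gr cochD(1)[OF f]) auto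
      then show ?thesis using * snoc u by (simp add: lact_scl' M.scale_of_sg)
    qed (simp add: u)
  next
    case u: (Cons x v)
    show ?thesis
    proof (cases w rule: rev_cases)
      case Nil
      have 1: "f v \<in> gr M (i + sdeg v)" using * u by (intro cochD(1)[OF f]) auto
      show ?thesis using * u 1 Nil by (simp add: ract_scl' M.scale_of_sg)
    next
      case (snoc w' y)
      then show ?thesis using * u cochD(3)[OF f, of v w' a l r] xt_eq[of M i f x "v @ _ # w'" y]
        by (simp add: M.scale_of_sg)
    qed
  qed
qed

text \<open>On the two-sided bar construction the action terms of \<open>cD\<close> are products of
  an outer letter with its inner neighbour, so the codifferential is \<open>dif\<close> plus the bar
  differential. Identities for \<open>cD\<close> thereby reduce to identities for
  \<open>bdel\<close>.\<close>

lemma xt_cD: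
  assumes f: "coch A M i f" and w: "is_word A w"
  shows "xt M (i - 1) (cD A M i f) w = dif M (xt M i f w) + sg i (bdel A (xt M i f) w)"
proof (cases w rule: word_cases)
  case (3 x u y)
  obtain l j r k where xy: "x = (l, j)" "y = (r, k)" by force
  have wd: "l \<in> gr A j" "r \<in> gr A k" "is_word A u" using w by (auto simp: 3 xy)
  have dlr: "dif A l \<in> gr A (j - 1)" "dif A r \<in> gr A (k - 1)" using wd A.dif_degree by auto
  have fu: "f u \<in> gr M (i + sdeg u)" by (rule cochD(1)[OF f wd(3)])
  have fur: "ract M (f u) r \<in> gr M (i + sdeg u + k)" by (rule ract_gr[OF fu wd(2)])
  let ?X = "xt M i f" and ?s = "sg (i * j + k)" 
  have B: "bdel A (\<lambda>v. ?X (x # v @ [y])) u = ?s (lact M l (ract M (bdel A f u) r))"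
    using bd_hom[of "\<lambda>m. ?s (lact M l (ract M m r))" A f u] by (simp add: xy)
  have d: "dif M (?X w) = ?s (lact M (dif A l) (ract M (f u) r)) + ?s (sg j (lact M l (ract M (dif M (f u)) r)))
      + ?s (sg (j + i + sdeg u) (lact M l (ract M (f u) (dif A r))))"
    by (simp add: 3 xy dif_lact[OF wd(1) fur] dif_ract[OF fu wd(2)] algebra_simps)
  have b: "bdel A ?X w = - ?X ((dif A l, j - 1) # u @ [y])
     + (if u = [] then 0 else sg (j + 1) (?X ((l * fst (hd u), j + snd (hd u)) # tl u @ [y])))
     + sg (j + 1) (?s (lact M l (ract M (bdel A f u) r)))
     - sg (j + 1 + sdeg u) (?X (x # u @ [(dif A r, k - 1)]))
     + (if u = [] then 0 else sg (j + 1 + sdeg u) (?X (x # butlast u @ [(fst (last u) * r, snd (last u) + k)])))"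
    unfolding 3 bd_Cons'[of A ?X x "u @ [y]"] bd_snoc[of A "\<lambda>v. ?X (x # v)" u y] B
    by (simp add: xy add.assoc)
  show ?thesis
  proof (cases "u = []")
    case True
    show ?thesis unfolding d b unfolding 3
      by (cases "even i"; cases "even j"; cases "even k") (simp_all add: True xy sg_def cD_def)
  next
    case False
    obtain a m where a: "hd u = (a, m)" by force
    obtain b n where bb: "last u = (b, n)" by force
    have u1: "a \<in> gr A m" "is_word A (tl u)" using wd(3) a False by (cases u; force)+
    have u2: "b \<in> gr A n" "is_word A (butlast u)" using wd(3) bb False
      by (metis append_butlast_last_id fst_conv is_word_simps(2,3) snd_conv)+
    have deg: "sdeg u = sdeg (butlast u) + n + 1" 
      using bb False by (metis add.assoc append_butlast_last_id sdeg_simps snd_conv add_0_right)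
    have ft: "f (tl u) \<in> gr M (i + sdeg (tl u))" by (rule cochD(1)[OF f u1(2)])
    have fb: "f (butlast u) \<in> gr M (i + sdeg (butlast u))" by (rule cochD(1)[OF f u2(2)])
    \<comment> \<open>Associativity, and the commuting of the two actions, turn the product of an
      outer and an inner letter into an action on the value of \<open>f\<close>.\<close>
    have 1: "lact M (l * a) (ract M (f (tl u)) r) = lact M l (ract M (lact M a (f (tl u))) r)"
      using lact_mult[OF wd(1) u1(1) ract_gr[OF ft wd(2)]] lact_ract[OF u1(1) wd(2) ft] by simp
    have 2: "lact M l (ract M (f (butlast u)) (b * r)) = lact M l (ract M (ract M (f (butlast u)) b) r)"
      using ract_mult[OF u2(1) wd(2) fb] by simp
    show ?thesis unfolding d b unfolding 3
      by (cases "even i"; cases "even j"; cases "even k"; cases "even m"; cases "even n"; cases "even (sdeg (butlast u))")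
         (simp_all add: False xy sg_def cD_def a bb 1 2 deg)
  qed
qed (use w coch_zero_hd in \<open>auto simp: bd_Cons'\<close>)

lemma coch_lact:
  assumes f: "coch A M i f"
  shows "coch A M (i - 1) (\<lambda>w. if w = [] then 0 else sg (i * (snd (hd w) + 1)) (lact M (fst (hd w)) (f (tl w))))"
proof (rule cochI)
  fix w assume w: "is_word A w"
  have "lact M (fst (hd w)) (f (tl w)) \<in> gr M (snd (hd w) + (i + sdeg (tl w)))" if "w \<noteq> []"
    using that w by (intro lact_gr cochD(1)[OF f]; cases w; auto)
  then show "(if w = [] then 0 else sg (i * (snd (hd w) + 1)) (lact M (fst (hd w)) (f (tl w)))) \<in> gr M (i - 1 + sdeg w)"
    by (cases w) (auto simp: algebra_simps)
next
  fix u w a b l assume *: "is_word A u" "is_word A w" "a \<in> gr A l" "b \<in> gr A l"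
  then show "(if u @ (a + b, l) # w = [] then 0 else sg (i * (snd (hd (u @ (a + b, l) # w)) + 1)) (lact M (fst (hd (u @ (a + b, l) # w))) (f (tl (u @ (a + b, l) # w)))))
   = (if u @ (a, l) # w = [] then 0 else sg (i * (snd (hd (u @ (a, l) # w)) + 1)) (lact M (fst (hd (u @ (a, l) # w))) (f (tl (u @ (a, l) # w)))))
    + (if u @ (b, l) # w = [] then 0 else sg (i * (snd (hd (u @ (b, l) # w)) + 1)) (lact M (fst (hd (u @ (b, l) # w))) (f (tl (u @ (b, l) # w)))))"
    by (cases u) (auto simp: lact_add'[OF _ _ cochD(1)[OF f]] cochD(2)[OF f])
next
  fix u w a r l assume *: "is_word A u" "is_word A w" "a \<in> gr A l"
  then show "(if u @ (scl A r a, l) # w = [] then 0 else sg (i * (snd (hd (u @ (scl A r a, l) # w)) + 1)) (lact M (fst (hd (u @ (scl A r a, l) # w))) (f (tl (u @ (scl A r a, l) # w)))))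
   = scl M r (if u @ (a, l) # w = [] then 0 else sg (i * (snd (hd (u @ (a, l) # w)) + 1)) (lact M (fst (hd (u @ (a, l) # w))) (f (tl (u @ (a, l) # w)))))"
    by (cases u) (auto simp: lact_scl'[OF _ cochD(1)[OF f]] cochD(3)[OF f] M.scale_of_sg)
qed

lemma coch_ract:
  assumes f: "coch A M i f"
  shows "coch A M (i - 1) (\<lambda>w. if w = [] then 0 else sg (i + sdeg (butlast w)) (ract M (f (butlast w)) (fst (last w))))"
    (is "coch A M (i - 1) ?R")
proof (rule cochI)
  fix w assume w: "is_word A w"
  show "?R w \<in> gr M (i - 1 + sdeg w)"
  proof (cases w rule: rev_cases)
    case (snoc v y)
    then have "ract M (f v) (fst y) \<in> gr M (i + sdeg v + snd y)"
      using w by (intro ract_gr cochD(1)[OF f]) auto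
    then show ?thesis using snoc by (simp add: algebra_simps)
  qed simp
next
  fix u w a b l assume *: "is_word A u" "is_word A w" "a \<in> gr A l" "b \<in> gr A l"
  show "?R (u @ (a + b, l) # w) = ?R (u @ (a, l) # w) + ?R (u @ (b, l) # w)"
  proof (cases w rule: rev_cases)
    case (snoc v y)
    then show ?thesis using * cochD(2)[OF f, of u v a l b] by (simp add: butlast_append)
  qed (use * in \<open>simp add: ract_add'[OF _ _ cochD(1)[OF f]]\<close>)
next
  fix u w a r l assume *: "is_word A u" "is_word A w" "a \<in> gr A l"
  show "?R (u @ (scl A r a, l) # w) = scl M r (?R (u @ (a, l) # w))"
  proof (cases w rule: rev_cases)
    case (snoc v y)
    then show ?thesis using * cochD(3)[OF f, of u v a l r] by (simp add: butlast_append M.scale_of_sg)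
  qed (use * in \<open>simp add: ract_scl'[OF _ cochD(1)[OF f]] M.scale_of_sg\<close>)
qed

lemma coch_dif: "coch A M i f \<Longrightarrow> coch A M (i - 1) (\<lambda>w. dif M (f w))"
  using dif_gr[OF cochD(1)[of A M i f]] by (intro cochI) (simp_all add: cochD(2,3) algebra_simps)

lemma coch_cD: "coch A M i f \<Longrightarrow> coch A M (i - 1) (cD A M i f)"
  unfolding cD_def by (intro coch_closed coch_dif coch_bd coch_lact coch_ract)

lemma cD_cong:
  assumes "is_word A w" "\<And>v. is_word A v \<Longrightarrow> f v = g v"
  shows "cD A M i f w = cD A M i g w"
proof -
  have "bdel A f w = bdel A g w" by (rule bd_cong) (use assms in auto)
  moreover have "w \<noteq> [] \<Longrightarrow> is_word A (tl w) \<and> is_word A (butlast w)"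
    using assms(1) by (metis append_butlast_last_id is_word_simps(2,3) list.collapse)
  ultimately show ?thesis using assms by (auto simp: cD_def)
qed

lemma cD_add: "cD A M i (\<lambda>w. f w + g w) w = cD A M i f w + cD A M i g w"
  by (simp add: cD_def bd_add algebra_simps)

lemma cD_scl: "cD A M i (\<lambda>w. scl M r (f w)) w = scl M r (cD A M i f w)"
  by (simp add: cD_def bd_scl M.scale_of_sg M.scale_right_distrib M.scale_right_diff_distrib)

lemma cD_neg: "cD A M i (\<lambda>w. - f w) w = - cD A M i f w"
  using cD_scl[of i "-1" f w] by simp

lemma cD_diff: "cD A M i (\<lambda>w. f w - g w) w = cD A M i f w - cD A M i g w"
  using cD_add[of i f "\<lambda>w. - g w" w] cD_neg[of i g w] by simp

lemma cD_sg: "cD A M i (\<lambda>w. sg n (f w)) w = sg n (cD A M i f w)"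
  by (simp add: sg_def cD_neg)

lemma cD_0 [simp]: "cD A M i (\<lambda>w. 0) w = 0"
  using cD_scl[of i 0 "\<lambda>w. 0" w] by simp

text \<open>Units as outer letters recover a cochain from its extension \<open>xt\<close>. There the
  square vanishes because \<open>dif\<close> and \<open>bdel\<close> square to zero and commute,
  while their mixed terms occur with opposite signs.\<close>

lemma cD_cD:
  assumes f: "coch A M i f" and w: "is_word A w"
  shows "cD A M (i - 1) (cD A M i f) w = 0"
proof -
  let ?X = "xt M i f" and ?w = "(1, 0) # w @ [(1, 0)]"
  have w': "is_word A ?w" using w A.one_degree by simp
  have X: "coch A M (i - 2) ?X" by (rule coch_xt[OF f])
  have "cD A M (i - 1) (cD A M i f) w = xt M (i - 1 - 1) (cD A M (i - 1) (cD A M i f)) ?w"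
  proof -
    have "cD A M (i - 1) (cD A M i f) w \<in> gr M (i - 1 - 1 + sdeg w)"
      using cochD(1)[OF coch_cD[OF coch_cD[OF f]] w] .
    then show ?thesis by (simp add: lact_one ract_one)
  qed
  also have "\<dots> = dif M (xt M (i - 1) (cD A M i f) ?w) + sg (i - 1) (bdel A (xt M (i - 1) (cD A M i f)) ?w)"
    by (rule xt_cD[OF coch_cD[OF f] w'])
  also have "bdel A (xt M (i - 1) (cD A M i f)) ?w = bdel A (\<lambda>w. dif M (?X w) + sg i (bdel A ?X w)) ?w"
    by (rule bd_cong[OF w']) (rule xt_cD[OF f])
  also have "\<dots> = dif M (bdel A ?X ?w)"
    using bd_hom[of "dif M" A ?X ?w] bd_bd[OF X w'] by (simp add: bd_add bd_sg)
  also have "xt M (i - 1) (cD A M i f) ?w = dif M (?X ?w) + sg i (bdel A ?X ?w)"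
    by (rule xt_cD[OF f w'])
  also have "dif M (dif M (?X ?w) + sg i (bdel A ?X ?w)) + sg (i - 1) (dif M (bdel A ?X ?w)) = 0"
    using dif_dif[OF cochD(1)[OF X w']] by (simp add: sg_def)
  finally show ?thesis .
qed

end

section \<open>Normalization\<close>

locale aug_weak_bimodule = weak_bimodule A M + augmented_dg_algebra A \<epsilon>
  for A :: "('k::field, 'a::ring_1) dg" and M :: "('k, 'a, 'm::ab_group_add) dg_bimod" and \<epsilon> :: "'a \<Rightarrow> 'k"

context augmented_dg_algebra begin

lemma aug_simps [simp]:
  "\<epsilon> 0 = 0" "\<epsilon> (a + b) = \<epsilon> a + \<epsilon> b" "\<epsilon> (a - b) = \<epsilon> a - \<epsilon> b" "\<epsilon> (- a) = - \<epsilon> a" "\<epsilon> (scl A r a) = r * \<epsilon> a"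
  "\<epsilon> 1 = 1" "\<epsilon> (a * b) = \<epsilon> a * \<epsilon> b" "\<epsilon> (dif A a) = 0"
proof -
  interpret e: Vector_Spaces.linear "scl A" "(*)" \<epsilon> by (rule aug_linear)
  show "\<epsilon> 0 = 0" "\<epsilon> (a + b) = \<epsilon> a + \<epsilon> b" "\<epsilon> (a - b) = \<epsilon> a - \<epsilon> b" "\<epsilon> (- a) = - \<epsilon> a" "\<epsilon> (scl A r a) = r * \<epsilon> a"
    by (simp_all add: e.zero e.add e.diff e.neg e.scale)
qed (simp_all add: aug_one aug_mult aug_dif)

text \<open>The projection to the augmentation ideal along the unit.\<close>

definition bar :: "'a \<Rightarrow> 'a" where "bar a = a - scl A (\<epsilon> a) 1"

lemma bar_degree: "a \<in> gr A l \<Longrightarrow> bar a \<in> gr A l"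
  using aug_degree[of a l] one_degree by (cases "l = 0") (auto simp: bar_def)

end

context aug_weak_bimodule begin

lemma letter_map_bar: "letter_map bar"
  unfolding letter_map_def
  by (auto simp: bar_degree) (simp_all add: bar_def A.scale_left_distrib A.scale_right_diff_distrib algebra_simps)

text \<open>Together with \<open>bar\<close> on the letters to the left this is the homotopy of
  normalization: the unit component of a letter becomes \<open>1|1\<close>, and since
  \<open>1 * 1 = 1\<close> the bar differential undoes the doubling.\<close>

definition hhE :: "('a word \<Rightarrow> 'm) \<Rightarrow> 'a \<Rightarrow> int \<Rightarrow> 'a word \<Rightarrow> 'm" where
  "hhE F a i w = scl M (\<epsilon> a) (F ((1, 0) # (1, 0) # w))"

definition hmE :: "('a word \<Rightarrow> 'm) \<Rightarrow> 'a \<Rightarrow> int \<Rightarrow> 'a word \<Rightarrow> 'm" where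
  "hmE F a i w = (if w = [] then 0 else hhE F a i w)"

text \<open>\<open>hh\<close> doubles the first unit of a word; \<open>hm\<close> and \<open>hq\<close> do so in words of the two-sided bar
  construction, leaving alone the last letter and both outer letters, respectively.\<close>

definition hh :: "('a word \<Rightarrow> 'm) \<Rightarrow> 'a word \<Rightarrow> 'm" where "hh = opr hhE bar"

definition hm :: "('a word \<Rightarrow> 'm) \<Rightarrow> 'a word \<Rightarrow> 'm" where "hm = opr hmE bar"

definition hq :: "('a word \<Rightarrow> 'm) \<Rightarrow> 'a word \<Rightarrow> 'm" where
  "hq F w = (case w of [] \<Rightarrow> 0 | x # v \<Rightarrow> sg (snd x + 1) (hm (\<lambda>v. F (x # v)) v))"

lemma local_op_hh: "local_op hhE 1"
  unfolding local_op_def hhE_def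
proof (intro conjI allI impI)
  fix F G :: "'a word \<Rightarrow> 'm" and a l w
  assume "\<forall>v. is_word A v \<longrightarrow> F v = G v" "is_word A ((a, l) # w)"
  then show "scl M (\<epsilon> a) (F ((1, 0) # (1, 0) # w)) = scl M (\<epsilon> a) (G ((1, 0) # (1, 0) # w))"
    by (simp add: A.one_degree)
next
  fix i F a l assume F: "coch A M i F" and a: "a \<in> gr A l"
  have "coch A M (i + 0 + 1 + 0 + 1) (\<lambda>w. F ((1, 0) # (1, 0) # w))"
    using coch_Cons[OF coch_Cons[OF F, of "(1, 0)"], of "(1, 0)"] A.one_degree by simp
  then show "coch A M (i + l + 1 + 1) (\<lambda>w. scl M (\<epsilon> a) (F ((1, 0) # (1, 0) # w)))"
    using aug_degree[OF a] by (cases "l = 0") (auto intro: coch_closed)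
qed (auto simp: M.scale_right_distrib M.scale_left_distrib mult.commute)

lemma local_op_hm: "local_op hmE 1"
proof -
  note h = local_opD[OF local_op_hh]
  show ?thesis
    unfolding local_op_def hmE_def
  proof (intro conjI allI impI)
    fix F G :: "'a word \<Rightarrow> 'm" and a l w
    assume "\<forall>v. is_word A v \<longrightarrow> F v = G v" "is_word A ((a, l) # w)"
    then show "(if w = [] then 0 else hhE F a l w) = (if w = [] then 0 else hhE G a l w)"
      using h(1)[of F G a l w] by auto
  next
    fix i F a l assume F: "coch A M i F" and a: "a \<in> gr A l"
    show "coch A M (i + l + 1 + 1) (\<lambda>w. if w = [] then 0 else hhE F a l w)"
      using cochD[OF h(4)[OF F a]] by (intro cochI) auto
  qed (auto simp: h(2,3,5,6))
qed

lemmas hh_cong = opr_cong[OF local_op_hh letter_map_bar, folded hh_def]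
lemmas hm_cong = opr_cong[OF local_op_hm letter_map_bar, folded hm_def]
lemmas hm_lin = opr_add[OF local_op_hm letter_map_bar, folded hm_def]
  opr_diff[OF local_op_hm letter_map_bar, folded hm_def] opr_neg[OF local_op_hm letter_map_bar, folded hm_def]
  opr_sg[OF local_op_hm letter_map_bar, folded hm_def] opr_scl[OF local_op_hm letter_map_bar, folded hm_def]

lemma coch_hh: "coch A M i F \<Longrightarrow> coch A M (i + 1) (hh F)"
  using coch_opr[OF local_op_hh letter_map_bar] by (simp add: hh_def)

lemma hm_simps: "hm F [] = 0"
  "hm F ((a, i) # w) = (if w = [] then 0 else scl M (\<epsilon> a) (F ((1, 0) # (1, 0) # w))) + sg (i + 1) (hm (\<lambda>v. F ((bar a, i) # v)) w)"
  by (simp_all add: hm_def hmE_def hhE_def)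

lemma hq_simps [simp]: "hq F [] = 0" "hq F [x] = 0" "hq F [x, y] = 0"
  by (cases y; simp add: hq_def hm_simps)+

lemma hq_Cons: "hq F (x # v) = sg (snd x + 1) (hm (\<lambda>v. F (x # v)) v)"
  by (simp add: hq_def)

lemma hq_lin: "hq (\<lambda>v. F v + G v) w = hq F w + hq G w" "hq (\<lambda>v. F v - G v) w = hq F w - hq G w"
  "hq (\<lambda>v. - F v) w = - hq F w" "hq (\<lambda>v. sg n (F v)) w = sg n (hq F w)" 
  by (auto simp: hq_def hm_lin algebra_simps split: list.splits)

lemma hq_cong: "is_word A w \<Longrightarrow> (\<And>v. is_word A v \<Longrightarrow> F v = G v) \<Longrightarrow> hq F w = hq G w"
  by (cases w) (auto simp: hq_def intro!: hm_cong)

lemma hq_zero_hd: "coch A M i F \<Longrightarrow> is_word A w \<Longrightarrow> hq F ((0, l) # w) = 0"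
proof -
  assume *: "coch A M i F" "is_word A w"
  have "hm (\<lambda>v. F ((0, l) # v)) w = hm (\<lambda>v. scl M 0 0) w"
    by (rule hm_cong) (use * coch_zero_hd in auto)
  then show ?thesis unfolding hm_lin(5)[of _ "\<lambda>v. 0"] by (simp add: hq_def)
qed

text \<open>Splitting \<open>bar a\<close> into \<open>a\<close> and its unit component expresses
  \<open>hm\<close> through \<open>hq\<close>, which keeps the first letter. The induction for
  \<open>hq_bd\<close> runs on this form.\<close>

lemma hm_Cons:
  assumes F: "coch A M n F" and w: "is_word A ((a, i) # v)"
  shows "hm F ((a, i) # v) = (if v = [] then 0 else scl M (\<epsilon> a) (F ((1, 0) # (1, 0) # v)))
     + hq F ((a, i) # v) - scl M (\<epsilon> a) (hq F ((1, 0) # v))"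
proof (cases "i = 0")
  case True
  have e: "scl A (\<epsilon> a) 1 \<in> gr A 0" using A.one_degree by blast
  have "hm (\<lambda>v. F ((bar a, i) # v)) v = hm (\<lambda>v. F ((a, i) # v) - scl M (\<epsilon> a) (F ((1, 0) # v))) v"
    using w True e A.one_degree
    by (intro hm_cong) (auto simp: bar_def coch_letter_hd[OF F] coch_hd[OF F])
  then show ?thesis
    by (simp add: hm_simps hq_Cons hm_lin True sg_def)
next
  case False
  then have "\<epsilon> a = 0" using w aug_degree[of a i] by simp
  then show ?thesis using False by (simp add: hm_simps hq_Cons bar_def)
qed

definition mb :: "'a word \<Rightarrow> 'a word" where
  "mb w = (if w = [] then [] else map (\<lambda>x. (bar (fst x), snd x)) (butlast w) @ [last w])"

text \<open>The homotopy formula of normalization: up to \<open>bdel\<close>, the identity agrees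
  with the projection of all inner letters to the augmentation ideal. Because of the splitting in
  \<open>hm_Cons\<close>, the induction hypothesis enters twice, with the first inner letter
  \<open>y\<close> and with the unit in the role of the outer letter.\<close>

lemma hq_bd:
  "w \<noteq> [] \<Longrightarrow> is_word A (x # w) \<Longrightarrow> coch A M n F \<Longrightarrow>
   bdel A (hq F) (x # w) + hq (bdel A F) (x # w) = F (x # w) - F (x # mb w)"
proof (induction w arbitrary: x F n)
  case (Cons y v)
  note F = Cons.prems(3)
  show ?case
  proof (cases "v = []")
    case True
    then show ?thesis by (simp add: bd_Cons' mb_def)
  next
    case False
    obtain b m v' where v: "v = (b, m) # v'" using False by (cases v) force+
    obtain l j a i where xy: "x = (l, j)" "y = (a, i)" by force
    define e where "e = \<epsilon> a"
    define o1 :: "'a \<times> int" where "o1 = (1, 0)"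
    have o1: "fst o1 = 1" "snd o1 = 0" by (simp_all add: o1_def)
    have wd: "l \<in> gr A j" "a \<in> gr A i" "b \<in> gr A m" "is_word A v'" "is_word A v" "1 \<in> gr A 0"
      using Cons.prems A.one_degree by (auto simp: xy v)
    define G where "G = (\<lambda>z. F (x # z))"
    have G: "coch A M (n + j + 1) G" unfolding G_def using coch_Cons[OF F, of x] wd xy by simp
    have e0: "e = 0 \<or> i = 0" using aug_degree[OF wd(2)] by (auto simp: e_def)
    \<comment> \<open>\<open>E\<close> and \<open>Y\<close> are the doubled unit and the unit
      correction in \<open>hm_Cons\<close>, as functions of the word, so that \<open>bdel\<close>
      can be applied to each of them. \<open>Mm\<close> multiplies the outer letter with its
      neighbour.\<close>
    define E where "E = (\<lambda>z::'a word. case z of [] \<Rightarrow> 0 | (a, i) # v \<Rightarrow>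
       if v = [] then 0 else scl M (\<epsilon> a) (G (o1 # o1 # v)))"
    define Y where "Y = (\<lambda>z::'a word. case z of [] \<Rightarrow> 0 | (a, i) # v \<Rightarrow> scl M (\<epsilon> a) (hq G (o1 # v)))"
    define Mm where "Mm = (\<lambda>z::'a word. case z of [] \<Rightarrow> 0 | (b, m) # z \<Rightarrow> F ((l * b, j + m) # z))"
    have hmG: "hm G z = E z + hq G z - Y z" if "is_word A z" for z
      using that hm_Cons[OF G] by (cases z) (auto simp: E_def Y_def hm_simps o1_def)
    have hqF: "hq F (x # z) = sg (j + 1) (hm G z)" for z
      by (simp add: hq_Cons G_def xy)
    have bdhq: "bdel A (\<lambda>z. hq F (x # z)) (y # v) = sg (j + 1) (bdel A E (y # v) + bdel A (hq G) (y # v) - bdel A Y (y # v))"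
    proof -
      have "bdel A (\<lambda>z. hq F (x # z)) (y # v) = bdel A (\<lambda>z. sg (j + 1) (E z + hq G z - Y z)) (y # v)"
        using Cons.prems by (intro bd_cong) (auto simp: hqF hmG)
      then show ?thesis by (simp only: bd_sg bd_add bd_diff)
    qed
    have scl_bd: "bdel A (\<lambda>z. scl M e (H z)) v = scl M e (bdel A H v)" for H by (rule bd_scl)
    have Ey: "E (y # z) = (if z = [] then 0 else scl M e (G (o1 # o1 # z)))" for z
      by (simp add: E_def xy e_def)
    have Yy: "Y (y # z) = scl M e (hq G (o1 # z))" for z
      by (simp add: Y_def xy e_def)
    have bdE: "bdel A E (y # v) = sg (i + 1) (if v' = [] then 0 else scl M (e * \<epsilon> b) (G (o1 # o1 # v')))
        + sg (i + 1) (scl M e (bdel A (\<lambda>z. G (o1 # o1 # z)) v))"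
      unfolding bd_Cons'[of A E y v] Ey bd_if_Nil scl_bd
      by (simp add: xy E_def v e_def)
    have bdY: "bdel A Y (y # v) = sg (i + 1) (scl M (e * \<epsilon> b) (hq G (o1 # v')))
        + sg (i + 1) (scl M e (bdel A (\<lambda>z. hq G (o1 # z)) v))"
      unfolding bd_Cons'[of A Y y v] Yy scl_bd
      by (simp add: xy Y_def v e_def)
    have hq1: "bdel A (\<lambda>z. hq G (o1 # z)) v = - hq G v - bdel A (hq G) (o1 # v)"
      using hq_zero_hd[OF G wd(5)] unfolding bd_Cons'[of A "hq G" o1 v] by (simp add: o1 v sg_def)
    have IH1: "bdel A (hq G) (y # v) + hq (bdel A G) (y # v) = G (y # v) - G (y # mb v)"
      using Cons.IH[OF False _ G, of y] Cons.prems by simp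
    have IH2: "bdel A (hq G) (o1 # v) + hq (bdel A G) (o1 # v) = G (o1 # v) - G (o1 # mb v)"
      using Cons.IH[OF False _ G, of o1] wd by (simp add: o1)
    have bdF: "(\<lambda>z. bdel A F (x # z)) = (\<lambda>z. - F ((dif A l, j - 1) # z) + sg (j + 1) (Mm z) + sg (j + 1) (bdel A G z))"
      by (auto simp: fun_eq_iff xy bd_Cons Mm_def G_def split: list.splits)
    have hqM: "hq Mm (y # v) = sg (i + 1) (hm (\<lambda>z. F ((l * a, j + i) # z)) v)" "hq Mm (o1 # v) = - hm G v"
      by (simp_all add: hq_Cons Mm_def xy o1 o1_def G_def sg_def)
    have G0: "G ((0, k) # z) = 0" "G (o1 # (0, k) # z) = 0" if "is_word A z" for z k
      using that coch_zero_letter[OF G, of "[]" z] coch_zero_letter[OF G, of "[o1]" z] wd by (auto simp: o1)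
    have bdG11: "bdel A G (o1 # o1 # v) = bdel A (\<lambda>z. G (o1 # o1 # z)) v"
      using G0[of "o1 # v"] G0[of v] wd by (simp add: bd_Cons' o1 sg_def v) (simp add: o1_def)
    have bdF11: "bdel A F (x # o1 # o1 # v) = - F ((dif A l, j - 1) # o1 # o1 # v)
        + sg (j + 1) (G (o1 # v)) + sg (j + 1) (bdel A (\<lambda>z. G (o1 # o1 # z)) v)"
      unfolding bd_Cons'[of A F x] bdG11[unfolded G_def] by (simp add: o1 xy G_def)
    have cdl: "coch A M (n + j) (\<lambda>z. F ((dif A l, j - 1) # z))"
      using coch_Cons[OF F, of "(dif A l, j - 1)"] wd A.dif_degree by simp
    have hqbdF: "hq (bdel A F) (x # y # v) = sg (j + 1) (scl M e (bdel A F (x # o1 # o1 # v))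
        + hq (\<lambda>z. bdel A F (x # z)) (y # v) - scl M e (hq (\<lambda>z. bdel A F (x # z)) (o1 # v)))"
      using hm_Cons[OF coch_Cons[OF coch_bd[OF F], of x], of a i v] wd False
      by (simp add: hq_Cons[of _ "(l, j)"] xy e_def o1_def)
    have hqdl: "hq F ((dif A l, j - 1) # y # v) = sg j (scl M e (F ((dif A l, j - 1) # o1 # o1 # v))
        + hq (\<lambda>z. F ((dif A l, j - 1) # z)) (y # v) - scl M e (hq (\<lambda>z. F ((dif A l, j - 1) # z)) (o1 # v)))"
      using hm_Cons[OF cdl, of a i v] wd False
      by (simp add: hq_Cons[of _ "(dif A l, j - 1)"] xy e_def o1_def)
    have hqla: "hq F ((l * a, j + i) # v) = sg (j + i + 1) (hm (\<lambda>z. F ((l * a, j + i) # z)) v)"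
      by (simp add: hq_Cons)
    have bdhqF: "bdel A (hq F) (x # y # v) = - hq F ((dif A l, j - 1) # y # v) + sg (j + 1) (hq F ((l * a, j + i) # v))
        + sg (j + 1) (bdel A (\<lambda>z. hq F (x # z)) (y # v))"
      unfolding bd_Cons'[of A "hq F" x] by (simp add: xy)
    have hmGv: "hm G v = (if v' = [] then 0 else scl M (\<epsilon> b) (G (o1 # o1 # v'))) + hq G v - scl M (\<epsilon> b) (hq G (o1 # v'))"
      using hmG[OF wd(5)] by (simp add: E_def Y_def v)
    have mbv: "F (x # mb (y # v)) = G (y # mb v) - scl M e (G (o1 # mb v))"
    proof -
      have mbw: "is_word A (mb v)" using wd(5) False
        by (induction v) (auto simp: mb_def bar_degree split: if_splits)
      have "G ((bar a, i) # mb v) = G ((a, i) # mb v) - scl M e (G (o1 # mb v))"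
      proof (cases "i = 0")
        case True
        then have "scl A (\<epsilon> a) 1 \<in> gr A i" using wd by simp
        then show ?thesis using True wd mbw
          by (simp add: bar_def coch_letter_hd[OF G] coch_hd[OF G] o1_def e_def)
      next
        case False
        then show ?thesis using e0 by (simp add: bar_def e_def)
      qed
      moreover have "mb (y # v) = (bar a, i) # mb v" using False by (simp add: mb_def xy)
      ultimately show ?thesis by (simp add: G_def xy)
    qed
    have hG: "hq (bdel A G) (y # v) = G (y # v) - G (y # mb v) - bdel A (hq G) (y # v)"
      "hq (bdel A G) (o1 # v) = G (o1 # v) - G (o1 # mb v) - bdel A (hq G) (o1 # v)"
      using IH1 IH2 by (simp_all add: algebra_simps)
    have Gx: "F (x # y # v) = G (y # v)" by (simp add: G_def)
    \<comment> \<open>Either \<open>a\<close> has no unit component and all doubled terms vanish, or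
      \<open>a\<close> has degree \<open>0\<close> and its sign is known.\<close>
    from e0 show ?thesis
    proof
      assume "e = 0"
      then show ?thesis
        unfolding bdhqF hqbdF bdhq bdE bdY bdF hq_lin hqM hqdl hqla hG mbv Gx
        by (cases "even i"; cases "even j") (simp_all add: sg_def)
    next
      assume "i = 0"
      then show ?thesis
        unfolding bdhqF hqbdF bdhq bdE bdY bdF hq_lin hqM hqdl hqla hG mbv Gx bdF11 hq1 hmGv
        by (cases "even j"; cases "v' = []") (simp_all add: sg_def M.scale_right_distrib M.scale_right_diff_distrib algebra_simps)
    qed
  qed
qed simp

lemma hm_snoc: "hm F (u @ [y]) = hh (\<lambda>v. F (v @ [y])) u"
proof (induction u arbitrary: F)
  case Nil
  then show ?case by (cases y) (simp add: hm_simps hh_def)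
next
  case (Cons x u)
  then show ?case by (cases x) (simp add: hm_simps hh_def hhE_def)
qed

lemma opr_nat:
  assumes "\<And>x y. L (x + y) = L x + L y" "\<And>r x. L (scl M r x) = scl M r (L x)"
  shows "L (hh F w) = hh (\<lambda>v. L (F v)) w" "L (hm F w) = hm (\<lambda>v. L (F v)) w" "L (hq F w) = hq (\<lambda>v. L (F v)) w"
proof -
  show "L (hh F w) = hh (\<lambda>v. L (F v)) w"
    unfolding hh_def by (rule opr_hom) (simp_all add: assms hhE_def)
  have L0: "L 0 = 0" using assms(1)[of 0 0] by simp
  show hm: "L (hm F w) = hm (\<lambda>v. L (F v)) w" for F w
    unfolding hm_def by (rule opr_hom) (simp_all add: assms hmE_def hhE_def L0)
  show "L (hq F w) = hq (\<lambda>v. L (F v)) w"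
    by (cases w) (simp_all add: hq_Cons hm sg_hom[of L, OF assms(1)] L0)
qed

text \<open>The minus sign arises because \<open>hq\<close> carries the sign of passing the outer
  letter in \<open>sA\<close>, \<open>xt\<close> in the raised cochain degree that of the same
  letter in \<open>A\<close>, and these two degrees differ by one.\<close>

lemma xt_hh: "xt M (i + 1) (hh f) w = - hq (xt M i f) w"
proof (cases w rule: word_cases)
  case (3 x u y)
  have "hh (\<lambda>v. xt M i f (x # v @ [y])) u = sg (i * snd x + snd y) (lact M (fst x) (ract M (hh f u) (fst y)))"
    using opr_nat(1)[of "\<lambda>m. sg (i * snd x + snd y) (lact M (fst x) (ract M m (fst y)))" f u]
    by (simp add: M.scale_of_sg)
  then have "hq (xt M i f) w = sg (snd x + 1 + (i * snd x + snd y)) (lact M (fst x) (ract M (hh f u) (fst y)))"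
    unfolding 3 hq_Cons hm_snoc by simp
  then show ?thesis unfolding 3
    by (cases "even i"; cases "even (snd x)"; cases "even (snd y)") (simp_all add: sg_def)
qed auto

text \<open>The formula \<open>hq_bd\<close> for the extension of \<open>f\<close>, read off with
  units as outer letters as in \<open>cD_cD\<close>. Consequently a cocycle is cohomologous to its
  composite with \<open>bar\<close> in every letter, which vanishes on words containing a
  unit.\<close>

lemma cD_hh:
  assumes f: "coch A M i f" and u: "is_word A u"
  shows "cD A M (i + 1) (hh f) u - hh (cD A M i f) u = sg i (f u - f (map (\<lambda>x. (bar (fst x), snd x)) u))"
proof -
  let ?X = "xt M i f" and ?w = "(1, 0) # u @ [(1, 0)]" and ?bu = "map (\<lambda>x. (bar (fst x), snd x)) u"
  have w: "is_word A ?w" using u A.one_degree by simp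
  have bu: "is_word A ?bu" using u by (induction u) (auto simp: bar_degree)
  have one: "xt M j g ((1, 0) # v @ [(1, 0)]) = g v" if "g v \<in> gr M l" for j g l v
    using that by (simp add: lact_one ract_one)
  have "cD A M (i + 1) (hh f) u = xt M (i + 1 - 1) (cD A M (i + 1) (hh f)) ?w"
    by (rule one[symmetric]) (rule cochD(1)[OF coch_cD[OF coch_hh[OF f]] u])
  also have "\<dots> = dif M (xt M (i + 1) (hh f) ?w) + sg (i + 1) (bdel A (xt M (i + 1) (hh f)) ?w)"
    by (rule xt_cD[OF coch_hh[OF f] w])
  also have "\<dots> = - dif M (hq ?X ?w) + sg i (bdel A (hq ?X) ?w)"
  proof -
    have "xt M (i + 1) (hh f) = (\<lambda>w. - hq ?X w)" by (simp add: fun_eq_iff xt_hh)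
    then have "bdel A (xt M (i + 1) (hh f)) ?w = - bdel A (hq ?X) ?w"
      by (simp only: bd_neg)
    then show ?thesis unfolding xt_hh by (simp add: sg_def)
  qed
  finally have 1: "cD A M (i + 1) (hh f) u = - dif M (hq ?X ?w) + sg i (bdel A (hq ?X) ?w)" .
  have "hh (cD A M i f) u = xt M (i - 1 + 1) (hh (cD A M i f)) ?w"
    by (rule one[symmetric]) (rule cochD(1)[OF coch_hh[OF coch_cD[OF f]] u])
  also have "\<dots> = - hq (xt M (i - 1) (cD A M i f)) ?w" by (rule xt_hh)
  also have "hq (xt M (i - 1) (cD A M i f)) ?w = hq (\<lambda>v. dif M (?X v) + sg i (bdel A ?X v)) ?w"
    by (rule hq_cong[OF w]) (rule xt_cD[OF f])
  also have "\<dots> = dif M (hq ?X ?w) + sg i (hq (bdel A ?X) ?w)"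
    using opr_nat(3)[of "dif M" ?X ?w] by (simp add: hq_lin)
  finally have 2: "hh (cD A M i f) u = - (dif M (hq ?X ?w) + sg i (hq (bdel A ?X) ?w))" .
  have 3: "bdel A (hq ?X) ?w + hq (bdel A ?X) ?w = ?X ?w - ?X ((1, 0) # mb (u @ [(1, 0)]))"
    by (rule hq_bd[OF _ w coch_xt[OF f]]) simp
  have "cD A M (i + 1) (hh f) u - hh (cD A M i f) u = sg i (bdel A (hq ?X) ?w + hq (bdel A ?X) ?w)"
    unfolding 1 2 by simp
  also have "\<dots> = sg i (f u - f ?bu)"
    unfolding 3 using one[of f u, OF cochD(1)[OF f u]] one[of f ?bu, OF cochD(1)[OF f bu]] by (simp add: mb_def)
  finally show ?thesis .
qed

end

section \<open>Exactness of relative cochain complexes\<close>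

definition lw :: "('a \<Rightarrow> int \<Rightarrow> bool) \<Rightarrow> 'a word \<Rightarrow> bool" where
  "lw L w \<longleftrightarrow> (\<forall>x\<in>set w. L (fst x) (snd x))"

lemma lw_simps [simp]:
  "lw L []" "lw L (x # w) \<longleftrightarrow> L (fst x) (snd x) \<and> lw L w" "lw L (u @ w) \<longleftrightarrow> lw L u \<and> lw L w"
  by (auto simp: lw_def)

lemma lw_tl: "lw L w \<Longrightarrow> lw L (tl w)"
  by (cases w) auto

lemma lw_butlast: "lw L w \<Longrightarrow> lw L (butlast w)" and lw_take: "lw L w \<Longrightarrow> lw L (take n w)"
  and lw_drop: "lw L w \<Longrightarrow> lw L (drop n w)"
  by (auto simp: lw_def dest: in_set_butlastD in_set_takeD in_set_dropD)

lemma lw_hd: "lw L w \<Longrightarrow> w \<noteq> [] \<Longrightarrow> L (fst (hd w)) (snd (hd w))" and lw_last: "lw L w \<Longrightarrow> w \<noteq> [] \<Longrightarrow> L (fst (last w)) (snd (last w))"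
  by (auto simp: lw_def)

lemma is_word_lw: "is_word A w \<longleftrightarrow> lw (\<lambda>a i. a \<in> gr A i) w"
  by (auto simp: is_word_def lw_def)

text \<open>Closure under \<open>dif\<close> and products makes the words with letters in
  \<open>L\<close> stable under the bar differential.\<close>

definition letter_class :: "('k, 'a::ring_1) dg \<Rightarrow> ('a \<Rightarrow> int \<Rightarrow> bool) \<Rightarrow> bool" where
  "letter_class A L \<longleftrightarrow> (\<forall>a i. L a i \<longrightarrow> a \<in> gr A i \<and> L (dif A a) (i - 1)) \<and>
     (\<forall>a i b j. L a i \<longrightarrow> L b j \<longrightarrow> L (a * b) (i + j))"

lemma letter_classD:
  assumes "letter_class A L"
  shows "L a i \<Longrightarrow> a \<in> gr A i" "L a i \<Longrightarrow> L (dif A a) (i - 1)" "L a i \<Longrightarrow> L b j \<Longrightarrow> L (a * b) (i + j)"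
  using assms by (auto simp: letter_class_def)

lemma lw_is_word: "letter_class A L \<Longrightarrow> lw L w \<Longrightarrow> is_word A w"
  by (auto simp: is_word_lw lw_def letter_class_def)

text \<open>The bounds on length and degree serve two inductions: by word length in
  \<open>length_induction\<close>, and by degree in the elimination of the coefficients.\<close>

lemma bd_congL:
  assumes L: "letter_class A L"
  shows "lw L w \<Longrightarrow> (\<And>v. lw L v \<Longrightarrow> length v \<le> length w \<Longrightarrow> sdeg v = sdeg w - 1 \<Longrightarrow> F v = G v) \<Longrightarrow> bdel A F w = bdel A G w"
proof (induction w arbitrary: F G)
  case (Cons x w)
  note d = letter_classD[OF L]
  have 1: "F ((dif A (fst x), snd x - 1) # w) = G ((dif A (fst x), snd x - 1) # w)"
    using Cons.prems d(2) by (intro Cons.prems(2)) auto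
  have 2: "w \<noteq> [] \<Longrightarrow> F ((fst x * fst (hd w), snd x + snd (hd w)) # tl w) = G ((fst x * fst (hd w), snd x + snd (hd w)) # tl w)"
    using Cons.prems d(3) by (intro Cons.prems(2)) (cases w; auto)+
  have 3: "bdel A (\<lambda>v. F (x # v)) w = bdel A (\<lambda>v. G (x # v)) w"
    using Cons.prems(1) by (intro Cons.IH) (auto intro!: Cons.prems(2))
  show ?case unfolding bd_Cons' using 1 2 3 by simp
qed simp

lemma bd1_short:
  assumes L: "letter_class A L"
  shows "lw L w \<Longrightarrow> (\<And>v. lw L v \<Longrightarrow> length v < length w \<Longrightarrow> F v = 0) \<Longrightarrow> bd1 F w = 0"
proof (induction w arbitrary: F)
  case (Cons x w)
  note d = letter_classD[OF L]
  have 3: "bd1 (\<lambda>v. F (x # v)) w = 0"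
    using Cons.prems(1) by (intro Cons.IH) (auto intro!: Cons.prems(2))
  have 2: "F ((fst x * b, snd x + j) # v) = 0" if "w = (b, j) # v" for b j v
    using Cons.prems that d(3) by (intro Cons.prems(2)) auto
  show ?case using 2 3 by (cases x) (auto simp: bd1_Cons split: list.splits)
qed simp

lemma bd_gr:
  assumes L: "letter_class A L"
    and S: "\<And>x y. x \<in> S \<Longrightarrow> y \<in> S \<Longrightarrow> x + y \<in> S" "\<And>x. x \<in> S \<Longrightarrow> - x \<in> S" "(0::'m::ab_group_add) \<in> S"
  shows "lw L w \<Longrightarrow> (\<And>v. lw L v \<Longrightarrow> sdeg v = sdeg w - 1 \<Longrightarrow> length v \<le> length w \<Longrightarrow> F v \<in> S) \<Longrightarrow> bdel A F w \<in> S"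
proof (induction w arbitrary: F)
  case (Cons x w)
  note d = letter_classD[OF L]
  have sgS: "y \<in> S \<Longrightarrow> sg n y \<in> S" for n y using S by (simp add: sg_def)
  have 3: "bdel A (\<lambda>v. F (x # v)) w \<in> S"
    using Cons.prems(1) by (intro Cons.IH) (auto intro!: Cons.prems(2))
  have 1: "- F ((dif A (fst x), snd x - 1) # w) \<in> S"
    using Cons.prems d(2) by (intro S(2) Cons.prems(2)) auto
  have 2: "w \<noteq> [] \<Longrightarrow> F ((fst x * fst (hd w), snd x + snd (hd w)) # tl w) \<in> S"
    using Cons.prems d(3) by (intro Cons.prems(2)) (cases w; auto)+
  show ?case unfolding bd_Cons'
    by (intro S(1) 1) (use sgS S 2 3 in \<open>simp_all del: sg_simps\<close>)
qed (simp add: S)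

context weak_bimodule begin

lemma letter_class_gr: "letter_class A (\<lambda>a i. a \<in> gr A i)"
  by (simp add: letter_class_def A.dif_degree A.mult_degree)

lemma cD_congL:
  assumes L: "letter_class A L" and w: "lw L w"
    and fg: "\<And>v. lw L v \<Longrightarrow> length v \<le> length w \<Longrightarrow> f v = g v"
  shows "cD A M i f w = cD A M i g w"
proof -
  have "bdel A f w = bdel A g w" using bd_congL[OF L w] fg by blast
  moreover have "w \<noteq> [] \<Longrightarrow> f (tl w) = g (tl w) \<and> f (butlast w) = g (butlast w)"
    using w by (auto intro!: fg lw_tl lw_butlast)
  ultimately show ?thesis using fg[OF w] by (auto simp: cD_def)
qed

text \<open>Products and actions evaluate \<open>f\<close> at shorter words. At the lowest length
  where \<open>f\<close> is nonzero only the internal differentials remain.\<close>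

lemma cD_lead:
  assumes L: "letter_class A L" and w: "lw L w"
    and f: "\<And>v. lw L v \<Longrightarrow> length v < length w \<Longrightarrow> f v = 0"
  shows "cD A M i f w = dif M (f w) - sg i (bd0 A f w)"
proof -
  have "bd1 f w = 0" using bd1_short[OF L w] f by blast
  moreover have "w \<noteq> [] \<Longrightarrow> f (tl w) = 0 \<and> f (butlast w) = 0"
    using w by (auto intro!: f lw_tl lw_butlast)
  ultimately show ?thesis by (auto simp: cD_def bd_split)
qed

text \<open>A perturbation argument. \<open>H\<close> inverts \<open>cD\<close> only at the lowest
  length \<open>n\<close> at which the cocycle \<open>f\<close> does not vanish; subtracting
  \<open>cD (H f)\<close> raises \<open>n\<close>. The infinitely many corrections can be summed
  because at a given word only those with \<open>n\<close> at most its length contribute. The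
  equation is solved on words in \<open>W\<close>, while \<open>V\<close> and \<open>K\<close> carry
  a condition on the values along.\<close>

lemma length_induction:
  fixes H :: "('a word \<Rightarrow> 'm) \<Rightarrow> 'a word \<Rightarrow> 'm"
  assumes W: "letter_class A W" and K: "M.subspace K"
    and H: "\<And>n f. coch A M i f \<Longrightarrow> (\<And>w. lw V w \<Longrightarrow> f w \<in> K) \<Longrightarrow> (\<And>w. lw W w \<Longrightarrow> cD A M i f w = 0) \<Longrightarrow>
        (\<And>w. lw W w \<Longrightarrow> length w < n \<Longrightarrow> f w = 0) \<Longrightarrow>
        coch A M (i + 1) (H f) \<and> (\<forall>w. lw V w \<longrightarrow> H f w \<in> K) \<and> (\<forall>w. lw W w \<longrightarrow> length w < n \<longrightarrow> H f w = 0) \<and>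
        (\<forall>w. lw W w \<longrightarrow> length w = n \<longrightarrow> cD A M (i + 1) (H f) w = f w)"
    and V: "\<And>g w. coch A M (i + 1) g \<Longrightarrow> (\<And>w. lw V w \<Longrightarrow> g w \<in> K) \<Longrightarrow> lw V w \<Longrightarrow> cD A M (i + 1) g w \<in> K"
    and f: "coch A M i f" "\<And>w. lw V w \<Longrightarrow> f w \<in> K" "\<And>w. lw W w \<Longrightarrow> cD A M i f w = 0"
  shows "\<exists>g. coch A M (i + 1) g \<and> (\<forall>w. lw V w \<longrightarrow> g w \<in> K) \<and> (\<forall>w. lw W w \<longrightarrow> cD A M (i + 1) g w = f w)"
proof -
  define fs where "fs = rec_nat f (\<lambda>n F w. F w - cD A M (i + 1) (H F) w)"
  have fs0: "fs 0 = f" and fsS: "fs (Suc n) = (\<lambda>w. fs n w - cD A M (i + 1) (H (fs n)) w)" for n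
    by (simp_all add: fs_def)
  have inv: "coch A M i (fs n) \<and> (\<forall>w. lw V w \<longrightarrow> fs n w \<in> K) \<and> (\<forall>w. lw W w \<longrightarrow> cD A M i (fs n) w = 0) \<and>
      (\<forall>w. lw W w \<longrightarrow> length w < n \<longrightarrow> fs n w = 0)" for n
  proof (induction n)
    case 0
    then show ?case using f by (simp add: fs0)
  next
    case (Suc n)
    then have h: "coch A M (i + 1) (H (fs n))" "\<And>w. lw V w \<Longrightarrow> H (fs n) w \<in> K" 
      "\<And>w. lw W w \<Longrightarrow> length w < n \<Longrightarrow> H (fs n) w = 0"
      "\<And>w. lw W w \<Longrightarrow> length w = n \<Longrightarrow> cD A M (i + 1) (H (fs n)) w = fs n w"
      using H[of "fs n" n] by blast+
    have c: "coch A M (i + 1 - 1) (cD A M (i + 1) (H (fs n)))" by (rule coch_cD[OF h(1)])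
    have 1: "coch A M i (fs (Suc n))"
      unfolding fsS using Suc c by (intro coch_closed) auto
    have 2: "\<forall>w. lw V w \<longrightarrow> fs (Suc n) w \<in> K"
      unfolding fsS using Suc V[OF h(1,2)] K by (auto intro: M.subspace_diff)
    have 3: "cD A M i (fs (Suc n)) w = 0" if w: "lw W w" for w
      unfolding fsS cD_diff using Suc w cD_cD[OF h(1) lw_is_word[OF W w]] by simp
    have 4: "fs (Suc n) w = 0" if w: "lw W w" "length w < Suc n" for w
    proof (cases "length w = n")
      case True
      then show ?thesis using h(4) w by (simp add: fsS)
    next
      case False
      then have "length w < n" using w by simp
      moreover have "cD A M (i + 1) (H (fs n)) w = cD A M (i + 1) (\<lambda>_. 0) w"
        by (rule cD_congL[OF W w(1)]) (use h(3) calculation in auto)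
      ultimately show ?thesis using Suc w by (simp add: fsS)
    qed
    show ?case using 1 2 3 4 by blast
  qed
  have h: "coch A M (i + 1) (H (fs n))" "\<And>w. lw V w \<Longrightarrow> H (fs n) w \<in> K" 
      "\<And>w. lw W w \<Longrightarrow> length w < n \<Longrightarrow> H (fs n) w = 0" for n
    using H[of "fs n" n] inv by blast+
  \<comment> \<open>Corrections of index above \<open>length w\<close> vanish at words in
    \<open>W\<close>. Truncating there gives a finite sum at every list, and the bound does not
    change when one letter is replaced, so \<open>g\<close> stays multilinear.\<close>
  define g where "g = (\<lambda>w. \<Sum>n\<le>length w. H (fs n) w)"
  have 1: "coch A M (i + 1) g"
  proof (rule cochI)
    fix w assume "is_word A w"
    then show "g w \<in> gr M (i + 1 + sdeg w)"
      unfolding g_def by (intro M.subspace_sum gr_sub cochD(1)[OF h(1)])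
  next
    fix u w a b l assume "is_word A u" "is_word A w" "a \<in> gr A l" "b \<in> gr A l"
    then show "g (u @ (a + b, l) # w) = g (u @ (a, l) # w) + g (u @ (b, l) # w)"
      by (simp add: g_def cochD(2)[OF h(1)] sum.distrib del: sum.atMost_Suc)
  next
    fix u w a r l assume "is_word A u" "is_word A w" "a \<in> gr A l"
    then show "g (u @ (scl A r a, l) # w) = scl M r (g (u @ (a, l) # w))"
      by (simp add: g_def cochD(3)[OF h(1)] M.scale_sum_right del: sum.atMost_Suc)
  qed
  have part: "cD A M (i + 1) (\<lambda>w. \<Sum>n\<le>N. H (fs n) w) w = f w - fs (Suc N) w" for N w
    by (induction N) (simp_all add: cD_add fsS fs0)
  have 2: "cD A M (i + 1) g w = f w" if w: "lw W w" for w
  proof -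
    have "cD A M (i + 1) g w = cD A M (i + 1) (\<lambda>v. \<Sum>n\<le>length w. H (fs n) v) w"
    proof (rule cD_congL[OF W w])
      fix v assume v: "lw W v" "length v \<le> length w"
      show "g v = (\<Sum>n\<le>length w. H (fs n) v)"
        unfolding g_def by (rule sum.mono_neutral_left) (use v h(3) in auto)
    qed
    then show ?thesis using part[of "length w" w] inv[of "Suc (length w)"] w by simp
  qed
  have 3: "g w \<in> K" if "lw V w" for w
    unfolding g_def using that by (intro M.subspace_sum K h(2))
  show ?thesis using 1 2 3 by blast
qed

end

section \<open>Contraction to a subalgebra that is the ground field in degree 0\<close>

text \<open>
  For \<open>A\<close> concentrated in non-positive degrees with \<open>H\<^sub>0\<close> the ground field, the map \<open>s\<close> inverts the
  differential on the augmentation ideal of \<open>A\<^sub>0\<close> and contracts \<open>A\<close> to the subalgebra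
  \<open>{a. s a = 0 \<and> s (d a) = 0}\<close>, which is the ground field in degree \<open>0\<close>.
\<close>

locale contraction = augmented_dg_algebra A \<epsilon>
  for A :: "('k::field, 'a::ring_1) dg" and \<epsilon> :: "'a \<Rightarrow> 'k" +
  fixes s :: "'a \<Rightarrow> 'a"
  assumes nonneg: "i > 0 \<Longrightarrow> gr A i = {0}"
    and s_add: "s (a + b) = s a + s b"
    and s_scl: "s (scl A r a) = scl A r (s a)"
    and s_gr: "a \<in> gr A i \<Longrightarrow> s a \<in> gr A (i + 1)"
    and s_degree: "a \<in> gr A i \<Longrightarrow> i \<noteq> -1 \<Longrightarrow> s a = 0"
    and s_dif: "a \<in> gr A 0 \<Longrightarrow> s (dif A a) = a - scl A (\<epsilon> a) 1"
    and aug_s: "\<epsilon> (s a) = 0"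
begin

lemma s_simps [simp]: "s 0 = 0" "s (a + b) = s a + s b" "s (- a) = - s a" "s (a - b) = s a - s b" "s (scl A r a) = scl A r (s a)" "s 1 = 0"
proof -
  show 0: "s 0 = 0" using s_scl[of 0 0] by simp
  show m: "s (- a) = - s a" for a using s_scl[of "-1" a] by simp
  show "s (a - b) = s a - s b" using s_add[of a "- b"] m by simp
  show "s 1 = 0" using s_degree[OF one_degree] by simp
qed (simp_all add: s_add s_scl)

definition pr :: "'a \<Rightarrow> 'a" where "pr a = a - dif A (s a) - s (dif A a)"

lemma pr_gr: "a \<in> gr A l \<Longrightarrow> pr a \<in> gr A l"
  using dif_degree[OF s_gr, of a l] s_gr[OF dif_degree, of a l] by (auto simp: pr_def)

lemma pr_dif: "pr (dif A a) = dif A (pr a)"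
  by (simp add: pr_def dif_dif)

text \<open>Follows from \<open>s \<circ> dif \<circ> s = s\<close> and
  \<open>s \<circ> s = 0\<close> on homogeneous elements. The first holds because \<open>s\<close>
  takes values in the augmentation ideal of degree \<open>0\<close>, where it is inverse to
  \<open>dif\<close>.\<close>

lemma s_pr: assumes a: "a \<in> gr A l" shows "s (pr a) = 0" "s (dif A (pr a)) = 0"
proof -
  have ss: "s (s (dif A a)) = 0" using s_degree[OF s_gr[OF dif_degree[OF a]]] s_degree[OF dif_degree[OF a]] by (cases "l = -1") auto
  have 1: "s (dif A (s b)) = s b" if b: "b \<in> gr A j" for b j
  proof (cases "j = -1")
    case True
    then show ?thesis using s_dif[of "s b"] s_gr[OF b] aug_s by simp
  next
    case False
    then show ?thesis using s_degree[OF b] by simp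
  qed
  show "s (pr a) = 0" using 1[OF a] ss by (simp add: pr_def)
  show "s (dif A (pr a)) = 0" using 1[OF dif_degree[OF a]] by (simp add: pr_def dif_dif)
qed

definition tl_letter :: "'a \<Rightarrow> int \<Rightarrow> bool" where
  "tl_letter a i \<longleftrightarrow> a \<in> gr A i \<and> s a = 0 \<and> s (dif A a) = 0"

text \<open>The part of the subalgebra in negative degrees, which complements the unit; there
  \<open>s (dif A a) = 0\<close> holds for degree reasons.\<close>

definition b_letter :: "'a \<Rightarrow> int \<Rightarrow> bool" where
  "b_letter a i \<longleftrightarrow> a \<in> gr A i \<and> i < 0 \<and> s a = 0"

lemma tl_letter0: "tl_letter a 0 \<longleftrightarrow> a = scl A (\<epsilon> a) 1"
proof
  assume "tl_letter a 0"
  then show "a = scl A (\<epsilon> a) 1" using s_dif[of a] by (simp add: tl_letter_def)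
next
  assume a: "a = scl A (\<epsilon> a) 1"
  have "s a = scl A (\<epsilon> a) (s 1)" "dif A a = scl A (\<epsilon> a) (dif A 1)" "scl A (\<epsilon> a) 1 \<in> gr A 0"
    using s_scl[of "\<epsilon> a" 1] dif_simps(5)[of "\<epsilon> a" 1] a gr_intros(5)[OF one_degree] by metis+
  then show "tl_letter a 0" using a by (simp add: tl_letter_def)
qed

lemma tl_letter_pos: "tl_letter a i \<Longrightarrow> i > 0 \<Longrightarrow> a = 0"
  using nonneg[of i] by (auto simp: tl_letter_def)

lemma b_letter_tl: "b_letter a i \<longleftrightarrow> tl_letter a i \<and> i < 0"
  using s_degree[OF dif_degree, of a i] by (auto simp: b_letter_def tl_letter_def)

text \<open>A factor of degree \<open>0\<close> is a scalar. A product of two factors of negative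
  degree has degree at most \<open>-2\<close>, where both conditions hold since \<open>s\<close> is
  nonzero in degree \<open>-1\<close> only.\<close>

lemma tl_letter_class: "letter_class A tl_letter"
  unfolding letter_class_def
proof (intro conjI allI impI)
  fix a i b j assume a: "tl_letter a i" and b: "tl_letter b j"
  show "tl_letter (a * b) (i + j)"
  proof (cases "i > 0 \<or> j > 0")
    case True
    then have "a * b = 0" using tl_letter_pos[OF a] tl_letter_pos[OF b] by auto
    then show ?thesis by (simp add: tl_letter_def)
  next
    case False
    have ab: "a * b \<in> gr A (i + j)" using a b mult_degree by (auto simp: tl_letter_def)
    show ?thesis
    proof (cases "i = 0 \<or> j = 0")
      case True
      then have "a * b = scl A (\<epsilon> a) b \<and> i = 0 \<or> a * b = scl A (\<epsilon> b) a \<and> j = 0"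
        using a b tl_letter0[of a] tl_letter0[of b]
        by (metis mult.left_neutral mult.right_neutral scl_mult_left scl_mult_right)
      then show ?thesis using a b by (auto simp: tl_letter_def)
    next
      case False
      then have "i + j \<noteq> -1" "i + j - 1 \<noteq> - 1" using \<open>\<not> (i > 0 \<or> j > 0)\<close> by auto
      then show ?thesis using s_degree[OF ab] s_degree[OF dif_degree[OF ab]] ab by (simp add: tl_letter_def)
    qed
  qed
qed (auto simp: tl_letter_def dif_degree dif_dif)

lemma b_letter_class: "letter_class A b_letter"
  using tl_letter_class unfolding letter_class_def b_letter_tl by fastforce

lemma b_letter_aug: "b_letter a i \<Longrightarrow> \<epsilon> a = 0"
  using aug_degree[of a i] by (auto simp: b_letter_def)

lemma sdeg_b: "lw b_letter w \<Longrightarrow> sdeg w \<le> 0"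
  by (induction w) (auto simp: b_letter_def)

lemma b_word: "lw b_letter w \<Longrightarrow> is_word A w"
  by (rule lw_is_word[OF b_letter_class])

end

locale contraction_bimodule = contraction A \<epsilon> s + weak_bimodule A M
  for A :: "('k::field, 'a::ring_1) dg" and \<epsilon> :: "'a \<Rightarrow> 'k" and s :: "'a \<Rightarrow> 'a"
    and M :: "('k, 'a, 'm::ab_group_add) dg_bimod"
begin

sublocale aug_weak_bimodule A M \<epsilon> ..

lemma letter_map_pr: "letter_map pr"
  unfolding letter_map_def by (auto simp: pr_gr) (simp_all add: pr_def scale_right_diff_distrib algebra_simps)

text \<open>The tensor trick: \<open>s\<close> on one letter, \<open>pr\<close> on the letters to
  its left, the identity on those to its right.\<close>

definition hsE :: "('a word \<Rightarrow> 'm) \<Rightarrow> 'a \<Rightarrow> int \<Rightarrow> 'a word \<Rightarrow> 'm" where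
  "hsE F a i w = F ((s a, i + 1) # w)"

definition hs :: "('a word \<Rightarrow> 'm) \<Rightarrow> 'a word \<Rightarrow> 'm" where "hs = opr hsE pr"

lemma hs_simps [simp]: "hs F [] = 0"
  "hs F ((a, i) # w) = F ((s a, i + 1) # w) + sg (i + 1) (hs (\<lambda>v. F ((pr a, i) # v)) w)"
  by (simp_all add: hs_def hsE_def)

lemma local_op_hs: "local_op hsE 1"
  unfolding local_op_def hsE_def
proof (intro conjI allI impI)
  fix i F a l assume F: "coch A M i F" and a: "a \<in> gr A l"
  have "coch A M (i + (l + 1) + 1) (\<lambda>w. F ((s a, l + 1) # w))"
    using coch_Cons[OF F, of "(s a, l + 1)"] s_gr[OF a] by simp
  then show "coch A M (i + l + 1 + 1) (\<lambda>w. F ((s a, l + 1) # w))"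
    by (simp add: algebra_simps)
qed (auto simp: s_gr coch_hd)

lemmas hs_lin = opr_add[OF local_op_hs letter_map_pr, folded hs_def]
  opr_diff[OF local_op_hs letter_map_pr, folded hs_def] opr_neg[OF local_op_hs letter_map_pr, folded hs_def]
  opr_sg[OF local_op_hs letter_map_pr, folded hs_def] opr_scl[OF local_op_hs letter_map_pr, folded hs_def]

lemma coch_hs: "coch A M i F \<Longrightarrow> coch A M (i + 1) (hs F)"
  using coch_opr[OF local_op_hs letter_map_pr] by (simp add: hs_def)

lemma hs_zero:
  "is_word A w \<Longrightarrow> (\<And>v. is_word A v \<Longrightarrow> length v = length w \<Longrightarrow> F v = 0) \<Longrightarrow> hs F w = 0"
proof (induction w arbitrary: F)
  case (Cons x w)
  then show ?case by (cases x) (auto simp: s_gr pr_gr)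
qed simp

lemma hs_tl_letter: "lw tl_letter w \<Longrightarrow> coch A M i F \<Longrightarrow> hs F w = 0"
proof (induction w arbitrary: i F)
  case (Cons x w)
  obtain a l where x: "x = (a, l)" by force
  have a: "a \<in> gr A l" "s a = 0" using Cons.prems by (auto simp: tl_letter_def x)
  have w: "is_word A w" using Cons.prems lw_is_word[OF tl_letter_class] by auto
  have "hs (\<lambda>v. F ((pr a, l) # v)) w = 0"
    using Cons.IH[OF _ coch_Cons[OF Cons.prems(2), of "(pr a, l)"]] Cons.prems(1) a pr_gr by simp
  then show ?case using coch_zero_hd[OF Cons.prems(2) w] a by (simp add: x)
qed simp

text \<open>\<open>s\<close> is compatible with \<open>dif\<close> but in general not with products,
  so the homotopy formula concerns \<open>bd0\<close> only; \<open>length_induction\<close> takes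
  care of \<open>bd1\<close>.\<close>

lemma hs_bd0:
  "is_word A w \<Longrightarrow> coch A M n F \<Longrightarrow>
   bd0 A (hs F) w + hs (bd0 A F) w = F (map (\<lambda>x. (pr (fst x), snd x)) w) - F w"
proof (induction w arbitrary: n F)
  case (Cons x w)
  obtain a i where x: "x = (a, i)" by force
  note F = Cons.prems(2)
  have a: "a \<in> gr A i" "is_word A w" "dif A a \<in> gr A (i - 1)" "pr a \<in> gr A i" "s (dif A a) \<in> gr A i" "dif A (s a) \<in> gr A i" "s a \<in> gr A (i + 1)"
    using Cons.prems dif_degree pr_gr s_gr[of "dif A a" "i - 1"] dif_degree[of "s a" "i + 1"] s_gr by (auto simp: x)
  have IH: "bd0 A (hs (\<lambda>v. F ((pr a, i) # v))) w + hs (bd0 A (\<lambda>v. F ((pr a, i) # v))) w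
      = F ((pr a, i) # map (\<lambda>x. (pr (fst x), snd x)) w) - F ((pr a, i) # w)"
    using Cons.IH[OF a(2) coch_Cons[OF F, of "(pr a, i)"]] a by simp
  have lin: "bd0 A (\<lambda>v. G v + sg k (H v)) w = bd0 A G w + sg k (bd0 A H w)" for G H :: "'a word \<Rightarrow> 'm" and k
    using opr_add[OF local_op_bd0 letter_map_id, of G "\<lambda>v. sg k (H v)"] opr_sg[OF local_op_bd0 letter_map_id]
    by (simp add: bd0_def)
  have 1: "bd0 A (\<lambda>v. hs F ((a, i) # v)) w = bd0 A (\<lambda>v. F ((s a, i + 1) # v)) w + sg (i + 1) (bd0 A (hs (\<lambda>v. F ((pr a, i) # v))) w)"
    by (simp add: lin)
  have 2: "hs (\<lambda>v. bd0 A F ((pr a, i) # v)) w = - hs (\<lambda>v. F ((dif A (pr a), i - 1) # v)) w + sg (i + 1) (hs (bd0 A (\<lambda>v. F ((pr a, i) # v))) w)"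
    using hs_lin(2)[of "\<lambda>v. sg (i + 1) (bd0 A (\<lambda>v. F ((pr a, i) # v)) v)" "\<lambda>v. F ((dif A (pr a), i - 1) # v)" w]
    by (simp add: bd0_Cons hs_lin(4))
  have 3: "F ((a, i) # w) = F ((pr a, i) # w) + F ((dif A (s a), i) # w) + F ((s (dif A a), i) # w)"
  proof -
    have e: "a = pr a + dif A (s a) + s (dif A a)" by (simp add: pr_def)
    show ?thesis
      by (subst e) (use a coch_hd[OF F] in simp)
  qed
  show ?case
    unfolding x bd0_Cons[of A "hs F" a i w] hs_simps(2)[of "bd0 A F" a i w] list.map fst_conv snd_conv 1 2
    using IH 3 by (cases "even i") (simp_all add: bd0_Cons sg_def pr_dif algebra_simps)
qed (simp add: bd0_def)

text \<open>On the lowest word length \<open>hs\<close> contracts the complex of cochains that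
  vanish on the subalgebra, because \<open>pr\<close> moves every letter into the subalgebra, where
  \<open>f\<close> is zero.\<close>

lemma exact_rel_tl:
  assumes f: "coch A M i f" "\<And>w. lw tl_letter w \<Longrightarrow> f w = 0" "\<And>w. is_word A w \<Longrightarrow> cD A M i f w = 0"
  shows "\<exists>g. coch A M (i + 1) g \<and> (\<forall>w. lw tl_letter w \<longrightarrow> g w = 0) \<and> (\<forall>w. is_word A w \<longrightarrow> cD A M (i + 1) g w = f w)"
proof -
  have "\<exists>g. coch A M (i + 1) g \<and> (\<forall>w. lw tl_letter w \<longrightarrow> g w \<in> {0}) \<and>
      (\<forall>w. lw (\<lambda>a i. a \<in> gr A i) w \<longrightarrow> cD A M (i + 1) g w = f w)"
  proof (rule length_induction[where H = "\<lambda>f w. - sg i (hs f w)"])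
    fix n and f :: "'a word \<Rightarrow> 'm"
    assume f: "coch A M i f" "\<And>w. lw tl_letter w \<Longrightarrow> f w \<in> {0}" "\<And>w. lw (\<lambda>a i. a \<in> gr A i) w \<Longrightarrow> cD A M i f w = 0"
      and sh: "\<And>w. lw (\<lambda>a i. a \<in> gr A i) w \<Longrightarrow> length w < n \<Longrightarrow> f w = 0"
    have 1: "coch A M (i + 1) (\<lambda>w. - sg i (hs f w))"
      by (intro coch_closed coch_hs f)
    have 2: "hs f w = 0" if "lw tl_letter w" for w
      using hs_tl_letter[OF that f(1)] .
    have 3: "hs f w = 0" if "is_word A w" "length w < n" for w
      using that sh by (intro hs_zero) (auto simp: is_word_lw)
    have 4: "cD A M (i + 1) (\<lambda>w. - sg i (hs f w)) w = f w" if w: "is_word A w" "length w = n" for w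
    proof -
      have "lw (\<lambda>a i. a \<in> gr A i) w" using w by (simp add: is_word_lw)
      then have a: "cD A M (i + 1) (hs f) w = dif M (hs f w) + sg i (bd0 A (hs f) w)"
        using cD_lead[OF letter_class_gr, of w "hs f" "i + 1"] 3 w by (simp add: is_word_lw sg_def)
      have "hs (\<lambda>v. dif M (f v) - sg i (bd0 A f v)) w = hs (\<lambda>v. 0) w"
      proof -
        have "dif M (f v) - sg i (bd0 A f v) = 0" if "is_word A v" "length v = length w" for v
          using cD_lead[OF letter_class_gr, of v f i] f(3)[of v] sh that w by (simp add: is_word_lw)
        then have "hs (\<lambda>v. dif M (f v) - sg i (bd0 A f v)) w = 0"
          by (intro hs_zero) (use w in auto)
        moreover have "hs (\<lambda>v. 0) w = 0" by (rule hs_zero) (use w in auto)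
        ultimately show ?thesis by simp
      qed
      then have "hs (\<lambda>v. dif M (f v)) w = sg i (hs (bd0 A f) w)"
        using hs_zero[of w "\<lambda>v. 0"] w by (simp add: hs_lin)
      moreover have "dif M (hs f w) = hs (\<lambda>v. dif M (f v)) w"
        unfolding hs_def by (rule opr_hom) (simp_all add: hsE_def)
      ultimately have "cD A M (i + 1) (hs f) w = sg i (hs (bd0 A f) w + bd0 A (hs f) w)"
        using a by simp
      also have "\<dots> = sg i (f (map (\<lambda>x. (pr (fst x), snd x)) w) - f w)"
        using hs_bd0[OF w(1) f(1)] by (simp add: add.commute)
      also have "f (map (\<lambda>x. (pr (fst x), snd x)) w) = 0"
      proof -
        have "lw tl_letter (map (\<lambda>x. (pr (fst x), snd x)) w)" using w(1)
          by (auto simp: lw_def is_word_def tl_letter_def pr_gr s_pr split: prod.splits)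
        then show ?thesis using f(2) by simp
      qed
      finally have "cD A M (i + 1) (hs f) w = - sg i (f w)" by simp
      then show ?thesis by (simp add: cD_neg cD_sg) (simp add: sg_def)
    qed
    show "coch A M (i + 1) (\<lambda>w. - sg i (hs f w)) \<and> (\<forall>w. lw tl_letter w \<longrightarrow> - sg i (hs f w) \<in> {0}) \<and>
      (\<forall>w. lw (\<lambda>a i. a \<in> gr A i) w \<longrightarrow> length w < n \<longrightarrow> - sg i (hs f w) = 0) \<and>
      (\<forall>w. lw (\<lambda>a i. a \<in> gr A i) w \<longrightarrow> length w = n \<longrightarrow> cD A M (i + 1) (\<lambda>w. - sg i (hs f w)) w = f w)"
      using 1 2 3 4 by (simp add: is_word_lw)
  next
    fix g :: "'a word \<Rightarrow> 'm" and w assume g: "\<And>w. lw tl_letter w \<Longrightarrow> g w \<in> {0}" and w: "lw tl_letter w"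
    have "cD A M (i + 1) g w = cD A M (i + 1) (\<lambda>_. 0) w"
      by (rule cD_congL[OF tl_letter_class w]) (use g in auto)
    then show "cD A M (i + 1) g w \<in> {0}" by simp
  qed (use f letter_class_gr in \<open>auto simp: is_word_lw M.subspace_def\<close>)
  then show ?thesis by (simp add: is_word_lw)
qed

lemma hh_b_letter: "lw b_letter w \<Longrightarrow> hh F w = 0"
proof (induction w arbitrary: F)
  case (Cons x w)
  then show ?case by (cases x) (auto simp: hh_def hhE_def b_letter_aug)
qed (simp add: hh_def)

text \<open>Normalization comes before \<open>exact_rel_tl\<close>. After the coboundary of
  \<open>hh f\<close> is subtracted, the cocycle is \<open>f\<close> composed with
  \<open>bar\<close>. Its value at a word of the subalgebra is zero: if all letters are negative
  this is the hypothesis on \<open>f\<close>, and any other letter is zero or a multiple of the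
  unit, which \<open>bar\<close> kills.\<close>

lemma exact_rel_b:
  assumes f: "coch A M i f" "\<And>w. lw b_letter w \<Longrightarrow> f w = 0" "\<And>w. is_word A w \<Longrightarrow> cD A M i f w = 0"
  shows "\<exists>g. coch A M (i + 1) g \<and> (\<forall>w. lw b_letter w \<longrightarrow> g w = 0) \<and> (\<forall>w. is_word A w \<longrightarrow> cD A M (i + 1) g w = f w)"
proof -
  let ?g = "\<lambda>w. sg i (hh f w)"
  let ?f = "\<lambda>w. f w - cD A M (i + 1) ?g w"
  have g: "coch A M (i + 1) ?g" by (intro coch_closed coch_hh f)
  have f': "coch A M i ?f"
    using coch_cD[OF g] f(1) by (intro coch_closed) auto
  have fbar: "?f w = f (map (\<lambda>x. (bar (fst x), snd x)) w)" if w: "is_word A w" for w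
  proof -
    have "hh (cD A M i f) w = hh (\<lambda>v. scl M 0 0) w"
      by (rule hh_cong[OF w]) (use f(3) in auto)
    also have "\<dots> = scl M 0 (hh (\<lambda>v. 0) w)" 
      unfolding hh_def by (rule opr_scl[OF local_op_hh letter_map_bar])
    finally have "hh (cD A M i f) w = 0" by simp
    then show ?thesis using cD_hh[OF f(1) w] by (cases "even i") (simp_all add: cD_sg, simp_all add: sg_def)
  qed
  have "?f w = 0" if w: "lw tl_letter w" for w
  proof (cases "lw b_letter w")
    case True
    then have "map (\<lambda>x. (bar (fst x), snd x)) w = w"
      by (auto simp: lw_def bar_def b_letter_aug intro!: map_idI)
    then show ?thesis using fbar[OF lw_is_word[OF tl_letter_class w]] True f(2) by simp
  next
    case False
    then obtain x where x: "x \<in> set w" "\<not> b_letter (fst x) (snd x)" by (auto simp: lw_def)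
    then have "bar (fst x) = 0"
      using w tl_letter0[of "fst x"] tl_letter_pos[of "fst x" "snd x"]
      by (cases "snd x = 0") (auto simp: lw_def b_letter_tl bar_def)
    moreover obtain u v where "w = u @ x # v" using x by (meson split_list)
    moreover have "is_word A (map (\<lambda>x. (bar (fst x), snd x)) u)" if "is_word A u" for u
      using that by (auto simp: is_word_def bar_degree)
    ultimately show ?thesis
      using fbar[OF lw_is_word[OF tl_letter_class w]] lw_is_word[OF tl_letter_class w] coch_zero_letter[OF f(1)]
      by simp
  qed
  moreover have "cD A M i ?f w = 0" if w: "is_word A w" for w
    using cD_diff[of i f "cD A M (i + 1) ?g" w] cD_cD[OF g w] f(3)[OF w] by simp
  ultimately obtain g' where g': "coch A M (i + 1) g'" "\<And>w. lw tl_letter w \<Longrightarrow> g' w = 0"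
    "\<And>w. is_word A w \<Longrightarrow> cD A M (i + 1) g' w = ?f w"
    using exact_rel_tl[OF f'] by blast
  have "coch A M (i + 1) (\<lambda>w. ?g w + g' w)" by (intro coch_closed(2) g g')
  moreover have "?g w + g' w = 0" if w: "lw b_letter w" for w
    using hh_b_letter[OF w, of f] g'(2) w by (simp add: lw_def b_letter_tl)
  moreover have "cD A M (i + 1) (\<lambda>w. ?g w + g' w) w = f w" if w: "is_word A w" for w
    using cD_add[of "i + 1" ?g g' w] g'(3)[OF w] by simp
  ultimately show ?thesis by blast
qed

text \<open>Contracts the coefficients instead of the letters. \<open>t\<close> is a contracting
  homotopy of \<open>K\<close> for \<open>dif\<close> alone; \<open>length_induction\<close>
  corrects for the actions. The intended \<open>K\<close> consists of the functionals on
  \<open>A\<close> that vanish on the subalgebra.\<close>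

lemma exact_coeff:
  assumes K: "M.subspace K" "\<And>x. x \<in> K \<Longrightarrow> dif M x \<in> K"
    "\<And>a i x. b_letter a i \<Longrightarrow> x \<in> K \<Longrightarrow> lact M a x \<in> K \<and> ract M x a \<in> K"
    and t: "\<And>x y. t (x + y) = t x + t y" "\<And>r x. t (scl M r x) = scl M r (t x)"
    "\<And>x j. x \<in> gr M j \<Longrightarrow> t x \<in> gr M (j + 1)" "\<And>x. x \<in> K \<Longrightarrow> t x \<in> K"
    "\<And>x j. x \<in> K \<Longrightarrow> x \<in> gr M j \<Longrightarrow> dif M (t x) + t (dif M x) = x"
    and f: "coch A M i f" "\<And>w. lw b_letter w \<Longrightarrow> f w \<in> K" "\<And>w. lw b_letter w \<Longrightarrow> cD A M i f w = 0"
  shows "\<exists>g. coch A M (i + 1) g \<and> (\<forall>w. lw b_letter w \<longrightarrow> g w \<in> K) \<and> (\<forall>w. lw b_letter w \<longrightarrow> cD A M (i + 1) g w = f w)"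
proof (rule length_induction[where H = "\<lambda>f w. t (f w)"])
  fix n and f :: "'a word \<Rightarrow> 'm"
  assume f: "coch A M i f" "\<And>w. lw b_letter w \<Longrightarrow> f w \<in> K" "\<And>w. lw b_letter w \<Longrightarrow> cD A M i f w = 0"
    and sh: "\<And>w. lw b_letter w \<Longrightarrow> length w < n \<Longrightarrow> f w = 0"
  have t0: "t 0 = 0" using t(1)[of 0 0] by simp
  have 1: "coch A M (i + 1) (\<lambda>w. t (f w))"
  proof (rule cochI)
    fix w assume "is_word A w"
    then show "t (f w) \<in> gr M (i + 1 + sdeg w)" using t(3)[OF cochD(1)[OF f(1)]] by (simp add: algebra_simps)
  qed (simp_all add: cochD(2,3)[OF f(1)] t)
  have 3: "cD A M (i + 1) (\<lambda>w. t (f w)) w = f w" if w: "lw b_letter w" "length w = n" for w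
  proof -
    have "t (bd0 A f w) = bd0 A (\<lambda>v. t (f v)) w"
    proof -
      have "t (- x) = - t x" for x using t(2)[of "-1" x] by simp
      then show ?thesis unfolding bd0_def by (intro opr_hom t) (simp add: bd0E_def)
    qed
    moreover have "cD A M (i + 1) (\<lambda>w. t (f w)) w = dif M (t (f w)) - sg (i + 1) (bd0 A (\<lambda>v. t (f v)) w)"
      by (rule cD_lead[OF b_letter_class w(1)]) (use sh w t0 in auto)
    moreover have "dif M (f w) = sg i (bd0 A f w)"
      using cD_lead[OF b_letter_class w(1), of f i] f(3)[OF w(1)] sh w by simp
    moreover have "dif M (t (f w)) + t (dif M (f w)) = f w"
      using t(5)[OF f(2)[OF w(1)] cochD(1)[OF f(1) b_word[OF w(1)]]] .
    ultimately show ?thesis using sg_hom[of t i "bd0 A f w", OF t(1)] by (simp add: sg_def split: if_splits)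
  qed
  show "coch A M (i + 1) (\<lambda>w. t (f w)) \<and> (\<forall>w. lw b_letter w \<longrightarrow> t (f w) \<in> K) \<and>
      (\<forall>w. lw b_letter w \<longrightarrow> length w < n \<longrightarrow> t (f w) = 0) \<and>
      (\<forall>w. lw b_letter w \<longrightarrow> length w = n \<longrightarrow> cD A M (i + 1) (\<lambda>w. t (f w)) w = f w)"
    using 1 3 t(4) f(2) sh t0 by simp
next
  fix g :: "'a word \<Rightarrow> 'm" and w assume g: "\<And>w. lw b_letter w \<Longrightarrow> g w \<in> K" and w: "lw b_letter w"
  have sgK: "x \<in> K \<Longrightarrow> sg n x \<in> K" for x n using K(1) by (rule M.subspace_sg)
  have "bdel A g w \<in> K"
    by (rule bd_gr[OF b_letter_class _ _ _ w]) (use K(1) g in \<open>auto intro: M.subspace_add M.subspace_neg M.subspace_0\<close>)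
  moreover have "w \<noteq> [] \<Longrightarrow> lact M (fst (hd w)) (g (tl w)) \<in> K \<and> ract M (g (butlast w)) (fst (last w)) \<in> K"
    using K(3) w by (meson g lw_butlast lw_hd lw_last lw_tl)
  ultimately show "cD A M (i + 1) g w \<in> K"
    unfolding cD_def using K(1,2) g[OF w] by (auto intro!: M.subspace_add M.subspace_diff sgK M.subspace_0)
qed (use K b_letter_class f in auto)

end

section \<open>Linear algebra of chains\<close>

lemma lookup_chain_scale [simp]: "Poly_Mapping.lookup (chain_scale r x) g = r * Poly_Mapping.lookup x g"
  by (simp add: chain_scale_def map.rep_eq when_def)

interpretation chain: vector_space "chain_scale :: 'k::field \<Rightarrow> ('k, 'm, 'a) chain \<Rightarrow> _"
  by unfold_locales (auto intro!: poly_mapping_eqI simp: lookup_add algebra_simps)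

interpretation fld: vector_space "(*) :: 'k::field \<Rightarrow> 'k \<Rightarrow> 'k"
  by unfold_locales (auto simp: algebra_simps)

definition lin_ext :: "('k::field \<Rightarrow> 'v \<Rightarrow> 'v::ab_group_add) \<Rightarrow> (('m, 'a) bar_gen \<Rightarrow> 'v) \<Rightarrow> ('k, 'm, 'a) chain \<Rightarrow> 'v" where
  "lin_ext sc \<phi> x = (\<Sum>g\<in>Poly_Mapping.keys x. sc (Poly_Mapping.lookup x g) (\<phi> g))"

lemma chain_lin_eq: "chain_lin = lin_ext chain_scale"
  by (simp add: fun_eq_iff chain_lin_def lin_ext_def)

context vector_space begin

lemma lin_ext_superset:
  assumes "finite S" "Poly_Mapping.keys x \<subseteq> S"
  shows "lin_ext scale \<phi> x = (\<Sum>g\<in>S. scale (Poly_Mapping.lookup x g) (\<phi> g))"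
  unfolding lin_ext_def by (rule sum.mono_neutral_left) (use assms in \<open>auto simp: in_keys_iff\<close>)

lemma lin_ext_add: "lin_ext scale \<phi> (x + y) = lin_ext scale \<phi> x + lin_ext scale \<phi> y"
proof -
  let ?S = "Poly_Mapping.keys x \<union> Poly_Mapping.keys y"
  have "lin_ext scale \<phi> (x + y) = (\<Sum>g\<in>?S. scale (Poly_Mapping.lookup (x + y) g) (\<phi> g))"
    by (rule lin_ext_superset) (auto dest: subsetD[OF keys_add])
  also have "\<dots> = (\<Sum>g\<in>?S. scale (Poly_Mapping.lookup x g) (\<phi> g)) + (\<Sum>g\<in>?S. scale (Poly_Mapping.lookup y g) (\<phi> g))"
    by (simp add: lookup_add scale_left_distrib sum.distrib)
  also have "\<dots> = lin_ext scale \<phi> x + lin_ext scale \<phi> y"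
    by (simp add: lin_ext_superset[of ?S])
  finally show ?thesis .
qed

lemma lin_ext_scale: "lin_ext scale \<phi> (chain_scale r x) = scale r (lin_ext scale \<phi> x)"
proof -
  have "lin_ext scale \<phi> (chain_scale r x) = (\<Sum>g\<in>Poly_Mapping.keys x. scale (Poly_Mapping.lookup (chain_scale r x) g) (\<phi> g))"
    by (rule lin_ext_superset) (auto simp: in_keys_iff)
  then show ?thesis by (simp add: lin_ext_def scale_sum_right)
qed

lemma lin_ext_linear: "Vector_Spaces.linear chain_scale scale (lin_ext scale \<phi>)"
  unfolding Vector_Spaces.linear_iff
  using chain.vector_space_axioms vector_space_axioms lin_ext_add lin_ext_scale by blast

lemma lin_ext_pure [simp]: "lin_ext scale \<phi> (pure m w) = \<phi> (m, w)"
  by (simp add: lin_ext_def pure_def)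

lemma separating_functional:
  assumes "x \<notin> span S"
  shows "\<exists>\<phi>. Vector_Spaces.linear scale (*) \<phi> \<and> (\<forall>y\<in>S. \<phi> y = 0) \<and> \<phi> x = 1"
proof -
  interpret p: vector_space_pair scale "(*) :: 'a \<Rightarrow> 'a \<Rightarrow> 'a" ..
  obtain B where B: "B \<subseteq> S" "independent B" "S \<subseteq> span B"
    using maximal_independent_subset[of S] by blast
  have xB: "x \<notin> span B" using assms B(1) span_mono by blast
  have "independent (insert x B)" using xB B(2) independent_insertI by blast
  then obtain g where g: "Vector_Spaces.linear scale (*) g" "\<forall>y\<in>insert x B. g y = (if y = x then 1 else 0)"
    using p.linear_independent_extend[of "insert x B" "\<lambda>y. if y = x then 1 else 0"] by auto
  have "x \<notin> B" using xB span_base by blast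
  then have "g y = 0" if "y \<in> S" for y
    using p.linear_eq_0_on_span[OF g(1), of B y] g(2) B(3) that by (metis insertCI subsetD)
  then show ?thesis using g by auto
qed

end

lemma linear_simps:
  assumes "Vector_Spaces.linear s1 s2 f"
  shows "f 0 = 0" "f (x + y) = f x + f y" "f (x - y) = f x - f y" "f (- x) = - f x" "f (s1 r x) = s2 r (f x)"
    "f (sg n x) = sg n (f x)" "f (sum h S) = (\<Sum>x\<in>S. f (h x))"
proof -
  interpret Vector_Spaces.linear s1 s2 f by fact
  show "f 0 = 0" "f (x + y) = f x + f y" "f (x - y) = f x - f y" "f (- x) = - f x" "f (s1 r x) = s2 r (f x)"
    "f (sum h S) = (\<Sum>x\<in>S. f (h x))"
    by (simp_all add: zero add diff neg scale sum)
  show "f (sg n x) = sg n (f x)" by (rule sg_hom) (rule add)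
qed

lemma linearI':
  assumes "vector_space s1" "vector_space s2" "\<And>x y. f (x + y) = f x + f y" "\<And>r x. f (s1 r x) = s2 r (f x)"
  shows "Vector_Spaces.linear s1 s2 f"
  unfolding Vector_Spaces.linear_iff using assms by blast

lemma chain_lin_linear: "Vector_Spaces.linear chain_scale chain_scale (chain_lin \<phi>)"
  unfolding chain_lin_eq by (rule chain.lin_ext_linear)

lemmas chain_lin_simps [simp] = linear_simps[OF chain_lin_linear]

lemma chain_lin_pure [simp]: "chain_lin \<phi> (pure m w) = \<phi> (m, w)"
  unfolding chain_lin_eq by simp

lemma linear_span_into:
  assumes f: "Vector_Spaces.linear chain_scale sc f" and T: "module.subspace sc T"
    and S: "\<And>x. x \<in> S \<Longrightarrow> f x \<in> T" and x: "x \<in> chain.span S"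
  shows "f x \<in> T"
proof -
  interpret l: Vector_Spaces.linear chain_scale sc f by fact
  have "chain.subspace {x. f x \<in> T}"
    using T by (auto simp: chain.subspace_def l.vs2.subspace_def l.zero l.add l.scale)
  then have "chain.span S \<subseteq> {x. f x \<in> T}"
    using S by (intro chain.span_minimal) auto
  then show ?thesis using x by blast
qed

lemma linear_eq_span:
  assumes "Vector_Spaces.linear chain_scale sc f" "Vector_Spaces.linear chain_scale sc g"
    and "\<And>x. x \<in> S \<Longrightarrow> f x = g x" "x \<in> chain.span S"
  shows "f x = g x"
proof -
  interpret l: Vector_Spaces.linear chain_scale sc f by fact
  interpret l': Vector_Spaces.linear chain_scale sc g by fact
  have "chain.subspace {x. f x = g x}"
    by (auto simp: chain.subspace_def l.zero l.add l.scale l'.zero l'.add l'.scale)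
  then have "chain.span S \<subseteq> {x. f x = g x}"
    using assms(3) by (intro chain.span_minimal) auto
  then show ?thesis using assms(4) by blast
qed

text \<open>Coefficients restricted by \<open>X\<close> and letters by \<open>L\<close>: the span of
  these symbols covers the full complex, negative letters, coefficients in the subalgebra, and the
  filtration by degree.\<close>

definition gens :: "('m \<Rightarrow> int \<Rightarrow> bool) \<Rightarrow> ('a \<Rightarrow> int \<Rightarrow> bool) \<Rightarrow> int \<Rightarrow> ('k::field, 'm, 'a) chain set" where
  "gens X L n = {pure (x, j) w | x j w. X x j \<and> lw L w \<and> j + sdeg w = n}"

definition chp :: "('m \<Rightarrow> int \<Rightarrow> bool) \<Rightarrow> ('a \<Rightarrow> int \<Rightarrow> bool) \<Rightarrow> int \<Rightarrow> ('k::field, 'm, 'a) chain set" where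
  "chp X L n = chain.span (gens X L n)"

lemma chain_part_eq: "chain_part A N n = chp (\<lambda>x j. x \<in> gr N j) (\<lambda>a i. a \<in> gr A i) n"
  by (auto simp: chain_part_def chp_def gens_def is_word_lw)

lemma pure_chp: "X x j \<Longrightarrow> lw L w \<Longrightarrow> j + sdeg w = n \<Longrightarrow> pure (x, j) w \<in> chp X L n"
  unfolding chp_def by (rule chain.span_base) (auto simp: gens_def)

lemma chp_subspace: "chain.subspace (chp X L n)"
  by (simp add: chp_def)

lemma chp_closed [simp, intro]:
  "0 \<in> chp X L n" "x \<in> chp X L n \<Longrightarrow> y \<in> chp X L n \<Longrightarrow> x + y \<in> chp X L n"
  "x \<in> chp X L n \<Longrightarrow> y \<in> chp X L n \<Longrightarrow> x - y \<in> chp X L n" "x \<in> chp X L n \<Longrightarrow> - x \<in> chp X L n"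
  "x \<in> chp X L n \<Longrightarrow> chain_scale r x \<in> chp X L n" "x \<in> chp X L n \<Longrightarrow> sg m x \<in> chp X L n"
  using chp_subspace chain.subspace_sg by (auto simp: chp_def chain.span_zero chain.span_add chain.span_diff chain.span_neg chain.span_scale)

lemma chp_mono: "(\<And>x j. X x j \<Longrightarrow> Y x j) \<Longrightarrow> (\<And>a i. L a i \<Longrightarrow> L' a i) \<Longrightarrow> chp X L n \<subseteq> chp Y L' n"
  unfolding chp_def gens_def lw_def by (rule chain.span_mono) blast

lemma chp_induct:
  assumes "z \<in> chp X L n" "chain.subspace {z. P z}" "\<And>x j w. X x j \<Longrightarrow> lw L w \<Longrightarrow> j + sdeg w = n \<Longrightarrow> P (pure (x, j) w)"
  shows "P z"
  using chain.span_minimal[OF _ assms(2), of "gens X L n"] assms(1,3) by (auto simp: chp_def gens_def)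

section \<open>The Hochschild chain complex\<close>

definition chD :: "('k::field, 'a::ring_1) dg \<Rightarrow> ('k, 'a, 'm::ab_group_add) dg_bimod \<Rightarrow>
    ('k, 'm, 'a) chain \<Rightarrow> ('k, 'm, 'a) chain" where
  "chD A N = chain_lin (\<lambda>g. chain_d0 A N g + chain_d1 A N g)"

lemma chD_linear: "Vector_Spaces.linear chain_scale chain_scale (chD A N)"
  unfolding chD_def by (rule chain_lin_linear)

lemmas chD_simps [simp] = linear_simps[OF chD_linear]

lemma chD_pure:
  "chD A N (pure (x, j) w) = pure (dif N x, j - 1) w + sg j (bdel A (\<lambda>v. pure (x, j) v) w)
     + (if w = [] then 0 else sg j (pure (ract N x (fst (hd w)), j + snd (hd w)) (tl w))
         - sg ((snd (last w) + 1) * (j + sdeg (butlast w))) (pure (lact N (fst (last w)) x, snd (last w) + j) (butlast w)))"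
  unfolding chD_def chain_lin_pure chain_d0.simps chain_d1.simps chain.scale_sg bd0_sum bd1_sum bd_split
  by (simp add: algebra_simps)

definition coeff_class :: "('k::field, 'a::ring_1) dg \<Rightarrow> ('k, 'a, 'm::ab_group_add) dg_bimod \<Rightarrow>
    ('a \<Rightarrow> int \<Rightarrow> bool) \<Rightarrow> ('m \<Rightarrow> int \<Rightarrow> bool) \<Rightarrow> bool" where
  "coeff_class A N L X \<longleftrightarrow> (\<forall>x j. X x j \<longrightarrow> x \<in> gr N j \<and> X (dif N x) (j - 1)) \<and>
     (\<forall>x j a i. X x j \<longrightarrow> L a i \<longrightarrow> X (ract N x a) (j + i) \<and> X (lact N a x) (i + j))"

lemma chD_chp:
  assumes L: "letter_class A L" and X: "coeff_class A N L X" and z: "z \<in> chp X L n"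
  shows "chD A N z \<in> chp X L (n - 1)"
proof (rule linear_span_into[OF chD_linear chp_subspace _ z[unfolded chp_def]])
  fix z :: "('a, 'c, 'b) chain" assume "z \<in> gens X L n"
  then obtain x j w where g: "X x j" "lw L w" "j + sdeg w = n" "z = pure (x, j) w" by (auto simp: gens_def)
  have 1: "pure (dif N x, j - 1) w \<in> chp X L (n - 1)"
    using g X by (intro pure_chp) (auto simp: coeff_class_def)
  have 2: "bdel A (\<lambda>v. pure (x, j) v) w \<in> chp X L (n - 1)"
    by (rule bd_gr[OF L _ _ _ g(2)]) (use g in \<open>auto intro: pure_chp\<close>)
  have 3: "pure (ract N x (fst (hd w)), j + snd (hd w)) (tl w) \<in> chp X L (n - 1)" if "w \<noteq> []"
    using g X that lw_hd[OF g(2)] by (intro pure_chp) (auto simp: coeff_class_def lw_tl; cases w; auto)+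
  have 4: "pure (lact N (fst (last w)) x, snd (last w) + j) (butlast w) \<in> chp X L (n - 1)" if "w \<noteq> []"
    using g X that lw_last[OF g(2)]
    by (intro pure_chp) (auto simp: coeff_class_def lw_butlast; cases w rule: rev_cases; auto)+
  show "chD A N z \<in> chp X L (n - 1)"
    unfolding g(4) chD_pure using 1 2 3 4 by auto
qed

section \<open>Functionals on chains\<close>

definition rfun :: "('k::field, 'a::ring_1) dg \<Rightarrow> ('k, 'a, 'm::ab_group_add) dg_bimod \<Rightarrow> (('k, 'm, 'a) chain \<Rightarrow> 'k) \<Rightarrow> bool" where
  "rfun A N \<phi> \<longleftrightarrow> Vector_Spaces.linear chain_scale (*) \<phi> \<and> (\<forall>x\<in>chain_relations A N. \<phi> x = 0)"

lemma rel_subspace: "chain.subspace (chain_relations A N)"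
  by (simp add: chain_relations_def)

lemma rel_closed [simp, intro]:
  "0 \<in> chain_relations A N" "x \<in> chain_relations A N \<Longrightarrow> y \<in> chain_relations A N \<Longrightarrow> x + y \<in> chain_relations A N"
  "x \<in> chain_relations A N \<Longrightarrow> y \<in> chain_relations A N \<Longrightarrow> x - y \<in> chain_relations A N"
  "x \<in> chain_relations A N \<Longrightarrow> - x \<in> chain_relations A N" "x \<in> chain_relations A N \<Longrightarrow> sg n x \<in> chain_relations A N"
  "x \<in> chain_relations A N \<Longrightarrow> chain_scale r x \<in> chain_relations A N"
  by (simp_all add: rel_subspace chain.subspace_0 chain.subspace_add chain.subspace_diff chain.subspace_neg chain.subspace_sg chain.subspace_scale)

text \<open>Over a field a subspace is the common kernel of the functionals vanishing on it.
  Identities modulo relations can thus be checked with multilinear scalar functions, without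
  exhibiting combinations of relations.\<close>

lemma rel_by_rfun: "(\<And>\<phi>. rfun A N \<phi> \<Longrightarrow> \<phi> x = 0) \<Longrightarrow> x \<in> chain_relations A N"
  using chain.separating_functional[of x "chain_relations A N"] chain.span_eq_iff[THEN iffD2, OF rel_subspace[of A N]]
  unfolding rfun_def by fastforce

lemma chain_relations_cases:
  assumes "x \<in> chain_relations A N" "chain.subspace T"
    and "\<And>x y j w. x \<in> gr N j \<Longrightarrow> y \<in> gr N j \<Longrightarrow> is_word A w \<Longrightarrow> pure (x + y, j) w - pure (x, j) w - pure (y, j) w \<in> T"
    and "\<And>r x j w. x \<in> gr N j \<Longrightarrow> is_word A w \<Longrightarrow> pure (scl N r x, j) w - chain_scale r (pure (x, j) w) \<in> T"
    and "\<And>x j u a b i w. x \<in> gr N j \<Longrightarrow> a \<in> gr A i \<Longrightarrow> b \<in> gr A i \<Longrightarrow> is_word A u \<Longrightarrow> is_word A w \<Longrightarrow>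
       pure (x, j) (u @ (a + b, i) # w) - pure (x, j) (u @ (a, i) # w) - pure (x, j) (u @ (b, i) # w) \<in> T"
    and "\<And>r x j u a i w. x \<in> gr N j \<Longrightarrow> a \<in> gr A i \<Longrightarrow> is_word A u \<Longrightarrow> is_word A w \<Longrightarrow>
       pure (x, j) (u @ (scl A r a, i) # w) - chain_scale r (pure (x, j) (u @ (a, i) # w)) \<in> T"
  shows "x \<in> T"
proof -
  have "chain_relations A N \<subseteq> T"
    unfolding chain_relations_def using assms(2)
    by (rule chain.span_minimal[rotated]) (use assms(3-6) in auto)
  then show ?thesis using assms(1) by blast
qed

lemma relations:
  "x \<in> gr N j \<Longrightarrow> y \<in> gr N j \<Longrightarrow> is_word A w \<Longrightarrow> pure (x + y, j) w - pure (x, j) w - pure (y, j) w \<in> chain_relations A N"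
  "x \<in> gr N j \<Longrightarrow> is_word A w \<Longrightarrow> pure (scl N r x, j) w - chain_scale r (pure (x, j) w) \<in> chain_relations A N"
  "x \<in> gr N j \<Longrightarrow> a \<in> gr A i \<Longrightarrow> b \<in> gr A i \<Longrightarrow> is_word A u \<Longrightarrow> is_word A w \<Longrightarrow>
     pure (x, j) (u @ (a + b, i) # w) - pure (x, j) (u @ (a, i) # w) - pure (x, j) (u @ (b, i) # w) \<in> chain_relations A N"
  "x \<in> gr N j \<Longrightarrow> a \<in> gr A i \<Longrightarrow> is_word A u \<Longrightarrow> is_word A w \<Longrightarrow>
     pure (x, j) (u @ (scl A r a, i) # w) - chain_scale r (pure (x, j) (u @ (a, i) # w)) \<in> chain_relations A N"
  unfolding chain_relations_def
     apply (rule chain.span_base, rule UnI1, rule UnI1, rule UnI1, blast)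
    apply (rule chain.span_base, rule UnI1, rule UnI1, rule UnI2, blast)
   apply (rule chain.span_base, rule UnI1, rule UnI2, blast)
  apply (rule chain.span_base, rule UnI2, blast)
  done

lemma rfunI:
  assumes l: "Vector_Spaces.linear chain_scale (*) \<phi>"
    and "\<And>x y j w. x \<in> gr N j \<Longrightarrow> y \<in> gr N j \<Longrightarrow> is_word A w \<Longrightarrow> \<phi> (pure (x + y, j) w) = \<phi> (pure (x, j) w) + \<phi> (pure (y, j) w)"
    and "\<And>r x j w. x \<in> gr N j \<Longrightarrow> is_word A w \<Longrightarrow> \<phi> (pure (scl N r x, j) w) = r * \<phi> (pure (x, j) w)"
    and "\<And>x j u a b i w. x \<in> gr N j \<Longrightarrow> a \<in> gr A i \<Longrightarrow> b \<in> gr A i \<Longrightarrow> is_word A u \<Longrightarrow> is_word A w \<Longrightarrow>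
       \<phi> (pure (x, j) (u @ (a + b, i) # w)) = \<phi> (pure (x, j) (u @ (a, i) # w)) + \<phi> (pure (x, j) (u @ (b, i) # w))"
    and "\<And>r x j u a i w. x \<in> gr N j \<Longrightarrow> a \<in> gr A i \<Longrightarrow> is_word A u \<Longrightarrow> is_word A w \<Longrightarrow>
       \<phi> (pure (x, j) (u @ (scl A r a, i) # w)) = r * \<phi> (pure (x, j) (u @ (a, i) # w))"
  shows "rfun A N \<phi>"
proof -
  note s = linear_simps[OF l]
  have "x \<in> {x. \<phi> x = 0}" if "x \<in> chain_relations A N" for x
    using that by (rule chain_relations_cases) (use assms(2-5) in \<open>auto simp: chain.subspace_def s\<close>)
  then show ?thesis using l by (auto simp: rfun_def)
qed

lemma rfunD:
  assumes "rfun A N \<phi>"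
  shows "Vector_Spaces.linear chain_scale (*) \<phi>"
    and "\<And>x. x \<in> chain_relations A N \<Longrightarrow> \<phi> x = 0"
    and "\<And>x y j w. x \<in> gr N j \<Longrightarrow> y \<in> gr N j \<Longrightarrow> is_word A w \<Longrightarrow> \<phi> (pure (x + y, j) w) = \<phi> (pure (x, j) w) + \<phi> (pure (y, j) w)"
    and "\<And>r x j w. x \<in> gr N j \<Longrightarrow> is_word A w \<Longrightarrow> \<phi> (pure (scl N r x, j) w) = r * \<phi> (pure (x, j) w)"
    and "\<And>x j u a b i w. x \<in> gr N j \<Longrightarrow> a \<in> gr A i \<Longrightarrow> b \<in> gr A i \<Longrightarrow> is_word A u \<Longrightarrow> is_word A w \<Longrightarrow>
       \<phi> (pure (x, j) (u @ (a + b, i) # w)) = \<phi> (pure (x, j) (u @ (a, i) # w)) + \<phi> (pure (x, j) (u @ (b, i) # w))"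
    and "\<And>r x j u a i w. x \<in> gr N j \<Longrightarrow> a \<in> gr A i \<Longrightarrow> is_word A u \<Longrightarrow> is_word A w \<Longrightarrow>
       \<phi> (pure (x, j) (u @ (scl A r a, i) # w)) = r * \<phi> (pure (x, j) (u @ (a, i) # w))"
proof -
  show l: "Vector_Spaces.linear chain_scale (*) \<phi>" and v: "\<And>x. x \<in> chain_relations A N \<Longrightarrow> \<phi> x = 0"
    using assms by (auto simp: rfun_def)
  note s = linear_simps[OF l]
  show "\<phi> (pure (x + y, j) w) = \<phi> (pure (x, j) w) + \<phi> (pure (y, j) w)"
    if "x \<in> gr N j" "y \<in> gr N j" "is_word A w" for x y j w
  proof -
    have "\<phi> (pure (x + y, j) w - pure (x, j) w - pure (y, j) w) = 0" by (intro v relations that)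
    then show ?thesis by (simp add: s algebra_simps)
  qed
  show "\<phi> (pure (scl N r x, j) w) = r * \<phi> (pure (x, j) w)" if "x \<in> gr N j" "is_word A w" for r x j w
  proof -
    have "\<phi> (pure (scl N r x, j) w - chain_scale r (pure (x, j) w)) = 0" by (intro v relations that)
    then show ?thesis by (simp add: s)
  qed
  show "\<phi> (pure (x, j) (u @ (a + b, i) # w)) = \<phi> (pure (x, j) (u @ (a, i) # w)) + \<phi> (pure (x, j) (u @ (b, i) # w))"
    if "x \<in> gr N j" "a \<in> gr A i" "b \<in> gr A i" "is_word A u" "is_word A w" for x j u a b i w
  proof -
    have "\<phi> (pure (x, j) (u @ (a + b, i) # w) - pure (x, j) (u @ (a, i) # w) - pure (x, j) (u @ (b, i) # w)) = 0"
      by (intro v relations that)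
    then show ?thesis by (simp add: s algebra_simps)
  qed
  show "\<phi> (pure (x, j) (u @ (scl A r a, i) # w)) = r * \<phi> (pure (x, j) (u @ (a, i) # w))"
    if "x \<in> gr N j" "a \<in> gr A i" "is_word A u" "is_word A w" for r x j u a i w
  proof -
    have "\<phi> (pure (x, j) (u @ (scl A r a, i) # w) - chain_scale r (pure (x, j) (u @ (a, i) # w))) = 0"
      by (intro v relations that)
    then show ?thesis by (simp add: s)
  qed
qed

section \<open>Homogeneous components\<close>

definition cmp :: "('k::field, 'v::ab_group_add, 'z) dg_scheme \<Rightarrow> 'v \<Rightarrow> int \<Rightarrow> 'v" where
  "cmp V x = (THE f. finite {i. f i \<noteq> 0} \<and> (\<forall>i. f i \<in> gr V i) \<and> x = (\<Sum>i | f i \<noteq> 0. f i))"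

text \<open>The sign of the degree as an operator on all elements, which allows the signs of the
  dual bimodule to be written for inhomogeneous arguments.\<close>

definition sigma :: "('k::field, 'v::ab_group_add, 'z) dg_scheme \<Rightarrow> 'v \<Rightarrow> 'v" where
  "sigma V x = (\<Sum>i | cmp V x i \<noteq> 0. sg i (cmp V x i))"

context dg_space begin

lemma cmp: "finite {i. cmp V x i \<noteq> 0}" "cmp V x i \<in> gr V i" "(\<Sum>i | cmp V x i \<noteq> 0. cmp V x i) = x"
  using theI'[OF gr_direct_sum[of x]] unfolding cmp_def by auto

lemma cmp_unique:
  assumes "finite S" "{i. f i \<noteq> 0} \<subseteq> S" "\<And>i. f i \<in> gr V i" "x = (\<Sum>i\<in>S. f i)"
  shows "cmp V x = f"
proof -
  have "x = (\<Sum>i | f i \<noteq> 0. f i)"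
    unfolding assms(4) by (rule sum.mono_neutral_right) (use assms in auto)
  moreover have "finite {i. f i \<noteq> 0}" using assms finite_subset by blast
  ultimately show ?thesis
    unfolding cmp_def using assms(3) by (intro the1_equality gr_direct_sum) auto
qed

lemma cmp_sum: "finite S \<Longrightarrow> {i. cmp V x i \<noteq> 0} \<subseteq> S \<Longrightarrow> (\<Sum>i\<in>S. cmp V x i) = x"
proof -
  assume *: "finite S" "{i. cmp V x i \<noteq> 0} \<subseteq> S"
  have "(\<Sum>i\<in>S. cmp V x i) = (\<Sum>i | cmp V x i \<noteq> 0. cmp V x i)"
    by (rule sum.mono_neutral_right) (use * in blast)+
  also have "\<dots> = x" by (rule cmp(3))
  finally show ?thesis .
qed

lemma cmp_add: "cmp V (x + y) = (\<lambda>i. cmp V x i + cmp V y i)"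
proof (rule cmp_unique)
  let ?S = "{i. cmp V x i \<noteq> 0} \<union> {i. cmp V y i \<noteq> 0}"
  show "finite ?S" using cmp(1) by simp
  then show "x + y = (\<Sum>i\<in>?S. cmp V x i + cmp V y i)"
    using cmp_sum[of ?S x] cmp_sum[of ?S y] by (simp add: sum.distrib)
qed (auto simp: cmp(2))

lemma cmp_scl: "cmp V (scl V r x) = (\<lambda>i. scl V r (cmp V x i))"
proof (rule cmp_unique[OF cmp(1)[of x]])
  show "scl V r x = (\<Sum>i | cmp V x i \<noteq> 0. scl V r (cmp V x i))"
    using cmp(3)[of x] by (metis scale_sum_right)
qed (auto simp: cmp(2))

lemma cmp_gr: "x \<in> gr V i \<Longrightarrow> cmp V x = (\<lambda>j. if j = i then x else 0)"
  by (rule cmp_unique[of "{i}"]) auto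

lemma hom_eqI:
  assumes "\<And>x y. f (x + y) = f x + f y" "\<And>x y. g (x + y) = g x + (g y :: 'w::ab_group_add)"
    and "\<And>x i. x \<in> gr V i \<Longrightarrow> f x = g x"
  shows "f x = g x"
proof -
  have 0: "f 0 = 0" "g 0 = 0" using assms(1)[of 0 0] assms(2)[of 0 0] by simp_all
  have "finite S \<Longrightarrow> f (sum h S) = (\<Sum>i\<in>S. f (h i))" "finite S \<Longrightarrow> g (sum h S) = (\<Sum>i\<in>S. g (h i))" for h and S :: "int set"
    by (induction S rule: finite_induct) (simp_all add: 0 assms)
  then have "f x = (\<Sum>i | cmp V x i \<noteq> 0. f (cmp V x i))" "g x = (\<Sum>i | cmp V x i \<noteq> 0. g (cmp V x i))"
    using cmp(1)[of x] cmp(3)[of x] by metis+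
  then show ?thesis using assms(3)[OF cmp(2)] by simp
qed

lemma sigma_superset: "finite S \<Longrightarrow> {i. cmp V x i \<noteq> 0} \<subseteq> S \<Longrightarrow> sigma V x = (\<Sum>i\<in>S. sg i (cmp V x i))"
  unfolding sigma_def by (rule sum.mono_neutral_left) auto

lemma sigma_add [simp]: "sigma V (x + y) = sigma V x + sigma V y"
proof -
  let ?S = "{i. cmp V x i \<noteq> 0} \<union> {i. cmp V y i \<noteq> 0}"
  have f: "finite ?S" using cmp(1) by simp
  have "sigma V (x + y) = (\<Sum>i\<in>?S. sg i (cmp V (x + y) i))" by (rule sigma_superset[OF f]) (auto simp: cmp_add)
  moreover have "sigma V x = (\<Sum>i\<in>?S. sg i (cmp V x i))" "sigma V y = (\<Sum>i\<in>?S. sg i (cmp V y i))"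
    by (rule sigma_superset[OF f]; blast)+
  ultimately show ?thesis by (simp add: cmp_add sum.distrib)
qed

lemma sigma_scl [simp]: "sigma V (scl V r x) = scl V r (sigma V x)"
proof -
  have "sigma V (scl V r x) = (\<Sum>i | cmp V x i \<noteq> 0. sg i (cmp V (scl V r x) i))"
    by (rule sigma_superset[OF cmp(1)]) (auto simp: cmp_scl)
  then show ?thesis by (simp only: cmp_scl scale_of_sg(2)[symmetric] scale_sum_right[symmetric] sigma_def[symmetric])
qed

lemma sigma_neg [simp]: "sigma V (- x) = - sigma V x"
  using sigma_scl[of "-1" x] by simp

lemma sigma_gr: "x \<in> gr V i \<Longrightarrow> sigma V x = sg i x"
proof -
  assume x: "x \<in> gr V i"
  have "sigma V x = (\<Sum>j\<in>{i}. sg j (cmp V x j))" by (rule sigma_superset) (auto simp: cmp_gr[OF x])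
  then show ?thesis by (simp add: cmp_gr[OF x])
qed

lemma sigma_sigma [simp]: "sigma V (sigma V x) = x"
proof (rule hom_eqI[where f = "\<lambda>x. sigma V (sigma V x)" and g = "\<lambda>x. x"])
  fix x i assume "x \<in> gr V i"
  then show "sigma V (sigma V x) = x" using sigma_gr[of x i] sigma_gr[of "sg i x" i] by (simp add: sg_def)
qed simp_all

lemma sigma_dif: "sigma V (dif V x) = - dif V (sigma V x)"
proof (rule hom_eqI[where f = "\<lambda>x. sigma V (dif V x)" and g = "\<lambda>x. - dif V (sigma V x)"])
  fix x i assume "x \<in> gr V i"
  then show "sigma V (dif V x) = - dif V (sigma V x)"
    using sigma_gr[of x i] sigma_gr[OF dif_degree, of x i] by (simp add: sg_def)
qed simp_all

end

lemma (in dg_algebra) sigma_mult: "sigma A (a * b) = sigma A a * sigma A b"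
proof (rule hom_eqI[where f = "\<lambda>a. sigma A (a * b)" and g = "\<lambda>a. sigma A a * sigma A b"])
  fix a i assume a: "a \<in> gr A i"
  show "sigma A (a * b) = sigma A a * sigma A b"
  proof (rule hom_eqI[where f = "\<lambda>b. sigma A (a * b)" and g = "\<lambda>b. sigma A a * sigma A b"])
    fix b j assume b: "b \<in> gr A j"
    show "sigma A (a * b) = sigma A a * sigma A b"
      using sigma_gr[OF a] sigma_gr[OF b] sigma_gr[OF mult_degree[OF a b]] by (simp add: sg_mult add.commute)
  qed (simp_all add: distrib_left)
qed (simp_all add: distrib_right)

context dg_bimodule begin

lemma act_simps [simp]:
  "lact M a (x + y) = lact M a x + lact M a y" "lact M a (scl M r x) = scl M r (lact M a x)" "lact M a 0 = 0" "lact M a (sg n x) = sg n (lact M a x)"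
  "lact M (a + b) x = lact M a x + lact M b x" "lact M (scl A r a) x = scl M r (lact M a x)" "lact M 0 x = 0" "lact M (sg n a) x = sg n (lact M a x)"
  "ract M (x + y) a = ract M x a + ract M y a" "ract M (scl M r x) a = scl M r (ract M x a)" "ract M 0 a = 0" "ract M (sg n x) a = sg n (ract M x a)"
  "ract M x (a + b) = ract M x a + ract M x b" "ract M x (scl A r a) = scl M r (ract M x a)" "ract M x 0 = 0" "ract M x (sg n a) = sg n (ract M x a)"
  by (rule linear_simps[OF lact_linear] linear_simps[OF lact_linear'] linear_simps[OF ract_linear] linear_simps[OF ract_linear'])+

sublocale weak: weak_bimodule A M
  by unfold_locales
     (simp_all add: gr_subspace dif_degree dif_dif lact_one ract_one lact_mult ract_mult lact_ract lact_degree ract_degree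
       dif_lact[unfolded scale_sg] dif_ract[unfolded scale_sg])

end

section \<open>The dual bimodule\<close>

text \<open>A functional of degree \<open>l\<close> is supported in degree \<open>- l\<close>; not
  every functional is a finite sum of such. The signs carried by \<open>sigma\<close> are chosen so
  that \<open>cD\<close> becomes the transpose of \<open>chD\<close> up to a global sign, see
  \<open>pair_chD\<close>.\<close>

definition dual_bimod :: "('k::field, 'a::ring_1) dg \<Rightarrow> ('k, 'a, 'm::ab_group_add) dg_bimod \<Rightarrow> ('k, 'a, 'm \<Rightarrow> 'k) dg_bimod" where
  "dual_bimod A N = \<lparr>scl = (\<lambda>r \<phi> x. r * \<phi> x),
     gr = (\<lambda>l. {\<phi>. Vector_Spaces.linear (scl N) (*) \<phi> \<and> (\<forall>j. j \<noteq> - l \<longrightarrow> (\<forall>x\<in>gr N j. \<phi> x = 0))}),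
     dif = (\<lambda>\<phi> x. \<phi> (dif N (sigma N x))),
     lact = (\<lambda>a \<phi> x. \<phi> (ract N x (sigma A a))), ract = (\<lambda>\<phi> a x. \<phi> (lact N a x))\<rparr>"

lemma dual_simps:
  "scl (dual_bimod A N) r \<phi> = (\<lambda>x. r * \<phi> x)" "dif (dual_bimod A N) \<phi> = (\<lambda>x. \<phi> (dif N (sigma N x)))"
  "lact (dual_bimod A N) a \<phi> = (\<lambda>x. \<phi> (ract N x (sigma A a)))" "ract (dual_bimod A N) \<phi> a = (\<lambda>x. \<phi> (lact N a x))"
  by (simp_all add: dual_bimod_def)

lemma dual_gr: "\<phi> \<in> gr (dual_bimod A N) l \<longleftrightarrow> Vector_Spaces.linear (scl N) (*) \<phi> \<and> (\<forall>j. j \<noteq> - l \<longrightarrow> (\<forall>x\<in>gr N j. \<phi> x = 0))"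
  by (simp add: dual_bimod_def)

lemma dual_gr_zero: "\<phi> \<in> gr (dual_bimod A N) l \<Longrightarrow> x \<in> gr N j \<Longrightarrow> j + l \<noteq> 0 \<Longrightarrow> \<phi> x = 0"
  by (metis dual_gr eq_neg_iff_add_eq_0)

lemma sg_fun: "sg n (\<phi> :: 'x \<Rightarrow> 'v::ab_group_add) x = sg n (\<phi> x)"
  by (simp add: sg_def)

context dg_bimodule begin

lemma linear_functionalI:
  "(\<And>x y. \<phi> (x + y) = \<phi> x + \<phi> y) \<Longrightarrow> (\<And>r x. \<phi> (scl M r x) = r * \<phi> x) \<Longrightarrow> Vector_Spaces.linear (scl M) (*) \<phi>"
  by (rule linearI') (auto simp: vector_space_axioms fld.vector_space_axioms)

lemma dual_weak: "weak_bimodule A (dual_bimod A M)"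
proof -
  interpret D: vector_space "scl (dual_bimod A M)"
    by (rule vector_space.intro; rule ext; simp only: dual_simps plus_fun_apply distrib_left distrib_right mult.assoc mult_1_left)
  show ?thesis
  proof unfold_locales
    fix i show "module.subspace (scl (dual_bimod A M)) (gr (dual_bimod A M) i)"
    proof (rule D.subspaceI)
      show "0 \<in> gr (dual_bimod A M) i" by (auto simp: dual_gr intro!: linear_functionalI)
    next
      fix \<phi> \<psi> assume h: "\<phi> \<in> gr (dual_bimod A M) i" "\<psi> \<in> gr (dual_bimod A M) i"
      have "Vector_Spaces.linear (scl M) (*) \<phi>" "Vector_Spaces.linear (scl M) (*) \<psi>" using h by (auto simp: dual_gr)
      then show "\<phi> + \<psi> \<in> gr (dual_bimod A M) i"
        using h by (auto simp: dual_gr linear_simps distrib_left intro!: linear_functionalI)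
    next
      fix r \<phi> assume h: "\<phi> \<in> gr (dual_bimod A M) i"
      have "Vector_Spaces.linear (scl M) (*) \<phi>" using h by (auto simp: dual_gr)
      then show "scl (dual_bimod A M) r \<phi> \<in> gr (dual_bimod A M) i"
        using h by (auto simp: dual_gr dual_simps linear_simps distrib_left intro!: linear_functionalI)
    qed
  next
    fix \<phi> j assume \<phi>: "\<phi> \<in> gr (dual_bimod A M) j"
    note l = linear_simps[OF dual_gr[THEN iffD1, OF \<phi>, THEN conjunct1]]
    show "dif (dual_bimod A M) \<phi> \<in> gr (dual_bimod A M) (j - 1)"
      unfolding dual_gr
    proof (intro conjI allI impI ballI)
      fix i x assume "i \<noteq> - (j - 1)" "x \<in> gr M i"
      then show "dif (dual_bimod A M) \<phi> x = 0"
        using dual_gr_zero[OF \<phi> dif_degree[of x i]] sigma_gr[of x i] by (simp add: dual_simps l)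
    qed (auto intro!: linear_functionalI simp: dual_simps l)
    show "dif (dual_bimod A M) (dif (dual_bimod A M) \<phi>) = 0"
      by (simp add: dual_simps fun_eq_iff sigma_dif dif_dif l)
    show "lact (dual_bimod A M) 1 \<phi> = \<phi>" "ract (dual_bimod A M) \<phi> 1 = \<phi>"
      using A.sigma_gr[OF A.one_degree] by (simp_all add: dual_simps ract_one lact_one)
    fix a i assume a: "a \<in> gr A i"
    show "lact (dual_bimod A M) a \<phi> \<in> gr (dual_bimod A M) (i + j)"
      unfolding dual_gr
    proof (intro conjI allI impI ballI)
      fix m x assume "m \<noteq> - (i + j)" "x \<in> gr M m"
      then show "lact (dual_bimod A M) a \<phi> x = 0"
        using dual_gr_zero[OF \<phi> ract_degree[of x m a i]] A.sigma_gr[OF a] a by (simp add: dual_simps l)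
    qed (auto intro!: linear_functionalI simp: dual_simps l)
    show "ract (dual_bimod A M) \<phi> a \<in> gr (dual_bimod A M) (j + i)"
      unfolding dual_gr
    proof (intro conjI allI impI ballI)
      fix m x assume "m \<noteq> - (j + i)" "x \<in> gr M m"
      then show "ract (dual_bimod A M) \<phi> a x = 0"
        using dual_gr_zero[OF \<phi> lact_degree[of a i x m]] a by (simp add: dual_simps)
    qed (auto intro!: linear_functionalI simp: dual_simps l)
    show "dif (dual_bimod A M) (lact (dual_bimod A M) a \<phi>) =
      lact (dual_bimod A M) (dif A a) \<phi> + sg i (lact (dual_bimod A M) a (dif (dual_bimod A M) \<phi>))"
    proof (rule ext, rule hom_eqI)
      fix x m assume x: "x \<in> gr M m"
      have "sigma M (ract M x a) = sg (m + i) (ract M x a)" by (rule sigma_gr[OF ract_degree[OF x a]])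
      then show "dif (dual_bimod A M) (lact (dual_bimod A M) a \<phi>) x = (lact (dual_bimod A M) (dif A a) \<phi> + sg i (lact (dual_bimod A M) a (dif (dual_bimod A M) \<phi>))) x"
        using sigma_gr[OF x] A.sigma_gr[OF a] weak.dif_ract[OF x a] A.sigma_gr[OF A.dif_degree[OF a]]
        by (cases "even i"; cases "even m") (simp_all add: dual_simps l sg_fun, simp_all add: sg_def l)
    qed (simp_all add: dual_simps l sg_fun)
    show "dif (dual_bimod A M) (ract (dual_bimod A M) \<phi> a) =
      ract (dual_bimod A M) (dif (dual_bimod A M) \<phi>) a + sg j (ract (dual_bimod A M) \<phi> (dif A a))"
    proof (rule ext, rule hom_eqI)
      fix x m assume x: "x \<in> gr M m"
      have 1: "sigma M (lact M a x) = sg (i + m) (lact M a x)" by (rule sigma_gr[OF lact_degree[OF a x]])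
      \<comment> \<open>\<open>\<phi>\<close> is supported in degree \<open>- j\<close>, which ties
        the parity of \<open>i + m\<close> to that of \<open>j\<close> whenever the value is
        nonzero.\<close>
      have 2: "sg (i + m) (\<phi> (lact M (dif A a) x)) = - sg j (\<phi> (lact M (dif A a) x))"
      proof (cases "i - 1 + m = - j")
        case True
        then have "i + m = 1 - j" by simp
        then show ?thesis by (simp add: sg_def)
      next
        case False
        then have "\<phi> (lact M (dif A a) x) = 0"
          using dual_gr_zero[OF \<phi> lact_degree[OF A.dif_degree[OF a] x]] by simp
        then show ?thesis by simp
      qed
      show "dif (dual_bimod A M) (ract (dual_bimod A M) \<phi> a) x = (ract (dual_bimod A M) (dif (dual_bimod A M) \<phi>) a + sg j (ract (dual_bimod A M) \<phi> (dif A a))) x"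
        using sigma_gr[OF x] 1 2 weak.dif_lact[OF a x]
        by (cases "even i"; cases "even m") (simp_all add: dual_simps l sg_fun, simp_all add: sg_def l split: if_splits)
    qed (simp_all add: dual_simps l sg_fun)
    fix b k assume b: "b \<in> gr A k"
    show "lact (dual_bimod A M) (a * b) \<phi> = lact (dual_bimod A M) a (lact (dual_bimod A M) b \<phi>)"
      "ract (dual_bimod A M) \<phi> (a * b) = ract (dual_bimod A M) (ract (dual_bimod A M) \<phi> a) b"
      "lact (dual_bimod A M) a (ract (dual_bimod A M) \<phi> b) = ract (dual_bimod A M) (lact (dual_bimod A M) a \<phi>) b"
      by (simp_all add: dual_simps A.sigma_mult ract_mult lact_mult lact_ract)
  next
    fix a b \<phi> i j assume \<phi>: "\<phi> \<in> gr (dual_bimod A M) j"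
    note l = linear_simps[OF dual_gr[THEN iffD1, OF \<phi>, THEN conjunct1]]
    show "lact (dual_bimod A M) (a + b) \<phi> = lact (dual_bimod A M) a \<phi> + lact (dual_bimod A M) b \<phi>"
      "ract (dual_bimod A M) \<phi> (a + b) = ract (dual_bimod A M) \<phi> a + ract (dual_bimod A M) \<phi> b"
      "lact (dual_bimod A M) (scl A r a) \<phi> = scl (dual_bimod A M) r (lact (dual_bimod A M) a \<phi>)"
      "ract (dual_bimod A M) \<phi> (scl A r a) = scl (dual_bimod A M) r (ract (dual_bimod A M) \<phi> a)" for r
      by (simp_all add: dual_simps l fun_eq_iff)
  qed (simp_all add: dual_simps fun_eq_iff)
qed

sublocale dual: weak_bimodule A "dual_bimod A M"
  by (rule dual_weak)

abbreviation "MD \<equiv> dual_bimod A M"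

lemma chain_part_coeff: "coeff_class A M (\<lambda>a i. a \<in> gr A i) (\<lambda>x j. x \<in> gr M j)"
  by (simp add: coeff_class_def dif_degree lact_degree ract_degree)

lemma chD_part: "z \<in> chain_part A M n \<Longrightarrow> chD A M z \<in> chain_part A M (n - 1)"
  unfolding chain_part_eq by (rule chD_chp[OF weak.letter_class_gr chain_part_coeff])

text \<open>Chains over \<open>M\<close> are paired with cochains valued in the dual of
  \<open>M\<close>; the sign is that of interchanging the coefficient and the word.\<close>

definition pairg :: "('a word \<Rightarrow> 'm \<Rightarrow> 'k) \<Rightarrow> ('m, 'a) bar_gen \<Rightarrow> 'k" where
  "pairg \<psi> = (\<lambda>((x, j), w). sg (j * sdeg w) (\<psi> w x))"

definition pair :: "('a word \<Rightarrow> 'm \<Rightarrow> 'k) \<Rightarrow> ('k, 'm, 'a) chain \<Rightarrow> 'k" where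
  "pair \<psi> = lin_ext (*) (pairg \<psi>)"

lemma pair_linear: "Vector_Spaces.linear chain_scale (*) (pair \<psi>)"
  unfolding pair_def by (rule fld.lin_ext_linear)

lemmas pair_simps = linear_simps[OF pair_linear]

lemma pair_pure [simp]: "pair \<psi> (pure (x, j) w) = sg (j * sdeg w) (\<psi> w x)"
  by (simp add: pair_def pairg_def)

lemma coch_dualD:
  assumes "coch A MD i \<psi>" "is_word A w"
  shows "\<psi> w (x + y) = \<psi> w x + \<psi> w y" "\<psi> w (scl M r x) = r * \<psi> w x" "\<psi> w (sg n x) = sg n (\<psi> w x)" "\<psi> w 0 = 0"
    and "x \<in> gr M j \<Longrightarrow> j + sdeg w \<noteq> - i \<Longrightarrow> \<psi> w x = 0"
proof -
  have g: "\<psi> w \<in> gr MD (i + sdeg w)" using cochD(1)[OF assms] .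
  then have l: "Vector_Spaces.linear (scl M) (*) (\<psi> w)" by (simp add: dual_gr)
  show "\<psi> w (x + y) = \<psi> w x + \<psi> w y" "\<psi> w (scl M r x) = r * \<psi> w x" "\<psi> w (sg n x) = sg n (\<psi> w x)" "\<psi> w 0 = 0"
    by (rule linear_simps[OF l])+
  show "x \<in> gr M j \<Longrightarrow> j + sdeg w \<noteq> - i \<Longrightarrow> \<psi> w x = 0"
    using dual_gr_zero[OF g] by simp
qed

lemma pair_rfun: "coch A MD i \<psi> \<Longrightarrow> rfun A M (pair \<psi>)"
proof (rule rfunI[OF pair_linear])
  assume c: "coch A MD i \<psi>"
  show "pair \<psi> (pure (x, j) (u @ (a + b, k) # w)) = pair \<psi> (pure (x, j) (u @ (a, k) # w)) + pair \<psi> (pure (x, j) (u @ (b, k) # w))"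
    if "x \<in> gr M j" "a \<in> gr A k" "b \<in> gr A k" "is_word A u" "is_word A w" for x j u a b k w
    using cochD(2)[OF c that(4,5,2,3)] by simp
  show "pair \<psi> (pure (x, j) (u @ (scl A r a, k) # w)) = r * pair \<psi> (pure (x, j) (u @ (a, k) # w))"
    if "x \<in> gr M j" "a \<in> gr A k" "is_word A u" "is_word A w" for r x j u a k w
    using cochD(3)[OF c that(3,4,2)] by (simp add: dual_simps fld.scale_of_sg)
qed (simp_all add: coch_dualD fld.scale_of_sg)

lemma pair_degree: "coch A MD i \<psi> \<Longrightarrow> z \<in> chain_part A M n \<Longrightarrow> n \<noteq> - i \<Longrightarrow> pair \<psi> z = 0"
  unfolding chain_part_eq
  by (erule chp_induct) (auto simp: chain.subspace_def pair_simps coch_dualD(5) is_word_lw)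

lemma pair_chD_pure:
  assumes c: "coch A MD i \<psi>" and x: "x \<in> gr M j" and w: "is_word A w"
  shows "pair \<psi> (chD A M (pure (x, j) w)) = - sg i (pair (cD A MD i \<psi>) (pure (x, j) w))"
\<comment> \<open>Away from this degree both sides vanish. In it the parity of \<open>i\<close> is
  determined by the coefficient and the word, which the comparison of signs requires.\<close>
proof (cases "j + sdeg w = 1 - i")
  case False
  have p: "pure (x, j) w \<in> chain_part A M (j + sdeg w)"
    using x w by (auto simp: chain_part_eq is_word_lw intro: pure_chp)
  have "pair \<psi> (chD A M (pure (x, j) w)) = 0"
    by (rule pair_degree[OF c chD_part[OF p]]) (use False in auto)
  moreover have "pair (cD A MD i \<psi>) (pure (x, j) w) = 0"
    by (rule pair_degree[OF dual.coch_cD[OF c] p]) (use False in auto)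
  ultimately show ?thesis by simp
next
  case True
  have b: "pair \<psi> (bdel A (\<lambda>v. pure (x, j) v) w) = sg (j * (sdeg w - 1)) (bdel A \<psi> w x)"
  proof -
    have "pair \<psi> (bdel A (\<lambda>v. pure (x, j) v) w) = bdel A (\<lambda>v. sg (j * sdeg v) (\<psi> v x)) w"
      by (subst bd_hom) (simp_all add: pair_simps)
    also have "\<dots> = bdel A (\<lambda>v. sg (j * (sdeg w - 1)) (\<psi> v x)) w"
      by (rule bd_sdeg[of A "\<lambda>n v. sg (j * n) (\<psi> v x)"])
    also have "\<dots> = sg (j * (sdeg w - 1)) (bdel A \<psi> w x)"
      using bd_hom[of "\<lambda>\<phi>. sg (j * (sdeg w - 1)) (\<phi> x)" A \<psi> w] by simp
    finally show ?thesis .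
  qed
  have d: "dif MD (\<psi> w) x = sg j (\<psi> w (dif M x))"
    using sigma_gr[OF x] coch_dualD[OF c w] by (simp add: dual_simps)
  show ?thesis
  proof (cases "w = []")
    case w0: True
    then have j: "j = 1 - i" using True by simp
    show ?thesis using b d by (simp add: w0 chD_pure pair_simps cD_def sg_fun j; simp add: sg_def)
  next
    case False
    obtain a m where a: "hd w = (a, m)" by force
    obtain e n where e: "last w = (e, n)" by force
    have tw: "is_word A (tl w)" "is_word A (butlast w)" using w by (auto simp: is_word_lw lw_tl lw_butlast)
    have ag: "a \<in> gr A m" using lw_hd[OF w[unfolded is_word_lw] False] a by simp
    have deg: "sdeg w = m + 1 + sdeg (tl w)" "sdeg w = sdeg (butlast w) + n + 1"
      using False a e by (cases w, simp_all) (metis append_butlast_last_id list.distinct(1) sdeg_simps add.assoc add_0_right snd_conv)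
    have la: "lact MD a (\<psi> (tl w)) x = sg m (\<psi> (tl w) (ract M x a))"
      using A.sigma_gr[OF ag] coch_dualD[OF c tw(1)] by (simp add: dual_simps)
    have ra: "ract MD (\<psi> (butlast w)) e x = \<psi> (butlast w) (lact M e x)"
      by (simp add: dual_simps)
    have p1: "even i \<longleftrightarrow> even (j + m + sdeg (tl w))" using True deg(1) by presburger
    have p2: "even (sdeg w) \<longleftrightarrow> even (m + 1 + sdeg (tl w))" "even (m + sdeg (tl w)) \<longleftrightarrow> even (sdeg (butlast w) + n)"
      using deg by presburger+
    have L: "pair \<psi> (chD A M (pure (x, j) w)) = sg ((j - 1) * sdeg w) (\<psi> w (dif M x)) + sg (j + j * (sdeg w - 1)) (bdel A \<psi> w x)
       + sg (j + (j + m) * sdeg (tl w)) (\<psi> (tl w) (ract M x a))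
       - sg ((n + 1) * (j + sdeg (butlast w)) + (n + j) * sdeg (butlast w)) (\<psi> (butlast w) (lact M e x))"
      by (simp add: chD_pure pair_simps b False a e)
    have R: "pair (cD A MD i \<psi>) (pure (x, j) w) = sg (j * sdeg w) (sg j (\<psi> w (dif M x)) - sg i (bdel A \<psi> w x)
       - sg (i * (m + 1) + m) (\<psi> (tl w) (ract M x a)) + sg (i + sdeg (butlast w)) (\<psi> (butlast w) (lact M e x)))"
      by (simp add: cD_def sg_fun False a e la ra d del: sg_simps(2-4))
    show ?thesis unfolding L R using p1 p2
      by (cases "even j"; cases "even m"; cases "even n"; cases "even (sdeg (tl w))"; cases "even (sdeg (butlast w))")
         (simp_all add: sg_def)
  qed
qed

lemma pair_chD:
  assumes c: "coch A MD i \<psi>" and z: "z \<in> chain_part A M n"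
  shows "pair \<psi> (chD A M z) = - sg i (pair (cD A MD i \<psi>) z)"
proof -
  have "(pair \<psi> (chD A M z) = - sg i (pair (cD A MD i \<psi>) z))"
    using z unfolding chain_part_eq
    by (rule chp_induct) (use pair_chD_pure[OF c] in \<open>auto simp: chain.subspace_def pair_simps fld.scale_of_sg is_word_lw algebra_simps\<close>)
  then show ?thesis .
qed

text \<open>The bridge from chains to cochains: a functional that separates \<open>x\<close> from
  the span and the relations is multilinear, hence the pairing with a cochain valued in the
  dual.\<close>

lemma dual_separation:
  assumes S: "S \<subseteq> chain_part A M n" and x: "x \<in> chain_part A M n"
    and sep: "\<And>\<psi>. coch A MD (- n) \<psi> \<Longrightarrow> (\<And>y. y \<in> S \<Longrightarrow> pair \<psi> y = 0) \<Longrightarrow> pair \<psi> x = 0"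
  shows "x \<in> chain.span (S \<union> chain_relations A M)"
proof (rule ccontr)
  assume "x \<notin> chain.span (S \<union> chain_relations A M)"
  then obtain \<phi> where \<phi>: "Vector_Spaces.linear chain_scale (*) \<phi>" "\<And>y. y \<in> S \<Longrightarrow> \<phi> y = 0" "\<phi> x = 1"
    and r: "rfun A M \<phi>"
    using chain.separating_functional unfolding rfun_def by blast
  note l = linear_simps[OF \<phi>(1)] and rD = rfunD[OF r]
  have r0: "\<phi> (pure (0, j) w) = 0" if "is_word A w" for j w
    using rD(4)[of 0 j w 0] that by simp
  \<comment> \<open>The component of degree \<open>n - sdeg w\<close> is the only coefficient that a
    chain of degree \<open>n\<close> can have at \<open>w\<close>; the sign cancels the one in
    \<open>pair\<close>.\<close>
  define \<psi> where "\<psi> = (\<lambda>w y. sg ((n - sdeg w) * sdeg w) (\<phi> (pure (cmp M y (n - sdeg w), n - sdeg w) w)))"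
  have \<psi>: "coch A MD (- n) \<psi>"
  proof (rule cochI)
    fix w assume w: "is_word A w"
    show "\<psi> w \<in> gr MD (- n + sdeg w)"
      unfolding dual_gr
    proof (intro conjI linear_functionalI allI impI ballI)
      show "\<psi> w (y + z) = \<psi> w y + \<psi> w z" for y z
        using rD(3)[OF cmp(2) cmp(2) w] by (simp add: \<psi>_def cmp_add)
      show "\<psi> w (scl M r y) = r * \<psi> w y" for r y
        using rD(4)[OF cmp(2) w] by (simp add: \<psi>_def cmp_scl fld.scale_of_sg)
      show "\<psi> w y = 0" if "j \<noteq> - (- n + sdeg w)" "y \<in> gr M j" for j y
        using that r0[OF w] by (auto simp: \<psi>_def cmp_gr)
    qed
  next
    fix u w a b l assume "is_word A u" "is_word A w" "a \<in> gr A l" "b \<in> gr A l"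
    then show "\<psi> (u @ (a + b, l) # w) = \<psi> (u @ (a, l) # w) + \<psi> (u @ (b, l) # w)"
      using rD(5)[OF cmp(2)] by (simp add: \<psi>_def fun_eq_iff)
  next
    fix u w a r l assume "is_word A u" "is_word A w" "a \<in> gr A l"
    then show "\<psi> (u @ (scl A r a, l) # w) = scl MD r (\<psi> (u @ (a, l) # w))"
      using rD(6)[OF cmp(2)] by (simp add: \<psi>_def fun_eq_iff dual_simps fld.scale_of_sg)
  qed
  have eq: "pair \<psi> y = \<phi> y" if "y \<in> chain_part A M n" for y
    using that unfolding chain_part_eq
  proof (rule chp_induct)
    fix x j w assume "x \<in> gr M j" "lw (\<lambda>a i. a \<in> gr A i) w" "j + sdeg w = n"
    moreover from this have "n - sdeg w = j" by simp
    ultimately show "pair \<psi> (pure (x, j) w) = \<phi> (pure (x, j) w)"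
      by (simp add: \<psi>_def cmp_gr) (simp add: sg_def)
  qed (auto simp: chain.subspace_def l pair_simps)
  have "pair \<psi> x = 0" by (rule sep[OF \<psi>]) (use eq S \<phi>(2) in auto)
  then show False using eq[OF x] \<phi>(3) by simp
qed

lemma rel_by_pair:
  assumes x: "x \<in> chain_part A M n" and p: "\<And>\<psi>. coch A MD (- n) \<psi> \<Longrightarrow> pair \<psi> x = 0"
  shows "x \<in> chain_relations A M"
  using dual_separation[of "{}" n x] x p chain.span_eq_iff[THEN iffD2, OF rel_subspace[of A M]] by auto

text \<open>Transposed from \<open>cD_cD\<close> for the dual bimodule, so the signs of the chain
  differential need no second computation.\<close>

lemma chD_chD: "z \<in> chain_part A M n \<Longrightarrow> chD A M (chD A M z) \<in> chain_relations A M"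
proof (rule rel_by_pair[OF chD_part[OF chD_part]])
  fix \<psi> assume z: "z \<in> chain_part A M n" and c: "coch A MD (- (n - 1 - 1)) \<psi>"
  let ?i = "- (n - 1 - 1)"
  have "pair (cD A MD (?i - 1) (cD A MD ?i \<psi>)) z = 0"
    using z unfolding chain_part_eq
    by (rule chp_induct) (use dual.cD_cD[OF c] in \<open>auto simp: chain.subspace_def pair_simps is_word_lw\<close>)
  then show "pair \<psi> (chD A M (chD A M z)) = 0"
    using pair_chD[OF c chD_part[OF z]] pair_chD[OF dual.coch_cD[OF c] z] by simp
qed

text \<open>Detection by pairing works in one degree at a time, hence the reduction to generating
  relations, which are homogeneous.\<close>

lemma chD_rel: 
  assumes "x \<in> chain_relations A M" shows "chD A M x \<in> chain_relations A M"
proof -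
  have *: "x \<in> {x. chD A M x \<in> chain_relations A M}" if x: "x \<in> chain_part A M n" "x \<in> chain_relations A M" for x n
  proof -
    have "pair \<psi> (chD A M x) = 0" if c: "coch A MD (- (n - 1)) \<psi>" for \<psi>
      using pair_chD[OF c] rfunD(2)[OF pair_rfun[OF dual.coch_cD[OF c]]] x by simp
    then show ?thesis using rel_by_pair[OF chD_part[OF x(1)]] by blast
  qed
  have p: "pure (x, j) w \<in> chain_part A M (j + sdeg w)" if "x \<in> gr M j" "is_word A w" for x j w
    using that by (auto simp: chain_part_eq is_word_lw intro: pure_chp)
  have sub: "chain_part A M n = chp (\<lambda>x j. x \<in> gr M j) (\<lambda>a i. a \<in> gr A i) n" for n by (rule chain_part_eq)
  have "x \<in> {x. chD A M x \<in> chain_relations A M}"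
    using assms
  proof (rule chain_relations_cases)
    show "chain.subspace {x. chD A M x \<in> chain_relations A M}" by (auto simp: chain.subspace_def)
  next
    fix x y j w assume h: "x \<in> gr M j" "y \<in> gr M j" "is_word A w"
    show "pure (x + y, j) w - pure (x, j) w - pure (y, j) w \<in> {x. chD A M x \<in> chain_relations A M}"
    proof (rule *)
      show "pure (x + y, j) w - pure (x, j) w - pure (y, j) w \<in> chain_part A M (j + sdeg w)"
        using p[of "x + y" j w] p[of x j w] p[of y j w] h by (simp add: sub)
      show "pure (x + y, j) w - pure (x, j) w - pure (y, j) w \<in> chain_relations A M"
        by (intro relations h)
    qed
  next
    fix r x j w assume h: "x \<in> gr M j" "is_word A w"
    show "pure (scl M r x, j) w - chain_scale r (pure (x, j) w) \<in> {x. chD A M x \<in> chain_relations A M}"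
    proof (rule *)
      show "pure (scl M r x, j) w - chain_scale r (pure (x, j) w) \<in> chain_part A M (j + sdeg w)"
        using p[of "scl M r x" j w] p[of x j w] h by (simp add: sub)
      show "pure (scl M r x, j) w - chain_scale r (pure (x, j) w) \<in> chain_relations A M"
        by (intro relations h)
    qed
  next
    fix x j u a b i w assume h: "x \<in> gr M j" "a \<in> gr A i" "b \<in> gr A i" "is_word A u" "is_word A w"
    let ?r = "pure (x, j) (u @ (a + b, i) # w) - pure (x, j) (u @ (a, i) # w) - pure (x, j) (u @ (b, i) # w)"
    show "?r \<in> {x. chD A M x \<in> chain_relations A M}"
    proof (rule *)
      show "?r \<in> chain_part A M (j + sdeg (u @ (a, i) # w))"
        using p[of x j "u @ (a + b, i) # w"] p[of x j "u @ (a, i) # w"] p[of x j "u @ (b, i) # w"] h by (simp add: sub)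
      show "?r \<in> chain_relations A M"
        by (intro relations h)
    qed
  next
    fix r x j u a i w assume h: "x \<in> gr M j" "a \<in> gr A i" "is_word A u" "is_word A w"
    let ?r = "pure (x, j) (u @ (scl A r a, i) # w) - chain_scale r (pure (x, j) (u @ (a, i) # w))"
    show "?r \<in> {x. chD A M x \<in> chain_relations A M}"
    proof (rule *)
      show "?r \<in> chain_part A M (j + sdeg (u @ (a, i) # w))"
        using p[of x j "u @ (scl A r a, i) # w"] p[of x j "u @ (a, i) # w"] h by (simp add: sub)
      show "?r \<in> chain_relations A M"
        by (intro relations h)
    qed
  qed
  then show ?thesis by simp
qed

end

section \<open>Exactness of relative chain complexes\<close>

lemma span_decomp:
  assumes "x \<in> chain.span (P \<union> Q \<union> R)" "chain.subspace P" "chain.subspace Q" "chain.subspace R"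
  obtains p q where "p \<in> P" "q \<in> Q" "x - p - q \<in> R"
proof -
  have "chain.span (P \<union> Q \<union> R) = {x + y |x y. x \<in> {x + y |x y. x \<in> P \<and> y \<in> Q} \<and> y \<in> R}"
    unfolding chain.span_Un using assms(2-4) by (simp add: chain.span_eq_iff[THEN iffD2])
  then obtain p q r where "x = p + q + r" "p \<in> P" "q \<in> Q" "r \<in> R" using assms(1) by auto
  then show ?thesis using that[of p q] by simp
qed

lemma chD_image_subspace: "chain.subspace (chD A N ` chp X L n)"
proof -
  interpret l: Vector_Spaces.linear chain_scale chain_scale "chD A N" by (rule chD_linear)
  show ?thesis by (rule l.subspace_image[OF chp_subspace])
qed

context dg_bimodule begin

lemma dual_zeroI:
  assumes c: "coch A MD i \<psi>" and w: "is_word A w" and z: "\<And>x j. x \<in> gr M j \<Longrightarrow> j + sdeg w = - i \<Longrightarrow> \<psi> w x = 0"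
  shows "\<psi> w = 0"
proof
  fix x
  have "\<psi> w x = (\<lambda>_. 0) x"
  proof (rule hom_eqI)
    fix x j assume "x \<in> gr M j"
    then show "\<psi> w x = 0" using z coch_dualD(5)[OF c w] by (cases "j + sdeg w = - i") auto
  qed (simp_all add: coch_dualD[OF c w])
  then show "\<psi> w x = 0 x" by simp
qed

lemma pair_cong:
  assumes "z \<in> chp X L n" "\<And>x j w. X x j \<Longrightarrow> lw L w \<Longrightarrow> \<psi> w x = \<psi>' w x"
  shows "pair \<psi> z = pair \<psi>' z"
  using assms(1) by (rule chp_induct) (auto simp: chain.subspace_def pair_simps assms(2))

lemma cD_zero_of_pair:
  assumes c: "coch A MD (- n) \<psi>" and w: "is_word A w"
    and p: "\<And>x j. x \<in> gr M j \<Longrightarrow> j + sdeg w = n + 1 \<Longrightarrow> pair \<psi> (chD A M (pure (x, j) w)) = 0"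
  shows "cD A MD (- n) \<psi> w = 0"
proof (rule dual_zeroI[OF dual.coch_cD[OF c] w])
  fix x j assume "x \<in> gr M j" "j + sdeg w = - (- n - 1)"
  then show "cD A MD (- n) \<psi> w x = 0"
    using pair_chD_pure[OF c _ w, of x j] p[of x j] by simp
qed

end

locale contraction_dg = contraction A \<epsilon> s + N: dg_bimodule A N
  for A :: "('k::field, 'a::ring_1) dg" and \<epsilon> :: "'a \<Rightarrow> 'k" and s :: "'a \<Rightarrow> 'a"
    and N :: "('k, 'a, 'm::ab_group_add) dg_bimod"
begin

abbreviation "CB \<equiv> chp (\<lambda>x j. x \<in> gr N j) b_letter"

lemma CB_part: "z \<in> CB n \<Longrightarrow> z \<in> chain_part A N n"
  unfolding chain_part_eq using chp_mono[of "\<lambda>x j. x \<in> gr N j" "\<lambda>x j. x \<in> gr N j" b_letter "\<lambda>a i. a \<in> gr A i" n]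
  by (auto simp: b_letter_def)

lemma chD_CB: "z \<in> CB n \<Longrightarrow> chD A N z \<in> CB (n - 1)"
  by (rule chD_chp[OF b_letter_class])
     (auto simp: coeff_class_def b_letter_def N.dif_degree N.lact_degree N.ract_degree)

text \<open>By \<open>dual_separation\<close> it suffices to consider a cochain
  \<open>\<psi>\<close> that kills boundaries and chains with negative letters. It is a cocycle
  vanishing on such words, so \<open>exact_rel_b\<close> writes it as \<open>cD g\<close> with
  \<open>g\<close> vanishing there too. Pairing \<open>\<psi>\<close> with \<open>t\<close> is, up
  to sign, pairing \<open>g\<close> with \<open>b\<close>, which is zero.\<close>

lemma chain_rel_exact:
  assumes t: "t \<in> chain_part A N n" and b: "b \<in> CB (n - 1)" "chD A N t - b \<in> chain_relations A N"
  obtains t' b' where "t' \<in> chain_part A N (n + 1)" "b' \<in> CB n" "t - chD A N t' - b' \<in> chain_relations A N"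
proof -
  interpret D: contraction_bimodule A \<epsilon> s "dual_bimod A N" ..
  let ?S = "chD A N ` chain_part A N (n + 1) \<union> CB n"
  have "t \<in> chain.span (?S \<union> chain_relations A N)"
  proof (rule N.dual_separation[OF _ t])
    have "chD A N ` chain_part A N (n + 1) \<subseteq> chain_part A N n"
      using N.chD_part[of _ "n + 1"] by auto
    then show "?S \<subseteq> chain_part A N n" using CB_part by blast
  next
    fix \<psi> assume c: "coch A (dual_bimod A N) (- n) \<psi>" and z: "\<And>y. y \<in> ?S \<Longrightarrow> N.pair \<psi> y = 0"
    have 1: "cD A (dual_bimod A N) (- n) \<psi> w = 0" if w: "is_word A w" for w
    proof (rule N.cD_zero_of_pair[OF c w])
      fix x j assume "x \<in> gr N j" "j + sdeg w = n + 1"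
      then have "pure (x, j) w \<in> chain_part A N (n + 1)"
        using w by (auto simp: chain_part_eq is_word_lw intro: pure_chp)
      then show "N.pair \<psi> (chD A N (pure (x, j) w)) = 0" using z by blast
    qed
    have 2: "\<psi> w = 0" if w: "lw b_letter w" for w
    proof (rule N.dual_zeroI[OF c b_word[OF w]])
      fix x j assume "x \<in> gr N j" "j + sdeg w = - (- n)"
      then have "pure (x, j) w \<in> CB n" using w by (auto intro: pure_chp)
      then have "N.pair \<psi> (pure (x, j) w) = 0" by (intro z) blast
      then show "\<psi> w x = 0" by simp
    qed
    obtain g where g: "coch A (dual_bimod A N) (- n + 1) g" "\<And>w. lw b_letter w \<Longrightarrow> g w = 0"
      "\<And>w. is_word A w \<Longrightarrow> cD A (dual_bimod A N) (- n + 1) g w = \<psi> w"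
      using D.exact_rel_b[OF c 2 1] by blast
    have "N.pair \<psi> t = N.pair (cD A (dual_bimod A N) (- n + 1) g) t"
      using t unfolding chain_part_eq by (rule N.pair_cong) (use g(3) in \<open>simp add: is_word_lw\<close>)
    moreover have "N.pair g (chD A N t) = 0"
    proof -
      have "N.pair g (chD A N t - b) = 0" using rfunD(2)[OF N.pair_rfun[OF g(1)] b(2)] .
      moreover have "N.pair g b = N.pair (\<lambda>_ _. 0) b" using b(1) by (rule N.pair_cong) (simp add: g(2))
      moreover have "N.pair (\<lambda>_ _. 0) b = 0" using b(1) by (rule chp_induct) (auto simp: chain.subspace_def N.pair_simps)
      ultimately show ?thesis by (simp add: N.pair_simps)
    qed
    ultimately show "N.pair \<psi> t = 0" using N.pair_chD[OF g(1) t] by simp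
  qed
  from this[unfolded chain_part_eq]
  obtain p q where "p \<in> chD A N ` chp (\<lambda>x j. x \<in> gr N j) (\<lambda>a i. a \<in> gr A i) (n + 1)" "q \<in> CB n" "t - p - q \<in> chain_relations A N"
    by (rule span_decomp[OF _ chD_image_subspace chp_subspace rel_subspace])
  then show ?thesis using that unfolding chain_part_eq by blast
qed

end

section \<open>The regular bimodule and the coefficients of a cycle over it\<close>

context dg_algebra begin

lemma regular_simps [simp]:
  "scl (regular_bimod A) = scl A" "gr (regular_bimod A) = gr A" "dif (regular_bimod A) = dif A"
  "lact (regular_bimod A) = (*)" "ract (regular_bimod A) = (*)"
  by (simp_all add: regular_bimod_def)

lemma regular_dg_bimodule: "dg_bimodule A (regular_bimod A)"
proof -
  have lin: "Vector_Spaces.linear (scl A) (scl A) h"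
    if "\<And>x y. h (x + y) = h x + h y" "\<And>r x. h (scl A r x) = scl A r (h x)" for h
    by (rule linearI') (use that vector_space_axioms in auto)
  show ?thesis
    by unfold_locales
       (auto intro!: lin simp: gr_subspace gr_direct_sum dif_degree dif_dif mult_degree dif_mult_sg scale_sg
        algebra_simps scl_mult_left scl_mult_right)
qed

end

context contraction begin

text \<open>The dual argument of \<open>chain_rel_exact\<close> once more, now moving the
  coefficient into the subalgebra: a cochain that kills the target takes values in functionals
  vanishing on the subalgebra, and \<open>exact_coeff\<close> applies with the transpose of
  \<open>s\<close>.\<close>

lemma chain_coeff_exact:
  assumes z: "z \<in> chp (\<lambda>x j. x \<in> gr A j) b_letter n" "chD A (regular_bimod A) z \<in> chain_relations A (regular_bimod A)"
  obtains t z' where "t \<in> chp (\<lambda>x j. x \<in> gr A j) b_letter (n + 1)" "z' \<in> chp tl_letter b_letter n"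
    "z - chD A (regular_bimod A) t - z' \<in> chain_relations A (regular_bimod A)"
proof -
  let ?M = "regular_bimod A" and ?D = "dual_bimod A (regular_bimod A)"
  interpret M: dg_bimodule A ?M by (rule regular_dg_bimodule)
  interpret R: contraction_dg A \<epsilon> s ?M ..
  interpret D: contraction_bimodule A \<epsilon> s ?D ..
  have CB: "R.CB = chp (\<lambda>x j. x \<in> gr A j) b_letter" by simp
  define K where "K = {\<phi>. \<forall>x i. tl_letter x i \<longrightarrow> \<phi> x = (0::'k)}"
  \<comment> \<open>The transpose of \<open>s\<close>; \<open>sigma\<close> and the minus sign match
    the sign in the dual differential.\<close>
  define t where "t = (\<lambda>(\<phi>::'a \<Rightarrow> 'k) x. - \<phi> (s (sigma A x)))"
  have sigA: "sigma ?M = sigma A" by (simp add: fun_eq_iff sigma_def cmp_def)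
  have tl_gr: "x \<in> gr A i" if "tl_letter x i" for x i using that by (simp add: tl_letter_def)
  have tl_sg: "tl_letter (sg n x) i" if "tl_letter x i" for n x i
    using that by (simp add: tl_letter_def sg_def)
  \<comment> \<open>\<open>K\<close> also contains functions that are not linear, so
    \<open>\<phi> 0 = 0\<close> has to come from \<open>0\<close> being an element of the
    subalgebra.\<close>
  have tl0: "tl_letter 0 0" by (simp add: tl_letter_def)
  note tlc = letter_classD[OF tl_letter_class]
  let ?S = "chD A ?M ` chp (\<lambda>x j. x \<in> gr A j) b_letter (n + 1) \<union> chp tl_letter b_letter n"
  have "z \<in> chain.span (?S \<union> chain_relations A ?M)"
  proof (rule M.dual_separation)
    have "chD A ?M ` chp (\<lambda>x j. x \<in> gr A j) b_letter (n + 1) \<subseteq> chp (\<lambda>x j. x \<in> gr A j) b_letter n"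
      using R.chD_CB[of _ "n + 1"] by auto
    moreover have "chp tl_letter b_letter n \<subseteq> chp (\<lambda>x j. x \<in> gr A j) b_letter n"
      by (rule chp_mono) (auto simp: tl_gr)
    ultimately show "?S \<subseteq> chain_part A ?M n" using R.CB_part by auto
    show "z \<in> chain_part A ?M n" using R.CB_part z(1) by simp
  next
    fix \<psi> assume c: "coch A ?D (- n) \<psi>" and 0: "\<And>y. y \<in> ?S \<Longrightarrow> M.pair \<psi> y = 0"
    have 1: "cD A ?D (- n) \<psi> w = 0" if w: "lw b_letter w" for w
    proof (rule M.cD_zero_of_pair[OF c b_word[OF w]])
      fix x j assume "x \<in> gr ?M j" "j + sdeg w = n + 1"
      then have "pure (x, j) w \<in> chp (\<lambda>x j. x \<in> gr A j) b_letter (n + 1)" using w by (auto intro: pure_chp)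
      then show "M.pair \<psi> (chD A ?M (pure (x, j) w)) = 0" using 0 by blast
    qed
    have 2: "\<psi> w \<in> K" if w: "lw b_letter w" for w
    proof -
      have "\<psi> w x = 0" if x: "tl_letter x i" for x i
      proof (cases "i + sdeg w = n")
        case True
        then have "pure (x, i) w \<in> chp tl_letter b_letter n" using w x by (auto intro: pure_chp)
        then have "M.pair \<psi> (pure (x, i) w) = 0" by (intro 0) blast
        then show ?thesis by simp
      next
        case False
        then show ?thesis using M.coch_dualD(5)[OF c b_word[OF w], of x i] tl_gr[OF x] by simp
      qed
      then show ?thesis by (auto simp: K_def)
    qed
    have "\<exists>g. coch A ?D (- n + 1) g \<and> (\<forall>w. lw b_letter w \<longrightarrow> g w \<in> K) \<and> (\<forall>w. lw b_letter w \<longrightarrow> cD A ?D (- n + 1) g w = \<psi> w)"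
    proof (rule D.exact_coeff[where t = t, OF _ _ _ _ _ _ _ _ c 2 1])
      show "module.subspace (scl ?D) K" by (auto simp: M.dual.M.subspace_def K_def dual_simps)
    next
      fix \<phi> assume \<phi>: "\<phi> \<in> K"
      show "dif ?D \<phi> \<in> K"
        unfolding K_def dual_simps
      proof (intro CollectI allI impI)
        fix x i assume x: "tl_letter x i"
        then have "\<phi> (dif A (sg i x)) = 0"
          using \<phi> tlc(2)[OF tl_sg[OF x]] unfolding K_def by blast
        then show "\<phi> (dif ?M (sigma ?M x)) = 0"
          using sigma_gr[OF tl_gr[OF x]] by (simp add: sigA del: dif_simps)
      qed
      show "t \<phi> \<in> K"
        unfolding K_def t_def
      proof (intro CollectI allI impI)
        fix x i assume x: "tl_letter x i"
        have "s (sg i x) = 0" using tl_sg[OF x] by (simp add: tl_letter_def)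
        then show "- \<phi> (s (sigma A x)) = 0"
          using \<phi>[unfolded K_def mem_Collect_eq, rule_format, OF tl0] sigma_gr[OF tl_gr[OF x]] by (simp del: s_simps)
      qed
    next
      fix a i \<phi> assume a: "b_letter a i" and \<phi>: "\<phi> \<in> K"
      have a': "tl_letter a i" "sigma A a = sg i a" using a by (auto simp: b_letter_tl sigma_gr tl_gr)
      show "lact ?D a \<phi> \<in> K \<and> ract ?D \<phi> a \<in> K"
      proof -
        have "\<phi> y = 0" if "tl_letter y m" for y m using \<phi> that unfolding K_def by blast
        then have "\<phi> (x * sg i a) = 0" "\<phi> (a * x) = 0" if "tl_letter x m" for x m
          using tlc(3)[OF that tl_sg[OF a'(1)]] tlc(3)[OF a'(1) that] by blast+
        then show ?thesis unfolding K_def dual_simps by (auto simp: a'(2))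
      qed
    next
      show "t (\<phi> + \<phi>') = t \<phi> + t \<phi>'" "t (scl ?D r \<phi>) = scl ?D r (t \<phi>)" for \<phi> \<phi>' r
        by (simp_all add: t_def dual_simps fun_eq_iff)
    next
      fix \<phi> j assume \<phi>: "\<phi> \<in> gr ?D j"
      then have l: "Vector_Spaces.linear (scl A) (*) \<phi>" by (simp add: dual_gr)
      note ls = linear_simps[OF l]
      show "t \<phi> \<in> gr ?D (j + 1)"
        unfolding dual_gr
      proof (intro conjI allI impI ballI)
        show "Vector_Spaces.linear (scl ?M) (*) (t \<phi>)"
          by (rule M.linear_functionalI) (simp_all add: t_def ls)
        fix i x assume "i \<noteq> - (j + 1)" "x \<in> gr ?M i"
        then show "t \<phi> x = 0"
          using dual_gr_zero[OF \<phi>, of "s (sigma A x)" "i + 1"] s_gr sigma_gr[of x i] by (simp add: t_def)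
      qed
      assume K: "\<phi> \<in> K"
      show "dif ?D (t \<phi>) + t (dif ?D \<phi>) = \<phi>"
      proof (rule ext, rule hom_eqI)
        fix x i assume x: "x \<in> gr A i"
        have 1: "sigma A (dif A (sigma A x)) = - dif A x" by (simp add: sigma_dif)
        have "sigma A (s (sigma A x)) = - s x"
          using sigma_gr[OF x] sigma_gr[OF s_gr[OF x]] by (simp add: sg_def)
        then have "(dif ?D (t \<phi>) + t (dif ?D \<phi>)) x = \<phi> (s (dif A x)) + \<phi> (dif A (s x))"
          by (simp add: dual_simps t_def sigA 1 ls)
        also have "\<dots> = \<phi> x - \<phi> (pr x)" by (simp add: pr_def ls)
        also have "\<phi> (pr x) = 0" using K s_pr[OF x] pr_gr[OF x] unfolding K_def tl_letter_def by blast
        finally show "(dif ?D (t \<phi>) + t (dif ?D \<phi>)) x = \<phi> x" by simp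
      qed (simp_all add: dual_simps t_def sigA ls)
    qed
    then obtain g where g: "coch A ?D (- n + 1) g" "\<And>w. lw b_letter w \<Longrightarrow> cD A ?D (- n + 1) g w = \<psi> w"
      by blast
    have "M.pair \<psi> z = M.pair (cD A ?D (- n + 1) g) z"
      using z(1) by (rule M.pair_cong) (use g(2) in simp)
    moreover have "M.pair g (chD A ?M z) = 0" using rfunD(2)[OF M.pair_rfun[OF g(1)] z(2)] .
    ultimately show "M.pair \<psi> z = 0" using M.pair_chD[OF g(1), of z n] R.CB_part z(1) by simp
  qed
  then obtain p q where "p \<in> chD A ?M ` chp (\<lambda>x j. x \<in> gr A j) b_letter (n + 1)" "q \<in> chp tl_letter b_letter n"
      "z - p - q \<in> chain_relations A ?M"
    by (rule span_decomp[OF _ chD_image_subspace chp_subspace rel_subspace])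
  then show ?thesis using that by blast
qed

end

section \<open>Cap products\<close>

definition spl :: "('a word \<Rightarrow> 'a word \<Rightarrow> 'c::comm_monoid_add) \<Rightarrow> 'a word \<Rightarrow> 'c" where
  "spl K w = (\<Sum>q\<le>length w. K (take q w) (drop q w))"

lemma spl_Nil [simp]: "spl K [] = K [] []"
  by (simp add: spl_def)

lemma spl_Cons: "spl K (x # w) = K [] (x # w) + spl (\<lambda>u v. K (x # u) v) w"
  by (simp add: spl_def sum.atMost_Suc_shift del: sum.atMost_Suc)

lemma spl_add: "spl (\<lambda>u v. K u v + K' u v) w = spl K w + spl K' w"
  by (simp add: spl_def sum.distrib)

lemma spl_diff: "spl (\<lambda>u v. K u v - (K' u v :: 'c::ab_group_add)) w = spl K w - spl K' w"
  by (simp add: spl_def sum_subtractf)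

lemma spl_sg: "spl (\<lambda>u v. sg n (K u v)) w = sg n (spl K w)"
  by (simp add: spl_def sg_sum)

lemma spl_cong: "(\<And>u v. w = u @ v \<Longrightarrow> K u v = K' u v) \<Longrightarrow> spl K w = spl K' w"
  by (auto simp: spl_def intro!: sum.cong)

lemma spl_hom: "(\<And>x y. h (x + y) = h x + h y) \<Longrightarrow> h 0 = 0 \<Longrightarrow> h (spl K w) = spl (\<lambda>u v. h (K u v)) w"
  by (induction w arbitrary: K) (simp_all add: spl_Cons)

lemma spl_append: "spl K (p @ x # r) = spl (\<lambda>u v. K u (v @ x # r)) p + spl (\<lambda>u v. K (p @ x # u) v) r"
  by (induction p arbitrary: K) (simp_all add: spl_Cons add.assoc)

lemma spl_snoc: "spl K (w @ [y]) = spl (\<lambda>u v. K u (v @ [y])) w + K (w @ [y]) []"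
  using spl_append[of K w y "[]"] by simp

lemma spl_if_Nil: "spl (\<lambda>u v. if u = [] then P v else K u v) w = P w - K [] w + (spl K w :: 'c::ab_group_add)"
  by (cases w) (simp_all add: spl_Cons)

text \<open>Moves the cut by one letter. It matches the right action in the cochain differential, by
  the last letter before the cut, with the right action in the chain differential, by the first
  letter after it.\<close>

lemma spl_shift:
  "spl (\<lambda>u v. if u = [] then 0 else J (butlast u) (last u) v) w = spl (\<lambda>u v. if v = [] then 0 else (J u (hd v) (tl v) :: 'c::ab_group_add)) w"
proof (induction w arbitrary: J)
  case (Cons x w)
  have "spl (\<lambda>u v. J (butlast (x # u)) (last (x # u)) v) w =
      spl (\<lambda>u v. if u = [] then J [] x v else J (x # butlast u) (last u) v) w"
    by (rule spl_cong) simp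
  also have "\<dots> = J [] x w + spl (\<lambda>u v. if u = [] then 0 else J (x # butlast u) (last u) v) w"
    by (simp add: spl_if_Nil)
  finally show ?case using Cons.IH[of "\<lambda>u. J (x # u)"] by (simp add: spl_Cons)
qed simp

lemma spl_last:
  "w \<noteq> [] \<Longrightarrow> spl (\<lambda>u v. if v = [] then 0 else K u (butlast v) (last v)) w = spl (\<lambda>u v. K u v (last w)) (butlast w)"
  by (cases w rule: rev_cases) (simp_all add: spl_snoc)

lemma spl_first:
  "w \<noteq> [] \<Longrightarrow> spl (\<lambda>u v. if u = [] then 0 else K (hd u) (tl u) v) w = spl (K (hd w)) (tl w)"
  by (cases w) (simp_all add: spl_Cons)

lemma bd_add': "bdel A (\<lambda>v. F v + G v) w = bdel A F w + bdel A G w"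
proof (induction w arbitrary: F G)
  case (Cons x w)
  then show ?case by (simp add: bd_Cons')
qed simp

text \<open>The differential of the bar construction is a coderivation of the deconcatenation coproduct.\<close>

lemma bd_spl:
  "bdel A (spl K) w = spl (\<lambda>u v. bdel A (\<lambda>u. K u v) u + sg (sdeg u) (bdel A (K u) v)) w"
proof (induction w arbitrary: K)
  case (Cons x w)
  have 1: "bdel A (\<lambda>v. spl K (x # v)) w = bdel A (\<lambda>v. K [] (x # v)) w + bdel A (spl (\<lambda>u v. K (x # u) v)) w"
    using bd_add'[of A "\<lambda>v. K [] (x # v)" "spl (\<lambda>u v. K (x # u) v)" w] by (simp add: spl_Cons)
  have 2: "spl (\<lambda>u v. if u = [] then 0 else sg (snd x + 1) (K ((fst x * fst (hd u), snd x + snd (hd u)) # tl u) v)) w =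
      (if w = [] then 0 else sg (snd x + 1) (spl (\<lambda>u v. K ((fst x * fst (hd w), snd x + snd (hd w)) # u) v) (tl w)))"
    using spl_first[of w "\<lambda>y u v. sg (snd x + 1) (K ((fst x * fst y, snd x + snd y) # u) v)"] by (auto simp: spl_sg)
  have 3: "spl (\<lambda>u v. bdel A (\<lambda>u. K u v) (x # u) + sg (sdeg (x # u)) (bdel A (K (x # u)) v)) w
    = - spl (\<lambda>u v. K ((dif A (fst x), snd x - 1) # u) v) w
      + (if w = [] then 0 else sg (snd x + 1) (spl (\<lambda>u v. K ((fst x * fst (hd w), snd x + snd (hd w)) # u) v) (tl w)))
      + sg (snd x + 1) (spl (\<lambda>u v. bdel A (\<lambda>u. K (x # u) v) u + sg (sdeg u) (bdel A (K (x # u)) v)) w)"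
  proof -
    have "spl (\<lambda>u v. bdel A (\<lambda>u. K u v) (x # u) + sg (sdeg (x # u)) (bdel A (K (x # u)) v)) w =
      spl (\<lambda>u v. sg 1 (K ((dif A (fst x), snd x - 1) # u) v)
        + (if u = [] then 0 else sg (snd x + 1) (K ((fst x * fst (hd u), snd x + snd (hd u)) # tl u) v))
        + sg (snd x + 1) (bdel A (\<lambda>u. K (x # u) v) u + sg (sdeg u) (bdel A (K (x # u)) v))) w"
      by (rule spl_cong) (simp add: bd_Cons' add.assoc, simp add: sg_def)
    then show ?thesis unfolding spl_add spl_sg 2 by (simp add: sg_def)
  qed
  show ?case
    unfolding bd_Cons'[of A "spl K" x w] 1 Cons.IH spl_Cons[of _ x w] 3
    by (cases "w = []") (simp_all add: bd_Cons' spl_Cons)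
qed simp

text \<open>Treats together the three products used below: \<open>A\<close> acting on
  \<open>N\<close>, \<open>A\<close> acting on the ground field through \<open>\<epsilon>\<close>,
  and the ground field acting on itself.\<close>

locale cap_act = B: dg_bimodule A B + N: dg_bimodule A N
  for A :: "('k::field, 'a::ring_1) dg" and B :: "('k, 'a, 'b::ab_group_add) dg_bimod"
    and N :: "('k, 'a, 'm::ab_group_add) dg_bimod" +
  fixes act :: "'b \<Rightarrow> 'm \<Rightarrow> 'm"
  assumes act_add: "act (x + x') y = act x y + act x' y" "act x (y + y') = act x y + act x y'"
    and act_scl: "act (scl B r x) y = scl N r (act x y)" "act x (scl N r y) = scl N r (act x y)"
    and act_gr: "x \<in> gr B j \<Longrightarrow> y \<in> gr N i \<Longrightarrow> act x y \<in> gr N (j + i)"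
    and act_dif: "x \<in> gr B j \<Longrightarrow> dif N (act x y) = act (dif B x) y + sg j (act x (dif N y))"
    and act_mid: "act (ract B x a) y = act x (lact N a y)"
    and act_left: "act (lact B a x) y = lact N a (act x y)"
    and act_right: "act x (ract N y a) = ract N (act x y) a"
begin

lemma cap_linear: "Vector_Spaces.linear chain_scale chain_scale (\<lambda>z. cap act i z f)"
  unfolding cap_def by (rule chain_lin_linear)

lemmas cap_simps = linear_simps[OF cap_linear]

lemma cap_pure: "cap act i (pure (x, j) w) f = sg (i * sdeg w) (spl (\<lambda>u v. pure (act x (f u), j + (i + sdeg u)) v) w)"
  unfolding cap_def chain_lin_pure by (simp add: chain.scale_sg spl_def sg_sum)

lemma cap_chp:
  fixes f :: "'a word \<Rightarrow> 'm" and z :: "('k, 'b, 'a) chain"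
  assumes "\<And>x j u. X x j \<Longrightarrow> lw L u \<Longrightarrow> Y (act x (f u)) (j + (i + sdeg u))" and z: "z \<in> chp X L n"
  shows "cap act i z f \<in> chp Y L (n + i)"
proof (rule linear_span_into[OF cap_linear chp_subspace _ z[unfolded chp_def]])
  fix z :: "('k, 'b, 'a) chain" assume "z \<in> gens X L n"
  then obtain x j w where g: "X x j" "lw L w" "j + sdeg w = n" "z = pure (x, j) w" by (auto simp: gens_def)
  have "spl (\<lambda>u v. pure (act x (f u), j + (i + sdeg u)) v) w \<in> chp Y L (n + i)"
    unfolding spl_def
  proof (intro chain.subspace_sum[OF chp_subspace] pure_chp)
    fix q 
    show "Y (act x (f (take q w))) (j + (i + sdeg (take q w)))" using assms(1) g lw_take by blast
    show "lw L (drop q w)" using g lw_drop by blast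
    have "sdeg (take q w) + sdeg (drop q w) = sdeg w" by (metis append_take_drop_id sdeg_simps(3))
    then show "j + (i + sdeg (take q w)) + sdeg (drop q w) = n + i" using g by simp
  qed
  then show "cap act i z f \<in> chp Y L (n + i)" unfolding g(4) cap_pure by blast
qed

lemma cap_cong:
  fixes f :: "'a word \<Rightarrow> 'm" and z :: "('k, 'b, 'a) chain"
  assumes z: "z \<in> chp X L n" and fg: "\<And>u. lw L u \<Longrightarrow> f u = g u"
  shows "cap act i z f = cap act i z g"
proof (rule linear_eq_span[OF cap_linear cap_linear _ z[unfolded chp_def]])
  fix z :: "('k, 'b, 'a) chain" assume "z \<in> gens X L n"
  then obtain x j w where g: "lw L w" "z = pure (x, j) w" by (auto simp: gens_def)
  have "spl (\<lambda>u v. pure (act x (f u), j + (i + sdeg u)) v) w = spl (\<lambda>u v. pure (act x (g u), j + (i + sdeg u)) v) w"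
    by (rule spl_cong) (use fg g(1) in simp)
  then show "cap act i z f = cap act i z g" unfolding g(2) cap_pure by simp
qed

lemma rfun_cap_pure:
  assumes "rfun A N \<phi>"
  shows "\<phi> (cap act i (pure (x, j) w) f) = sg (i * sdeg w) (spl (\<lambda>u v. \<phi> (pure (act x (f u), j + (i + sdeg u)) v)) w)"
  using linear_simps[OF rfunD(1)[OF assms]] by (simp add: cap_pure spl_hom[of \<phi>])

lemma cap_part:
  assumes "coch A N i f" "z \<in> chain_part A B n" shows "cap act i z f \<in> chain_part A N (n + i)"
  using assms(2) unfolding chain_part_eq
  by (rule cap_chp[rotated]) (rule act_gr, assumption, rule cochD(1)[OF assms(1)], simp add: is_word_lw)

text \<open>Composition with the cap product turns a functional that respects the relations over
  \<open>N\<close> into one that respects those over \<open>B\<close>; \<open>rel_by_rfun\<close>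
  does the rest.\<close>

lemma cap_rel:
  assumes f: "coch A N i f" and z: "z \<in> chain_relations A B"
  shows "cap act i z f \<in> chain_relations A N"
proof (rule rel_by_rfun)
  fix \<phi> assume \<phi>: "rfun A N \<phi>"
  note r = rfunD[OF \<phi>] and l = linear_simps[OF rfunD(1)[OF \<phi>]]
  have fw: "act x (f u) \<in> gr N (j + (i + sdeg u))" if "x \<in> gr B j" "is_word A u" for x j u
    using that cochD(1)[OF f] act_gr by blast
  have "rfun A B (\<lambda>z. \<phi> (cap act i z f))"
  proof (rule rfunI)
    show "Vector_Spaces.linear chain_scale (*) (\<lambda>z. \<phi> (cap act i z f))"
      by (rule linearI') (simp_all add: cap_simps l chain.vector_space_axioms fld.vector_space_axioms)
  next
    fix x y j w assume h: "x \<in> gr B j" "y \<in> gr B j" "is_word A w"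
    have "spl (\<lambda>u v. \<phi> (pure (act (x + y) (f u), j + (i + sdeg u)) v)) w =
      spl (\<lambda>u v. \<phi> (pure (act x (f u), j + (i + sdeg u)) v) + \<phi> (pure (act y (f u), j + (i + sdeg u)) v)) w"
      by (rule spl_cong) (use h r(3) fw in \<open>simp add: act_add\<close>)
    then show "\<phi> (cap act i (pure (x + y, j) w) f) = \<phi> (cap act i (pure (x, j) w) f) + \<phi> (cap act i (pure (y, j) w) f)"
      by (simp add: rfun_cap_pure[OF \<phi>] spl_add)
  next
    fix a x j w assume h: "x \<in> gr B j" "is_word A w"
    have "spl (\<lambda>u v. \<phi> (pure (act (scl B a x) (f u), j + (i + sdeg u)) v)) w =
      spl (\<lambda>u v. a * \<phi> (pure (act x (f u), j + (i + sdeg u)) v)) w"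
      by (rule spl_cong) (use h r(4) fw in \<open>simp add: act_scl\<close>)
    then show "\<phi> (cap act i (pure (scl B a x, j) w) f) = a * \<phi> (cap act i (pure (x, j) w) f)"
      by (simp add: rfun_cap_pure[OF \<phi>] spl_def sum_distrib_left fld.scale_of_sg)
  next
    fix x j u a b m w assume h: "x \<in> gr B j" "a \<in> gr A m" "b \<in> gr A m" "is_word A u" "is_word A w"
    have 1: "spl (\<lambda>p q. \<phi> (pure (act x (f p), j + (i + sdeg p)) (q @ (a + b, m) # w))) u =
      spl (\<lambda>p q. \<phi> (pure (act x (f p), j + (i + sdeg p)) (q @ (a, m) # w)) + \<phi> (pure (act x (f p), j + (i + sdeg p)) (q @ (b, m) # w))) u"
      by (rule spl_cong) (use h r(5) fw in simp)
    have 2: "spl (\<lambda>p q. \<phi> (pure (act x (f (u @ (a + b, m) # p)), j + (i + sdeg (u @ (a + b, m) # p))) q)) w =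
      spl (\<lambda>p q. \<phi> (pure (act x (f (u @ (a, m) # p)), j + (i + sdeg (u @ (a, m) # p))) q)
         + \<phi> (pure (act x (f (u @ (b, m) # p)), j + (i + sdeg (u @ (b, m) # p))) q)) w"
    proof (rule spl_cong)
      fix p q assume "w = p @ q"
      then have w: "is_word A p" "is_word A q" using h by auto
      show "\<phi> (pure (act x (f (u @ (a + b, m) # p)), j + (i + sdeg (u @ (a + b, m) # p))) q) =
        \<phi> (pure (act x (f (u @ (a, m) # p)), j + (i + sdeg (u @ (a, m) # p))) q)
         + \<phi> (pure (act x (f (u @ (b, m) # p)), j + (i + sdeg (u @ (b, m) # p))) q)"
        using w h r(3)[OF fw[of x j "u @ (a, m) # p"] _ w(2), of "act x (f (u @ (b, m) # p))"] fw[of x j "u @ (b, m) # p"]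
        by (simp add: cochD(2)[OF f] act_add)
    qed
    show "\<phi> (cap act i (pure (x, j) (u @ (a + b, m) # w)) f) = \<phi> (cap act i (pure (x, j) (u @ (a, m) # w)) f) + \<phi> (cap act i (pure (x, j) (u @ (b, m) # w)) f)"
      unfolding rfun_cap_pure[OF \<phi>] spl_append 1 2 spl_add by simp
  next
    fix e x j u a m w assume h: "x \<in> gr B j" "a \<in> gr A m" "is_word A u" "is_word A w"
    have 1: "spl (\<lambda>p q. \<phi> (pure (act x (f p), j + (i + sdeg p)) (q @ (scl A e a, m) # w))) u =
      e * spl (\<lambda>p q. \<phi> (pure (act x (f p), j + (i + sdeg p)) (q @ (a, m) # w))) u"
      unfolding spl_hom[of "(*) e", OF distrib_left mult_zero_right] by (rule spl_cong) (use h r(6) fw in simp)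
    have 2: "spl (\<lambda>p q. \<phi> (pure (act x (f (u @ (scl A e a, m) # p)), j + (i + sdeg (u @ (scl A e a, m) # p))) q)) w =
      e * spl (\<lambda>p q. \<phi> (pure (act x (f (u @ (a, m) # p)), j + (i + sdeg (u @ (a, m) # p))) q)) w"
      unfolding spl_hom[of "(*) e", OF distrib_left mult_zero_right]
    proof (rule spl_cong)
      fix p q assume "w = p @ q"
      then have w: "is_word A p" "is_word A q" using h by auto
      show "\<phi> (pure (act x (f (u @ (scl A e a, m) # p)), j + (i + sdeg (u @ (scl A e a, m) # p))) q) =
        e * \<phi> (pure (act x (f (u @ (a, m) # p)), j + (i + sdeg (u @ (a, m) # p))) q)"
        using w h r(4)[OF fw[of x j "u @ (a, m) # p"] w(2), of e]
        by (simp add: cochD(3)[OF f] act_scl)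
    qed
    show "\<phi> (cap act i (pure (x, j) (u @ (scl A e a, m) # w)) f) = e * \<phi> (cap act i (pure (x, j) (u @ (a, m) # w)) f)"
      unfolding rfun_cap_pure[OF \<phi>] spl_append 1 2 by (simp add: fld.scale_of_sg distrib_left)
  qed
  then show "\<phi> (cap act i z f) = 0" using z by (simp add: rfun_def)
qed

lemma act_simps' [simp]: "act 0 y = 0" "act x 0 = 0" "act x (sg n y) = sg n (act x y)" "act x (- y) = - act x y" "act x (y - y') = act x y - act x y'"
proof -
  show 1: "act 0 y = 0" "act x 0 = 0" using act_add(1)[of 0 0 y] act_add(2)[of x 0 0] by simp_all
  show "act x (sg n y) = sg n (act x y)" by (rule sg_hom) (rule act_add)
  show m: "act x (- y) = - act x y" for y using act_scl(2)[of x "-1" y] by simp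
  show "act x (y - y') = act x y - act x y'" using act_add(2)[of x y "- y'"] m by simp
qed

text \<open>All three terms are expanded into sums over the cuts of the word. Applying a functional
  \<open>\<phi>\<close> that respects the relations makes the coefficients additive, so the sums can
  be split and compared.\<close>

lemma cap_leibniz_pure:
  assumes f: "coch A N i f" and x: "x \<in> gr B j" and w: "is_word A w" and \<phi>: "rfun A N \<phi>"
  shows "\<phi> (chD A N (cap act i (pure (x, j) w) f)) =
     \<phi> (cap act i (chD A B (pure (x, j) w)) f) + sg (j + sdeg w) (\<phi> (cap act (i - 1) (pure (x, j) w) (cD A N i f)))"
proof -
  note r = rfunD[OF \<phi>] and l = linear_simps[OF rfunD(1)[OF \<phi>]]
  have wd: "is_word A u" "is_word A v" if "w = u @ v" for u v using w that by simp_all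
  have \<phi>0: "\<phi> (pure (0, m) v) = 0" if "is_word A v" for m v using r(4)[of 0 m v 0] that by simp
  have \<phi>sg: "\<phi> (pure (sg n y, m) v) = sg n (\<phi> (pure (y, m) v))" if "is_word A v" "y \<in> gr N m" for n y m v
    using r(4)[of y m v "-1"] that by (simp add: sg_def)
  let ?K = "\<lambda>u v. \<phi> (pure (act x (f u), j + (i + sdeg u)) v)"
  let ?P = "\<lambda>m y v. \<phi> (pure (y, m) v)"
  let ?d = "\<lambda>u. j + (i - 1 + sdeg u)"
  have fu: "f u \<in> gr N (i + sdeg u)" if "is_word A u" for u by (rule cochD(1)[OF f that])
  have dx: "dif B x \<in> gr B (j - 1)" using B.dif_degree[OF x] .
  have bdf: "bdel A f u \<in> gr N (i - 1 + sdeg u)" if "is_word A u" for u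
    by (rule cochD(1)[OF N.weak.coch_bd[OF f] that])
  \<comment> \<open>\<open>Sa\<close> and \<open>Sb\<close> differentiate the coefficient and the
    value of \<open>f\<close>, \<open>Sd\<close> and \<open>Sc\<close> the word before and after the
    cut. \<open>Se\<close> is the right action at the cut, \<open>Sf\<close> the action of the first
    letter between \<open>x\<close> and \<open>f\<close>, and \<open>Sg\<close> the last letter
    wrapped around to the left. \<open>Sd\<close> and \<open>Sf\<close> occur only on the right-hand
    side and cancel there.\<close>
  define Sa where "Sa = spl (\<lambda>u v. ?P (?d u) (act (dif B x) (f u)) v) w"
  define Sb where "Sb = spl (\<lambda>u v. ?P (?d u) (act x (dif N (f u))) v) w"
  define Sc where "Sc = spl (\<lambda>u v. sg (sdeg u) (bdel A (?K u) v)) w"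
  define Sd where "Sd = spl (\<lambda>u v. ?P (?d u) (act x (bdel A f u)) v) w"
  define Se where "Se = spl (\<lambda>u v. if v = [] then 0 else sg (sdeg u) (?P (j + (i + sdeg u) + snd (hd v)) (ract N (act x (f u)) (fst (hd v))) (tl v))) w"
  define Sf where "Sf = (if w = [] then 0 else spl (\<lambda>u v. ?P (j + (i + sdeg u) + snd (hd w)) (act x (lact N (fst (hd w)) (f u))) v) (tl w))"
  define Sg where "Sg = (if w = [] then 0 else spl (\<lambda>u v. ?P (snd (last w) + (j + (i + sdeg u))) (lact N (fst (last w)) (act x (f u))) v) (butlast w))"
  let ?n = "(snd (last w) + 1) * (j + i + sdeg (butlast w))"
  have L: "\<phi> (chD A N (cap act i (pure (x, j) w) f)) =
      sg (i * sdeg w) (Sa + sg j Sb + sg (j + i) Sc + sg (j + i) Se - sg ?n Sg)"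
  proof -
    have "\<phi> (chD A N (cap act i (pure (x, j) w) f)) =
      sg (i * sdeg w) (spl (\<lambda>u v. \<phi> (chD A N (pure (act x (f u), j + (i + sdeg u)) v))) w)"
      using spl_hom[of "\<lambda>z. \<phi> (chD A N z)"] by (simp add: cap_pure l)
    also have "spl (\<lambda>u v. \<phi> (chD A N (pure (act x (f u), j + (i + sdeg u)) v))) w =
      spl (\<lambda>u v. ?P (?d u) (act (dif B x) (f u)) v + sg j (?P (?d u) (act x (dif N (f u))) v)
        + sg (j + i) (sg (sdeg u) (bdel A (?K u) v))
        + sg (j + i) (if v = [] then 0 else sg (sdeg u) (?P (j + (i + sdeg u) + snd (hd v)) (ract N (act x (f u)) (fst (hd v))) (tl v)))
        - sg ?n (if v = [] then 0 else ?P (snd (last v) + (j + (i + sdeg u))) (lact N (fst (last v)) (act x (f u))) (butlast v))) w"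
    proof (rule spl_cong)
      fix u v assume uv: "w = u @ v"
      note W = wd[OF uv]
      have lab: "j + (i + sdeg u) - 1 = ?d u" by simp
      have g1: "act (dif B x) (f u) \<in> gr N (?d u)" using act_gr[OF dx fu[OF W(1)]] by (simp add: algebra_simps)
      have g2: "act x (dif N (f u)) \<in> gr N (?d u)" using act_gr[OF x N.dif_degree[OF fu[OF W(1)]]] by (simp add: algebra_simps)
      have "\<phi> (pure (dif N (act x (f u)), j + (i + sdeg u) - 1) v) = ?P (?d u) (act (dif B x) (f u)) v + sg j (?P (?d u) (act x (dif N (f u))) v)"
        unfolding lab act_dif[OF x] using r(3)[OF g1 N.gr_intros(6)[OF g2] W(2)] \<phi>sg[OF W(2) g2] by simp
      moreover have "v \<noteq> [] \<Longrightarrow> last v = last w \<and> sdeg (butlast w) = sdeg u + sdeg (butlast v)"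
        unfolding uv by (simp add: butlast_append)
      moreover have "\<phi> (bdel A (\<lambda>v'. pure (act x (f u), j + (i + sdeg u)) v') v) = bdel A (?K u) v"
        by (rule bd_hom) (simp add: l)
      ultimately show "\<phi> (chD A N (pure (act x (f u), j + (i + sdeg u)) v)) =
        ?P (?d u) (act (dif B x) (f u)) v + sg j (?P (?d u) (act x (dif N (f u))) v)
        + sg (j + i) (sg (sdeg u) (bdel A (?K u) v))
        + sg (j + i) (if v = [] then 0 else sg (sdeg u) (?P (j + (i + sdeg u) + snd (hd v)) (ract N (act x (f u)) (fst (hd v))) (tl v)))
        - sg ?n (if v = [] then 0 else ?P (snd (last v) + (j + (i + sdeg u))) (lact N (fst (last v)) (act x (f u))) (butlast v))"
        by (cases "v = []") (simp_all add: chD_pure l add.assoc)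
    qed
    also have "\<dots> = Sa + sg j Sb + sg (j + i) Sc + sg (j + i) Se - sg ?n Sg"
      unfolding spl_add spl_diff spl_sg Sa_def Sb_def Sc_def Se_def Sg_def
      using spl_last[of w "\<lambda>u v y. ?P (snd y + (j + (i + sdeg u))) (lact N (fst y) (act x (f u))) v"] by (cases "w = []") simp_all
    finally show ?thesis .
  qed
  have bdK: "bdel A (\<lambda>u. ?K u v) u = ?P (?d u) (act x (bdel A f u)) v" if W: "is_word A u" "is_word A v" for u v
  proof -
    \<comment> \<open>The label of \<open>pure\<close> makes \<open>\<phi>\<close> additive in the
      coefficient only within one degree. Composing with the component of that degree makes it
      additive everywhere, as \<open>bd_hom\<close> requires.\<close>
    let ?h = "\<lambda>y. ?P (?d u) (act x (cmp N y (i - 1 + sdeg u))) v"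
    have h: "?h (y + z) = ?h y + ?h z" for y z
      unfolding N.cmp_add act_add(2) by (rule r(3)) (use act_gr[OF x N.cmp(2)] W in auto)
    have hf: "?h y = ?P (?d u) (act x y) v" if "y \<in> gr N (i - 1 + sdeg u)" for y
      using that by (simp add: N.cmp_gr)
    have "bdel A (\<lambda>u. ?K u v) u = bdel A (\<lambda>u. ?h (f u)) u"
    proof (rule bd_congL[OF N.weak.letter_class_gr W(1)[unfolded is_word_lw]])
      fix u' assume u': "lw (\<lambda>a i. a \<in> gr A i) u'" "sdeg u' = sdeg u - 1"
      have "f u' \<in> gr N (i - 1 + sdeg u)" using fu[of u'] u' by (simp add: is_word_lw algebra_simps)
      note hf[OF this]
      moreover have "j + (i + sdeg u') = ?d u" using u'(2) by simp
      ultimately show "?K u' v = ?h (f u')" by (simp only:)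
    qed
    also have "\<dots> = ?h (bdel A f u)" by (rule bd_hom[symmetric]) (rule h)
    also have "\<dots> = ?P (?d u) (act x (bdel A f u)) v" by (rule hf[OF bdf[OF W(1)]])
    finally show ?thesis .
  qed
  have R1: "\<phi> (cap act i (chD A B (pure (x, j) w)) f) =
      sg (i * sdeg w) Sa + sg (j + i * (sdeg w - 1)) (Sd + Sc)
      + (if w = [] then 0 else sg (j + i * sdeg (tl w)) Sf
          - sg ((snd (last w) + 1) * (j + sdeg (butlast w)) + i * sdeg (butlast w)) Sg)"
  proof -
    have a: "\<phi> (cap act i (pure (dif B x, j - 1) w) f) = sg (i * sdeg w) Sa"
      unfolding rfun_cap_pure[OF \<phi>] Sa_def by (simp add: algebra_simps)
    have b: "\<phi> (cap act i (bdel A (\<lambda>v. pure (x, j) v) w) f) = sg (i * (sdeg w - 1)) (Sd + Sc)"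
    proof -
      have "\<phi> (cap act i (bdel A (\<lambda>v. pure (x, j) v) w) f) = bdel A (\<lambda>v. sg (i * sdeg v) (spl ?K v)) w"
        by (subst bd_hom[of "\<lambda>z. \<phi> (cap act i z f)"]) (simp_all add: l cap_simps rfun_cap_pure[OF \<phi>])
      also have "\<dots> = bdel A (\<lambda>v. sg (i * (sdeg w - 1)) (spl ?K v)) w"
        by (rule bd_sdeg[of A "\<lambda>n v. sg (i * n) (spl ?K v)"])
      also have "\<dots> = sg (i * (sdeg w - 1)) (bdel A (spl ?K) w)"
        by (rule bd_hom[symmetric]) simp
      also have "bdel A (spl ?K) w = spl (\<lambda>u v. ?P (?d u) (act x (bdel A f u)) v + sg (sdeg u) (bdel A (?K u) v)) w"
        unfolding bd_spl by (rule spl_cong) (simp add: bdK wd)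
      finally show ?thesis unfolding spl_add Sd_def Sc_def .
    qed
    have cc: "\<phi> (cap act i (pure (ract B x (fst (hd w)), j + snd (hd w)) (tl w)) f) = sg (i * sdeg (tl w)) Sf" if "w \<noteq> []"
      unfolding rfun_cap_pure[OF \<phi>] Sf_def act_mid using that by (simp add: algebra_simps)
    have dd: "\<phi> (cap act i (pure (lact B (fst (last w)) x, snd (last w) + j) (butlast w)) f) = sg (i * sdeg (butlast w)) Sg" if "w \<noteq> []"
      unfolding rfun_cap_pure[OF \<phi>] Sg_def act_left using that by (simp add: algebra_simps)
    show ?thesis
    proof (cases "w = []")
      case True
      then show ?thesis using a \<phi>0[of "[]"] unfolding chD_pure by (simp add: cap_simps l Sd_def Sc_def)
    next
      case False
      then show ?thesis unfolding chD_pure by (simp add: cap_simps l a b cc dd)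
    qed
  qed
  have R2: "\<phi> (cap act (i - 1) (pure (x, j) w) (cD A N i f)) = sg ((i - 1) * sdeg w)
     (Sb - sg i Sd - (if w = [] then 0 else sg (i * (snd (hd w) + 1)) Sf) + sg i Se)"
  proof -
    have "\<phi> (cap act (i - 1) (pure (x, j) w) (cD A N i f)) = sg ((i - 1) * sdeg w) (spl (\<lambda>u v. ?P (?d u) (act x (cD A N i f u)) v) w)"
      by (rule rfun_cap_pure[OF \<phi>])
    also have "spl (\<lambda>u v. ?P (?d u) (act x (cD A N i f u)) v) w =
      spl (\<lambda>u v. ?P (?d u) (act x (dif N (f u))) v - sg i (?P (?d u) (act x (bdel A f u)) v)
        - (if u = [] then 0 else sg (i * (snd (hd u) + 1)) (?P (j + (i + sdeg (tl u)) + snd (hd u)) (act x (lact N (fst (hd u)) (f (tl u)))) v))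
        + sg i (if u = [] then 0 else sg (sdeg (butlast u)) (?P (j + (i + sdeg (butlast u)) + snd (last u)) (ract N (act x (f (butlast u))) (fst (last u))) v))) w"
    proof (rule spl_cong)
      fix u v assume uv: "w = u @ v"
      note W = wd[OF uv]
      have g1: "act x (dif N (f u)) \<in> gr N (?d u)" using act_gr[OF x N.dif_degree[OF fu[OF W(1)]]] by (simp add: algebra_simps)
      have g2: "act x (bdel A f u) \<in> gr N (?d u)" using act_gr[OF x bdf[OF W(1)]] .
      show "?P (?d u) (act x (cD A N i f u)) v =
         ?P (?d u) (act x (dif N (f u))) v - sg i (?P (?d u) (act x (bdel A f u)) v)
        - (if u = [] then 0 else sg (i * (snd (hd u) + 1)) (?P (j + (i + sdeg (tl u)) + snd (hd u)) (act x (lact N (fst (hd u)) (f (tl u)))) v))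
        + sg i (if u = [] then 0 else sg (sdeg (butlast u)) (?P (j + (i + sdeg (butlast u)) + snd (last u)) (ract N (act x (f (butlast u))) (fst (last u))) v))"
      proof (cases "u = []")
        case True
        have "?P (?d u) (act x (dif N (f u)) + sg (i + 1) (act x (bdel A f u))) v = ?P (?d u) (act x (dif N (f u))) v + sg (i + 1) (?P (?d u) (act x (bdel A f u)) v)"
          using r(3)[OF g1 N.gr_intros(6)[OF g2] W(2)] \<phi>sg[OF W(2) g2] by simp
        then show ?thesis using True by (simp add: cD_def)
      next
        case False
        have tu: "is_word A (tl u)" "is_word A (butlast u)" using W(1) by (auto simp: is_word_lw lw_tl lw_butlast)
        have hu: "fst (hd u) \<in> gr A (snd (hd u))" "fst (last u) \<in> gr A (snd (last u))"
          using lw_hd[OF W(1)[unfolded is_word_lw] False] lw_last[OF W(1)[unfolded is_word_lw] False] by auto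
        have deg: "sdeg u = snd (hd u) + 1 + sdeg (tl u)" "sdeg u = sdeg (butlast u) + (snd (last u) + 1)"
          using False by (cases u; simp) (metis False append_butlast_last_id sdeg_simps add_0_right)
        have e1: "j + (i + sdeg (tl u)) + snd (hd u) = ?d u" "j + (i + sdeg (butlast u)) + snd (last u) = ?d u"
          using deg by simp_all
        have g3: "act x (lact N (fst (hd u)) (f (tl u))) \<in> gr N (?d u)"
          using act_gr[OF x N.lact_degree[OF hu(1) fu[OF tu(1)]]] unfolding e1(1)[symmetric] by (simp add: algebra_simps)
        have g4: "act x (ract N (f (butlast u)) (fst (last u))) \<in> gr N (?d u)"
          using act_gr[OF x N.ract_degree[OF fu[OF tu(2)] hu(2)]] unfolding e1(2)[symmetric] by (simp add: algebra_simps)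
        have D: "act x (cD A N i f u) = act x (dif N (f u)) + (sg (i + 1) (act x (bdel A f u)) + (sg (i * (snd (hd u) + 1) + 1) (act x (lact N (fst (hd u)) (f (tl u))))
          + sg (i + sdeg (butlast u)) (act x (ract N (f (butlast u)) (fst (last u))))))"
          using False by (simp add: cD_def act_add) (simp add: sg_def)
        show ?thesis
          unfolding D e1 act_right[symmetric]
          using False g1 g2 g3 g4 W(2)
          by (simp add: r(3) \<phi>sg) (simp add: sg_def)
      qed
    qed
    also have "\<dots> = Sb - sg i Sd - (if w = [] then 0 else sg (i * (snd (hd w) + 1)) Sf) + sg i Se"
      unfolding spl_add spl_diff spl_sg Sb_def Sd_def Se_def Sf_def
      using spl_first[of w "\<lambda>y u v. sg (i * (snd y + 1)) (?P (j + (i + sdeg u) + snd y) (act x (lact N (fst y) (f u))) v)"]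
        spl_shift[of "\<lambda>u y v. sg (sdeg u) (?P (j + (i + sdeg u) + snd y) (ract N (act x (f u)) (fst y)) v)" w]
      by (cases "w = []") (simp_all add: spl_sg)
    finally show ?thesis .
  qed
  show ?thesis
  proof (cases "w = []")
    case True
    then show ?thesis unfolding L R1 R2
      by (cases "even i"; cases "even j") (simp_all add: sg_def Sg_def)
  next
    case False
    obtain a m where a: "hd w = (a, m)" by force
    obtain e n where e: "last w = (e, n)" by force
    have deg: "even (sdeg w) \<longleftrightarrow> even (m + 1 + sdeg (tl w))" "even (m + sdeg (tl w)) \<longleftrightarrow> even (sdeg (butlast w) + n)"
    proof -
      have "sdeg w = m + 1 + sdeg (tl w)" "sdeg w = sdeg (butlast w) + (n + 1)"
        using False a e by (cases w, simp_all) (metis append_butlast_last_id list.distinct(1) sdeg_simps add_0_right snd_conv)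
      then show "even (sdeg w) \<longleftrightarrow> even (m + 1 + sdeg (tl w))" "even (m + sdeg (tl w)) \<longleftrightarrow> even (sdeg (butlast w) + n)" by presburger+
    qed
    show ?thesis unfolding L R1 R2 using deg
      by (cases "even i"; cases "even j"; cases "even m"; cases "even n"; cases "even (sdeg (tl w))"; cases "even (sdeg (butlast w))")
         (simp_all add: sg_def False a e)
  qed
qed

lemma cap_leibniz:
  assumes f: "coch A N i f" and z: "z \<in> chain_part A B n"
  shows "chD A N (cap act i z f) - cap act i (chD A B z) f - sg n (cap act (i - 1) z (cD A N i f)) \<in> chain_relations A N"
proof (rule rel_by_rfun)
  fix \<phi> assume \<phi>: "rfun A N \<phi>"
  note l = linear_simps[OF rfunD(1)[OF \<phi>]]
  show "\<phi> (chD A N (cap act i z f) - cap act i (chD A B z) f - sg n (cap act (i - 1) z (cD A N i f))) = 0"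
    using z unfolding chain_part_eq
  proof (rule chp_induct)
    fix x j w assume "x \<in> gr B j" "lw (\<lambda>a i. a \<in> gr A i) w" "j + sdeg w = n"
    then show "\<phi> (chD A N (cap act i (pure (x, j) w) f) - cap act i (chD A B (pure (x, j) w)) f - sg n (cap act (i - 1) (pure (x, j) w) (cD A N i f))) = 0"
      using cap_leibniz_pure[OF f _ _ \<phi>, of x j w] by (simp add: l is_word_lw)
  qed (simp_all add: chain.subspace_def l cap_simps fld.scale_of_sg algebra_simps)
qed

lemma cap_add:
  assumes f: "coch A N i f" "coch A N i g" and z: "z \<in> chain_part A B n"
  shows "cap act i z (\<lambda>w. f w + g w) - cap act i z f - cap act i z g \<in> chain_relations A N"
proof (rule rel_by_rfun)
  fix \<phi> assume \<phi>: "rfun A N \<phi>"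
  note l = linear_simps[OF rfunD(1)[OF \<phi>]] and r = rfunD[OF \<phi>]
  show "\<phi> (cap act i z (\<lambda>w. f w + g w) - cap act i z f - cap act i z g) = 0"
    using z unfolding chain_part_eq
  proof (rule chp_induct)
    fix x j w assume h: "x \<in> gr B j" "lw (\<lambda>a i. a \<in> gr A i) w"
    have "spl (\<lambda>u v. \<phi> (pure (act x (f u + g u), j + (i + sdeg u)) v)) w =
      spl (\<lambda>u v. \<phi> (pure (act x (f u), j + (i + sdeg u)) v) + \<phi> (pure (act x (g u), j + (i + sdeg u)) v)) w"
    proof (rule spl_cong)
      fix u v assume "w = u @ v"
      then have "is_word A u" "is_word A v" using h by (auto simp: is_word_lw)
      then show "\<phi> (pure (act x (f u + g u), j + (i + sdeg u)) v) = \<phi> (pure (act x (f u), j + (i + sdeg u)) v) + \<phi> (pure (act x (g u), j + (i + sdeg u)) v)"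
        unfolding act_add using h by (intro r(3) act_gr cochD(1)[OF f(1)] cochD(1)[OF f(2)])
    qed
    then show "\<phi> (cap act i (pure (x, j) w) (\<lambda>w. f w + g w) - cap act i (pure (x, j) w) f - cap act i (pure (x, j) w) g) = 0"
      by (simp add: l rfun_cap_pure[OF \<phi>] spl_add)
  qed (simp_all add: chain.subspace_def l cap_simps algebra_simps)
qed

lemma cap_scl:
  assumes f: "coch A N i f" and z: "z \<in> chain_part A B n"
  shows "cap act i z (\<lambda>w. scl N e (f w)) - chain_scale e (cap act i z f) \<in> chain_relations A N"
proof (rule rel_by_rfun)
  fix \<phi> assume \<phi>: "rfun A N \<phi>"
  note l = linear_simps[OF rfunD(1)[OF \<phi>]] and r = rfunD[OF \<phi>]
  show "\<phi> (cap act i z (\<lambda>w. scl N e (f w)) - chain_scale e (cap act i z f)) = 0"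
    using z unfolding chain_part_eq
  proof (rule chp_induct)
    fix x j w assume h: "x \<in> gr B j" "lw (\<lambda>a i. a \<in> gr A i) w"
    have "spl (\<lambda>u v. \<phi> (pure (act x (scl N e (f u)), j + (i + sdeg u)) v)) w =
      e * spl (\<lambda>u v. \<phi> (pure (act x (f u), j + (i + sdeg u)) v)) w"
      unfolding spl_hom[of "(*) e", OF distrib_left mult_zero_right]
    proof (rule spl_cong)
      fix u v assume "w = u @ v"
      then have "is_word A u" "is_word A v" using h by (auto simp: is_word_lw)
      then show "\<phi> (pure (act x (scl N e (f u)), j + (i + sdeg u)) v) = e * \<phi> (pure (act x (f u), j + (i + sdeg u)) v)"
        unfolding act_scl using h by (intro r(4) act_gr cochD(1)[OF f])
    qed
    then show "\<phi> (cap act i (pure (x, j) w) (\<lambda>w. scl N e (f w)) - chain_scale e (cap act i (pure (x, j) w) f)) = 0"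
      by (simp add: l rfun_cap_pure[OF \<phi>] fld.scale_of_sg)
  qed (simp_all add: chain.subspace_def l cap_simps distrib_left mult.left_commute)
qed

end

section \<open>The cone of the cap product\<close>

text \<open>Exactness of the mapping cone of \<open>f \<mapsto> z \<inter> f\<close>, computed with the letters allowed by \<open>L\<close>.\<close>

definition cone_exact :: "('k::field, 'a::ring_1) dg \<Rightarrow> ('a \<Rightarrow> int \<Rightarrow> bool) \<Rightarrow> ('k, 'a, 'm::ab_group_add) dg_bimod \<Rightarrow>
    ('k, 'a, 'a) chain \<Rightarrow> int \<Rightarrow> bool" where
  "cone_exact A L N z d \<longleftrightarrow> (\<forall>i f y. coch A N i f \<longrightarrow> (\<forall>w. lw L w \<longrightarrow> cD A N i f w = 0) \<longrightarrow>
     y \<in> chp (\<lambda>x j. x \<in> gr N j) L (d + i + 1) \<longrightarrow> chD A N y - cap (lact N) i z f \<in> chain_relations A N \<longrightarrow>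
     (\<exists>g t. coch A N (i + 1) g \<and> t \<in> chp (\<lambda>x j. x \<in> gr N j) L (d + i + 2) \<and>
        (\<forall>w. lw L w \<longrightarrow> cD A N (i + 1) g w = f w) \<and>
        y - sg d (cap (lact N) (i + 1) z g) - chD A N t \<in> chain_relations A N))"

lemma cone_exactD:
  assumes "cone_exact A L N z d" "coch A N i f" "\<And>w. lw L w \<Longrightarrow> cD A N i f w = 0"
    "y \<in> chp (\<lambda>x j. x \<in> gr N j) L (d + i + 1)" "chD A N y - cap (lact N) i z f \<in> chain_relations A N"
  obtains g t where "coch A N (i + 1) g" "t \<in> chp (\<lambda>x j. x \<in> gr N j) L (d + i + 2)"
    "\<And>w. lw L w \<Longrightarrow> cD A N (i + 1) g w = f w"
    "y - sg d (cap (lact N) (i + 1) z g) - chD A N t \<in> chain_relations A N"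
  using assms unfolding cone_exact_def by blast

lemma pure_zero_rel: "0 \<in> gr N j \<Longrightarrow> vector_space (scl N) \<Longrightarrow> is_word A w \<Longrightarrow> pure (0, j) w \<in> chain_relations A N"
proof -
  assume a: "0 \<in> gr N j" "vector_space (scl N)" "is_word A w"
  interpret vector_space "scl N" by fact
  show ?thesis using relations(2)[OF a(1,3), of 0] by simp
qed

text \<open>A map that kills everything \<open>D\<close> sends into \<open>R\<close> descends to the
  image of \<open>D\<close> modulo \<open>R\<close> and extends to the whole space along a basis.
  This is what produces a primitive with values in \<open>N\<close> in one stroke.\<close>

lemma linear_factor:
  fixes D :: "'v::ab_group_add \<Rightarrow> 'w::ab_group_add" and h :: "'v \<Rightarrow> 'u::ab_group_add"
  assumes D: "Vector_Spaces.linear s1 s2 D" and h: "Vector_Spaces.linear s1 s3 h"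
    and U: "module.subspace s1 U" and R: "module.subspace s2 R"
    and ker: "\<And>u. u \<in> U \<Longrightarrow> D u \<in> R \<Longrightarrow> h u = 0"
  shows "\<exists>G. Vector_Spaces.linear s2 s3 G \<and> (\<forall>x\<in>R. G x = 0) \<and> (\<forall>u\<in>U. G (D u) = h u)"
proof -
  interpret D: Vector_Spaces.linear s1 s2 D by fact
  interpret h: Vector_Spaces.linear s1 s3 h by fact
  interpret p: vector_space_pair s2 s3 ..
  \<comment> \<open>The basis begins with one of \<open>R\<close>, where \<open>G\<close> is set to
    zero; the remaining basis vectors are images \<open>D u\<close> and receive
    \<open>h u\<close>.\<close>
  obtain S0 where S0: "S0 \<subseteq> R" "D.vs2.independent S0" "R \<subseteq> D.vs2.span S0"
    using D.vs2.maximal_independent_subset[of R] by blast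
  obtain S where S: "S0 \<subseteq> S" "S \<subseteq> S0 \<union> D ` U" "D.vs2.independent S" "S0 \<union> D ` U \<subseteq> D.vs2.span S"
    using D.vs2.maximal_independent_subset_extend[of S0 "S0 \<union> D ` U"] S0(2) by blast
  define c where "c b = (if b \<in> S0 then 0 else (SOME u. u \<in> U \<and> D u = b))" for b
  have c: "c b \<in> U \<and> D (c b) = b" if "b \<in> S" "b \<notin> S0" for b
  proof -
    have "\<exists>u. u \<in> U \<and> D u = b" using that S(2) by auto
    from someI_ex[OF this] show ?thesis unfolding c_def using that by simp
  qed
  have c0: "c b = 0" if "b \<in> S0" for b using that by (simp add: c_def)
  have 0: "0 \<in> U" using U by (simp add: D.vs1.subspace_0)
  obtain G where G: "Vector_Spaces.linear s2 s3 G" "\<And>b. b \<in> S \<Longrightarrow> G b = h (c b)"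
    using p.linear_independent_extend[OF S(3), of "\<lambda>b. h (c b)"] by blast
  interpret G: Vector_Spaces.linear s2 s3 G by fact
  have GR: "G x = 0" if "x \<in> R" for x
    using p.linear_eq_0_on_span[OF G(1), of S0 x] G(2) S(1) c0 h.zero that S0(3) by (metis subsetD)
  have "\<exists>u'\<in>U. x - D u' \<in> R \<and> G x = h u'" if "x \<in> D.vs2.span S" for x
    using that
  proof (induction rule: D.vs2.span_induct_alt)
    case base
    then show ?case using 0 R by (auto intro!: bexI[of _ 0] simp: D.zero h.zero G.zero D.vs2.subspace_0)
  next
    case (step r b x)
    then obtain u' where u': "u' \<in> U" "x - D u' \<in> R" "G x = h u'" by blast
    have cb: "c b \<in> U" "b - D (c b) \<in> R"
      using c[OF step(1)] c0[of b] 0 S0(1) R by (cases "b \<in> S0"; auto simp: D.zero D.vs2.subspace_0)+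
    have "s2 r b + x - D (s1 r (c b) + u') = s2 r (b - D (c b)) + (x - D u')"
      by (simp add: D.add D.scale D.vs2.scale_right_diff_distrib)
    moreover have "s2 r (b - D (c b)) + (x - D u') \<in> R"
      by (intro D.vs2.subspace_add[OF R] D.vs2.subspace_scale[OF R] cb u')
    ultimately have "s2 r b + x - D (s1 r (c b) + u') \<in> R" by (simp only:)
    moreover have "G (s2 r b + x) = h (s1 r (c b) + u')"
      using G(2)[OF step(1)] u' by (simp add: G.add G.scale h.add h.scale)
    moreover have "s1 r (c b) + u' \<in> U" using U cb u' by (simp add: D.vs1.subspace_add D.vs1.subspace_scale)
    ultimately show ?case by blast
  qed
  then have "G (D u) = h u" if "u \<in> U" for u
  proof -
    have "D u \<in> D.vs2.span S" using that S(4) by auto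
    then obtain u' where u': "u' \<in> U" "D u - D u' \<in> R" "G (D u) = h u'"
      using \<open>\<And>x. x \<in> D.vs2.span S \<Longrightarrow> \<exists>u'\<in>U. x - D u' \<in> R \<and> G x = h u'\<close> by blast
    have "h (u - u') = 0" using ker[of "u - u'"] U that u' by (simp add: D.diff D.vs1.subspace_diff)
    then show ?thesis using u' by (simp add: h.diff)
  qed
  then show ?thesis using G(1) GR by blast
qed

section \<open>The ground field as a bimodule\<close>

context augmented_dg_algebra begin

abbreviation "T \<equiv> trivial_bimod \<epsilon>"

lemma T_simps [simp]:
  "scl T = (*)" "gr T i = (if i = 0 then UNIV else {0})" "dif T x = 0" "lact T a x = \<epsilon> a * x" "ract T x a = x * \<epsilon> a"
  by (simp_all add: trivial_bimod_def)

lemma trivial_dg_bimodule: "dg_bimodule A T"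
proof -
  have lin: "Vector_Spaces.linear (scl T) (scl T) h" if "\<And>x y. h (x + y) = h x + h y" "\<And>r x. h (r * x) = r * h x" for h :: "'k \<Rightarrow> 'k"
    by (rule linearI') (use that fld.vector_space_axioms in auto)
  have lin': "Vector_Spaces.linear (scl A) (scl T) h" if "\<And>x y. h (x + y) = h x + h y" "\<And>r x. h (scl A r x) = r * h x" for h :: "'a \<Rightarrow> 'k"
    by (rule linearI') (use that fld.vector_space_axioms vector_space_axioms in auto)
  show ?thesis
  proof (intro dg_bimodule.intro dg_space.intro dg_algebra_axioms dg_space_axioms.intro dg_bimodule_axioms.intro)
    show "vector_space (scl T)" using fld.vector_space_axioms by simp
    show "module.subspace (scl T) (gr T i)" for i by (auto simp: fld.subspace_def)
    fix x
    show "\<exists>!f. finite {i. f i \<noteq> 0} \<and> (\<forall>i. f i \<in> gr T i) \<and> x = (\<Sum>i | f i \<noteq> 0. f i)"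
    proof (rule ex1I[of _ "\<lambda>i. if i = 0 then x else 0"])
      show "finite {i. (if i = (0::int) then x else 0) \<noteq> 0} \<and> (\<forall>i. (if i = 0 then x else 0) \<in> gr T i) \<and>
          x = (\<Sum>i | (if i = (0::int) then x else 0) \<noteq> 0. if i = 0 then x else 0)"
        by (cases "x = 0") auto
    next
      fix f assume f: "finite {i. f i \<noteq> 0} \<and> (\<forall>i. f i \<in> gr T i) \<and> x = (\<Sum>i | f i \<noteq> 0. f i)"
      then have f0: "f i = 0" if "i \<noteq> 0" for i using that by (metis (mono_tags, lifting) T_simps(2) singletonD)
      have "(\<Sum>i | f i \<noteq> 0. f i) = (\<Sum>i\<in>{0}. f i)" by (rule sum.mono_neutral_left) (use f0 in auto)
      then show "f = (\<lambda>i. if i = 0 then x else 0)" using f f0 by (auto simp: fun_eq_iff)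
    qed
  next
    show "Vector_Spaces.linear (scl T) (scl T) (dif T)" by (rule lin) simp_all
    show "Vector_Spaces.linear (scl T) (scl T) (lact T a)" "Vector_Spaces.linear (scl T) (scl T) (\<lambda>x. ract T x a)" for a
      by (rule lin; simp add: distrib_left distrib_right)+
    show "Vector_Spaces.linear (scl A) (scl T) (\<lambda>a. lact T a x)" "Vector_Spaces.linear (scl A) (scl T) (ract T x)" for x
      by (rule lin'; simp add: distrib_left distrib_right)+
  next
    fix a x i j assume "a \<in> gr A i" "x \<in> gr T j"
    then show "lact T a x \<in> gr T (i + j)" "ract T x a \<in> gr T (j + i)"
      using aug_degree[of a i] by (cases "i = 0"; simp split: if_splits)+
  qed simp_all
qed

end

text \<open>A cycle with negative letters sees cochains only on words with negative letters, and a
  coefficient in the subalgebra is a scalar or lowers the degree. The first makes the cap product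
  insensitive to changes elsewhere, the second makes it respect the filtration with a scalar leading
  part.\<close>

locale dg_duality = contraction_dg A \<epsilon> s N
  for A :: "('k::field, 'a::ring_1) dg" and \<epsilon> :: "'a \<Rightarrow> 'k" and s :: "'a \<Rightarrow> 'a"
    and N :: "('k, 'a, 'm::ab_group_add) dg_bimod" +
  fixes z :: "('k, 'a, 'a) chain" and d :: int
  assumes z_chp: "z \<in> chp tl_letter b_letter d"
    and z_cycle: "chD A (regular_bimod A) z \<in> chain_relations A (regular_bimod A)"
begin

sublocale T: contraction_dg A \<epsilon> s T
  by (intro contraction_dg.intro contraction_axioms trivial_dg_bimodule)

sublocale Reg: dg_bimodule A "regular_bimod A"
  by (rule regular_dg_bimodule)

sublocale capN: cap_act A "regular_bimod A" N "lact N"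
  by (intro cap_act.intro cap_act_axioms.intro)
    (simp_all add: N.lact_degree N.dif_lact[unfolded N.scale_sg] N.lact_mult N.lact_ract Reg.dg_bimodule_axioms N.dg_bimodule_axioms)

sublocale capT: cap_act A "regular_bimod A" T "lact T"
proof (intro cap_act.intro cap_act_axioms.intro)
  fix x y j i assume "x \<in> gr (regular_bimod A) j" "y \<in> gr T i"
  then show "lact T x y \<in> gr T (j + i)" using T.N.lact_degree[of x j y i] by simp
qed (simp_all add: distrib_left distrib_right Reg.dg_bimodule_axioms T.N.dg_bimodule_axioms)

sublocale W: contraction_bimodule A \<epsilon> s N ..

lemma z_part: "z \<in> chain_part A (regular_bimod A) d"
  unfolding chain_part_eq
  using subsetD[OF chp_mono z_chp, of "\<lambda>x j. x \<in> gr (regular_bimod A) j" "\<lambda>a i. a \<in> gr A i"]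
  by (simp add: tl_letter_def b_letter_def)

lemma capN_CB: "coch A N i f \<Longrightarrow> cap (lact N) i z f \<in> CB (d + i)"
proof -
  assume f: "coch A N i f"
  show ?thesis
    by (rule capN.cap_chp[OF _ z_chp]) (use N.lact_degree[OF _ cochD(1)[OF f b_word]] in \<open>simp add: tl_letter_def\<close>)
qed

lemma capN_cong: "(\<And>w. lw b_letter w \<Longrightarrow> f w = g w) \<Longrightarrow> cap (lact N) i z f = cap (lact N) i z g"
  by (rule capN.cap_cong[OF z_chp])

lemma capN_leibniz:
  assumes "coch A N i f"
  shows "chD A N (cap (lact N) i z f) - sg d (cap (lact N) (i - 1) z (cD A N i f)) \<in> chain_relations A N"
  using rel_closed(2)[OF capN.cap_leibniz[OF assms z_part] capN.cap_rel[OF assms z_cycle]] by (simp add: algebra_simps)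

lemma capN_diff:
  assumes "coch A N i f" "coch A N i g"
  shows "cap (lact N) i z (\<lambda>w. f w - g w) - (cap (lact N) i z f - cap (lact N) i z g) \<in> chain_relations A N"
proof -
  have "cap (lact N) i z (\<lambda>w. (f w - g w) + g w) - cap (lact N) i z (\<lambda>w. f w - g w) - cap (lact N) i z g \<in> chain_relations A N"
    by (rule capN.cap_add) (use assms z_part in \<open>auto intro: N.weak.coch_closed\<close>)
  from rel_closed(4)[OF this] show ?thesis by (simp add: algebra_simps)
qed

text \<open>\<open>cD f\<close> vanishes on words with negative letters, so
  \<open>exact_rel_b\<close> provides a correction of \<open>f\<close> that is zero on those
  words.\<close>

lemma extend_cocycle:
  assumes f: "coch A N i f" "\<And>w. lw b_letter w \<Longrightarrow> cD A N i f w = 0"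
  obtains f' where "coch A N i f'" "\<And>w. lw b_letter w \<Longrightarrow> f' w = f w" "\<And>w. is_word A w \<Longrightarrow> cD A N i f' w = 0"
proof -
  obtain g where g: "coch A N (i - 1 + 1) g" "\<And>w. lw b_letter w \<Longrightarrow> g w = 0"
    "\<And>w. is_word A w \<Longrightarrow> cD A N (i - 1 + 1) g w = cD A N i f w"
    using W.exact_rel_b[OF N.weak.coch_cD[OF f(1)] f(2) N.weak.cD_cD[OF f(1)]] by blast
  show ?thesis
  proof (rule that[of "\<lambda>w. f w - g w"])
    show "coch A N i (\<lambda>w. f w - g w)" using g(1) f(1) by (intro N.weak.coch_closed) auto
    show "cD A N i (\<lambda>w. f w - g w) w = 0" if "is_word A w" for w
      using g(3)[OF that] N.weak.cD_diff[of i f g w] by simp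
  qed (use g in auto)
qed

text \<open>The cochain is first made a cocycle on all words, which does not change its cap product
  with \<open>z\<close>. The bounding chain found there has a boundary with negative letters up to
  relations, so \<open>chain_rel_exact\<close> replaces it by one with negative letters.\<close>

lemma cone_exact_all_to_b:
  assumes "cone_exact A (\<lambda>a i. a \<in> gr A i) N z d"
  shows "cone_exact A b_letter N z d"
  unfolding cone_exact_def
proof (intro allI impI)
  fix i f y assume f: "coch A N i f" "\<forall>w. lw b_letter w \<longrightarrow> cD A N i f w = 0"
    and y: "y \<in> CB (d + i + 1)" "chD A N y - cap (lact N) i z f \<in> chain_relations A N"
  obtain f' where f': "coch A N i f'" "\<And>w. lw b_letter w \<Longrightarrow> f' w = f w" "\<And>w. is_word A w \<Longrightarrow> cD A N i f' w = 0"
    using extend_cocycle[OF f(1)] f(2) by blast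
  have yp: "y \<in> chp (\<lambda>x j. x \<in> gr N j) (\<lambda>a i. a \<in> gr A i) (d + i + 1)"
    using CB_part[OF y(1)] by (simp add: chain_part_eq)
  have "chD A N y - cap (lact N) i z f' \<in> chain_relations A N" using y(2) capN_cong[of f' f i] f'(2) by simp
  then obtain g t where g: "coch A N (i + 1) g" "t \<in> chp (\<lambda>x j. x \<in> gr N j) (\<lambda>a i. a \<in> gr A i) (d + i + 2)"
    "\<And>w. lw (\<lambda>a i. a \<in> gr A i) w \<Longrightarrow> cD A N (i + 1) g w = f' w"
    "y - sg d (cap (lact N) (i + 1) z g) - chD A N t \<in> chain_relations A N"
    using cone_exactD[OF assms f'(1) _ yp] f'(3) by (auto simp: is_word_lw)
  have gC: "y - sg d (cap (lact N) (i + 1) z g) \<in> CB (d + i + 2 - 1)"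
    using y(1) capN_CB[OF g(1)] by (simp add: algebra_simps)
  have tp: "t \<in> chain_part A N (d + i + 2)" using g(2) by (simp add: chain_part_eq)
  obtain t' b' where t': "t' \<in> chain_part A N (d + i + 2 + 1)" "b' \<in> CB (d + i + 2)"
    "t - chD A N t' - b' \<in> chain_relations A N"
    using chain_rel_exact[OF tp gC] rel_closed(4)[OF g(4)] by (auto simp: algebra_simps)
  have "chD A N (t - chD A N t' - b') + chD A N (chD A N t') \<in> chain_relations A N"
    using N.chD_rel[OF t'(3)] N.chD_chD[OF t'(1)] by blast
  then have "(y - sg d (cap (lact N) (i + 1) z g) - chD A N t) + (chD A N (t - chD A N t' - b') + chD A N (chD A N t')) \<in> chain_relations A N"
    using g(4) by blast
  then have "y - sg d (cap (lact N) (i + 1) z g) - chD A N b' \<in> chain_relations A N" by simp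
  moreover have "cD A N (i + 1) g w = f w" if "lw b_letter w" for w
    using g(3)[of w] f'(2)[OF that] b_word[OF that] by (simp add: is_word_lw)
  ultimately show "\<exists>g t. coch A N (i + 1) g \<and> t \<in> CB (d + i + 2) \<and> (\<forall>w. lw b_letter w \<longrightarrow> cD A N (i + 1) g w = f w) \<and>
        y - sg d (cap (lact N) (i + 1) z g) - chD A N t \<in> chain_relations A N"
    using g(1) t'(2) by blast
qed

text \<open>In the other direction the chain \<open>y\<close> is moved first. The primitive then
  found solves the equation on negative letters; \<open>exact_rel_b\<close> supplies what is missing
  by a cochain \<open>r\<close> that vanishes there and hence does not affect the cap
  product.\<close>

lemma cone_exact_b_to_all:
  assumes "cone_exact A b_letter N z d"
  shows "cone_exact A (\<lambda>a i. a \<in> gr A i) N z d"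
  unfolding cone_exact_def
proof (intro allI impI)
  fix i f y assume f: "coch A N i f" "\<forall>w. lw (\<lambda>a i. a \<in> gr A i) w \<longrightarrow> cD A N i f w = 0"
    and y: "y \<in> chp (\<lambda>x j. x \<in> gr N j) (\<lambda>a i. a \<in> gr A i) (d + i + 1)" "chD A N y - cap (lact N) i z f \<in> chain_relations A N"
  have fw: "cD A N i f w = 0" if "is_word A w" for w using f(2) that by (simp add: is_word_lw)
  have yp: "y \<in> chain_part A N (d + i + 1)" using y(1) by (simp add: chain_part_eq)
  have cC: "cap (lact N) i z f \<in> CB (d + i + 1 - 1)" using capN_CB[OF f(1)] by simp
  obtain t' b' where t': "t' \<in> chain_part A N (d + i + 1 + 1)" "b' \<in> CB (d + i + 1)"
    "y - chD A N t' - b' \<in> chain_relations A N"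
    using chain_rel_exact[OF yp cC y(2)] by blast
  have "(chD A N y - cap (lact N) i z f) - (chD A N (y - chD A N t' - b') + chD A N (chD A N t')) \<in> chain_relations A N"
    using N.chD_rel[OF t'(3)] N.chD_chD[OF t'(1)] y(2) by blast
  then have "chD A N b' - cap (lact N) i z f \<in> chain_relations A N" by (simp add: algebra_simps)
  then obtain g t where g: "coch A N (i + 1) g" "t \<in> CB (d + i + 2)"
    "\<And>w. lw b_letter w \<Longrightarrow> cD A N (i + 1) g w = f w"
    "b' - sg d (cap (lact N) (i + 1) z g) - chD A N t \<in> chain_relations A N"
    using cone_exactD[OF assms f(1) _ t'(2)] fw b_word by blast
  let ?h = "\<lambda>w. f w - cD A N (i + 1) g w"
  have h: "coch A N i ?h" using N.weak.coch_cD[OF g(1)] f(1) by (intro N.weak.coch_closed) auto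
  have "cD A N i ?h w = 0" if "is_word A w" for w
    using N.weak.cD_diff[of i f "cD A N (i + 1) g" w] N.weak.cD_cD[OF g(1) that] fw[OF that] by simp
  then obtain r where r: "coch A N (i + 1) r" "\<And>w. lw b_letter w \<Longrightarrow> r w = 0" "\<And>w. is_word A w \<Longrightarrow> cD A N (i + 1) r w = ?h w"
    using W.exact_rel_b[OF h] g(3) by auto
  have c1: "cap (lact N) (i + 1) z (\<lambda>w. g w + r w) = cap (lact N) (i + 1) z g"
    by (rule capN_cong) (simp add: r(2))
  have c2: "cD A N (i + 1) (\<lambda>w. g w + r w) w = f w" if "is_word A w" for w
    using r(3)[OF that] N.weak.cD_add[of "i + 1" g r w] by simp
  have c3: "y - sg d (cap (lact N) (i + 1) z g) - chD A N (t + t') \<in> chain_relations A N"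
    using rel_closed(2)[OF g(4) t'(3)] by (simp add: algebra_simps)
  have c4: "t + t' \<in> chp (\<lambda>x j. x \<in> gr N j) (\<lambda>a i. a \<in> gr A i) (d + i + 2)"
  proof -
    have "d + i + 1 + 1 = d + i + 2" by simp
    then show ?thesis using t'(1) CB_part[OF g(2)] unfolding chain_part_eq by (simp only: chp_closed(2))
  qed
  have c5: "coch A N (i + 1) (\<lambda>w. g w + r w)" by (intro N.weak.coch_closed g r)
  show "\<exists>g t. coch A N (i + 1) g \<and> t \<in> chp (\<lambda>x j. x \<in> gr N j) (\<lambda>a i. a \<in> gr A i) (d + i + 2) \<and>
      (\<forall>w. lw (\<lambda>a i. a \<in> gr A i) w \<longrightarrow> cD A N (i + 1) g w = f w) \<and>
      y - sg d (cap (lact N) (i + 1) z g) - chD A N t \<in> chain_relations A N"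
  proof (intro exI conjI allI impI)
    show "y - sg d (cap (lact N) (i + 1) z (\<lambda>w. g w + r w)) - chD A N (t + t') \<in> chain_relations A N"
      unfolding c1 by (rule c3)
  qed (use c2 c4 c5 in \<open>simp_all only: is_word_lw\<close>)
qed

section \<open>Filtration of the coefficients by degree\<close>

text \<open>The zero coefficient is exempted from the bound since it may carry any degree
  label.\<close>

definition XF :: "nat \<Rightarrow> 'm \<Rightarrow> int \<Rightarrow> bool" where
  "XF p x j \<longleftrightarrow> x \<in> gr N j \<and> (x \<noteq> 0 \<longrightarrow> j \<le> - int p)"

abbreviation "CF p \<equiv> chp (XF p) b_letter"

abbreviation "RN \<equiv> chain_relations A N"
abbreviation "RT \<equiv> chain_relations A T"

text \<open>The values of a cochain have degree \<open>i + sdeg w\<close>, so this is the filtration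
  by coefficient degree, tested on the words that \<open>z\<close> sees.\<close>

definition ff :: "nat \<Rightarrow> int \<Rightarrow> ('a word \<Rightarrow> 'm) \<Rightarrow> bool" where
  "ff p i f \<longleftrightarrow> (\<forall>w. lw b_letter w \<longrightarrow> i + sdeg w > - int p \<longrightarrow> f w = 0)"

lemma CF_CB: "y \<in> CF p n \<Longrightarrow> y \<in> CB n"
  using chp_mono[of "XF p" "\<lambda>x j. x \<in> gr N j" b_letter b_letter n] by (auto simp: XF_def)

lemma pure0N: "is_word A w \<Longrightarrow> pure (0, j) w \<in> RN"
  by (rule pure_zero_rel) (simp_all add: N.vector_space_axioms)

lemma pure0T: "is_word A w \<Longrightarrow> pure (0, j) w \<in> RT"
  by (rule pure_zero_rel) (simp_all add: T.N.vector_space_axioms fld.vector_space_axioms)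

lemma sdeg_tl: "lw b_letter w \<Longrightarrow> sdeg w \<le> sdeg (tl w)" and sdeg_butlast: "lw b_letter w \<Longrightarrow> sdeg w \<le> sdeg (butlast w)"
proof -
  show "lw b_letter w \<Longrightarrow> sdeg w \<le> sdeg (tl w)" by (cases w) (auto simp: b_letter_def)
  show "lw b_letter w \<Longrightarrow> sdeg w \<le> sdeg (butlast w)" by (cases w rule: rev_cases) (auto simp: b_letter_def)
qed

text \<open>Dropping an outer negative letter does not lower \<open>sdeg\<close>, as its degree in
  \<open>sA\<close> is at most \<open>0\<close>, and the bar differential lowers it by exactly one.
  By the same count the bar differential alone reaches the leading degree in
  \<open>cD_lead_degree\<close>.\<close>

lemma cD_congS:
  assumes w: "lw b_letter w" and fg: "\<And>v. lw b_letter v \<Longrightarrow> sdeg w - 1 \<le> sdeg v \<Longrightarrow> f v = g v"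
  shows "cD A N i f w = cD A N i g w"
proof -
  have "bdel A f w = bdel A g w" by (rule bd_congL[OF b_letter_class w]) (use fg in auto)
  moreover have "f (tl w) = g (tl w)" "f (butlast w) = g (butlast w)" "f w = g w"
    using sdeg_tl[OF w] sdeg_butlast[OF w] w by (auto intro!: fg lw_tl lw_butlast)
  ultimately show ?thesis by (simp add: cD_def)
qed

lemma cD_lead_degree:
  assumes w: "lw b_letter w" and f: "\<And>v. lw b_letter v \<Longrightarrow> sdeg w \<le> sdeg v \<Longrightarrow> f v = 0"
  shows "cD A N i f w = - sg i (bdel A f w)"
  using f[OF w] f[OF lw_tl[OF w] sdeg_tl[OF w]] f[OF lw_butlast[OF w] sdeg_butlast[OF w]]
  by (simp add: cD_def)

lemma cD_T: 
  assumes w: "lw b_letter w"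
  shows "cD A T i f w = - sg i (bdel A f w)"
proof -
  have "w \<noteq> [] \<Longrightarrow> \<epsilon> (fst (hd w)) = 0 \<and> \<epsilon> (fst (last w)) = 0"
    using lw_hd[OF w] lw_last[OF w] b_letter_aug by blast
  then show ?thesis by (auto simp: cD_def)
qed

lemma ff_cD:
  assumes "ff p i f" shows "ff p (i - 1) (cD A N i f)"
  unfolding ff_def
proof (intro allI impI)
  fix w assume w: "lw b_letter w" "i - 1 + sdeg w > - int p"
  have "cD A N i f w = cD A N i (\<lambda>_. 0) w"
    by (rule cD_congS[OF w(1)]) (use assms w(2) in \<open>auto simp: ff_def\<close>)
  then show "cD A N i f w = 0" by simp
qed

text \<open>\<open>LC p l\<close> applies the functional \<open>l\<close> to the coefficients of degree \<open>-p\<close>, and \<open>VC p v\<close> multiplies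
  scalar coefficients by \<open>v\<close> of degree \<open>-p\<close>. Up to signs and lower filtration, both commute with the
  differentials and the cap products with \<open>z\<close>.\<close>

definition LC :: "nat \<Rightarrow> ('m \<Rightarrow> 'k) \<Rightarrow> ('k, 'm, 'a) chain \<Rightarrow> ('k, 'k, 'a) chain" where
  "LC p l = chain_lin (\<lambda>((x, j), w). if j = - int p then pure (l x, 0) w else 0)"

definition VC :: "nat \<Rightarrow> 'm \<Rightarrow> ('k, 'k, 'a) chain \<Rightarrow> ('k, 'm, 'a) chain" where
  "VC p v = chain_lin (\<lambda>((c, j), w). if j = 0 then pure (scl N c v, - int p) w else 0)"

lemma LC_linear: "Vector_Spaces.linear chain_scale chain_scale (LC p l)"
  unfolding LC_def by (rule chain_lin_linear)

lemma VC_linear: "Vector_Spaces.linear chain_scale chain_scale (VC p v)"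
  unfolding VC_def by (rule chain_lin_linear)

lemmas LC_simps = linear_simps[OF LC_linear] and VC_simps = linear_simps[OF VC_linear]

lemma LC_pure: "LC p l (pure (x, j) w) = (if j = - int p then pure (l x, 0) w else 0)"
  by (simp add: LC_def)

lemma VC_pure: "VC p v (pure (c, j) w) = (if j = 0 then pure (scl N c v, - int p) w else 0)"
  by (simp add: VC_def)

lemma LC_rel:
  assumes l: "Vector_Spaces.linear (scl N) (*) l" and x: "x \<in> RN" shows "LC p l x \<in> RT"
proof -
  note ls = linear_simps[OF l]
  have "x \<in> {x. LC p l x \<in> RT}"
    using x
  proof (rule chain_relations_cases)
    show "chain.subspace {x. LC p l x \<in> RT}" by (auto simp: chain.subspace_def LC_simps)
  next
    fix x y j w assume "is_word A w"
    then show "pure (x + y, j) w - pure (x, j) w - pure (y, j) w \<in> {x. LC p l x \<in> RT}"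
      using relations(1)[of "l x" T 0 "l y" A w] by (simp add: LC_simps LC_pure ls)
  next
    fix r x j w assume "is_word A w"
    then show "pure (scl N r x, j) w - chain_scale r (pure (x, j) w) \<in> {x. LC p l x \<in> RT}"
      using relations(2)[of "l x" T 0 A w r] by (simp add: LC_simps LC_pure ls)
  next
    fix x j u a b i w assume "a \<in> gr A i" "b \<in> gr A i" "is_word A u" "is_word A w"
    then show "pure (x, j) (u @ (a + b, i) # w) - pure (x, j) (u @ (a, i) # w) - pure (x, j) (u @ (b, i) # w) \<in> {x. LC p l x \<in> RT}"
      using relations(3)[of "l x" T 0 a A i b u w] by (simp add: LC_simps LC_pure)
  next
    fix r x j u a i w assume "a \<in> gr A i" "is_word A u" "is_word A w"
    then show "pure (x, j) (u @ (scl A r a, i) # w) - chain_scale r (pure (x, j) (u @ (a, i) # w)) \<in> {x. LC p l x \<in> RT}"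
      using relations(4)[of "l x" T 0 a A i u w r] by (simp add: LC_simps LC_pure)
  qed
  then show ?thesis by simp
qed

lemma VC_rel:
  assumes v: "v \<in> gr N (- int p)" and x: "x \<in> RT" shows "VC p v x \<in> RN"
proof -
  have vg: "scl N c v \<in> gr N (- int p)" for c using v by simp
  have "x \<in> {x. VC p v x \<in> RN}"
    using x
  proof (rule chain_relations_cases)
    show "chain.subspace {x. VC p v x \<in> RN}" by (auto simp: chain.subspace_def VC_simps)
  next
    fix x y j w assume "is_word A w"
    then show "pure (x + y, j) w - pure (x, j) w - pure (y, j) w \<in> {x. VC p v x \<in> RN}"
      using relations(1)[OF vg vg, of A w x y] by (simp add: VC_simps VC_pure N.scale_left_distrib)
  next
    fix r x j w assume "is_word A w"
    then show "pure (scl T r x, j) w - chain_scale r (pure (x, j) w) \<in> {x. VC p v x \<in> RN}"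
      using relations(2)[OF vg, of A w r x] by (simp add: VC_simps VC_pure)
  next
    fix x j u a b i w assume "a \<in> gr A i" "b \<in> gr A i" "is_word A u" "is_word A w"
    then show "pure (x, j) (u @ (a + b, i) # w) - pure (x, j) (u @ (a, i) # w) - pure (x, j) (u @ (b, i) # w) \<in> {x. VC p v x \<in> RN}"
      using relations(3)[OF vg, of a A i b u w x] by (simp add: VC_simps VC_pure)
  next
    fix r x j u a i w assume "a \<in> gr A i" "is_word A u" "is_word A w"
    then show "pure (x, j) (u @ (scl A r a, i) # w) - chain_scale r (pure (x, j) (u @ (a, i) # w)) \<in> {x. VC p v x \<in> RN}"
      using relations(4)[OF vg, of a A i u w x r] by (simp add: VC_simps VC_pure)
  qed
  then show ?thesis by simp
qed

lemma LC_CF: "y \<in> CF p n \<Longrightarrow> LC p l y \<in> T.CB (n + int p)"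
  unfolding chp_def[of "XF p"]
  by (rule linear_span_into[OF LC_linear chp_subspace]) (auto simp: gens_def LC_pure intro!: pure_chp)

lemma VC_CF: "v \<in> gr N (- int p) \<Longrightarrow> y \<in> T.CB n \<Longrightarrow> VC p v y \<in> CF p (n - int p)"
  unfolding chp_def[of _ _ n]
  by (rule linear_span_into[OF VC_linear chp_subspace]) (auto simp: gens_def VC_pure XF_def intro!: pure_chp)

text \<open>Terms with \<open>dif\<close> or an action have coefficients of degree below
  \<open>- int p\<close>, which \<open>LC\<close> discards. The sign is that of the coefficient
  degree, which \<open>LC\<close> resets to \<open>0\<close>.\<close>

lemma LC_chD:
  assumes l: "Vector_Spaces.linear (scl N) (*) l" and y: "y \<in> CF p n"
  shows "LC p l (chD A N y) - sg (int p) (chD A T (LC p l y)) \<in> RT"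
  using y
proof (rule chp_induct)
  note ls = linear_simps[OF l]
  show "chain.subspace {y. LC p l (chD A N y) - sg (int p) (chD A T (LC p l y)) \<in> RT}"
    using rel_closed
    by (auto simp: chain.subspace_def LC_simps add_diff_add chain.scale_of_sg(2)[symmetric] chain.scale_right_diff_distrib[symmetric])
next
  note ls = linear_simps[OF l]
  fix x j w assume x: "XF p x j" and w: "lw b_letter w" and "j + sdeg w = n"
  have ww: "is_word A w" "is_word A (tl w)" "is_word A (butlast w)" using w by (auto intro: b_word lw_tl lw_butlast)
  show "LC p l (chD A N (pure (x, j) w)) - sg (int p) (chD A T (LC p l (pure (x, j) w))) \<in> RT"
  \<comment> \<open>A zero coefficient may have a label above the filtration bound; such generators
    are handled through the relations.\<close>
  proof (cases "x = 0")
    case True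
    have "LC p l (chD A N (pure (0, j) w)) \<in> RT" by (intro LC_rel[OF l] N.chD_rel pure0N ww)
    moreover have "LC p l (pure (0, j) w) \<in> RT" by (intro LC_rel[OF l] pure0N ww)
    ultimately show ?thesis unfolding True by (intro rel_closed T.N.chD_rel)
  next
    case False
    then have j: "j \<le> - int p" using x by (simp add: XF_def)
    have hl: "w \<noteq> [] \<Longrightarrow> snd (hd w) < 0 \<and> snd (last w) < 0 \<and> \<epsilon> (fst (hd w)) = 0 \<and> \<epsilon> (fst (last w)) = 0"
      using lw_hd[OF w] lw_last[OF w] b_letter_aug by (auto simp: b_letter_def)
    have b: "LC p l (bdel A (\<lambda>v. pure (x, j) v) w) = (if j = - int p then bdel A (\<lambda>v. pure (l x, 0) v) w else 0)"
    proof -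
      have "LC p l (bdel A (\<lambda>v. pure (x, j) v) w) = bdel A (\<lambda>v. LC p l (pure (x, j) v)) w"
        by (rule bd_hom) (rule LC_simps)
      moreover have "bdel A (\<lambda>v. 0 :: ('k, 'k, 'a) chain) w = 0"
        using bd_hom[of "\<lambda>_. 0 :: ('k, 'k, 'a) chain" A "\<lambda>_. 0 :: ('k, 'k, 'a) chain" w] by simp
      ultimately show ?thesis by (simp add: LC_pure)
    qed
    have 1: "LC p l (chD A N (pure (x, j) w)) = (if j = - int p then sg (int p) (bdel A (\<lambda>v. pure (l x, 0) v) w) else 0)"
      unfolding chD_pure LC_simps b using j hl by (cases "w = []") (auto simp: LC_pure LC_simps, auto simp: sg_def)
    have 2: "chD A T (pure (l x, 0) w) - bdel A (\<lambda>v. pure (l x, 0) v) w \<in> RT"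
      unfolding chD_pure using hl pure0T ww by (cases "w = []") simp_all
    show ?thesis
    proof (cases "j = - int p")
      case True
      show ?thesis unfolding 1 unfolding LC_pure using True rel_closed(5)[OF rel_closed(4)[OF 2], of "int p"] by simp
    next
      case False
      then show ?thesis by (simp add: 1 LC_pure)
    qed
  qed
qed

lemma spl_rel_diff:
  assumes "chain.subspace W" "\<And>u v. w = u @ v \<Longrightarrow> K u v - K' u v \<in> W"
  shows "spl K w - spl K' w \<in> W"
  unfolding spl_diff[symmetric] unfolding spl_def
  by (intro chain.subspace_sum[OF assms(1)] assms(2)) simp

lemma coch_l:
  assumes l: "l \<in> gr (dual_bimod A N) (int p)" and f: "coch A N i f"
  shows "coch A T (i + int p) (\<lambda>w. l (f w))"
proof (rule cochI)
  fix w assume "is_word A w"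
  then show "l (f w) \<in> gr T (i + int p + sdeg w)"
    using dual_gr_zero[OF l cochD(1)[OF f]] by (auto simp: algebra_simps)
next
  have "Vector_Spaces.linear (scl N) (*) l" using l by (simp add: dual_gr)
  note ls = linear_simps[OF this]
  fix u w a b r k assume "is_word A u" "is_word A w" "a \<in> gr A k"
  then show "l (f (u @ (scl A r a, k) # w)) = scl T r (l (f (u @ (a, k) # w)))"
    and "b \<in> gr A k \<Longrightarrow> l (f (u @ (a + b, k) # w)) = l (f (u @ (a, k) # w)) + l (f (u @ (b, k) # w))"
    by (simp_all add: cochD(2,3)[OF f] ls)
qed

lemma tl_cases:
  assumes "tl_letter a j"
  obtains "a = 0" | "j = 0" "a = scl A (\<epsilon> a) 1" | "j < 0" "\<epsilon> a = 0"
  using assms tl_letter_pos[of a j] tl_letter0[of a] aug_degree[of a j] by (metis linorder_neqE_linordered_idom tl_letter_def less_irrefl)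

text \<open>Only scalar coefficients of \<open>z\<close> reach degree \<open>- int p\<close>: a
  coefficient of negative degree would need a value of \<open>f\<close> in a higher degree, where
  \<open>f\<close> is zero.\<close>

lemma LC_cap:
  assumes l: "l \<in> gr (dual_bimod A N) (int p)" and f: "coch A N i f" "ff p i f"
  shows "LC p l (cap (lact N) i z f) - sg (int p * d) (cap (lact T) (i + int p) z (\<lambda>w. l (f w))) \<in> RT"
  using z_chp
proof (rule chp_induct)
  show "chain.subspace {z. LC p l (cap (lact N) i z f) - sg (int p * d) (cap (lact T) (i + int p) z (\<lambda>w. l (f w))) \<in> RT}"
    using rel_closed
    by (auto simp: chain.subspace_def LC_simps capN.cap_simps capT.cap_simps add_diff_add chain.scale_of_sg(2)[symmetric] chain.scale_right_diff_distrib[symmetric])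
next
  have ll: "Vector_Spaces.linear (scl N) (*) l" using l by (simp add: dual_gr)
  note ls = linear_simps[OF ll]
  fix a j w assume a: "tl_letter a j" and w: "lw b_letter w" and jw: "j + sdeg w = d"
  let ?K = "\<lambda>u v. LC p l (pure (lact N a (f u), j + (i + sdeg u)) v)"
  let ?K' = "\<lambda>u v. pure (lact T a (l (f u)), j + (i + int p + sdeg u)) v"
  have *: "sg (i * sdeg w) (?K u v) - sg (int p * d + (i + int p) * sdeg w) (?K' u v) \<in> RT" if uv: "w = u @ v" for u v
  proof -
    have W: "lw b_letter u" "is_word A u" "is_word A v" using w b_word uv by auto
    have fu: "f u \<in> gr N (i + sdeg u)" by (rule cochD(1)[OF f(1) W(2)])
    show ?thesis
    proof (cases rule: tl_cases[OF a])
      case 1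
      then show ?thesis using pure0T[OF W(3)] by (simp add: LC_pure ls)
    next
      case 2
      have la: "lact N a (f u) = scl N (\<epsilon> a) (f u)" 
        by (subst 2(2)) (simp only: N.act_simps N.lact_one)
      \<comment> \<open>For a scalar coefficient the word has the full degree \<open>d\<close>, so
        the sign caused by shifting the cochain degree by \<open>p\<close> is the same for all
        generators.\<close>
      have e: "even (int p * d + (i + int p) * sdeg w) \<longleftrightarrow> even (i * sdeg w)" using 2(1) jw by auto
      have sge: "sg (int p * d + (i + int p) * sdeg w) y = sg (i * sdeg w) y" for y :: "('k, 'k, 'a) chain"
        using e by (simp add: sg_def)
      show ?thesis
      proof (cases "i + sdeg u = - int p")
        case True
        then have lab: "j + (i + int p + sdeg u) = 0" "j + (i + sdeg u) = - int p" using 2(1) by simp_all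
        show ?thesis unfolding sge lab by (simp add: LC_pure la ls)
      next
        case False
        then have "l (f u) = 0" using dual_gr_zero[OF l fu] by simp
        then show ?thesis using False pure0T[OF W(3)] by (simp add: LC_pure 2(1))
      qed
    next
      case 3
      have "?K u v \<in> RT"
      proof (cases "j + (i + sdeg u) = - int p")
        case True
        then have "f u = 0" using f(2) W(1) 3(1) by (auto simp: ff_def)
        then show ?thesis using pure0T[OF W(3)] by (simp add: LC_pure ls)
      qed (simp add: LC_pure)
      then show ?thesis using 3 pure0T[OF W(3)] by simp
    qed
  qed
  have "LC p l (cap (lact N) i (pure (a, j) w) f) - sg (int p * d) (cap (lact T) (i + int p) (pure (a, j) w) (\<lambda>w. l (f w)))
    = spl (\<lambda>u v. sg (i * sdeg w) (?K u v)) w - spl (\<lambda>u v. sg (int p * d + (i + int p) * sdeg w) (?K' u v)) w"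
    unfolding capN.cap_pure capT.cap_pure spl_sg by (simp add: LC_simps spl_hom[of "LC p l"])
  also have "\<dots> \<in> RT" by (rule spl_rel_diff[OF rel_subspace *])
  finally show "LC p l (cap (lact N) i (pure (a, j) w) f) - sg (int p * d) (cap (lact T) (i + int p) (pure (a, j) w) (\<lambda>w. l (f w))) \<in> RT" .
qed

text \<open>The terms with \<open>dif\<close> or an action do not disappear here, but have
  coefficients of degree below \<open>- int p\<close> and land in the next filtration step. Zero
  coefficients belong to every step, so the statement holds without relations.\<close>

lemma VC_chD:
  assumes v: "v \<in> gr N (- int p)" and y: "y \<in> T.CB n"
  shows "chD A N (VC p v y) - sg (int p) (VC p v (chD A T y)) \<in> CF (Suc p) (n - int p - 1)"
  using y
proof (rule chp_induct)
  show "chain.subspace {y. chD A N (VC p v y) - sg (int p) (VC p v (chD A T y)) \<in> CF (Suc p) (n - int p - 1)}"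
    using chp_closed
    by (auto simp: chain.subspace_def VC_simps add_diff_add chain.scale_of_sg(2)[symmetric] chain.scale_right_diff_distrib[symmetric])
next
  fix c j w assume c: "c \<in> gr T j" and w: "lw b_letter w" and jw: "j + sdeg w = n"
  let ?v = "scl N c v"
  have vg: "?v \<in> gr N (- int p)" using v by simp
  have hl: "w \<noteq> [] \<Longrightarrow> fst (hd w) \<in> gr A (snd (hd w)) \<and> fst (last w) \<in> gr A (snd (last w)) \<and> snd (hd w) < 0 \<and> snd (last w) < 0 \<and> \<epsilon> (fst (hd w)) = 0 \<and> \<epsilon> (fst (last w)) = 0"
    using lw_hd[OF w] lw_last[OF w] b_letter_aug by (auto simp: b_letter_def)
  have b: "VC p v (bdel A (\<lambda>u. pure (c, j) u) w) = (if j = 0 then bdel A (\<lambda>u. pure (?v, - int p) u) w else 0)"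
  proof -
    have "VC p v (bdel A (\<lambda>u. pure (c, j) u) w) = bdel A (\<lambda>u. VC p v (pure (c, j) u)) w"
      by (rule bd_hom) (rule VC_simps)
    moreover have "bdel A (\<lambda>v. 0 :: ('k, 'm, 'a) chain) w = 0"
      using bd_hom[of "\<lambda>_. 0 :: ('k, 'm, 'a) chain" A "\<lambda>_. 0 :: ('k, 'm, 'a) chain" w] by simp
    ultimately show ?thesis by (simp add: VC_pure)
  qed
  have z0: "pure (0, m) u \<in> CF (Suc p) k" if "lw b_letter u" "m + sdeg u = k" for m u k
    using that by (intro pure_chp) (auto simp: XF_def)
  show "chD A N (VC p v (pure (c, j) w)) - sg (int p) (VC p v (chD A T (pure (c, j) w))) \<in> CF (Suc p) (n - int p - 1)"
  proof (cases "j = 0")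
    case True
    have 1: "VC p v (chD A T (pure (c, j) w)) = bdel A (\<lambda>u. pure (?v, - int p) u) w"
      unfolding chD_pure VC_simps b using hl by (cases "w = []") (simp_all add: VC_pure VC_simps True)
    have 2: "pure (dif N ?v, - int p - 1) w \<in> CF (Suc p) (n - int p - 1)"
      using N.dif_degree[OF vg] w jw True by (intro pure_chp) (auto simp: XF_def)
    have 3: "pure (ract N ?v (fst (hd w)), - int p + snd (hd w)) (tl w) \<in> CF (Suc p) (n - int p - 1)" if "w \<noteq> []"
    proof (rule pure_chp[OF _ lw_tl[OF w]])
      show "XF (Suc p) (ract N ?v (fst (hd w))) (- int p + snd (hd w))"
        unfolding XF_def using N.ract_degree[OF vg, of "fst (hd w)" "snd (hd w)"] hl[OF that] by auto
      show "- int p + snd (hd w) + sdeg (tl w) = n - int p - 1" using that jw True by (cases w) auto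
    qed
    have 4: "pure (lact N (fst (last w)) ?v, snd (last w) + - int p) (butlast w) \<in> CF (Suc p) (n - int p - 1)" if "w \<noteq> []"
    proof (rule pure_chp[OF _ lw_butlast[OF w]])
      show "XF (Suc p) (lact N (fst (last w)) ?v) (snd (last w) + - int p)"
        unfolding XF_def using N.lact_degree[of "fst (last w)" "snd (last w)", OF _ vg] hl[OF that] by auto
      show "snd (last w) + - int p + sdeg (butlast w) = n - int p - 1" using that jw True by (cases w rule: rev_cases) auto
    qed
    have VCp: "VC p v (pure (c, j) w) = pure (?v, - int p) w" by (simp add: VC_pure True)
    have spp: "sg (- int p) y = sg (int p) y" for y :: "('k, 'm, 'a) chain" by (simp add: sg_def)
    have 5: "(if w = [] then 0 else sg (int p) (pure (ract N ?v (fst (hd w)), - int p + snd (hd w)) (tl w))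
         - sg ((snd (last w) + 1) * (- int p + sdeg (butlast w))) (pure (lact N (fst (last w)) ?v, snd (last w) + - int p) (butlast w)))
       \<in> CF (Suc p) (n - int p - 1)"
      using 3 4 by (cases "w = []") (auto intro!: chp_closed(3) chp_closed(6))
    have "chD A N (pure (?v, - int p) w) - sg (int p) (bdel A (\<lambda>u. pure (?v, - int p) u) w) =
      pure (dif N ?v, - int p - 1) w + (if w = [] then 0 else sg (int p) (pure (ract N ?v (fst (hd w)), - int p + snd (hd w)) (tl w))
         - sg ((snd (last w) + 1) * (- int p + sdeg (butlast w))) (pure (lact N (fst (last w)) ?v, snd (last w) + - int p) (butlast w)))"
      unfolding chD_pure spp by simp
    then show ?thesis unfolding 1 VCp using chp_closed(2)[OF 2 5] by (simp only:)
  next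
    case False
    then have c0: "c = 0" using c by simp
    have 1: "VC p v (pure (0, m) u) \<in> CF (Suc p) (m + sdeg u - int p)" if "lw b_letter u" for m u
      using that by (auto simp: VC_pure intro!: z0)
    have e: "j - 1 + sdeg w - int p = n - int p - 1" using jw by simp
    have "w \<noteq> [] \<Longrightarrow> j + snd (hd w) + sdeg (tl w) - int p = n - int p - 1"
      using jw by (cases w) auto
    moreover have "w \<noteq> [] \<Longrightarrow> snd (last w) + j + sdeg (butlast w) - int p = n - int p - 1"
      using jw by (cases w rule: rev_cases) auto
    ultimately have e2: "w \<noteq> [] \<Longrightarrow> j + snd (hd w) + sdeg (tl w) - int p = n - int p - 1"
      "w \<noteq> [] \<Longrightarrow> snd (last w) + j + sdeg (butlast w) - int p = n - int p - 1" by blast+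
    have m1: "VC p v (pure (0, j + snd (hd w)) (tl w)) \<in> CF (Suc p) (n - int p - 1)" if "w \<noteq> []"
      using 1[OF lw_tl[OF w], of "j + snd (hd w)"] unfolding e2(1)[OF that] .
    have m2: "VC p v (pure (0, snd (last w) + j) (butlast w)) \<in> CF (Suc p) (n - int p - 1)" if "w \<noteq> []"
      using 1[OF lw_butlast[OF w], of "snd (last w) + j"] unfolding e2(2)[OF that] .
    have m0: "VC p v (pure (0, j - 1) w) \<in> CF (Suc p) (n - int p - 1)"
      using 1[OF w, of "j - 1"] unfolding e .
    have "VC p v (chD A T (pure (c, j) w)) = VC p v (pure (0, j - 1) w)
        + (if w = [] then 0 else sg j (VC p v (pure (0, j + snd (hd w)) (tl w)))
         - sg ((snd (last w) + 1) * (j + sdeg (butlast w))) (VC p v (pure (0, snd (last w) + j) (butlast w))))"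
      unfolding chD_pure VC_simps b using False by (cases "w = []") (simp_all add: VC_simps c0)
    also have "\<dots> \<in> CF (Suc p) (n - int p - 1)"
      using m1 m2 by (intro chp_closed(2) m0) (auto intro!: chp_closed(3) chp_closed(6))
    finally have "VC p v (chD A T (pure (c, j) w)) \<in> CF (Suc p) (n - int p - 1)" .
    then show ?thesis by (simp add: VC_pure False)
  qed
qed

lemma coch_v:
  assumes v: "v \<in> gr N (- int p)" and g: "coch A T (i + int p) g"
  shows "coch A N i (\<lambda>w. scl N (g w) v)"
proof (rule cochI)
  fix w assume w: "is_word A w"
  have "i + sdeg w = - int p \<or> g w = 0" using cochD(1)[OF g w] by (auto split: if_splits)
  then show "scl N (g w) v \<in> gr N (i + sdeg w)" using v by auto
qed (simp_all add: cochD(2,3)[OF g] N.scale_left_distrib)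

text \<open>As in \<open>LC_cap\<close> only scalar coefficients of \<open>z\<close> contribute to
  the leading part; coefficients of negative degree contribute to the next filtration step.\<close>

lemma VC_cap:
  assumes v: "v \<in> gr N (- int p)" and g: "coch A T (i + int p) g"
  shows "VC p v (cap (lact T) (i + int p) z g) - sg (int p * d) (cap (lact N) i z (\<lambda>w. scl N (g w) v)) \<in> CF (Suc p) (d + i)"
  using z_chp
proof (rule chp_induct)
  show "chain.subspace {z. VC p v (cap (lact T) (i + int p) z g) - sg (int p * d) (cap (lact N) i z (\<lambda>w. scl N (g w) v)) \<in> CF (Suc p) (d + i)}"
    using chp_closed
    by (auto simp: chain.subspace_def VC_simps capN.cap_simps capT.cap_simps add_diff_add chain.scale_of_sg(2)[symmetric] chain.scale_right_diff_distrib[symmetric])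
next
  fix a j w assume a: "tl_letter a j" and w: "lw b_letter w" and jw: "j + sdeg w = d"
  let ?K = "\<lambda>u u'. VC p v (pure (lact T a (g u), j + (i + int p + sdeg u)) u')"
  let ?K' = "\<lambda>u u'. pure (lact N a (scl N (g u) v), j + (i + sdeg u)) u'"
  have *: "sg ((i + int p) * sdeg w) (?K u u') - sg (int p * d + i * sdeg w) (?K' u u') \<in> CF (Suc p) (d + i)" if uv: "w = u @ u'" for u u'
  proof -
    have W: "lw b_letter u" "is_word A u" "lw b_letter u'" using w b_word uv by auto
    have deg: "j + (i + sdeg u) + sdeg u' = d + i" using jw by (simp add: uv)
    have z0: "pure (0, m) u' \<in> CF (Suc p) (d + i)" if "m + sdeg u' = d + i" for m
      using that W by (intro pure_chp) (auto simp: XF_def)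
    have gu: "i + sdeg u = - int p \<or> g u = 0" using cochD(1)[OF g W(2)] by (auto split: if_splits)
    have K0: "?K u u' \<in> CF (Suc p) (d + i)" if "lact T a (g u) = 0"
      unfolding that VC_pure using deg z0[of "- int p"] by auto
    show ?thesis
    proof (cases rule: tl_cases[OF a])
      case 1
      show ?thesis by (intro chp_closed(3) chp_closed(6) K0) (use 1 z0[OF deg] in simp_all)
    next
      case 2
      have la: "lact N a (scl N (g u) v) = scl N (\<epsilon> a * g u) v" 
        by (subst 2(2)) (simp only: N.act_simps N.lact_one N.scale_scale mult.commute)
      have e: "even (int p * d + i * sdeg w) \<longleftrightarrow> even ((i + int p) * sdeg w)" using 2(1) jw by auto
      have sge: "sg (int p * d + i * sdeg w) y = sg ((i + int p) * sdeg w) y" for y :: "('k, 'm, 'a) chain"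
        using e by (simp add: sg_def)
      from gu show ?thesis
      proof
        assume t: "i + sdeg u = - int p"
        then have lab: "j + (i + int p + sdeg u) = 0" "j + (i + sdeg u) = - int p" using 2(1) by simp_all
        show ?thesis unfolding sge la lab by (simp add: VC_pure mult.commute)
      next
        assume gu0: "g u = 0"
        show ?thesis by (intro chp_closed(3) chp_closed(6) K0) (use gu0 z0[OF deg] in simp_all)
      qed
    next
      case 3
      have "?K' u u' \<in> CF (Suc p) (d + i)"
      proof (cases "g u = 0")
        case True
        then show ?thesis using z0[OF deg] by simp
      next
        case False
        then have e: "i + sdeg u = - int p" using gu by simp
        have "lact N a (scl N (g u) v) \<in> gr N (j + - int p)"
          using a v by (intro N.lact_degree) (auto simp: tl_letter_def)
        then show ?thesis using e 3 W deg by (intro pure_chp) (auto simp: XF_def)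
      qed
      moreover have "?K u u' \<in> CF (Suc p) (d + i)" by (rule K0) (simp add: 3)
      ultimately show ?thesis by (intro chp_closed(3) chp_closed(6))
    qed
  qed
  have "VC p v (cap (lact T) (i + int p) (pure (a, j) w) g) - sg (int p * d) (cap (lact N) i (pure (a, j) w) (\<lambda>w. scl N (g w) v))
    = spl (\<lambda>u u'. sg ((i + int p) * sdeg w) (?K u u')) w - spl (\<lambda>u u'. sg (int p * d + i * sdeg w) (?K' u u')) w"
    unfolding capN.cap_pure capT.cap_pure spl_sg by (simp add: VC_simps spl_hom[of "VC p v"])
  also have "\<dots> \<in> CF (Suc p) (d + i)" by (rule spl_rel_diff[OF chp_subspace *])
  finally show "VC p v (cap (lact T) (i + int p) (pure (a, j) w) g) - sg (int p * d) (cap (lact N) i (pure (a, j) w) (\<lambda>w. scl N (g w) v)) \<in> CF (Suc p) (d + i)" .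
qed

end

section \<open>Eliminating one degree of the coefficients at a time\<close>

context dg_duality begin

lemma chD_T_pure:
  assumes w: "lw b_letter w"
  shows "chD A T (pure (c, 0) w) - bdel A (\<lambda>v. pure (c, 0) v) w \<in> RT"
proof -
  have "w \<noteq> [] \<Longrightarrow> \<epsilon> (fst (hd w)) = 0 \<and> \<epsilon> (fst (last w)) = 0"
    using lw_hd[OF w] lw_last[OF w] b_letter_aug by blast
  then show ?thesis
    unfolding chD_pure using pure0T b_word[OF w] b_word[OF lw_tl[OF w]] b_word[OF lw_butlast[OF w]]
    by (cases "w = []") simp_all
qed

lemma functional_detect:
  assumes x: "x \<in> gr N (- int p)" and l: "\<And>l. l \<in> gr (dual_bimod A N) (int p) \<Longrightarrow> l x = 0"
  shows "x = 0"
proof (rule ccontr)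
  assume "x \<noteq> 0"
  then have "x \<notin> N.span {}" by simp
  then obtain \<phi> where \<phi>: "Vector_Spaces.linear (scl N) (*) \<phi>" "\<phi> x = 1"
    using N.separating_functional by blast
  note s = linear_simps[OF \<phi>(1)]
  have "(\<lambda>y. \<phi> (cmp N y (- int p))) \<in> gr (dual_bimod A N) (int p)"
    unfolding dual_gr
    by (auto intro!: N.linear_functionalI simp: N.cmp_add N.cmp_scl N.cmp_gr s)
  from l[OF this] show False using \<phi>(2) x by (simp add: N.cmp_gr)
qed

text \<open>Evaluates a cochain with values in \<open>N\<close> on chains over the ground field;
  \<open>ehat\<close> is the scalar case.\<close>

definition fhat :: "('a word \<Rightarrow> 'm) \<Rightarrow> ('k, 'k, 'a) chain \<Rightarrow> 'm" where
  "fhat f = lin_ext (scl N) (\<lambda>((c, j), w). if j = 0 then scl N c (f w) else 0)"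

definition ehat :: "('a word \<Rightarrow> 'k) \<Rightarrow> ('k, 'k, 'a) chain \<Rightarrow> 'k" where
  "ehat h = lin_ext (*) (\<lambda>((c, j), w). if j = 0 then c * h w else 0)"

lemma fhat_linear: "Vector_Spaces.linear chain_scale (scl N) (fhat f)"
  unfolding fhat_def by (rule N.lin_ext_linear)

lemma ehat_linear: "Vector_Spaces.linear chain_scale (*) (ehat h)"
  unfolding ehat_def by (rule fld.lin_ext_linear)

lemma fhat_pure: "fhat f (pure (c, j) w) = (if j = 0 then scl N c (f w) else 0)"
  by (simp add: fhat_def)

lemma ehat_pure: "ehat h (pure (c, j) w) = (if j = 0 then c * h w else 0)"
  by (simp add: ehat_def)

lemmas fhat_simps = linear_simps[OF fhat_linear] and ehat_simps = linear_simps[OF ehat_linear]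

lemma ehat_rfun:
  assumes h: "coch A T i h" shows "rfun A T (ehat h)"
proof (rule rfunI[OF ehat_linear])
  fix x y :: 'k and j w
  show "ehat h (pure (x + y, j) w) = ehat h (pure (x, j) w) + ehat h (pure (y, j) w)"
    by (simp add: ehat_pure distrib_right)
next
  fix r x j w
  show "ehat h (pure (scl T r x, j) w) = r * ehat h (pure (x, j) w)"
    by (simp add: ehat_pure)
next
  fix x :: 'k and j u a b k w assume "a \<in> gr A k" "b \<in> gr A k" "is_word A u" "is_word A w"
  then show "ehat h (pure (x, j) (u @ (a + b, k) # w)) = ehat h (pure (x, j) (u @ (a, k) # w)) + ehat h (pure (x, j) (u @ (b, k) # w))"
    using cochD(2)[OF h, of u w a k b] by (simp only: ehat_pure distrib_left) simp
next
  fix r x :: 'k and j u a k w assume "a \<in> gr A k" "is_word A u" "is_word A w"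
  then show "ehat h (pure (x, j) (u @ (scl A r a, k) # w)) = r * ehat h (pure (x, j) (u @ (a, k) # w))"
    using cochD(3)[OF h, of u w a k r] by (simp add: ehat_pure)
qed

lemma ehat_cD:
  assumes g: "coch A T i g" and u: "u \<in> T.CB n"
  shows "ehat (cD A T i g) u = - sg i (ehat g (chD A T u))"
  using u
proof (rule chp_induct)
  show "chain.subspace {u. ehat (cD A T i g) u = - sg i (ehat g (chD A T u))}"
    by (auto simp: chain.subspace_def ehat_simps fld.scale_of_sg)
next
  fix c j w assume c: "c \<in> gr T j" and w: "lw b_letter w"
  show "ehat (cD A T i g) (pure (c, j) w) = - sg i (ehat g (chD A T (pure (c, j) w)))"
  proof (cases "j = 0")
    case True
    have "ehat g (chD A T (pure (c, 0) w) - bdel A (\<lambda>v. pure (c, 0) v) w) = 0"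
      using rfunD(2)[OF ehat_rfun[OF g] chD_T_pure[OF w]] .
    then have "ehat g (chD A T (pure (c, 0) w)) = ehat g (bdel A (\<lambda>v. pure (c, 0) v) w)"
      by (simp add: ehat_simps)
    also have "\<dots> = bdel A (\<lambda>v. ehat g (pure (c, 0) v)) w"
      by (rule bd_hom) (rule ehat_simps)
    also have "\<dots> = c * bdel A g w"
      using bd_hom[of "(*) c" A g w, OF distrib_left] by (simp add: ehat_pure)
    finally show ?thesis using True by (simp add: ehat_pure cD_T[OF w] sg_mult)
  next
    case False
    then have "c = 0" using c by simp
    moreover have "ehat g (chD A T (pure (0, j) w)) = 0"
      by (rule rfunD(2)[OF ehat_rfun[OF g]]) (intro T.N.chD_rel pure0T b_word[OF w])
    ultimately show ?thesis by (simp add: ehat_pure)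
  qed
qed

text \<open>A functional of degree \<open>p\<close> carries a cocycle of the cone in filtration
  \<open>p\<close> to a cocycle of the cone over the ground field. The sign combines those of
  \<open>LC_chD\<close> and \<open>LC_cap\<close>.\<close>

lemma LC_cone:
  assumes l: "l \<in> gr (dual_bimod A N) (int p)" and f: "coch A N i f" "ff p i f"
    and y: "y \<in> CF p (d + i + 1)" "chD A N y - cap (lact N) i z f \<in> RN"
  shows "chD A T (sg (int p + int p * d) (LC p l y)) - cap (lact T) (i + int p) z (\<lambda>w. l (f w)) \<in> RT"
    and "sg (int p + int p * d) (LC p l y) \<in> T.CB (d + (i + int p) + 1)"
proof -
  have ll: "Vector_Spaces.linear (scl N) (*) l" using l by (simp add: dual_gr)
  let ?c = "cap (lact N) i z f" and ?c' = "cap (lact T) (i + int p) z (\<lambda>w. l (f w))"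
  have a1: "LC p l (chD A N y) - sg (int p) (chD A T (LC p l y)) \<in> RT" by (rule LC_chD[OF ll y(1)])
  have a2: "LC p l (chD A N y) - LC p l ?c \<in> RT" using LC_rel[OF ll y(2)] by (simp add: LC_simps)
  have a3: "LC p l ?c - sg (int p * d) ?c' \<in> RT" by (rule LC_cap[OF l f])
  have "sg (int p * d) ((LC p l (chD A N y) - LC p l ?c) - (LC p l (chD A N y) - sg (int p) (chD A T (LC p l y)))
      + (LC p l ?c - sg (int p * d) ?c')) \<in> RT"
    by (intro a1 a2 a3 rel_closed(2) rel_closed(3)[of "LC p l (chD A N y) - LC p l ?c"] rel_closed(5))
  moreover have "sg (int p * d) ((LC p l (chD A N y) - LC p l ?c) - (LC p l (chD A N y) - sg (int p) (chD A T (LC p l y)))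
      + (LC p l ?c - sg (int p * d) ?c')) = chD A T (sg (int p + int p * d) (LC p l y)) - ?c'"
    by (cases "even (int p)"; cases "even (int p * d)") (simp_all add: sg_def)
  ultimately show "chD A T (sg (int p + int p * d) (LC p l y)) - ?c' \<in> RT" by (simp only:)
  have "d + i + 1 + int p = d + (i + int p) + 1" by simp
  then show "sg (int p + int p * d) (LC p l y) \<in> T.CB (d + (i + int p) + 1)"
    using LC_CF[OF y(1)] by (simp only: chp_closed(6))
qed

lemma cD_l:
  assumes l: "l \<in> gr (dual_bimod A N) (int p)" and f: "coch A N i f" "ff p i f"
    and w: "lw b_letter w" and Df: "cD A N i f w = 0"
  shows "cD A T (i + int p) (\<lambda>w. l (f w)) w = 0"
proof (cases "i + int p - 1 + sdeg w = 0")
  case True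
  have ll: "Vector_Spaces.linear (scl N) (*) l" using l by (simp add: dual_gr)
  have "cD A N i f w = - sg i (bdel A f w)"
    by (rule cD_lead_degree[OF w]) (use f(2) True in \<open>auto simp: ff_def\<close>)
  then have "bdel A f w = 0" using Df by simp
  moreover have "l (bdel A f w) = bdel A (\<lambda>w. l (f w)) w" by (rule bd_hom) (rule linear_simps[OF ll])
  ultimately show ?thesis using linear_simps(1)[OF ll] by (simp add: cD_T[OF w])
next
  case False
  then show ?thesis using cochD(1)[OF T.N.weak.coch_cD[OF coch_l[OF l f(1)]] b_word[OF w]] by (simp split: if_splits)
qed

context
  assumes exact_T: "cone_exact A b_letter T z d"
begin

text \<open>For each functional \<open>l\<close>, exactness over the ground field makes
  \<open>l \<circ> f\<close> a coboundary on negative letters, hence zero on cycles. As functionals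
  detect elements of degree \<open>- int p\<close>, \<open>f\<close> itself vanishes on cycles and
  factors through the differential; the factor is the required primitive in the leading
  degree.\<close>

lemma lead_cochain:
  assumes f: "coch A N i f" "\<And>w. lw b_letter w \<Longrightarrow> cD A N i f w = 0" "ff p i f"
    and y: "y \<in> CF p (d + i + 1)" "chD A N y - cap (lact N) i z f \<in> RN"
  obtains g where "coch A N (i + 1) g" "\<And>w. g w \<noteq> 0 \<Longrightarrow> sdeg w = - (i + 1) - int p"
    "ff (Suc p) i (\<lambda>w. f w - cD A N (i + 1) g w)"
proof -
  let ?n = "- (i + int p)"
  have fh: "fhat f u \<in> gr N (- int p)" if "u \<in> T.CB ?n" for u
  proof (rule linear_span_into[OF fhat_linear N.gr_subspace _ that[unfolded chp_def]])
    fix x :: "('k, 'k, 'a) chain" assume "x \<in> gens (\<lambda>x j. x \<in> gr T j) b_letter ?n"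
    then obtain c j w where h: "lw b_letter w" "j + sdeg w = ?n" "x = pure (c, j) w" by (auto simp: gens_def)
    have "i + sdeg w = - int p" if "j = 0" using h that by simp
    then show "fhat f x \<in> gr N (- int p)"
      using cochD(1)[OF f(1) b_word[OF h(1)]] by (auto simp: h(3) fhat_pure)
  qed
  have ker: "fhat f u = 0" if u: "u \<in> T.CB ?n" "chD A T u \<in> RT" for u
  proof (rule functional_detect[OF fh[OF u(1)]])
    fix l assume l: "l \<in> gr (dual_bimod A N) (int p)"
    then have ll: "Vector_Spaces.linear (scl N) (*) l" by (simp add: dual_gr)
    obtain g where g: "coch A T (i + int p + 1) g" "\<And>w. lw b_letter w \<Longrightarrow> cD A T (i + int p + 1) g w = l (f w)"
      using cone_exactD[OF exact_T coch_l[OF l f(1)] cD_l[OF l f(1,3) _ f(2)] LC_cone(2)[OF l f(1,3) y] LC_cone(1)[OF l f(1,3) y]] by blast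
    have "l (fhat f u) = ehat (cD A T (i + int p + 1) g) u"
      using u(1)
    proof (rule chp_induct)
      show "chain.subspace {u. l (fhat f u) = ehat (cD A T (i + int p + 1) g) u}"
        by (auto simp: chain.subspace_def ehat_simps fhat_simps linear_simps[OF ll])
    qed (simp add: fhat_pure ehat_pure g(2) linear_simps[OF ll])
    also have "\<dots> = - sg (i + int p + 1) (ehat g (chD A T u))" by (rule ehat_cD[OF g(1) u(1)])
    also have "\<dots> = 0" using rfunD(2)[OF ehat_rfun[OF g(1)] u(2)] by simp
    finally show "l (fhat f u) = 0" .
  qed
  obtain G where G: "Vector_Spaces.linear chain_scale (scl N) G" "\<And>x. x \<in> RT \<Longrightarrow> G x = 0"
    "\<And>u. u \<in> T.CB ?n \<Longrightarrow> G (chD A T u) = fhat f u"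
    using linear_factor[where U = "T.CB ?n" and R = RT, OF chD_linear fhat_linear chp_subspace rel_subspace ker] by blast
  note Gs = linear_simps[OF G(1)]
  \<comment> \<open>\<open>G\<close> is prescribed only on relations and boundaries, so the
    component of degree \<open>- int p\<close> is taken to have values in the right degree
    everywhere. The sign \<open>sg i\<close> cancels the one that \<open>cD_lead_degree\<close>
    gives in degree \<open>i + 1\<close>.\<close>
  let ?h = "\<lambda>v. sg i (cmp N (G (pure (1, 0) v)) (- int p))"
  define g where "g w = (if is_word A w \<and> sdeg w = - (i + 1) - int p then ?h w else 0)" for w
  have Gadd: "G (pure (1, 0) (u @ (a + b, l) # w)) = G (pure (1, 0) (u @ (a, l) # w)) + G (pure (1, 0) (u @ (b, l) # w))"
    if "is_word A u" "is_word A w" "a \<in> gr A l" "b \<in> gr A l" for u w a b l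
    using G(2)[OF relations(3)[of 1 T 0 a A l b u w]] that by (simp add: Gs algebra_simps)
  have Gscl: "G (pure (1, 0) (u @ (scl A r a, l) # w)) = scl N r (G (pure (1, 0) (u @ (a, l) # w)))"
    if "is_word A u" "is_word A w" "a \<in> gr A l" for u w a r l
    using G(2)[OF relations(4)[of 1 T 0 a A l u w r]] that by (simp add: Gs)
  have g: "coch A N (i + 1) g"
  proof (rule cochI)
    fix w :: "'a word"
    have "sdeg w = - (i + 1) - int p \<Longrightarrow> i + 1 + sdeg w = - int p" by simp
    then show "g w \<in> gr N (i + 1 + sdeg w)" by (auto simp: g_def N.cmp(2))
  qed (simp_all add: g_def Gadd Gscl N.cmp_add N.cmp_scl N.scale_of_sg)
  have conc: "sdeg w = - (i + 1) - int p" if "g w \<noteq> 0" for w using that by (auto simp: g_def split: if_splits)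
  have ffg: "ff p (i + 1) g" using conc by (fastforce simp: ff_def)
  have "ff (Suc p) i (\<lambda>w. f w - cD A N (i + 1) g w)"
    unfolding ff_def
  proof (intro allI impI)
    fix w assume w: "lw b_letter w" "- int (Suc p) < i + sdeg w"
    show "f w - cD A N (i + 1) g w = 0"
    proof (cases "i + sdeg w = - int p")
      case False
      then have "i + sdeg w > - int p" using w(2) by simp
      then show ?thesis using f(3) ff_cD[OF ffg] w(1) by (simp add: ff_def)
    next
      case True
      have "cD A N (i + 1) g w = - sg (i + 1) (bdel A g w)"
      proof (rule cD_lead_degree[OF w(1)])
        fix v :: "'a word" assume "sdeg w \<le> sdeg v" then show "g v = 0" using conc[of v] True by fastforce
      qed
      also have "bdel A g w = bdel A ?h w"
        by (rule bd_congL[OF N.weak.letter_class_gr b_word[OF w(1), unfolded is_word_lw]])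
          (use True in \<open>simp add: g_def is_word_lw\<close>)
      also have "\<dots> = sg i (cmp N (G (bdel A (\<lambda>v. pure (1, 0) v) w)) (- int p))"
        by (rule bd_hom[symmetric]) (simp add: Gs N.cmp_add)
      also have "G (bdel A (\<lambda>v. pure (1, 0) v) w) = G (chD A T (pure (1, 0) w))"
        using G(2)[OF chD_T_pure[OF w(1), of 1]] by (simp add: Gs)
      also have "\<dots> = fhat f (pure (1, 0) w)"
        by (rule G(3)) (use w(1) True in \<open>auto intro!: pure_chp\<close>)
      also have "\<dots> = f w" by (simp add: fhat_pure)
      also have "cmp N (f w) (- int p) = f w"
        using cochD(1)[OF f(1) b_word[OF w(1)]] True by (simp add: N.cmp_gr)
      finally show ?thesis by (simp add: sg_def)
    qed
  qed
  then show ?thesis using that g conc by blast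
qed

text \<open>The image of the filtration in the quotient by the relations, pulled back to the free
  space.\<close>

definition WW :: "nat \<Rightarrow> int \<Rightarrow> ('k, 'm, 'a) chain set" where
  "WW p n = {x. \<exists>c\<in>CF p n. x - c \<in> RN}"

lemma WW_subspace: "chain.subspace (WW p n)"
  unfolding chain.subspace_def
proof (intro conjI ballI allI)
  show "0 \<in> WW p n" unfolding WW_def by (auto intro!: bexI[of _ 0])
next
  fix x y assume "x \<in> WW p n" "y \<in> WW p n"
  then obtain c c' where "c \<in> CF p n" "c' \<in> CF p n" "x - c \<in> RN" "y - c' \<in> RN" by (auto simp: WW_def)
  then have "c + c' \<in> CF p n" "x + y - (c + c') \<in> RN" using rel_closed(2)[of "x - c" A N "y - c'"] by (auto simp: add_diff_add)
  then show "x + y \<in> WW p n" by (auto simp: WW_def)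
next
  fix r x assume "x \<in> WW p n"
  then obtain c where "c \<in> CF p n" "x - c \<in> RN" by (auto simp: WW_def)
  then have "chain_scale r c \<in> CF p n" "chain_scale r x - chain_scale r c \<in> RN"
    using rel_closed(6)[of "x - c" A N r] by (auto simp: chain.scale_right_diff_distrib)
  then show "chain_scale r x \<in> WW p n" by (auto simp: WW_def)
qed

lemma WW_RN: "x \<in> RN \<Longrightarrow> x \<in> WW p n" and WW_CF: "x \<in> CF p n \<Longrightarrow> x \<in> WW p n"
proof -
  show "x \<in> RN \<Longrightarrow> x \<in> WW p n" unfolding WW_def by (auto intro!: bexI[of _ 0])
  show "x \<in> CF p n \<Longrightarrow> x \<in> WW p n" unfolding WW_def by (auto intro!: bexI[of _ x])
qed

lemmas WW_closed = chain.subspace_add[OF WW_subspace] chain.subspace_diff[OF WW_subspace] chain.subspace_sg[OF WW_subspace]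
  chain.subspace_neg[OF WW_subspace] chain.subspace_sum[OF WW_subspace] chain.subspace_scale[OF WW_subspace]

lemma pure_sum:
  assumes "finite S" "\<And>v. v \<in> S \<Longrightarrow> h v \<in> gr N j" "is_word A w"
  shows "pure (\<Sum>v\<in>S. h v, j) w - (\<Sum>v\<in>S. pure (h v, j) w) \<in> RN"
  using assms(1,2)
proof (induction S rule: finite_induct)
  case empty
  then show ?case using pure0N[OF assms(3)] by simp
next
  case (insert x S)
  have "(\<Sum>v\<in>S. h v) \<in> gr N j" using insert by (intro N.subspace_sum N.gr_subspace) auto
  then have "pure (h x + (\<Sum>v\<in>S. h v), j) w - pure (h x, j) w - pure (\<Sum>v\<in>S. h v, j) w \<in> RN"
    using insert assms(3) by (intro relations(1)) auto
  from rel_closed(2)[OF this insert.IH] insert show ?case by (simp add: algebra_simps)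
qed

text \<open>A basis of the degree \<open>- int p\<close> part of \<open>N\<close>, possibly
  infinite, with its coordinate functionals. Every finite set of basis vectors containing
  \<open>R\<close> serves for \<open>x\<close>, so that finitely many coefficients can share one
  set.\<close>

lemma coordinates:
  obtains Bs and lc :: "'m \<Rightarrow> 'm \<Rightarrow> 'k" where "Bs \<subseteq> gr N (- int p)"
    "\<And>v. lc v \<in> gr (dual_bimod A N) (int p)"
    "\<And>x. x \<in> gr N (- int p) \<Longrightarrow> \<exists>R. finite R \<and> R \<subseteq> Bs \<and> (\<forall>S. finite S \<longrightarrow> R \<subseteq> S \<longrightarrow> (\<Sum>v\<in>S. scl N (lc v x) v) = x)"
proof -
  obtain Bs where Bs: "Bs \<subseteq> gr N (- int p)" "N.independent Bs" "gr N (- int p) \<subseteq> N.span Bs"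
    using N.maximal_independent_subset by blast
  define lc where "lc v x = N.representation Bs (cmp N x (- int p)) v" for v x
  have sp: "cmp N x (- int p) \<in> N.span Bs" for x using Bs(3) N.cmp(2) by blast
  have r0: "N.representation Bs 0 v = 0" for v by (simp add: N.representation_zero)
  show ?thesis
  proof (rule that[OF Bs(1), of lc])
    show "lc v \<in> gr (dual_bimod A N) (int p)" for v
      unfolding dual_gr
      by (auto intro!: N.linear_functionalI simp: lc_def N.cmp_add N.cmp_scl N.representation_add[OF Bs(2) sp sp]
        N.representation_scale[OF Bs(2) sp] N.cmp_gr r0)
    fix x assume x: "x \<in> gr N (- int p)"
    have lcx: "lc v x = N.representation Bs x v" for v using x by (simp add: lc_def N.cmp_gr)
    have xs: "x \<in> N.span Bs" using x Bs(3) by blast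
    let ?R = "{v. N.representation Bs x v \<noteq> 0}"
    show "\<exists>R. finite R \<and> R \<subseteq> Bs \<and> (\<forall>S. finite S \<longrightarrow> R \<subseteq> S \<longrightarrow> (\<Sum>v\<in>S. scl N (lc v x) v) = x)"
    proof (intro exI[of _ ?R] conjI allI impI)
      show "finite ?R" by (rule N.finite_representation)
      show "?R \<subseteq> Bs" using N.representation_ne_zero by blast
      fix S assume S: "finite S" "?R \<subseteq> S"
      have "(\<Sum>v\<in>S. scl N (lc v x) v) = (\<Sum>v\<in>?R. scl N (lc v x) v)"
        by (rule sum.mono_neutral_right) (use S lcx in auto)
      also have "\<dots> = x" unfolding lcx by (rule N.sum_nonzero_representation_eq[OF Bs(2) xs])
      finally show "(\<Sum>v\<in>S. scl N (lc v x) v) = x" .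
    qed
  qed
qed

text \<open>Generators in the leading degree are expanded in coordinates, all others already lie in
  the next filtration step. Allowing every finite set above \<open>R\<close> makes the property
  closed under addition.\<close>

lemma decompose:
  assumes Bs: "Bs \<subseteq> gr N (- int p)" and lc: "\<And>v. lc v \<in> gr (dual_bimod A N) (int p)"
    and co: "\<And>x. x \<in> gr N (- int p) \<Longrightarrow> \<exists>R. finite R \<and> R \<subseteq> Bs \<and> (\<forall>S. finite S \<longrightarrow> R \<subseteq> S \<longrightarrow> (\<Sum>v\<in>S. scl N (lc v x) v) = x)"
    and y: "y \<in> CF p n"
  shows "\<exists>R. finite R \<and> R \<subseteq> Bs \<and> (\<forall>S. finite S \<longrightarrow> R \<subseteq> S \<longrightarrow> S \<subseteq> Bs \<longrightarrow>
     y - (\<Sum>v\<in>S. VC p v (LC p (lc v) y)) \<in> WW (Suc p) n)" (is "?P y")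
  using y
proof (rule chp_induct)
  show "chain.subspace {y. ?P y}"
    unfolding chain.subspace_def mem_Collect_eq
  proof (intro conjI ballI allI)
    show "?P 0" by (rule exI[of _ "{}"]) (simp add: LC_simps VC_simps chain.subspace_0[OF WW_subspace])
  next
    fix x y assume "x \<in> {y. ?P y}" "y \<in> {y. ?P y}"
    then obtain R R' where R: "finite R" "R \<subseteq> Bs" "finite R'" "R' \<subseteq> Bs"
      "\<And>S. finite S \<Longrightarrow> R \<subseteq> S \<Longrightarrow> S \<subseteq> Bs \<Longrightarrow> x - (\<Sum>v\<in>S. VC p v (LC p (lc v) x)) \<in> WW (Suc p) n"
      "\<And>S. finite S \<Longrightarrow> R' \<subseteq> S \<Longrightarrow> S \<subseteq> Bs \<Longrightarrow> y - (\<Sum>v\<in>S. VC p v (LC p (lc v) y)) \<in> WW (Suc p) n"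
      by auto
    have "x + y - (\<Sum>v\<in>S. VC p v (LC p (lc v) (x + y))) \<in> WW (Suc p) n" if S: "finite S" "R \<union> R' \<subseteq> S" "S \<subseteq> Bs" for S
      using WW_closed(1)[OF R(5)[of S] R(6)[of S]] S by (simp add: LC_simps VC_simps sum.distrib add_diff_add)
    then show "?P (x + y)" by (intro exI[of _ "R \<union> R'"]) (use R in simp)
  next
    fix r x assume "x \<in> {y. ?P y}"
    then obtain R where R: "finite R" "R \<subseteq> Bs"
      "\<And>S. finite S \<Longrightarrow> R \<subseteq> S \<Longrightarrow> S \<subseteq> Bs \<Longrightarrow> x - (\<Sum>v\<in>S. VC p v (LC p (lc v) x)) \<in> WW (Suc p) n"
      by auto
    have "chain_scale r x - (\<Sum>v\<in>S. VC p v (LC p (lc v) (chain_scale r x))) \<in> WW (Suc p) n" if S: "finite S" "R \<subseteq> S" "S \<subseteq> Bs" for S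
      using WW_closed(6)[OF R(3)[OF S], of r]
      by (simp add: LC_simps VC_simps chain.scale_right_diff_distrib chain.scale_sum_right)
    then show "?P (chain_scale r x)" by (intro exI[of _ R]) (use R in simp)
  qed
next
  fix x j w assume x: "XF p x j" and w: "lw b_letter w" and jw: "j + sdeg w = n"
  show "?P (pure (x, j) w)"
  proof (cases "j = - int p")
    case True
    then have xg: "x \<in> gr N (- int p)" using x by (simp add: XF_def)
    obtain R where R: "finite R" "R \<subseteq> Bs" "\<And>S. finite S \<Longrightarrow> R \<subseteq> S \<Longrightarrow> (\<Sum>v\<in>S. scl N (lc v x) v) = x"
      using co[OF xg] by blast
    have "pure (x, j) w - (\<Sum>v\<in>S. VC p v (LC p (lc v) (pure (x, j) w))) \<in> WW (Suc p) n" if S: "finite S" "R \<subseteq> S" "S \<subseteq> Bs" for S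
    proof -
      have "pure (\<Sum>v\<in>S. scl N (lc v x) v, - int p) w - (\<Sum>v\<in>S. pure (scl N (lc v x) v, - int p) w) \<in> RN"
        using S Bs by (intro pure_sum b_word[OF w]) auto
      then show ?thesis using R(3)[OF S(1,2)] True by (simp add: LC_pure VC_pure WW_RN)
    qed
    then show ?thesis using R by blast
  next
    case False
    then have "XF (Suc p) x j" using x by (auto simp: XF_def)
    then have "pure (x, j) w \<in> CF (Suc p) n" using w jw by (intro pure_chp) auto
    then show ?thesis using False by (intro exI[of _ "{}"]) (auto simp: LC_pure VC_simps intro: WW_CF)
  qed
qed

lemma cap_sum:
  assumes "finite S" "\<And>v. v \<in> S \<Longrightarrow> coch A N i (h v)"
  shows "coch A N i (\<lambda>w. \<Sum>v\<in>S. h v w) \<and> cap (lact N) i z (\<lambda>w. \<Sum>v\<in>S. h v w) - (\<Sum>v\<in>S. cap (lact N) i z (h v)) \<in> RN"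
  using assms
proof (induction S rule: finite_induct)
  case empty
  have "cap (lact N) i z (\<lambda>w. scl N 0 0) - chain_scale 0 (cap (lact N) i z (\<lambda>w. 0)) \<in> RN"
    by (rule capN.cap_scl[OF _ z_part]) (rule N.weak.coch_closed)
  then show ?case by (simp add: N.weak.coch_closed(1))
next
  case (insert x S)
  have IH: "coch A N i (\<lambda>w. \<Sum>v\<in>S. h v w)" "cap (lact N) i z (\<lambda>w. \<Sum>v\<in>S. h v w) - (\<Sum>v\<in>S. cap (lact N) i z (h v)) \<in> RN"
    using insert by auto
  have hx: "coch A N i (h x)" using insert by auto
  have "cap (lact N) i z (\<lambda>w. h x w + (\<Sum>v\<in>S. h v w)) - cap (lact N) i z (h x) - cap (lact N) i z (\<lambda>w. \<Sum>v\<in>S. h v w) \<in> RN"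
    by (rule capN.cap_add[OF hx IH(1) z_part])
  from rel_closed(2)[OF this IH(2)] N.weak.coch_closed(2)[OF hx IH(1)] insert(1,2) show ?case
    by (simp add: algebra_simps)
qed

text \<open>Once \<open>f\<close> has no leading part, each coordinate of the leading part of
  \<open>y\<close> is a cycle over the ground field. Exactness there, applied to the zero cochain,
  presents it as a cap product with a cocycle plus a boundary; multiplying by the basis vectors and
  summing gives \<open>g\<close> and \<open>t\<close>.\<close>

lemma lead_chain:
  assumes f: "coch A N i f" "ff (Suc p) i f"
    and y: "y \<in> CF p (d + i + 1)" "chD A N y - cap (lact N) i z f \<in> RN"
  obtains g t y' where "coch A N (i + 1) g" "\<And>w. g w \<noteq> 0 \<Longrightarrow> sdeg w = - (i + 1) - int p"
    "ff (Suc p) i (cD A N (i + 1) g)" "t \<in> CB (d + i + 2)" "y' \<in> CF (Suc p) (d + i + 1)"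
    "y - sg d (cap (lact N) (i + 1) z g) - chD A N t - y' \<in> RN"
proof -
  have f': "ff p i f" using f(2) by (auto simp: ff_def)
  obtain Bs and lc :: "'m \<Rightarrow> 'm \<Rightarrow> 'k" where Bs: "Bs \<subseteq> gr N (- int p)" "\<And>v. lc v \<in> gr (dual_bimod A N) (int p)"
    "\<And>x. x \<in> gr N (- int p) \<Longrightarrow> \<exists>R. finite R \<and> R \<subseteq> Bs \<and> (\<forall>S. finite S \<longrightarrow> R \<subseteq> S \<longrightarrow> (\<Sum>v\<in>S. scl N (lc v x) v) = x)"
    by (rule coordinates[of p]) blast
  obtain S where S: "finite S" "S \<subseteq> Bs" "y - (\<Sum>v\<in>S. VC p v (LC p (lc v) y)) \<in> WW (Suc p) (d + i + 1)"
    using decompose[OF Bs y(1)] by blast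
  have "\<exists>g t. coch A T (i + 1 + int p) g \<and> t \<in> T.CB (d + i + int p + 2) \<and> (\<forall>w. lw b_letter w \<longrightarrow> cD A T (i + 1 + int p) g w = 0) \<and>
      LC p (lc v) y - sg d (cap (lact T) (i + 1 + int p) z g) - chD A T t \<in> RT" for v
  proof -
    \<comment> \<open>The sign that \<open>LC_cone\<close> puts on the coordinate; it is moved back
      onto the cochain and the bounding chain below.\<close>
    let ?e = "int p + int p * d"
    have "l0 w = 0" if "lw b_letter w" "l0 = (\<lambda>w. lc v (f w))" for w l0
    proof (cases "i + sdeg w = - int p")
      case True
      then have "f w = 0" using f(2) that(1) by (simp add: ff_def)
      then show ?thesis using Bs(2)[of v] linear_simps(1) that(2) by (auto simp: dual_gr)
    next
      case False
      then show ?thesis using dual_gr_zero[OF Bs(2)[of v] cochD(1)[OF f(1) b_word[OF that(1)]]] that(2) by simp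
    qed
    then have "cap (lact T) (i + int p) z (\<lambda>w. lc v (f w)) = cap (lact T) (i + int p) z (\<lambda>_. 0)"
      by (intro capT.cap_cong[OF z_chp]) simp
    then have "chD A T (sg ?e (LC p (lc v) y)) - cap (lact T) (i + int p) z (\<lambda>_. 0) \<in> RT"
      using LC_cone(1)[OF Bs(2) f(1) f' y, of v] by simp
    then obtain g t where g: "coch A T (i + int p + 1) g" "t \<in> T.CB (d + (i + int p) + 2)"
      "\<And>w. lw b_letter w \<Longrightarrow> cD A T (i + int p + 1) g w = 0"
      "sg ?e (LC p (lc v) y) - sg d (cap (lact T) (i + int p + 1) z g) - chD A T t \<in> RT"
      using cone_exactD[OF exact_T T.N.weak.coch_closed(1) T.N.weak.cD_0 LC_cone(2)[OF Bs(2) f(1) f' y, of v]] by blast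
    have gs: "coch A T (i + int p + 1) (\<lambda>w. scl T (sg ?e 1) (g w))" by (rule T.N.weak.coch_closed(5)[OF g(1)])
    have c: "cap (lact T) (i + int p + 1) z (\<lambda>w. scl T (sg ?e 1) (g w)) - chain_scale (sg ?e 1) (cap (lact T) (i + int p + 1) z g) \<in> RT"
      by (rule capT.cap_scl[OF g(1) z_part])
    have "sg ?e (sg ?e (LC p (lc v) y) - sg d (cap (lact T) (i + int p + 1) z g) - chD A T t)
        - sg d (cap (lact T) (i + int p + 1) z (\<lambda>w. scl T (sg ?e 1) (g w)) - chain_scale (sg ?e 1) (cap (lact T) (i + int p + 1) z g)) \<in> RT"
      by (rule rel_closed(3)[OF rel_closed(5)[OF g(4)] rel_closed(5)[OF c]])
    moreover have "sg ?e (sg ?e (LC p (lc v) y) - sg d (cap (lact T) (i + int p + 1) z g) - chD A T t)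
        - sg d (cap (lact T) (i + int p + 1) z (\<lambda>w. scl T (sg ?e 1) (g w)) - chain_scale (sg ?e 1) (cap (lact T) (i + int p + 1) z g))
      = LC p (lc v) y - sg d (cap (lact T) (i + int p + 1) z (\<lambda>w. scl T (sg ?e 1) (g w))) - chD A T (sg ?e t)"
      by (cases "even ?e"; cases "even d") (simp_all add: sg_def)
    moreover have "cD A T (i + int p + 1) (\<lambda>w. scl T (sg ?e 1) (g w)) w = 0" if "lw b_letter w" for w
      using g(3)[OF that] T.N.weak.cD_scl[of "i + int p + 1" "sg ?e 1" g w] by simp
    moreover have "i + int p + 1 = i + 1 + int p" "d + (i + int p) + 2 = d + i + int p + 2" by simp_all
    ultimately show ?thesis using gs chp_closed(6)[OF g(2), of ?e] by metis
  qed
  then obtain gg tt where gt: "\<And>v. coch A T (i + 1 + int p) (gg v)" "\<And>v. tt v \<in> T.CB (d + i + int p + 2)"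
    "\<And>v w. lw b_letter w \<Longrightarrow> cD A T (i + 1 + int p) (gg v) w = 0"
    "\<And>v. LC p (lc v) y - sg d (cap (lact T) (i + 1 + int p) z (gg v)) - chD A T (tt v) \<in> RT"
    by metis
  \<comment> \<open>The sign of \<open>VC_cap\<close>, turned into a scalar so that the cochain can
    absorb it.\<close>
  define e where "e = (sg (int p * d) 1 :: 'k)"
  define h where "h v w = scl N e (scl N (gg v w) v)" for v w
  define t where "t = (\<Sum>v\<in>S. sg (int p) (VC p v (tt v)))"
  have vS: "v \<in> gr N (- int p)" if "v \<in> S" for v using that S(2) Bs(1) by blast
  have hv: "coch A N (i + 1) (\<lambda>w. scl N (gg v w) v)" if "v \<in> S" for v by (rule coch_v[OF vS[OF that] gt(1)])
  have h: "coch A N (i + 1) (h v)" if "v \<in> S" for v unfolding h_def by (rule N.weak.coch_closed(5)[OF hv[OF that]])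
  let ?W = "WW (Suc p) (d + i + 1)"
  let ?g = "\<lambda>w. \<Sum>v\<in>S. h v w"
  have g: "coch A N (i + 1) ?g" "cap (lact N) (i + 1) z ?g - (\<Sum>v\<in>S. cap (lact N) (i + 1) z (h v)) \<in> RN"
    using cap_sum[of S "i + 1" h] S(1) h by auto
  have gconc: "gg v w = 0" if "is_word A w" "sdeg w \<noteq> - (i + 1) - int p" for v w
    using cochD(1)[OF gt(1)[of v] that(1)] that(2) by (simp split: if_splits)
  \<comment> \<open>The scalar cochains are arbitrary on lists that are not words; cutting them off
    there leaves \<open>g'\<close> nonzero in a single word degree.\<close>
  define g' where "g' w = (if is_word A w then ?g w else 0)" for w
  have g'g: "g' w = ?g w" if "is_word A w" for w using that by (simp add: g'_def)
  have cg': "coch A N (i + 1) g'"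
    by (rule coch_congA[OF g(1)]) (simp add: g'_def)
  have capg': "cap (lact N) (i + 1) z g' = cap (lact N) (i + 1) z ?g"
    by (rule capN_cong) (simp add: g'_def b_word)
  have conc: "sdeg w = - (i + 1) - int p" if "g' w \<noteq> 0" for w
    using that gconc[of w] by (auto simp: g'_def h_def split: if_splits intro: ccontr)
  have Dg: "ff (Suc p) i (cD A N (i + 1) g')"
    unfolding ff_def
  proof (intro allI impI)
    fix w assume w: "lw b_letter w" "- int (Suc p) < i + sdeg w"
    show "cD A N (i + 1) g' w = 0"
    proof (cases "i + sdeg w = - int p")
      case False
      then have 1: "i + 1 - 1 + sdeg w > - int p" using w(2) by simp
      have "ff p (i + 1) g'" using conc by (fastforce simp: ff_def)
      from ff_cD[OF this] show ?thesis using w(1) 1 by (simp add: ff_def)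
    next
      case True
      have "cD A N (i + 1) g' w = - sg (i + 1) (bdel A g' w)"
      proof (rule cD_lead_degree[OF w(1)])
        fix v :: "'a word" assume "sdeg w \<le> sdeg v" then show "g' v = 0" using conc[of v] True by fastforce
      qed
      also have "bdel A g' w = bdel A ?g w" by (rule N.weak.bd_cong[OF b_word[OF w(1)]]) (rule g'g)
      also have "bdel A ?g w = (\<Sum>v\<in>S. bdel A (h v) w)"
        using S(1) 
      proof (induction S rule: finite_induct)
        case empty
        show ?case using N.weak.bd_scl[of 0 "\<lambda>_. 0" w] by simp
      next
        case (insert x F)
        then show ?case using N.weak.bd_add[of "h x" "\<lambda>w. \<Sum>v\<in>F. h v w" w] by simp
      qed
      also have "\<dots> = 0"
      proof (rule sum.neutral, rule ballI)
        fix v assume "v \<in> S"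
        have "bdel A (gg v) w = 0" using gt(3)[OF w(1), of v] cD_T[OF w(1), of "i + 1 + int p" "gg v"] by simp
        moreover have "scl N e (scl N (bdel A (gg v) w) v) = bdel A (h v) w"
          unfolding h_def by (rule bd_hom) (simp add: N.scale_left_distrib N.scale_right_distrib)
        ultimately show "bdel A (h v) w = 0" by simp
      qed
      finally show ?thesis by simp
    qed
  qed
  have t: "t \<in> CB (d + i + 2)"
    unfolding t_def
  proof (intro chain.subspace_sum[OF chp_subspace] chp_closed(6) CF_CB)
    fix v assume "v \<in> S"
    have "d + i + int p + 2 - int p = d + i + 2" by simp
    then show "VC p v (tt v) \<in> CF p (d + i + 2)" using VC_CF[OF vS[OF \<open>v \<in> S\<close>] gt(2)] by (simp only:)
  qed
  have main: "VC p v (LC p (lc v) y) - sg d (cap (lact N) (i + 1) z (h v)) - chD A N (sg (int p) (VC p v (tt v))) \<in> ?W" if v: "v \<in> S" for v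
  proof -
    let ?Lg = "VC p v (cap (lact T) (i + 1 + int p) z (gg v))" and ?cg = "cap (lact N) (i + 1) z (\<lambda>w. scl N (gg v w) v)"
    have a1: "VC p v (LC p (lc v) y) - sg d ?Lg - VC p v (chD A T (tt v)) \<in> ?W"
      using VC_rel[OF vS[OF v] gt(4)] by (simp add: VC_simps WW_RN)
    have a2: "?Lg - sg (int p * d) ?cg \<in> ?W"
      using VC_cap[OF vS[OF v] gt(1)] by (intro WW_CF) (simp add: add.assoc)
    have a3: "chD A N (VC p v (tt v)) - sg (int p) (VC p v (chD A T (tt v))) \<in> ?W"
    proof -
      have "d + i + int p + 2 - int p - 1 = d + i + 1" by simp
      then show ?thesis using VC_chD[OF vS[OF v] gt(2)] by (intro WW_CF) (simp only:)
    qed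
    have a4: "cap (lact N) (i + 1) z (h v) - chain_scale e ?cg \<in> ?W"
      unfolding h_def by (intro WW_RN capN.cap_scl[OF hv[OF v] z_part])
    have "(VC p v (LC p (lc v) y) - sg d ?Lg - VC p v (chD A T (tt v))) + sg d (?Lg - sg (int p * d) ?cg)
      - sg (int p) (chD A N (VC p v (tt v)) - sg (int p) (VC p v (chD A T (tt v)))) - sg d (cap (lact N) (i + 1) z (h v) - chain_scale e ?cg) \<in> ?W"
      by (intro WW_closed(1) WW_closed(2) WW_closed(3) a1 a2 a3 a4)
    moreover have "(VC p v (LC p (lc v) y) - sg d ?Lg - VC p v (chD A T (tt v))) + sg d (?Lg - sg (int p * d) ?cg)
      - sg (int p) (chD A N (VC p v (tt v)) - sg (int p) (VC p v (chD A T (tt v)))) - sg d (cap (lact N) (i + 1) z (h v) - chain_scale e ?cg)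
      = VC p v (LC p (lc v) y) - sg d (cap (lact N) (i + 1) z (h v)) - chD A N (sg (int p) (VC p v (tt v)))"
      unfolding e_def chain.scale_of_sg by (cases "even (int p)"; cases "even d") (simp_all add: sg_def)
    ultimately show ?thesis by (simp only:)
  qed
  have "(y - (\<Sum>v\<in>S. VC p v (LC p (lc v) y))) + (\<Sum>v\<in>S. VC p v (LC p (lc v) y) - sg d (cap (lact N) (i + 1) z (h v)) - chD A N (sg (int p) (VC p v (tt v))))
      - sg d (cap (lact N) (i + 1) z ?g - (\<Sum>v\<in>S. cap (lact N) (i + 1) z (h v))) \<in> ?W"
    by (intro WW_closed(1) WW_closed(2) WW_closed(3) WW_closed(5) S(3) main WW_RN[OF g(2)])
  moreover have "(y - (\<Sum>v\<in>S. VC p v (LC p (lc v) y))) + (\<Sum>v\<in>S. VC p v (LC p (lc v) y) - sg d (cap (lact N) (i + 1) z (h v)) - chD A N (sg (int p) (VC p v (tt v))))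
      - sg d (cap (lact N) (i + 1) z ?g - (\<Sum>v\<in>S. cap (lact N) (i + 1) z (h v))) = y - sg d (cap (lact N) (i + 1) z g') - chD A N t"
    unfolding capg' t_def by (simp add: sum_subtractf sg_sum)
  ultimately have "y - sg d (cap (lact N) (i + 1) z g') - chD A N t \<in> ?W" by (simp only:)
  then obtain y' where "y' \<in> CF (Suc p) (d + i + 1)" "y - sg d (cap (lact N) (i + 1) z g') - chD A N t - y' \<in> RN"
    by (auto simp: WW_def)
  then show ?thesis using that[OF cg' conc Dg t] by blast
qed

text \<open>The invariant of the elimination: cocycles of the cone that lie in filtration
  \<open>p\<close>.\<close>

definition Inv :: "int \<Rightarrow> nat \<Rightarrow> ('a word \<Rightarrow> 'm) \<Rightarrow> ('k, 'm, 'a) chain \<Rightarrow> bool" where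
  "Inv i p f y \<longleftrightarrow> coch A N i f \<and> (\<forall>w. lw b_letter w \<longrightarrow> cD A N i f w = 0) \<and> ff p i f \<and> y \<in> CF p (d + i + 1) \<and>
     chD A N y - cap (lact N) i z f \<in> RN"

text \<open>Subtracting the coboundary of the pair formed by \<open>g\<close> and \<open>t\<close>
  in the cone preserves cocycles; in the chain component this is the Leibniz rule for the cap
  product with the cycle \<open>z\<close>.\<close>

lemma cone_step:
  assumes f: "coch A N i f" and g: "coch A N (i + 1) g" and t: "t \<in> CB (d + i + 2)"
    and y: "chD A N y - cap (lact N) i z f \<in> RN" and y': "y - sg d (cap (lact N) (i + 1) z g) - chD A N t - y' \<in> RN"
  shows "chD A N y' - cap (lact N) i z (\<lambda>w. f w - cD A N (i + 1) g w) \<in> RN"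
proof -
  let ?c = "cap (lact N) (i + 1) z g" and ?f = "cap (lact N) i z f" and ?D = "cap (lact N) i z (cD A N (i + 1) g)"
    and ?fD = "cap (lact N) i z (\<lambda>w. f w - cD A N (i + 1) g w)"
  have Dg: "coch A N i (cD A N (i + 1) g)" using N.weak.coch_cD[OF g] by simp
  have a1: "chD A N y - sg d (chD A N ?c) - chD A N (chD A N t) - chD A N y' \<in> RN" using N.chD_rel[OF y'] by simp
  have a2: "chD A N ?c - sg d ?D \<in> RN" using capN_leibniz[OF g] by simp
  have a3: "chD A N (chD A N t) \<in> RN" using N.chD_chD[OF CB_part[OF t]] .
  have a4: "?fD - (?f - ?D) \<in> RN" by (rule capN_diff[OF f Dg])
  have "(chD A N y - ?f) - (chD A N y - sg d (chD A N ?c) - chD A N (chD A N t) - chD A N y') - chD A N (chD A N t)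
      - sg d (chD A N ?c - sg d ?D) - (?fD - (?f - ?D)) \<in> RN"
    by (intro rel_closed(3) rel_closed(5) a1 a2 a3 a4 y)
  moreover have "(chD A N y - ?f) - (chD A N y - sg d (chD A N ?c) - chD A N (chD A N t) - chD A N y') - chD A N (chD A N t)
      - sg d (chD A N ?c - sg d ?D) - (?fD - (?f - ?D)) = chD A N y' - ?fD"
    by (cases "even d") (simp_all add: sg_def)
  ultimately show ?thesis by (simp only:)
qed

text \<open>Two corrections: \<open>lead_cochain\<close> removes the leading part of
  \<open>f\<close>, then \<open>lead_chain\<close> that of \<open>y\<close>. The second cochain has
  a coboundary in the next filtration step, so it does not bring back what the first
  removed.\<close>

lemma elim_step:
  assumes "Inv i p f y"
  obtains g t y' where "coch A N (i + 1) g" "\<And>w. g w \<noteq> 0 \<Longrightarrow> sdeg w = - (i + 1) - int p" "t \<in> CB (d + i + 2)"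
    "y - sg d (cap (lact N) (i + 1) z g) - chD A N t - y' \<in> RN" "Inv i (Suc p) (\<lambda>w. f w - cD A N (i + 1) g w) y'"
proof -
  have f: "coch A N i f" "\<And>w. lw b_letter w \<Longrightarrow> cD A N i f w = 0" "ff p i f"
    and y: "y \<in> CF p (d + i + 1)" "chD A N y - cap (lact N) i z f \<in> RN"
    using assms by (auto simp: Inv_def)
  obtain g0 where g0: "coch A N (i + 1) g0" "\<And>w. g0 w \<noteq> 0 \<Longrightarrow> sdeg w = - (i + 1) - int p"
    "ff (Suc p) i (\<lambda>w. f w - cD A N (i + 1) g0 w)"
    using lead_cochain[OF f y] by blast
  let ?f1 = "\<lambda>w. f w - cD A N (i + 1) g0 w" and ?y1 = "y - sg d (cap (lact N) (i + 1) z g0)"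
  have Df: "coch A N i (\<lambda>w. f w - cD A N (i + 1) g w)" "cD A N i (\<lambda>w. f w - cD A N (i + 1) g w) w = 0"
    if "coch A N (i + 1) g" "lw b_letter w" for g w
  proof -
    show "coch A N i (\<lambda>w. f w - cD A N (i + 1) g w)"
      using N.weak.coch_cD[OF that(1)] f(1) by (intro N.weak.coch_closed) auto
    show "cD A N i (\<lambda>w. f w - cD A N (i + 1) g w) w = 0"
      using N.weak.cD_diff[of i f "cD A N (i + 1) g" w] N.weak.cD_cD[OF that(1) b_word[OF that(2)]] f(2)[OF that(2)] by simp
  qed
  have f1: "coch A N i ?f1" using Df(1)[OF g0(1), of "[]"] by simp
  have capg0: "cap (lact N) (i + 1) z g0 \<in> CF p (d + (i + 1))"
  proof (rule capN.cap_chp[OF _ z_chp])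
    fix a j u assume a: "tl_letter a j" and u: "lw b_letter u"
    have "lact N a (g0 u) \<in> gr N (j + (i + 1 + sdeg u))"
      using N.lact_degree[OF _ cochD(1)[OF g0(1) b_word[OF u]]] a by (simp add: tl_letter_def)
    moreover have "j + (i + 1 + sdeg u) \<le> - int p" if "lact N a (g0 u) \<noteq> 0"
    proof -
      have "g0 u \<noteq> 0" "a \<noteq> 0" using that by auto
      then have "sdeg u = - (i + 1) - int p" "j \<le> 0" using g0(2) tl_letter_pos[OF a] by force+
      then show ?thesis by simp
    qed
    ultimately show "XF p (lact N a (g0 u)) (j + (i + 1 + sdeg u))" by (simp add: XF_def)
  qed
  have y1: "?y1 \<in> CF p (d + i + 1)" using y(1) capg0 by (simp add: add.assoc)
  have c1: "chD A N ?y1 - cap (lact N) i z ?f1 \<in> RN"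
    by (rule cone_step[OF f(1) g0(1) _ y(2), of 0]) simp_all
  obtain g1 t y' where g1: "coch A N (i + 1) g1" "\<And>w. g1 w \<noteq> 0 \<Longrightarrow> sdeg w = - (i + 1) - int p"
    "ff (Suc p) i (cD A N (i + 1) g1)" "t \<in> CB (d + i + 2)" "y' \<in> CF (Suc p) (d + i + 1)"
    "?y1 - sg d (cap (lact N) (i + 1) z g1) - chD A N t - y' \<in> RN"
    using lead_chain[OF f1 g0(3) y1 c1] by blast
  let ?g = "\<lambda>w. g0 w + g1 w"
  have g: "coch A N (i + 1) ?g" by (intro N.weak.coch_closed g0 g1)
  have "cap (lact N) (i + 1) z ?g - cap (lact N) (i + 1) z g0 - cap (lact N) (i + 1) z g1 \<in> RN"
    by (rule capN.cap_add[OF g0(1) g1(1) z_part])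
  from rel_closed(3)[OF g1(6) rel_closed(5)[OF this, of d]]
  have yy: "y - sg d (cap (lact N) (i + 1) z ?g) - chD A N t - y' \<in> RN" by (simp add: algebra_simps)
  have eq: "f w - cD A N (i + 1) ?g w = ?f1 w - cD A N (i + 1) g1 w" for w
    using N.weak.cD_add[of "i + 1" g0 g1 w] by simp
  have "Inv i (Suc p) (\<lambda>w. f w - cD A N (i + 1) ?g w) y'"
    unfolding Inv_def
  proof (intro conjI allI impI)
    show "coch A N i (\<lambda>w. f w - cD A N (i + 1) ?g w)" using Df(1)[OF g, of "[]"] by simp
    show "cD A N i (\<lambda>w. f w - cD A N (i + 1) ?g w) w = 0" if "lw b_letter w" for w using Df(2)[OF g that] .
    show "ff (Suc p) i (\<lambda>w. f w - cD A N (i + 1) ?g w)" unfolding eq using g0(3) g1(3) by (simp add: ff_def)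
    show "chD A N y' - cap (lact N) i z (\<lambda>w. f w - cD A N (i + 1) ?g w) \<in> RN"
      by (rule cone_step[OF f(1) g g1(4) y(2) yy])
  qed (rule g1(5))
  moreover have "sdeg w = - (i + 1) - int p" if "?g w \<noteq> 0" for w using that g0(2)[of w] g1(2)[of w] by fastforce
  ultimately show ?thesis using that[OF g _ g1(4) yy] by blast
qed

text \<open>The infinitely many eliminations of degrees \<open>0, -1, -2, \<dots>\<close> of the coefficients add up, because a
  cochain takes values in a single degree on each word, while a chain in high filtration vanishes.\<close>

lemma cone_exact_from_trivial:
  assumes nonneg: "\<And>j. j > 0 \<Longrightarrow> gr N j = {0}"
  shows "cone_exact A b_letter N z d"
  unfolding cone_exact_def
proof (intro allI impI)
  fix i f y assume f: "coch A N i f" "\<forall>w. lw b_letter w \<longrightarrow> cD A N i f w = 0"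
    and y: "y \<in> CB (d + i + 1)" "chD A N y - cap (lact N) i z f \<in> RN"
  have I0: "Inv i 0 f y"
  proof -
    have "ff 0 i f"
      unfolding ff_def
    proof (intro allI impI)
      fix w assume w: "lw b_letter w" "- int 0 < i + sdeg w"
      then show "f w = 0" using cochD(1)[OF f(1) b_word[OF w(1)]] nonneg[of "i + sdeg w"] by simp
    qed
    moreover have "CB (d + i + 1) \<subseteq> CF 0 (d + i + 1)"
      by (rule chp_mono) (use nonneg in \<open>force simp: XF_def\<close>)+
    ultimately show ?thesis using f y by (auto simp: Inv_def)
  qed
  \<comment> \<open>Dependent choice: \<open>Q\<close> relates a state at stage \<open>p\<close> to
    a correction and the chain that remains after it, \<open>X\<close> selects one, and
    \<open>st\<close> iterates.\<close>
  define Q where "Q = (\<lambda>p (f, y) ((g, t), y'). coch A N (i + 1) g \<and> (\<forall>w. g w \<noteq> 0 \<longrightarrow> sdeg w = - (i + 1) - int p) \<and>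
     t \<in> CB (d + i + 2) \<and> y - sg d (cap (lact N) (i + 1) z g) - chD A N t - y' \<in> RN \<and>
     Inv i (Suc p) (\<lambda>w. f w - cD A N (i + 1) g w) y')"
  define X where "X p s = (SOME x. Q p s x)" for p s
  define st where "st = rec_nat (f, y) (\<lambda>p s. (\<lambda>w. fst s w - cD A N (i + 1) (fst (fst (X p s))) w, snd (X p s)))"
  have st0: "st 0 = (f, y)" and stS: "st (Suc p) = (\<lambda>w. fst (st p) w - cD A N (i + 1) (fst (fst (X p (st p)))) w, snd (X p (st p)))" for p
    by (simp_all add: st_def)
  have XQ: "Q p (f, y) (X p (f, y))" if I: "Inv i p f y" for p f y
  proof -
    obtain g t y' where "coch A N (i + 1) g" "\<And>w. g w \<noteq> 0 \<Longrightarrow> sdeg w = - (i + 1) - int p" "t \<in> CB (d + i + 2)"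
    "y - sg d (cap (lact N) (i + 1) z g) - chD A N t - y' \<in> RN" "Inv i (Suc p) (\<lambda>w. f w - cD A N (i + 1) g w) y'"
      using elim_step[OF I] by blast
    then have "Q p (f, y) ((g, t), y')" by (simp add: Q_def)
    then show ?thesis unfolding X_def by (rule someI)
  qed
  define gs where "gs p = fst (fst (X p (st p)))" for p
  define ts where "ts p = snd (fst (X p (st p)))" for p
  have inv: "Inv i p (fst (st p)) (snd (st p))" for p
  proof (induction p)
    case 0
    then show ?case using I0 by (simp add: st0)
  next
    case (Suc p)
    from XQ[OF this] show ?case by (simp add: Q_def stS case_prod_unfold)
  qed
  have step: "coch A N (i + 1) (gs p)" "\<And>w. gs p w \<noteq> 0 \<Longrightarrow> sdeg w = - (i + 1) - int p" "ts p \<in> CB (d + i + 2)"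
    "snd (st p) - sg d (cap (lact N) (i + 1) z (gs p)) - chD A N (ts p) - snd (st (Suc p)) \<in> RN"
    "fst (st (Suc p)) = (\<lambda>w. fst (st p) w - cD A N (i + 1) (gs p) w)" for p
    using XQ[OF inv[of p]] by (simp_all add: Q_def stS case_prod_unfold gs_def ts_def)
  define G where "G P w = (\<Sum>p<P. gs p w)" for P w
  have cG: "coch A N (i + 1) (G P)" for P
    unfolding G_def by (induction P) (auto intro: N.weak.coch_closed step(1))
  have DG: "cD A N (i + 1) (G P) w = f w - fst (st P) w" for P w
  proof (induction P)
    case 0
    then show ?case by (simp add: G_def st0)
  next
    case (Suc P)
    have "G (Suc P) = (\<lambda>w. G P w + gs P w)" by (simp add: G_def fun_eq_iff)
    then show ?case using Suc N.weak.cD_add[of "i + 1" "G P" "gs P" w] by (simp add: step(5))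
  qed
  have capG: "y - sg d (cap (lact N) (i + 1) z (G P)) - chD A N (\<Sum>p<P. ts p) - snd (st P) \<in> RN" for P
  proof (induction P)
    case 0
    have "cap (lact N) (i + 1) z (\<lambda>w. scl N 0 0) - chain_scale 0 (cap (lact N) (i + 1) z (\<lambda>w. 0)) \<in> RN"
      by (rule capN.cap_scl[OF _ z_part]) (rule N.weak.coch_closed)
    moreover have "G 0 = (\<lambda>w. 0)" by (simp add: G_def fun_eq_iff)
    ultimately show ?case by (simp add: st0)
  next
    case (Suc P)
    have "cap (lact N) (i + 1) z (\<lambda>w. G P w + gs P w) - cap (lact N) (i + 1) z (G P) - cap (lact N) (i + 1) z (gs P) \<in> RN"
      by (rule capN.cap_add[OF cG step(1) z_part])
    moreover have "G (Suc P) = (\<lambda>w. G P w + gs P w)" by (simp add: G_def fun_eq_iff)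
    ultimately have c: "cap (lact N) (i + 1) z (G (Suc P)) - cap (lact N) (i + 1) z (G P) - cap (lact N) (i + 1) z (gs P) \<in> RN" by simp
    have "(y - sg d (cap (lact N) (i + 1) z (G P)) - chD A N (\<Sum>p<P. ts p) - snd (st P))
       + (snd (st P) - sg d (cap (lact N) (i + 1) z (gs P)) - chD A N (ts P) - snd (st (Suc P)))
       - sg d (cap (lact N) (i + 1) z (G (Suc P)) - cap (lact N) (i + 1) z (G P) - cap (lact N) (i + 1) z (gs P)) \<in> RN"
      by (intro rel_closed(2) rel_closed(3) rel_closed(5) Suc step(4) c)
    then show ?case by (simp add: algebra_simps)
  qed
  \<comment> \<open>The correction of stage \<open>p\<close> is nonzero only at words of degree
    \<open>- (i + 1) - int p\<close>, so the stage that matters at \<open>w\<close> is read off from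
    \<open>sdeg w\<close>.\<close>
  define g where "g w = (if - (i + 1) - sdeg w \<ge> 0 then gs (nat (- (i + 1) - sdeg w)) w else 0)" for w
  have gG: "G P w = g w" if "- (i + 1) - sdeg w < int P" for P w
  proof (cases "- (i + 1) - sdeg w \<ge> 0")
    case True
    let ?q = "nat (- (i + 1) - sdeg w)"
    have "G P w = (\<Sum>p\<in>{?q}. gs p w)"
      unfolding G_def
    proof (rule sum.mono_neutral_right)
      show "\<forall>p\<in>{..<P} - {?q}. gs p w = 0" using step(2) True by fastforce
    qed (use that True in auto)
    then show ?thesis using True by (simp add: g_def)
  next
    case False
    have "gs p w = 0" for p using step(2)[of p w] False by fastforce
    then show ?thesis using False by (simp add: G_def g_def)
  qed
  have cg: "coch A N (i + 1) g"
  proof (rule cochI)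
    fix w assume "is_word A w"
    then show "g w \<in> gr N (i + 1 + sdeg w)" using cochD(1)[OF step(1)] by (auto simp: g_def)
  next
    fix u w a b l assume "is_word A u" "is_word A w" "a \<in> gr A l" "b \<in> gr A l"
    then show "g (u @ (a + b, l) # w) = g (u @ (a, l) # w) + g (u @ (b, l) # w)"
      by (simp add: g_def cochD(2)[OF step(1)])
  next
    fix u w a r l assume "is_word A u" "is_word A w" "a \<in> gr A l"
    then show "g (u @ (scl A r a, l) # w) = scl N r (g (u @ (a, l) # w))"
      by (simp add: g_def cochD(3)[OF step(1)])
  qed
  have Dg: "cD A N (i + 1) g w = f w" if w: "lw b_letter w" for w
  proof -
    \<comment> \<open>\<open>cD\<close> at \<open>w\<close> evaluates \<open>g\<close> at words of
      degree at least \<open>sdeg w - 1\<close>, which bounds the stages involved; the same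
      \<open>P\<close> puts \<open>w\<close> in the range where the remaining cochain
      vanishes.\<close>
    define P where "P = nat (\<bar>i\<bar> + \<bar>sdeg w\<bar> + 2)"
    have "cD A N (i + 1) g w = cD A N (i + 1) (G P) w"
    proof (rule cD_congS[OF w])
      fix v :: "'a word" assume "sdeg w - 1 \<le> sdeg v"
      then have "- (i + 1) - sdeg v < int P" by (simp add: P_def)
      then show "g v = G P v" by (rule gG[symmetric])
    qed
    moreover have "fst (st P) w = 0"
    proof -
      have "ff P i (fst (st P))" using inv[of P] by (simp add: Inv_def)
      moreover have "- int P < i + sdeg w" by (simp add: P_def)
      ultimately show ?thesis using w by (simp add: ff_def)
    qed
    ultimately show ?thesis by (simp add: DG)
  qed
  \<comment> \<open>Now one bound for the chain component. The cap product with \<open>z\<close>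
    meets only words of degree at least \<open>d\<close>, hence stages below \<open>P\<close>; and
    negative letters give words of degree at most \<open>0\<close>, so no nonzero coefficient of
    degree at most \<open>- int P\<close> fits into chain degree \<open>d + i + 1\<close>.\<close>
  define P where "P = nat (\<bar>i\<bar> + \<bar>d\<bar> + 2)"
  have capg: "cap (lact N) (i + 1) z g = cap (lact N) (i + 1) z (G P)"
  proof (rule linear_eq_span[OF capN.cap_linear capN.cap_linear _ z_chp[unfolded chp_def]])
    fix x :: "('k, 'a, 'a) chain" assume "x \<in> gens tl_letter b_letter d"
    then obtain a j w where h: "tl_letter a j" "lw b_letter w" "j + sdeg w = d" "x = pure (a, j) w" by (auto simp: gens_def)
    have "spl (\<lambda>u v. pure (lact N a (g u), j + (i + 1 + sdeg u)) v) w = spl (\<lambda>u v. pure (lact N a (G P u), j + (i + 1 + sdeg u)) v) w"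
    proof (rule spl_cong)
      fix u v assume uv: "w = u @ v"
      have "lact N a (g u) = lact N a (G P u)"
      proof (cases "j \<le> 0")
        case True
        have "sdeg v \<le> 0" using sdeg_b[of v] h(2) uv by simp
        then have "- (i + 1) - sdeg u < int P" using True h(3) by (simp add: P_def uv)
        then show ?thesis by (simp add: gG)
      next
        case False
        then show ?thesis using tl_letter_pos[OF h(1)] by simp
      qed
      then show "pure (lact N a (g u), j + (i + 1 + sdeg u)) v = pure (lact N a (G P u), j + (i + 1 + sdeg u)) v" by simp
    qed
    then show "cap (lact N) (i + 1) x g = cap (lact N) (i + 1) x (G P)" unfolding h(4) capN.cap_pure by simp
  qed
  have yP: "snd (st P) \<in> RN"
  proof -
    have "snd (st P) \<in> CF P (d + i + 1)" using inv[of P] by (simp add: Inv_def)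
    then show ?thesis
    proof (rule chp_induct)
      fix x j w assume h: "XF P x j" "lw b_letter w" "j + sdeg w = d + i + 1"
      have "x = 0"
      proof (rule ccontr)
        assume "x \<noteq> 0"
        then have "j \<le> - int P" using h(1) by (simp add: XF_def)
        then show False using h(3) sdeg_b[OF h(2)] by (simp add: P_def)
      qed
      then show "pure (x, j) w \<in> RN" using pure0N b_word[OF h(2)] by simp
    qed (simp add: rel_subspace)
  qed
  have "y - sg d (cap (lact N) (i + 1) z g) - chD A N (\<Sum>p<P. ts p) \<in> RN"
    using rel_closed(2)[OF capG[of P] yP] unfolding capg by simp
  moreover have "(\<Sum>p<P. ts p) \<in> CB (d + i + 2)" by (intro chain.subspace_sum[OF chp_subspace] step(3))
  ultimately show "\<exists>g t. coch A N (i + 1) g \<and> t \<in> CB (d + i + 2) \<and> (\<forall>w. lw b_letter w \<longrightarrow> cD A N (i + 1) g w = f w) \<and>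
        y - sg d (cap (lact N) (i + 1) z g) - chD A N t \<in> RN"
    using cg Dg by blast
qed

end

end

section \<open>Isomorphisms on homology\<close>

text \<open>Collects the linearity that makes classes, their sums and their multiples well
  defined.\<close>

locale lin_complex = vs: vector_space "csc C" for C :: "('k::field, 'v::ab_group_add) pcomplex" +
  assumes part_sub: "vs.subspace (part C i)" and rel_sub: "vs.subspace (rel C)"
    and bd_add: "bd C i (x + y) = bd C i x + bd C i y" and bd_scl: "bd C i (csc C r x) = csc C r (bd C i x)"
begin

lemma bd_simps: "bd C i 0 = 0" "bd C i (- x) = - bd C i x" "bd C i (x - y) = bd C i x - bd C i y"
proof -
  show 0: "bd C i 0 = 0" using bd_add[of i 0 0] by simp
  show m: "bd C i (- x) = - bd C i x" for x using bd_add[of i x "- x"] 0 by (simp add: eq_neg_iff_add_eq_0 add.commute)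
  show "bd C i (x - y) = bd C i x - bd C i y" using bd_add[of i x "- y"] m by simp
qed

lemma cycles_sub: "vs.subspace (cycles C i)"
  using part_sub[of i] rel_sub by (auto simp: vs.subspace_def cycles_def bd_simps bd_add bd_scl)

lemma homologousI: "x \<in> cycles C i \<Longrightarrow> y \<in> cycles C i \<Longrightarrow> z \<in> part C (i + 1) \<Longrightarrow> x - y - bd C (i + 1) z \<in> rel C \<Longrightarrow> (x, y) \<in> homologous C i"
  by (auto simp: homologous_def)

lemma homologousE:
  assumes "(x, y) \<in> homologous C i"
  obtains z where "x \<in> cycles C i" "y \<in> cycles C i" "z \<in> part C (i + 1)" "x - y - bd C (i + 1) z \<in> rel C"
  using assms by (auto simp: homologous_def)

lemma homologous_rel: "x \<in> cycles C i \<Longrightarrow> y \<in> cycles C i \<Longrightarrow> x - y \<in> rel C \<Longrightarrow> (x, y) \<in> homologous C i"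
  by (rule homologousI[of _ _ _ 0]) (simp_all add: vs.subspace_0 part_sub bd_simps)

lemma homologous_refl: "x \<in> cycles C i \<Longrightarrow> (x, x) \<in> homologous C i"
  by (rule homologous_rel) (simp_all add: vs.subspace_0 rel_sub)

lemma homologous_sym: "(x, y) \<in> homologous C i \<Longrightarrow> (y, x) \<in> homologous C i"
proof (erule homologousE)
  fix z assume h: "x \<in> cycles C i" "y \<in> cycles C i" "z \<in> part C (i + 1)" "x - y - bd C (i + 1) z \<in> rel C"
  have "- (x - y - bd C (i + 1) z) \<in> rel C" by (rule vs.subspace_neg[OF rel_sub h(4)])
  then show "(y, x) \<in> homologous C i"
    by (intro homologousI[OF h(2,1) vs.subspace_neg[OF part_sub h(3)]]) (simp add: bd_simps algebra_simps)
qed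

lemma homologous_trans: "(x, y) \<in> homologous C i \<Longrightarrow> (y, w) \<in> homologous C i \<Longrightarrow> (x, w) \<in> homologous C i"
proof (elim homologousE)
  fix z z' assume h: "x \<in> cycles C i" "w \<in> cycles C i" "z \<in> part C (i + 1)" "x - y - bd C (i + 1) z \<in> rel C"
    "z' \<in> part C (i + 1)" "y - w - bd C (i + 1) z' \<in> rel C"
  have "(x - y - bd C (i + 1) z) + (y - w - bd C (i + 1) z') \<in> rel C" by (rule vs.subspace_add[OF rel_sub h(4,6)])
  then show "(x, w) \<in> homologous C i"
    by (intro homologousI[OF h(1,2) vs.subspace_add[OF part_sub h(3,5)]]) (simp add: bd_add algebra_simps)
qed

lemma homologous_add: "(x, y) \<in> homologous C i \<Longrightarrow> (x', y') \<in> homologous C i \<Longrightarrow> (x + x', y + y') \<in> homologous C i"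
proof (elim homologousE)
  fix z z' assume h: "x \<in> cycles C i" "y \<in> cycles C i" "z \<in> part C (i + 1)" "x - y - bd C (i + 1) z \<in> rel C"
    "x' \<in> cycles C i" "y' \<in> cycles C i" "z' \<in> part C (i + 1)" "x' - y' - bd C (i + 1) z' \<in> rel C"
  have "(x - y - bd C (i + 1) z) + (x' - y' - bd C (i + 1) z') \<in> rel C" by (rule vs.subspace_add[OF rel_sub h(4,8)])
  then show "(x + x', y + y') \<in> homologous C i"
    by (intro homologousI[OF _ _ vs.subspace_add[OF part_sub h(3,7)]] vs.subspace_add[OF cycles_sub] h) (simp add: bd_add algebra_simps)
qed

lemma homologous_scl: "(x, y) \<in> homologous C i \<Longrightarrow> (csc C r x, csc C r y) \<in> homologous C i"
proof (elim homologousE)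
  fix z assume h: "x \<in> cycles C i" "y \<in> cycles C i" "z \<in> part C (i + 1)" "x - y - bd C (i + 1) z \<in> rel C"
  have "csc C r (x - y - bd C (i + 1) z) \<in> rel C" by (rule vs.subspace_scale[OF rel_sub h(4)])
  then show "(csc C r x, csc C r y) \<in> homologous C i"
    by (intro homologousI[OF _ _ vs.subspace_scale[OF part_sub h(3)]] vs.subspace_scale[OF cycles_sub] h)
      (simp add: bd_scl vs.scale_right_diff_distrib)
qed

lemma class_eq_iff: "x \<in> cycles C i \<Longrightarrow> y \<in> cycles C i \<Longrightarrow> homologous C i `` {x} = homologous C i `` {y} \<longleftrightarrow> (x, y) \<in> homologous C i"
  using homologous_refl homologous_sym homologous_trans by blast

lemma homologyE:
  assumes "\<alpha> \<in> homology C i" obtains x where "x \<in> cycles C i" "\<alpha> = homologous C i `` {x}"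
  using assms by (auto simp: homology_def quotient_def)

lemma homologyI: "x \<in> cycles C i \<Longrightarrow> homologous C i `` {x} \<in> homology C i"
  by (auto simp: homology_def quotient_def)

lemma UN_class:
  assumes "x \<in> cycles C i" "\<And>x'. (x, x') \<in> homologous C i \<Longrightarrow> F x' = S"
  shows "(\<Union>x'\<in>homologous C i `` {x}. F x') = S"
  using assms homologous_refl[OF assms(1)] by auto

lemma hadd_class: "x \<in> cycles C i \<Longrightarrow> y \<in> cycles C i \<Longrightarrow> hadd C i (homologous C i `` {x}) (homologous C i `` {y}) = homologous C i `` {x + y}"
  unfolding hadd_def
proof (intro UN_class)
  fix x' y' assume h: "x \<in> cycles C i" "y \<in> cycles C i" "(x, x') \<in> homologous C i" "(y, y') \<in> homologous C i"
  from homologous_add[OF h(3,4)] show "homologous C i `` {x' + y'} = homologous C i `` {x + y}"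
    using homologous_sym homologous_trans by blast
qed

lemma hscale_class: "x \<in> cycles C i \<Longrightarrow> hscale C i r (homologous C i `` {x}) = homologous C i `` {csc C r x}"
  unfolding hscale_def
proof (intro UN_class)
  fix x' assume h: "(x, x') \<in> homologous C i"
  from homologous_scl[OF h, of r] show "homologous C i `` {csc C r x'} = homologous C i `` {csc C r x}"
    using homologous_sym homologous_trans by blast
qed

end

lemma homology_isoI:
  assumes C: "lin_complex C" and C': "lin_complex C'"
    and map: "\<And>x. x \<in> cycles C i \<Longrightarrow> \<phi> x \<in> cycles C' j" "\<And>x. x \<in> cycles C i \<Longrightarrow> \<Phi> (homologous C i `` {x}) = homologous C' j `` {\<phi> x}"
    and add: "\<And>x y. x \<in> cycles C i \<Longrightarrow> y \<in> cycles C i \<Longrightarrow> (\<phi> (x + y), \<phi> x + \<phi> y) \<in> homologous C' j"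
    and scl: "\<And>r x. x \<in> cycles C i \<Longrightarrow> (\<phi> (csc C r x), csc C' r (\<phi> x)) \<in> homologous C' j"
    and inj: "\<And>x. x \<in> cycles C i \<Longrightarrow> (\<phi> x, 0) \<in> homologous C' j \<Longrightarrow> (x, 0) \<in> homologous C i"
    and surj: "\<And>y. y \<in> cycles C' j \<Longrightarrow> \<exists>x\<in>cycles C i. (\<phi> x, y) \<in> homologous C' j"
  shows "homology_iso C i C' j \<Phi>"
proof -
  interpret C: lin_complex C by fact
  interpret C': lin_complex C' by fact
  have inj': "(x, y) \<in> homologous C i" if xy: "x \<in> cycles C i" "y \<in> cycles C i" "(\<phi> x, \<phi> y) \<in> homologous C' j" for x y
  proof -
    \<comment> \<open>Differences are written with \<open>csc C (-1)\<close> because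
      \<open>\<phi>\<close> is additive and homogeneous only up to homology.\<close>
    have my: "csc C (-1) y \<in> cycles C i" using xy(2) by (rule C.vs.subspace_scale[OF C.cycles_sub])
    have "(\<phi> (x + csc C (-1) y), \<phi> x + \<phi> (csc C (-1) y)) \<in> homologous C' j" by (rule add[OF xy(1) my])
    moreover have "(\<phi> x + \<phi> (csc C (-1) y), \<phi> y + csc C' (-1) (\<phi> y)) \<in> homologous C' j"
      by (rule C'.homologous_add[OF xy(3) scl[OF xy(2)]])
    ultimately have "(\<phi> (x + csc C (-1) y), 0) \<in> homologous C' j" using C'.homologous_trans by fastforce
    then have "(x + csc C (-1) y, 0) \<in> homologous C i" by (rule inj[OF C.vs.subspace_add[OF C.cycles_sub xy(1) my]])
    from C.homologous_add[OF this C.homologous_refl[OF xy(2)]] show ?thesis by simp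
  qed
  show ?thesis
    unfolding homology_iso_def
  proof (intro conjI ballI allI)
    show "bij_betw \<Phi> (homology C i) (homology C' j)"
    proof (intro bij_betw_imageI inj_onI)
      fix \<alpha> \<beta> assume "\<alpha> \<in> homology C i" "\<beta> \<in> homology C i" and eq: "\<Phi> \<alpha> = \<Phi> \<beta>"
      then obtain x y where xy: "x \<in> cycles C i" "y \<in> cycles C i" "\<alpha> = homologous C i `` {x}" "\<beta> = homologous C i `` {y}"
        by (meson C.homologyE)
      have "(\<phi> x, \<phi> y) \<in> homologous C' j"
        using eq map(2)[OF xy(1)] map(2)[OF xy(2)] C'.class_eq_iff[OF map(1)[OF xy(1)] map(1)[OF xy(2)]] xy(3,4) by simp
      then show "\<alpha> = \<beta>" using inj'[OF xy(1,2)] C.class_eq_iff[OF xy(1,2)] xy(3,4) by simp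
    next
      show "\<Phi> ` homology C i = homology C' j"
      proof (intro equalityI subsetI)
        fix \<beta> assume "\<beta> \<in> \<Phi> ` homology C i"
        then obtain x where "x \<in> cycles C i" "\<beta> = \<Phi> (homologous C i `` {x})" by (auto elim: C.homologyE)
        then show "\<beta> \<in> homology C' j" using map C'.homologyI by simp
      next
        fix \<beta> assume "\<beta> \<in> homology C' j"
        then obtain y where y: "y \<in> cycles C' j" "\<beta> = homologous C' j `` {y}" by (rule C'.homologyE)
        obtain x where x: "x \<in> cycles C i" "(\<phi> x, y) \<in> homologous C' j" using surj[OF y(1)] by blast
        then have "\<beta> = \<Phi> (homologous C i `` {x})"
          using y map C'.class_eq_iff[OF map(1)[OF x(1)] y(1)] by simp
        then show "\<beta> \<in> \<Phi> ` homology C i" using C.homologyI[OF x(1)] by blast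
      qed
    qed
  next
    fix \<alpha> \<beta> assume "\<alpha> \<in> homology C i" "\<beta> \<in> homology C i"
    then obtain x y where xy: "x \<in> cycles C i" "y \<in> cycles C i" "\<alpha> = homologous C i `` {x}" "\<beta> = homologous C i `` {y}"
      by (meson C.homologyE)
    have s: "x + y \<in> cycles C i" by (rule C.vs.subspace_add[OF C.cycles_sub xy(1,2)])
    have s': "\<phi> x + \<phi> y \<in> cycles C' j" by (rule C'.vs.subspace_add[OF C'.cycles_sub map(1)[OF xy(1)] map(1)[OF xy(2)]])
    show "\<Phi> (hadd C i \<alpha> \<beta>) = hadd C' j (\<Phi> \<alpha>) (\<Phi> \<beta>)"
      using add[OF xy(1,2)] C'.class_eq_iff[OF map(1)[OF s] s']
      by (simp add: xy(3,4) C.hadd_class[OF xy(1,2)] map(2)[OF s] map(2)[OF xy(1)] map(2)[OF xy(2)] C'.hadd_class[OF map(1)[OF xy(1)] map(1)[OF xy(2)]])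
  next
    fix r \<alpha> assume "\<alpha> \<in> homology C i"
    then obtain x where x: "x \<in> cycles C i" "\<alpha> = homologous C i `` {x}" by (rule C.homologyE)
    have s: "csc C r x \<in> cycles C i" by (rule C.vs.subspace_scale[OF C.cycles_sub x(1)])
    have s': "csc C' r (\<phi> x) \<in> cycles C' j" by (rule C'.vs.subspace_scale[OF C'.cycles_sub map(1)[OF x(1)]])
    show "\<Phi> (hscale C i r \<alpha>) = hscale C' j r (\<Phi> \<alpha>)"
      using scl[OF x(1), of r] C'.class_eq_iff[OF map(1)[OF s] s']
      by (simp add: x(2) C.hscale_class[OF x(1)] map(2)[OF s] map(2)[OF x(1)] C'.hscale_class[OF map(1)[OF x(1)]])
  qed
qed

lemma homology_isoD:
  assumes C: "lin_complex C" and C': "lin_complex C'" and iso: "homology_iso C i C' j \<Phi>"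
    and map: "\<And>x. x \<in> cycles C i \<Longrightarrow> \<phi> x \<in> cycles C' j" "\<And>x. x \<in> cycles C i \<Longrightarrow> \<Phi> (homologous C i `` {x}) = homologous C' j `` {\<phi> x}"
  shows "x \<in> cycles C i \<Longrightarrow> x' \<in> cycles C i \<Longrightarrow> (\<phi> x, \<phi> x') \<in> homologous C' j \<Longrightarrow> (x, x') \<in> homologous C i"
    and "y \<in> cycles C' j \<Longrightarrow> \<exists>x\<in>cycles C i. (\<phi> x, y) \<in> homologous C' j"
proof -
  interpret C: lin_complex C by fact
  interpret C': lin_complex C' by fact
  have b: "bij_betw \<Phi> (homology C i) (homology C' j)" using iso by (simp add: homology_iso_def)
  show "(x, x') \<in> homologous C i" if h: "x \<in> cycles C i" "x' \<in> cycles C i" "(\<phi> x, \<phi> x') \<in> homologous C' j"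
  proof -
    have "\<Phi> (homologous C i `` {x}) = \<Phi> (homologous C i `` {x'})"
      using h map C'.class_eq_iff[OF map(1)[OF h(1)] map(1)[OF h(2)]] by simp
    then have "homologous C i `` {x} = homologous C i `` {x'}"
      using b C.homologyI[OF h(1)] C.homologyI[OF h(2)] by (auto simp: bij_betw_def dest: inj_onD)
    then show ?thesis using C.class_eq_iff[OF h(1,2)] by simp
  qed
  show "\<exists>x\<in>cycles C i. (\<phi> x, y) \<in> homologous C' j" if y: "y \<in> cycles C' j"
  proof -
    have "homologous C' j `` {y} \<in> \<Phi> ` homology C i" using b C'.homologyI[OF y] by (simp add: bij_betw_def)
    then obtain x where x: "x \<in> cycles C i" "homologous C' j `` {y} = \<Phi> (homologous C i `` {x})"
      by (auto elim: C.homologyE)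
    then have "(\<phi> x, y) \<in> homologous C' j" using map y C'.class_eq_iff[OF map(1)[OF x(1)] y] by simp
    then show ?thesis using x(1) by blast
  qed
qed

section \<open>Hochschild homology classes and their cap products\<close>

lemma chains_simps [simp]:
  "csc (hochschild_chains A N) = chain_scale" "part (hochschild_chains A N) = chain_part A N"
  "rel (hochschild_chains A N) = chain_relations A N" "bd (hochschild_chains A N) i = chD A N"
  by (simp_all add: hochschild_chains_def chD_def)

lemma chains_lin: "lin_complex (hochschild_chains A N)"
  by unfold_locales (simp_all add: chain_part_eq chp_subspace rel_subspace chain.scale_right_distrib chain.scale_left_distrib)

context dg_bimodule begin

lemma cochains_simps [simp]:
  "csc (hochschild_cochains A M) = (\<lambda>r f w. scl M r (f w))" "part (hochschild_cochains A M) = cochain_part A M"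
  "rel (hochschild_cochains A M) = {0}" "bd (hochschild_cochains A M) i f = (\<lambda>w. if is_word A w then cD A M i f w else 0)"
  by (simp_all add: hochschild_cochains_def weak.cochain_D_eq fun_eq_iff)

lemma cochains_lin: "lin_complex (hochschild_cochains A M)"
proof -
  have vs: "vector_space (csc (hochschild_cochains A M))"
    by (rule vector_space.intro; rule ext; simp add: scale_right_distrib scale_left_distrib)
  interpret c: vector_space "csc (hochschild_cochains A M)" by (rule vs)
  show ?thesis
  proof unfold_locales
    fix i
    show "c.subspace (part (hochschild_cochains A M) i)"
    proof (rule c.subspaceI)
      show "0 \<in> part (hochschild_cochains A M) i"
        using weak.coch_closed(1)[of i] by (simp add: cochain_part_iff zero_fun_def)
    next
      fix f g assume "f \<in> part (hochschild_cochains A M) i" "g \<in> part (hochschild_cochains A M) i"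
      then show "f + g \<in> part (hochschild_cochains A M) i"
        using weak.coch_closed(2)[of i f g] by (simp add: cochain_part_iff plus_fun_def)
    next
      fix r f assume "f \<in> part (hochschild_cochains A M) i"
      then show "csc (hochschild_cochains A M) r f \<in> part (hochschild_cochains A M) i"
        using weak.coch_closed(5)[of i f r] by (simp add: cochain_part_iff)
    qed
    fix f g :: "'a word \<Rightarrow> 'm" and r
    show "bd (hochschild_cochains A M) i (f + g) = bd (hochschild_cochains A M) i f + bd (hochschild_cochains A M) i g"
      using weak.cD_add[of i f g] by (simp add: fun_eq_iff plus_fun_def)
    show "bd (hochschild_cochains A M) i (csc (hochschild_cochains A M) r f) = csc (hochschild_cochains A M) r (bd (hochschild_cochains A M) i f)"
      using weak.cD_scl[of i r f] by (simp add: fun_eq_iff)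
    show "c.subspace (rel (hochschild_cochains A M))"
      by (rule c.subspaceI) (auto simp: fun_eq_iff)
  qed
qed

lemma cocycle_iff: "f \<in> cycles (hochschild_cochains A M) i \<longleftrightarrow>
    coch A M i f \<and> (\<forall>w. \<not> is_word A w \<longrightarrow> f w = 0) \<and> (\<forall>w. is_word A w \<longrightarrow> cD A M i f w = 0)"
  by (auto simp: cycles_def cochain_part_iff fun_eq_iff)

lemma cycle_iff: "z \<in> cycles (hochschild_chains A M) i \<longleftrightarrow> z \<in> chain_part A M i \<and> chD A M z \<in> chain_relations A M"
  by (auto simp: cycles_def)

lemma restrict_cocycle:
  assumes "coch A M i f" "\<And>w. is_word A w \<Longrightarrow> cD A M i f w = 0"
  shows "(\<lambda>w. if is_word A w then f w else 0) \<in> cycles (hochschild_cochains A M) i"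
proof -
  have "coch A M i (\<lambda>w. if is_word A w then f w else 0)" by (rule A.coch_congA[OF assms(1)]) simp
  moreover have "cD A M i (\<lambda>w. if is_word A w then f w else 0) w = 0" if "is_word A w" for w
    using weak.cD_cong[OF that, of "\<lambda>w. if is_word A w then f w else 0" f i] assms(2)[OF that] by simp
  ultimately show ?thesis by (simp add: cocycle_iff)
qed

end

context cap_act begin

lemma cap_0: "z \<in> chain_part A B n \<Longrightarrow> cap act i z (\<lambda>_. 0) \<in> chain_relations A N"
  using cap_scl[OF N.weak.coch_closed(1)[of i], of z n 0] by simp

lemma cap_zero:
  assumes z: "z \<in> chain_part A B n" and f: "\<And>w. is_word A w \<Longrightarrow> f w = 0"
  shows "cap act i z f \<in> chain_relations A N"
proof -
  have "cap act i z f = cap act i z (\<lambda>_. 0)"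
    using z unfolding chain_part_eq by (rule cap_cong) (simp add: f is_word_lw)
  then show ?thesis using cap_0[OF z] by simp
qed

lemma cap_cocycle_leibniz:
  assumes f: "f \<in> cycles (hochschild_cochains A N) i" and z: "z \<in> chain_part A B n"
  shows "chD A N (cap act i z f) - cap act i (chD A B z) f \<in> chain_relations A N"
proof -
  have c: "coch A N i f" "\<And>w. is_word A w \<Longrightarrow> cD A N i f w = 0" using f by (auto simp: N.cocycle_iff)
  have "cap act (i - 1) z (cD A N i f) \<in> chain_relations A N" by (rule cap_zero[OF z c(2)])
  then have "sg n (cap act (i - 1) z (cD A N i f)) \<in> chain_relations A N" by (rule rel_closed(5))
  from rel_closed(2)[OF cap_leibniz[OF c(1) z] this] show ?thesis by simp
qed

lemma cap_cycle:
  assumes f: "f \<in> cycles (hochschild_cochains A N) i" and z: "z \<in> cycles (hochschild_chains A B) n"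
  shows "cap act i z f \<in> cycles (hochschild_chains A N) (n + i)"
proof -
  have c: "coch A N i f" using f by (auto simp: N.cocycle_iff)
  have z': "z \<in> chain_part A B n" "chD A B z \<in> chain_relations A B" using z by (auto simp: B.cycle_iff)
  from rel_closed(2)[OF cap_cocycle_leibniz[OF f z'(1)] cap_rel[OF c z'(2)]]
  show ?thesis using cap_part[OF c z'(1)] by (simp add: N.cycle_iff)
qed

lemma cap_homologous_left:
  assumes f: "f \<in> cycles (hochschild_cochains A N) i" and z: "(z, z') \<in> homologous (hochschild_chains A B) n"
  shows "(cap act i z f, cap act i z' f) \<in> homologous (hochschild_chains A N) (n + i)"
proof -
  have c: "coch A N i f" using f by (auto simp: N.cocycle_iff)
  obtain t where t: "z \<in> cycles (hochschild_chains A B) n" "z' \<in> cycles (hochschild_chains A B) n"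
    "t \<in> chain_part A B (n + 1)" "z - z' - chD A B t \<in> chain_relations A B"
    using z by (auto simp: homologous_def)
  have "cap act i (z - z' - chD A B t) f - (chD A N (cap act i t f) - cap act i (chD A B t) f) \<in> chain_relations A N"
    by (intro rel_closed(3) cap_rel[OF c t(4)] cap_cocycle_leibniz[OF f t(3)])
  then have "cap act i z f - cap act i z' f - chD A N (cap act i t f) \<in> chain_relations A N"
    by (simp add: cap_simps)
  moreover have "cap act i t f \<in> chain_part A N (n + i + 1)" using cap_part[OF c t(3)] by (simp add: algebra_simps)
  ultimately show ?thesis
    using cap_cycle[OF f t(1)] cap_cycle[OF f t(2)] by (auto simp: homologous_def)
qed

text \<open>By the Leibniz rule the cap product of a cycle with a coboundary is, up to sign and
  relations, the boundary of a cap product. Passing from \<open>f\<close> to \<open>f'\<close> plus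
  a coboundary uses their equality on words only.\<close>

lemma cap_homologous_right:
  assumes f: "(f, f') \<in> homologous (hochschild_cochains A N) i" and z: "z \<in> cycles (hochschild_chains A B) n"
  shows "(cap act i z f, cap act i z f') \<in> homologous (hochschild_chains A N) (n + i)"
proof -
  obtain g where g: "f \<in> cycles (hochschild_cochains A N) i" "f' \<in> cycles (hochschild_cochains A N) i"
    "g \<in> cochain_part A N (i + 1)" "f - f' - (\<lambda>w. if is_word A w then cD A N (i + 1) g w else 0) = 0"
    using f by (auto simp: homologous_def)
  have z': "z \<in> chain_part A B n" "chD A B z \<in> chain_relations A B" using z by (auto simp: B.cycle_iff)
  have c: "coch A N i f" "coch A N i f'" "coch A N (i + 1) g" using g by (auto simp: N.cocycle_iff cochain_part_iff)
  have eq: "f w = f' w + cD A N (i + 1) g w" if "is_word A w" for w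
    using fun_cong[OF g(4), of w] that by (simp add: algebra_simps)
  have "cap act i z f = cap act i z (\<lambda>w. f' w + cD A N (i + 1) g w)"
    using z'(1) unfolding chain_part_eq by (rule cap_cong) (simp add: eq is_word_lw)
  moreover have "cap act i z (\<lambda>w. f' w + cD A N (i + 1) g w) - cap act i z f' - cap act i z (cD A N (i + 1) g) \<in> chain_relations A N"
    by (rule cap_add[OF c(2) _ z'(1)]) (use N.weak.coch_cD[OF c(3)] in simp)
  ultimately have 1: "cap act i z f - cap act i z f' - cap act i z (cD A N (i + 1) g) \<in> chain_relations A N" by simp
  let ?c = "cap act (i + 1) z g"
  have 2: "chD A N ?c - cap act (i + 1) (chD A B z) g - sg n (cap act i z (cD A N (i + 1) g)) \<in> chain_relations A N"
    using cap_leibniz[OF c(3) z'(1)] by simp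
  have 3: "cap act (i + 1) (chD A B z) g \<in> chain_relations A N" by (rule cap_rel[OF c(3) z'(2)])
  have "(cap act i z f - cap act i z f' - cap act i z (cD A N (i + 1) g))
      - sg n (chD A N ?c - cap act (i + 1) (chD A B z) g - sg n (cap act i z (cD A N (i + 1) g)))
      - sg n (cap act (i + 1) (chD A B z) g) \<in> chain_relations A N"
    by (rule rel_closed(3)[OF rel_closed(3)[OF 1 rel_closed(5)[OF 2]] rel_closed(5)[OF 3]])
  moreover have "(cap act i z f - cap act i z f' - cap act i z (cD A N (i + 1) g))
      - sg n (chD A N ?c - cap act (i + 1) (chD A B z) g - sg n (cap act i z (cD A N (i + 1) g)))
      - sg n (cap act (i + 1) (chD A B z) g) = cap act i z f - cap act i z f' - chD A N (sg n ?c)"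
    by (cases "even n") (simp_all add: sg_def)
  ultimately have "cap act i z f - cap act i z f' - chD A N (sg n ?c) \<in> chain_relations A N" by (simp only:)
  moreover have "sg n ?c \<in> chain_part A N (n + i + 1)"
    using cap_part[OF c(3) z'(1)] by (simp add: chain_part_eq add.assoc)
  ultimately show ?thesis
    by (intro lin_complex.homologousI[OF chains_lin cap_cycle[OF g(1) z] cap_cycle[OF g(2) z]]) (simp_all only: chains_simps)
qed

lemma hcap_class:
  assumes z: "z \<in> cycles (hochschild_chains A B) d" and f: "f \<in> cycles (hochschild_cochains A N) (- p)"
  shows "hcap act A N d p (homologous (hochschild_chains A B) d `` {z}) (homologous (hochschild_cochains A N) (- p) `` {f})
    = homologous (hochschild_chains A N) (d - p) `` {cap act (- p) z f}"
  unfolding hcap_def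
proof (rule lin_complex.UN_class[OF chains_lin z], rule lin_complex.UN_class[OF N.cochains_lin f])
  interpret C: lin_complex "hochschild_chains A N" by (rule chains_lin)
  fix z' f' assume h: "(z, z') \<in> homologous (hochschild_chains A B) d" "(f, f') \<in> homologous (hochschild_cochains A N) (- p)"
  have f': "f' \<in> cycles (hochschild_cochains A N) (- p)" using h(2) by (auto simp: homologous_def)
  have "(cap act (- p) z f, cap act (- p) z' f') \<in> homologous (hochschild_chains A N) (d - p)"
    using C.homologous_trans[OF cap_homologous_right[OF h(2) z] cap_homologous_left[OF f' h(1)]] by simp
  then show "homologous (hochschild_chains A N) (d - p) `` {cap act (- p) z' f'} = homologous (hochschild_chains A N) (d - p) `` {cap act (- p) z f}"
    using C.homologous_sym C.homologous_trans by blast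
qed

end

section \<open>Change of coefficients along the augmentation\<close>

context augmented_dg_algebra begin

abbreviation "EC \<equiv> chain_coeff_map \<epsilon>"

lemma EC_linear: "Vector_Spaces.linear chain_scale chain_scale EC"
  unfolding chain_coeff_map_def by (rule chain_lin_linear)

lemmas EC_simps = linear_simps[OF EC_linear]

lemma EC_pure: "EC (pure (x, j) w) = pure (\<epsilon> x, j) w"
  by (simp add: chain_coeff_map_def)

lemma EC_gr: "x \<in> gr A j \<Longrightarrow> \<epsilon> x \<in> gr T j"
  using aug_degree[of x j] by simp

lemma EC_chD:
  assumes z: "z \<in> chain_part A (regular_bimod A) n" shows "EC (chD A (regular_bimod A) z) = chD A T (EC z)"
  using z unfolding chain_part_eq
proof (rule chp_induct)
  fix x j w
  have "EC (bdel A (\<lambda>v. pure (x, j) v) w :: ('k, 'a, 'a) chain) = bdel A (\<lambda>v. pure (\<epsilon> x, j) v) w"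
    using bd_hom[of EC A "\<lambda>v. pure (x, j) v" w] by (simp add: EC_simps EC_pure)
  then show "EC (chD A (regular_bimod A) (pure (x, j) w)) = chD A T (EC (pure (x, j) w))"
    by (simp add: chD_pure EC_simps EC_pure)
qed (auto simp: chain.subspace_def EC_simps)

lemma EC_part: "z \<in> chain_part A (regular_bimod A) n \<Longrightarrow> EC z \<in> chain_part A T n"
  unfolding chain_part_eq
proof (erule chp_induct)
  show "chain.subspace {z. EC z \<in> chp (\<lambda>x j. x \<in> gr T j) (\<lambda>a i. a \<in> gr A i) n}"
    using chp_closed by (auto simp: chain.subspace_def EC_simps)
next
  fix x j w assume "x \<in> gr (regular_bimod A) j" "lw (\<lambda>a i. a \<in> gr A i) w" "j + sdeg w = n"
  then show "EC (pure (x, j) w) \<in> chp (\<lambda>x j. x \<in> gr T j) (\<lambda>a i. a \<in> gr A i) n"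
    unfolding EC_pure by (intro pure_chp) (simp_all add: EC_gr del: T_simps(2))
qed

lemma EC_rel: "x \<in> chain_relations A (regular_bimod A) \<Longrightarrow> EC x \<in> chain_relations A T"
proof -
  assume x: "x \<in> chain_relations A (regular_bimod A)"
  have "x \<in> {x. EC x \<in> chain_relations A T}"
    using x
  proof (rule chain_relations_cases)
    show "chain.subspace {x. EC x \<in> chain_relations A T}" by (auto simp: chain.subspace_def EC_simps)
  next
    fix x y j w assume "x \<in> gr (regular_bimod A) j" "y \<in> gr (regular_bimod A) j" "is_word A w"
    then show "pure (x + y, j) w - pure (x, j) w - pure (y, j) w \<in> {x. EC x \<in> chain_relations A T}"
      using relations(1)[OF EC_gr EC_gr, of x j y A w] by (simp add: EC_simps EC_pure)
  next
    fix r x j w assume "x \<in> gr (regular_bimod A) j" "is_word A w"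
    then show "pure (scl (regular_bimod A) r x, j) w - chain_scale r (pure (x, j) w) \<in> {x. EC x \<in> chain_relations A T}"
      using relations(2)[OF EC_gr, of x j A w r] by (simp add: EC_simps EC_pure)
  next
    fix x j u a b i w assume "x \<in> gr (regular_bimod A) j" "a \<in> gr A i" "b \<in> gr A i" "is_word A u" "is_word A w"
    then show "pure (x, j) (u @ (a + b, i) # w) - pure (x, j) (u @ (a, i) # w) - pure (x, j) (u @ (b, i) # w) \<in> {x. EC x \<in> chain_relations A T}"
      using relations(3)[OF EC_gr, of x j a A i b u w] by (simp add: EC_simps EC_pure)
  next
    fix r x j u a i w assume "x \<in> gr (regular_bimod A) j" "a \<in> gr A i" "is_word A u" "is_word A w"
    then show "pure (x, j) (u @ (scl A r a, i) # w) - chain_scale r (pure (x, j) (u @ (a, i) # w)) \<in> {x. EC x \<in> chain_relations A T}"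
      using relations(4)[OF EC_gr, of x j a A i u w r] by (simp add: EC_simps EC_pure)
  qed
  then show ?thesis by simp
qed

lemma EC_homologous:
  assumes "(z, z') \<in> homologous (hochschild_chains A (regular_bimod A)) n"
  shows "(EC z, EC z') \<in> homologous (hochschild_chains A T) n"
proof -
  interpret R: dg_bimodule A "regular_bimod A" by (rule regular_dg_bimodule)
  interpret T: dg_bimodule A T by (rule trivial_dg_bimodule)
  have c: "EC x \<in> cycles (hochschild_chains A T) n" if "x \<in> cycles (hochschild_chains A (regular_bimod A)) n" for x
    using that EC_part EC_rel EC_chD[of x n, symmetric] by (auto simp: R.cycle_iff T.cycle_iff)
  obtain t where t: "z \<in> cycles (hochschild_chains A (regular_bimod A)) n" "z' \<in> cycles (hochschild_chains A (regular_bimod A)) n"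
    "t \<in> chain_part A (regular_bimod A) (n + 1)" "z - z' - chD A (regular_bimod A) t \<in> chain_relations A (regular_bimod A)"
    using assms by (auto simp: homologous_def)
  have "EC z - EC z' - chD A T (EC t) \<in> chain_relations A T"
    using EC_rel[OF t(4)] EC_chD[OF t(3)] by (simp add: EC_simps)
  then show ?thesis using c t(1,2) EC_part[OF t(3)] by (auto simp: homologous_def)
qed

end

section \<open>Exactness of the cone and isomorphisms on homology\<close>

context dg_duality begin

text \<open>The long exact sequence of the cone in elementary form: injectivity in one degree makes
  \<open>f\<close> a coboundary, and surjectivity in the next one adjusts the primitive by a cocycle
  until the rest of \<open>y\<close> is a boundary.\<close>

lemma cone_exact_of_iso:
  assumes iso: "\<And>p. homology_iso (ext_complex A \<epsilon>) (- p) (tor_complex A \<epsilon>) (d - p)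
           (hcap (*) A T d p (homologous (tor_complex A \<epsilon>) d `` {EC z}))"
  shows "cone_exact A (\<lambda>a i. a \<in> gr A i) T z d"
  unfolding cone_exact_def
proof (intro allI impI)
  interpret capk: cap_act A T T "(*)"
  proof (intro cap_act.intro cap_act_axioms.intro T.N.dg_bimodule_axioms)
    fix x y j i assume "x \<in> gr T j" "y \<in> gr T i"
    then show "x * y \<in> gr T (j + i)" by (auto split: if_splits)
  qed (simp_all add: distrib_left distrib_right)
  have zc: "z \<in> cycles (hochschild_chains A (regular_bimod A)) d" using z_part z_cycle by (simp add: Reg.cycle_iff)
  have ECz: "EC z \<in> cycles (hochschild_chains A T) d"
    using EC_part[OF z_part] EC_rel[OF z_cycle] EC_chD[OF z_part] by (simp add: T.N.cycle_iff)
  \<comment> \<open>\<open>A\<close> acts on the ground field through \<open>\<epsilon>\<close>, so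
    reducing the coefficients of \<open>z\<close> first gives the same product.\<close>
  have capEC: "cap (*) i (EC z) f = cap (lact T) i z f" for i f
    using z_part unfolding chain_part_eq
  proof (rule chp_induct)
    show "chain.subspace {z. cap (*) i (EC z) f = cap (lact T) i z f}"
      unfolding chain.subspace_def mem_Collect_eq EC_simps capk.cap_simps capT.cap_simps by (auto simp del: T_simps)
  next
    fix x j w show "cap (*) i (EC (pure (x, j) w)) f = cap (lact T) i (pure (x, j) w) f"
      unfolding EC_pure capk.cap_pure capT.cap_pure by simp
  qed
  note iso' = iso[unfolded tor_complex_def ext_complex_def]
  have map1: "cap (*) (- p) (EC z) f \<in> cycles (hochschild_chains A T) (d - p)"
    if "f \<in> cycles (hochschild_cochains A T) (- p)" for p f
    using capk.cap_cycle[OF that ECz] by simp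
  note D = homology_isoD[where \<phi> = "cap (*) (- p) (EC z)" for p, OF T.N.cochains_lin chains_lin iso' map1 capk.hcap_class[OF ECz]]
  fix i f y assume f: "coch A T i f" "\<forall>w. lw (\<lambda>a i. a \<in> gr A i) w \<longrightarrow> cD A T i f w = 0"
    and y: "y \<in> chp (\<lambda>x j. x \<in> gr T j) (\<lambda>a i. a \<in> gr A i) (d + i + 1)" "chD A T y - cap (lact T) i z f \<in> RT"
  have yp: "y \<in> chain_part A T (d + i + 1)" using y(1) by (simp only: chain_part_eq)
  define f' where "f' w = (if is_word A w then f w else 0)" for w
  have f': "f' \<in> cycles (hochschild_cochains A T) (- (- i))"
    unfolding f'_def minus_minus by (rule T.N.restrict_cocycle[OF f(1)]) (use f(2) in \<open>simp add: is_word_lw\<close>)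
  have zero: "0 \<in> cycles (hochschild_cochains A T) (- (- i))"
    using T.N.weak.coch_closed(1)[of i] T.N.weak.cD_0[of i] by (simp add: T.N.cocycle_iff zero_fun_def)
  have capf': "cap (lact T) i z f' = cap (lact T) i z f"
    by (rule capT.cap_cong[OF z_chp]) (simp add: f'_def b_word)
  have c0: "cap (lact T) i z 0 \<in> RT" by (rule capT.cap_zero[OF z_part]) simp
  have "(cap (*) (- (- i)) (EC z) f', cap (*) (- (- i)) (EC z) 0) \<in> homologous (hochschild_chains A T) (d - (- i))"
  proof (rule lin_complex.homologousI[OF chains_lin map1[OF f'] map1[OF zero], of y])
    have "- (chD A T y - cap (lact T) i z f) - cap (lact T) i z 0 \<in> RT" by (rule rel_closed(3)[OF rel_closed(4)[OF y(2)] c0])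
    then show "cap (*) (- (- i)) (EC z) f' - cap (*) (- (- i)) (EC z) 0 - bd (hochschild_chains A T) (d - - i + 1) y \<in> rel (hochschild_chains A T)"
      by (simp add: capEC capf' algebra_simps)
  qed (use yp in simp)
  \<comment> \<open>Injectivity: \<open>y\<close> bounds the cap product with \<open>f\<close>, so
    the class of \<open>f\<close> is zero.\<close>
  from D(1)[OF _ _ f' zero this] obtain g where g: "g \<in> cochain_part A T (i + 1)"
    "f' - 0 - (\<lambda>w. if is_word A w then cD A T (i + 1) g w else 0) = 0"
    by (auto simp: homologous_def)
  have cg: "coch A T (i + 1) g" using g(1) by (simp add: cochain_part_iff)
  have Dg: "cD A T (i + 1) g w = f w" if "is_word A w" for w
    using fun_cong[OF g(2), of w] that by (simp add: f'_def)
  let ?y = "y - sg d (cap (lact T) (i + 1) z g)"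
  have cgp: "cap (lact T) (i + 1) z g \<in> chain_part A T (d + i + 1)" using capT.cap_part[OF cg z_part] by (simp add: add.assoc)
  have "?y \<in> cycles (hochschild_chains A T) (d - (- (i + 1)))"
  proof -
    have "?y \<in> chain_part A T (d + i + 1)" using yp cgp unfolding chain_part_eq by (intro chp_closed(3) chp_closed(6))
    moreover have "chD A T ?y \<in> RT"
    proof -
      have 1: "chD A T (cap (lact T) (i + 1) z g) - cap (lact T) (i + 1) (chD A (regular_bimod A) z) g - sg d (cap (lact T) i z (cD A T (i + 1) g)) \<in> RT"
        using capT.cap_leibniz[OF cg z_part] by simp
      have 2: "cap (lact T) (i + 1) (chD A (regular_bimod A) z) g \<in> RT" by (rule capT.cap_rel[OF cg z_cycle])
      have 3: "cap (lact T) i z (cD A T (i + 1) g) = cap (lact T) i z f"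
        by (rule capT.cap_cong[OF z_chp]) (simp add: Dg b_word)
      have "(chD A T y - cap (lact T) i z f) - sg d (chD A T (cap (lact T) (i + 1) z g) - cap (lact T) (i + 1) (chD A (regular_bimod A) z) g - sg d (cap (lact T) i z f))
         - sg d (cap (lact T) (i + 1) (chD A (regular_bimod A) z) g) \<in> RT"
        by (rule rel_closed(3)[OF rel_closed(3)[OF y(2) rel_closed(5)[OF 1[unfolded 3]]] rel_closed(5)[OF 2]])
      moreover have "(chD A T y - cap (lact T) i z f) - sg d (chD A T (cap (lact T) (i + 1) z g) - cap (lact T) (i + 1) (chD A (regular_bimod A) z) g - sg d (cap (lact T) i z f))
         - sg d (cap (lact T) (i + 1) (chD A (regular_bimod A) z) g) = chD A T ?y"
        by (cases "even d") (simp_all add: sg_def)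
      ultimately show ?thesis by (simp only:)
    qed
    ultimately show ?thesis by (simp add: T.N.cycle_iff algebra_simps)
  qed
  \<comment> \<open>Surjectivity in cochain degree \<open>i + 1\<close>: what remains of
    \<open>y\<close> after \<open>g\<close> is a cycle, hence homologous to the cap product with a
    cocycle \<open>f1\<close>.\<close>
  from D(2)[OF _ _ this] obtain f1 where f1: "f1 \<in> cycles (hochschild_cochains A T) (- (- (i + 1)))"
    "(cap (*) (- (- (i + 1))) (EC z) f1, ?y) \<in> homologous (hochschild_chains A T) (d - (- (i + 1)))" by blast
  have f1c: "coch A T (i + 1) f1" "\<And>w. is_word A w \<Longrightarrow> cD A T (i + 1) f1 w = 0" using f1(1) unfolding minus_minus by (auto simp: T.N.cocycle_iff)
  have cf1: "cap (*) (- (- (i + 1))) (EC z) f1 = cap (lact T) (i + 1) z f1" by (simp only: capEC minus_minus)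
  obtain t where t: "t \<in> chain_part A T (d - (- (i + 1)) + 1)" "cap (lact T) (i + 1) z f1 - ?y - chD A T t \<in> RT"
    using f1(2) unfolding cf1 by (auto simp: homologous_def)
  \<comment> \<open>Converts the plain cap product with \<open>f1\<close> into the one with the sign
    \<open>sg d\<close> demanded by the cone.\<close>
  let ?e = "sg d 1 :: 'k"
  let ?f1 = "\<lambda>w. scl T ?e (f1 w)"
  have f2: "coch A T (i + 1) ?f1" by (rule T.N.weak.coch_closed(5)[OF f1c(1)])
  have gf: "coch A T (i + 1) (\<lambda>w. g w + ?f1 w)" by (rule T.N.weak.coch_closed(2)[OF cg f2])
  have Dgf: "cD A T (i + 1) (\<lambda>w. g w + ?f1 w) w = f w" if "is_word A w" for w
    unfolding T.N.weak.cD_add T.N.weak.cD_scl using Dg[OF that] f1c(2)[OF that] by simp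
  have a: "cap (lact T) (i + 1) z (\<lambda>w. g w + ?f1 w) - cap (lact T) (i + 1) z g - cap (lact T) (i + 1) z ?f1 \<in> RT"
    by (rule capT.cap_add[OF cg f2 z_part])
  have b: "cap (lact T) (i + 1) z ?f1 - chain_scale ?e (cap (lact T) (i + 1) z f1) \<in> RT"
    by (rule capT.cap_scl[OF f1c(1) z_part])
  have "- (cap (lact T) (i + 1) z f1 - ?y - chD A T t) - sg d (cap (lact T) (i + 1) z (\<lambda>w. g w + ?f1 w) - cap (lact T) (i + 1) z g - cap (lact T) (i + 1) z ?f1)
      - sg d (cap (lact T) (i + 1) z ?f1 - chain_scale ?e (cap (lact T) (i + 1) z f1)) \<in> RT"
    by (rule rel_closed(3)[OF rel_closed(3)[OF rel_closed(4)[OF t(2)] rel_closed(5)[OF a]] rel_closed(5)[OF b]])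
  moreover have "- (cap (lact T) (i + 1) z f1 - ?y - chD A T t) - sg d (cap (lact T) (i + 1) z (\<lambda>w. g w + ?f1 w) - cap (lact T) (i + 1) z g - cap (lact T) (i + 1) z ?f1)
      - sg d (cap (lact T) (i + 1) z ?f1 - chain_scale ?e (cap (lact T) (i + 1) z f1)) = y - sg d (cap (lact T) (i + 1) z (\<lambda>w. g w + ?f1 w)) - chD A T (- t)"
    unfolding chain.scale_of_sg by (cases "even d") (simp_all add: sg_def)
  ultimately have r: "y - sg d (cap (lact T) (i + 1) z (\<lambda>w. g w + ?f1 w)) - chD A T (- t) \<in> RT" by (simp only:)
  have "d - (- (i + 1)) + 1 = d + i + 2" by simp
  then have tp: "- t \<in> chp (\<lambda>x j. x \<in> gr T j) (\<lambda>a i. a \<in> gr A i) (d + i + 2)"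
    using t(1) unfolding chain_part_eq by (intro chp_closed(4)) (simp only:)
  show "\<exists>g t. coch A T (i + 1) g \<and> t \<in> chp (\<lambda>x j. x \<in> gr T j) (\<lambda>a i. a \<in> gr A i) (d + i + 2) \<and>
      (\<forall>w. lw (\<lambda>a i. a \<in> gr A i) w \<longrightarrow> cD A T (i + 1) g w = f w) \<and>
      y - sg d (cap (lact T) (i + 1) z g) - chD A T t \<in> RT"
    using gf tp Dgf[unfolded is_word_lw] r by blast
qed

text \<open>The converse passage: injectivity is exactness at a cocycle together with a chain
  bounding its cap product, surjectivity is exactness at a cycle together with the zero
  cochain.\<close>

lemma iso_of_cone_exact:
  assumes ce: "cone_exact A (\<lambda>a i. a \<in> gr A i) N z d"
  shows "homology_iso (hochschild_cochains A N) (- p) (hochschild_chains A N) (d - p)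
    (hcap (lact N) A N d p (homologous (hochschild_chains A (regular_bimod A)) d `` {z}))"
proof -
  interpret C: lin_complex "hochschild_chains A N" by (rule chains_lin)
  interpret C': lin_complex "hochschild_cochains A N" by (rule N.cochains_lin)
  have zc: "z \<in> cycles (hochschild_chains A (regular_bimod A)) d" using z_part z_cycle by (simp add: Reg.cycle_iff)
  have cc: "cap (lact N) (- p) z f \<in> cycles (hochschild_chains A N) (d - p)" if "f \<in> cycles (hochschild_cochains A N) (- p)" for f
    using capN.cap_cycle[OF that zc] by simp
  show ?thesis
  proof (rule homology_isoI[where \<phi> = "cap (lact N) (- p) z", OF N.cochains_lin chains_lin cc capN.hcap_class[OF zc]])
    fix f g assume h: "f \<in> cycles (hochschild_cochains A N) (- p)" "g \<in> cycles (hochschild_cochains A N) (- p)"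
    have s: "f + g \<in> cycles (hochschild_cochains A N) (- p)" by (rule C'.vs.subspace_add[OF C'.cycles_sub h])
    show "(cap (lact N) (- p) z (f + g), cap (lact N) (- p) z f + cap (lact N) (- p) z g) \<in> homologous (hochschild_chains A N) (d - p)"
    proof (rule C.homologous_rel[OF cc[OF s] C.vs.subspace_add[OF C.cycles_sub cc[OF h(1)] cc[OF h(2)]]])
      have "cap (lact N) (- p) z (\<lambda>w. f w + g w) - cap (lact N) (- p) z f - cap (lact N) (- p) z g \<in> RN"
        using h by (intro capN.cap_add[OF _ _ z_part]) (auto simp: N.cocycle_iff)
      then show "cap (lact N) (- p) z (f + g) - (cap (lact N) (- p) z f + cap (lact N) (- p) z g) \<in> rel (hochschild_chains A N)"
        by (simp add: plus_fun_def diff_diff_add)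
    qed
  next
    fix r f assume h: "f \<in> cycles (hochschild_cochains A N) (- p)"
    have s: "csc (hochschild_cochains A N) r f \<in> cycles (hochschild_cochains A N) (- p)" by (rule C'.vs.subspace_scale[OF C'.cycles_sub h])
    show "(cap (lact N) (- p) z (csc (hochschild_cochains A N) r f), csc (hochschild_chains A N) r (cap (lact N) (- p) z f)) \<in> homologous (hochschild_chains A N) (d - p)"
    proof (rule C.homologous_rel[OF cc[OF s] C.vs.subspace_scale[OF C.cycles_sub cc[OF h]]])
      show "cap (lact N) (- p) z (csc (hochschild_cochains A N) r f) - csc (hochschild_chains A N) r (cap (lact N) (- p) z f) \<in> rel (hochschild_chains A N)"
        using h capN.cap_scl[OF _ z_part, of "- p" f r] by (simp add: N.cocycle_iff)
    qed
  next
    fix f assume h: "f \<in> cycles (hochschild_cochains A N) (- p)" "(cap (lact N) (- p) z f, 0) \<in> homologous (hochschild_chains A N) (d - p)"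
    then obtain t where t: "t \<in> chain_part A N (d - p + 1)" "cap (lact N) (- p) z f - 0 - chD A N t \<in> RN"
      by (auto simp: homologous_def)
    have f: "coch A N (- p) f" "\<And>w. is_word A w \<Longrightarrow> cD A N (- p) f w = 0" "\<And>w. \<not> is_word A w \<Longrightarrow> f w = 0"
      using h(1) by (auto simp: N.cocycle_iff)
    have tp: "t \<in> chp (\<lambda>x j. x \<in> gr N j) (\<lambda>a i. a \<in> gr A i) (d + - p + 1)" using t(1) by (simp add: chain_part_eq)
    have tr: "chD A N t - cap (lact N) (- p) z f \<in> RN" using rel_closed(4)[OF t(2)] by simp
    obtain g where g: "coch A N (- p + 1) g" "\<And>w. is_word A w \<Longrightarrow> cD A N (- p + 1) g w = f w"
      using cone_exactD[OF ce f(1) f(2)[unfolded is_word_lw] tp tr] unfolding is_word_lw by blast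
    define g' where "g' w = (if is_word A w then g w else 0)" for w
    have g': "coch A N (- p + 1) g'" by (rule coch_congA[OF g(1)]) (simp add: g'_def)
    have Dg': "cD A N (- p + 1) g' w = f w" if "is_word A w" for w
      using N.weak.cD_cong[OF that, of g' g "- p + 1"] g(2)[OF that] by (simp add: g'_def)
    show "(f, 0) \<in> homologous (hochschild_cochains A N) (- p)"
    proof (rule C'.homologousI[OF h(1) C'.vs.subspace_0[OF C'.cycles_sub]])
      show "g' \<in> part (hochschild_cochains A N) (- p + 1)" using g' by (simp add: cochain_part_iff g'_def)
      show "f - 0 - bd (hochschild_cochains A N) (- p + 1) g' \<in> rel (hochschild_cochains A N)"
        using Dg' f(3) by (auto simp: fun_eq_iff simp del: add_uminus_conv_diff uminus_add_conv_diff)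
    qed
  next
    fix y assume y: "y \<in> cycles (hochschild_chains A N) (d - p)"
    \<comment> \<open>The zero cochain is taken one degree below, so that the primitive provided by
      the cone is a cocycle of degree \<open>- p\<close>.\<close>
    let ?i = "- p - 1"
    have yp: "y \<in> chp (\<lambda>x j. x \<in> gr N j) (\<lambda>a i. a \<in> gr A i) (d + ?i + 1)" using y by (simp add: N.cycle_iff chain_part_eq)
    have yr: "chD A N y - cap (lact N) ?i z (\<lambda>_. 0) \<in> RN"
      using y capN.cap_0[OF z_part, of ?i] by (intro rel_closed(3)) (auto simp: N.cycle_iff)
    obtain g t where g: "coch A N (?i + 1) g" "t \<in> chp (\<lambda>x j. x \<in> gr N j) (\<lambda>a i. a \<in> gr A i) (d + ?i + 2)"
      "\<And>w. is_word A w \<Longrightarrow> cD A N (?i + 1) g w = 0"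
      "y - sg d (cap (lact N) (?i + 1) z g) - chD A N t \<in> RN"
      using cone_exactD[OF ce N.weak.coch_closed(1) N.weak.cD_0 yp yr] unfolding is_word_lw by blast
    have i1: "?i + 1 = - p" by simp
    let ?e = "sg d 1 :: 'k"
    let ?g = "\<lambda>w. scl N ?e (g w)"
    have g': "coch A N (- p) ?g" using N.weak.coch_closed(5)[OF g(1)] unfolding i1 .
    have Dg: "cD A N (- p) ?g w = 0" if "is_word A w" for w
      using g(3)[OF that] unfolding i1 N.weak.cD_scl by simp
    let ?h = "\<lambda>w. if is_word A w then ?g w else 0"
    have h: "?h \<in> cycles (hochschild_cochains A N) (- p)" by (rule N.restrict_cocycle[OF g' Dg])
    have ch: "cap (lact N) (- p) z ?h = cap (lact N) (- p) z ?g" by (rule capN_cong) (simp add: b_word)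
    have b: "cap (lact N) (- p) z ?g - chain_scale ?e (cap (lact N) (- p) z g) \<in> RN"
      by (rule capN.cap_scl[OF _ z_part]) (use g(1) in \<open>simp add: i1\<close>)
    have "(cap (lact N) (- p) z ?h, y) \<in> homologous (hochschild_chains A N) (d - p)"
    proof (rule C.homologousI[OF cc[OF h] y, of "- t"])
      have "d + ?i + 2 = d - p + 1" by simp
      then show "- t \<in> part (hochschild_chains A N) (d - p + 1)"
        using g(2) unfolding chains_simps chain_part_eq by (intro chp_closed(4)) (simp only:)
      have "(cap (lact N) (- p) z ?g - chain_scale ?e (cap (lact N) (- p) z g)) - (y - sg d (cap (lact N) (- p) z g) - chD A N t) \<in> RN"
        using g(4) b unfolding i1 by (rule rel_closed(3)[rotated])
      then show "cap (lact N) (- p) z ?h - y - bd (hochschild_chains A N) (d - p + 1) (- t) \<in> rel (hochschild_chains A N)"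
        unfolding ch chain.scale_of_sg by (simp add: algebra_simps)
    qed
    then show "\<exists>x\<in>cycles (hochschild_cochains A N) (- p). (cap (lact N) (- p) z x, y) \<in> homologous (hochschild_chains A N) (d - p)"
      using h by blast
  qed
qed

end

section \<open>The theorem\<close>

text \<open>As \<open>A\<close> is zero in degree \<open>1\<close>, there are no boundaries in
  degree \<open>0\<close>, and the isomorphism on homology says in particular that a cycle with
  augmentation zero is zero. Hence \<open>dif\<close> is injective on the augmentation ideal of
  degree \<open>0\<close>, and a linear left inverse exists.\<close>

lemma contraction_exists:
  assumes A: "augmented_dg_algebra A \<epsilon>" and nonneg: "nonneg_upper_graded A"
    and iso: "homology_iso (underlying_complex A) 0 (underlying_complex (trivial_bimod \<epsilon>)) 0
           (hmap \<epsilon> (underlying_complex (trivial_bimod \<epsilon>)) 0)"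
  shows "\<exists>s. contraction A \<epsilon> s"
proof -
  interpret augmented_dg_algebra A \<epsilon> by fact
  let ?U = "underlying_complex A" and ?V = "underlying_complex T"
  have U: "csc ?U = scl A" "part ?U = gr A" "rel ?U = {0}" "bd ?U i = dif A" for i
    by (simp_all add: underlying_complex_def)
  have V: "csc ?V = (*)" "part ?V = gr T" "rel ?V = {0}" "bd ?V i x = 0" for i x
    by (simp_all add: underlying_complex_def del: T_simps(2))
  interpret U: lin_complex ?U
    by (intro lin_complex.intro lin_complex_axioms.intro; unfold U) (simp_all add: vector_space_axioms gr_subspace)
  interpret V: lin_complex ?V
    by (intro lin_complex.intro lin_complex_axioms.intro; unfold V) (auto simp: fld.vector_space_axioms fld.subspace_def)
  have g1: "gr A 1 = {0}" using nonneg by (simp add: nonneg_upper_graded_def)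
  have cyc: "x \<in> cycles ?U 0 \<longleftrightarrow> x \<in> gr A 0 \<and> dif A x = 0" for x by (simp add: cycles_def U)
  have cV: "x \<in> cycles ?V 0" for x by (simp add: cycles_def V)
  have hU: "(x, y) \<in> homologous ?U 0 \<longleftrightarrow> x \<in> cycles ?U 0 \<and> x = y" for x y
    by (auto simp: homologous_def U g1)
  have hm: "hmap \<epsilon> ?V 0 (homologous ?U 0 `` {x}) = homologous ?V 0 `` {\<epsilon> x}" if "x \<in> cycles ?U 0" for x
    unfolding hmap_def using that by (intro U.UN_class) (auto simp: hU)
  have inj: "x = 0" if "x \<in> gr A 0" "dif A x = 0" "\<epsilon> x = 0" for x
  proof -
    have "(x, 0) \<in> homologous ?U 0"
      using homology_isoD(1)[OF U.lin_complex_axioms V.lin_complex_axioms iso cV hm, of x 0] that V.homologous_refl[OF cV, of 0]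
      by (simp add: cyc)
    then show ?thesis by (simp add: hU)
  qed
  let ?K = "{a \<in> gr A 0. \<epsilon> a = 0}"
  have K: "subspace ?K" by (auto simp: subspace_def)
  have injK: "inj_on (dif A) ?K"
  proof (rule inj_onI)
    fix x y assume "x \<in> ?K" "y \<in> ?K" "dif A x = dif A y"
    then show "x = y" using inj[of "x - y"] by auto
  qed
  interpret p: vector_space_pair "scl A" "scl A" ..
  obtain r where r: "r ` UNIV \<subseteq> ?K" "Vector_Spaces.linear (scl A) (scl A) r" "\<And>v. v \<in> ?K \<Longrightarrow> r (dif A v) = v"
    using p.linear_exists_left_inverse_on[OF dif_linear K injK] by blast
  note rs = linear_simps[OF r(2)]
  have rK: "r x \<in> gr A 0" "\<epsilon> (r x) = 0" for x using r(1) by auto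
  \<comment> \<open>The left inverse is linear on all of \<open>A\<close>; taking the component of
    degree \<open>-1\<close> first makes \<open>s\<close> homogeneous.\<close>
  define s where "s a = r (cmp A a (-1))" for a
  have "contraction A \<epsilon> s"
  proof (intro contraction.intro contraction_axioms.intro A)
    show "gr A i = {0}" if "i > 0" for i using nonneg that by (simp add: nonneg_upper_graded_def)
    show "s (a + b) = s a + s b" "s (scl A q a) = scl A q (s a)" for a b q
      by (simp_all add: s_def cmp_add cmp_scl rs)
    show s0: "s a = 0" if "a \<in> gr A i" "i \<noteq> -1" for a i using that by (simp add: s_def cmp_gr rs)
    show "s a \<in> gr A (i + 1)" if "a \<in> gr A i" for a i
      using s0[OF that] rK(1) by (cases "i = -1") (simp_all add: s_def)
    show "\<epsilon> (s a) = 0" for a by (simp add: s_def rK)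
    show "s (dif A a) = a - scl A (\<epsilon> a) 1" if a: "a \<in> gr A 0" for a
    proof -
      have da: "dif A a \<in> gr A (-1)" using dif_degree[OF a] by simp
      have "r (dif A (a - scl A (\<epsilon> a) 1)) = a - scl A (\<epsilon> a) 1"
        using a one_degree by (intro r(3)) auto
      then show ?thesis by (simp add: s_def cmp_gr[OF da])
    qed
  qed
  then show ?thesis by blast
qed

theorem corollary14:
  fixes A :: "('k::field, 'a::ring_1) dg"
    and \<epsilon> :: "'a \<Rightarrow> 'k"
    and N :: "('k, 'a, 'n::ab_group_add) dg_bimod"
    and d :: int
    and c :: "('k, 'a, 'a) chain set"
    and \<mu> :: "('k, 'k, 'a) chain set"
  assumes "augmented_dg_algebra A \<epsilon>"
    and "nonneg_upper_graded A"
    and "homology_iso (underlying_complex A) 0 (underlying_complex (trivial_bimod \<epsilon>)) 0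
           (hmap \<epsilon> (underlying_complex (trivial_bimod \<epsilon>)) 0)"
    and "c \<in> homology (hochschild_chains A (regular_bimod A)) d"
    and "\<mu> = hmap (chain_coeff_map \<epsilon>) (tor_complex A \<epsilon>) d c"
    and "\<exists>n > 0. \<forall>i. i \<le> - n \<or> n \<le> i \<longrightarrow> homology_zero (tor_complex A \<epsilon>) i"
    and "\<And>i. homology_finite_dim (tor_complex A \<epsilon>) i"
    and "\<And>p. homology_iso (ext_complex A \<epsilon>) (- p) (tor_complex A \<epsilon>) (d - p)
           (hcap (*) A (trivial_bimod \<epsilon>) d p \<mu>)"
    and "dg_bimodule A N"
    and "nonneg_upper_graded N"
  shows "\<forall>p. homology_iso (hochschild_cochains A N) (- p) (hochschild_chains A N) (d - p)
           (hcap (lact N) A N d p c)"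
proof -
  obtain s where s: "contraction A \<epsilon> s" using contraction_exists assms(1-3) by blast
  interpret contraction A \<epsilon> s by fact
  let ?R = "regular_bimod A"
  interpret R: contraction_dg A \<epsilon> s ?R
    by (intro contraction_dg.intro s regular_dg_bimodule)
  interpret CR: lin_complex "hochschild_chains A ?R" by (rule chains_lin)
  obtain z0 where z0: "z0 \<in> cycles (hochschild_chains A ?R) d" "c = homologous (hochschild_chains A ?R) d `` {z0}"
    using CR.homologyE[OF assms(4)] by blast
  have z0p: "z0 \<in> chain_part A ?R d" "chD A ?R z0 - 0 \<in> chain_relations A ?R" using z0(1) by (auto simp: R.N.cycle_iff)
  \<comment> \<open>A representative in standard form is reached in two moves within the class:
    first the letters become negative, then the coefficients enter the subalgebra.\<close>
  obtain t1 b where b: "t1 \<in> chain_part A ?R (d + 1)" "b \<in> R.CB d" "z0 - chD A ?R t1 - b \<in> chain_relations A ?R"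
    using R.chain_rel_exact[OF z0p(1) _ z0p(2)] by blast
  have "chD A ?R z0 - chD A ?R (chD A ?R t1) - chD A ?R (z0 - chD A ?R t1 - b) \<in> chain_relations A ?R"
    using z0p(2) R.N.chD_chD[OF b(1)] R.N.chD_rel[OF b(3)] by (intro rel_closed(3)) simp_all
  then have bc: "chD A ?R b \<in> chain_relations A ?R" by simp
  have bb: "b \<in> chp (\<lambda>x j. x \<in> gr A j) b_letter d" using b(2) by simp
  obtain t2 z where z: "t2 \<in> chp (\<lambda>x j. x \<in> gr A j) b_letter (d + 1)" "z \<in> chp tl_letter b_letter d"
    "b - chD A ?R t2 - z \<in> chain_relations A ?R"
    using chain_coeff_exact[OF bb bc] by blast
  have t2: "t2 \<in> chain_part A ?R (d + 1)" using R.CB_part z(1) by simp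
  have "chD A ?R b - chD A ?R (chD A ?R t2) - chD A ?R (b - chD A ?R t2 - z) \<in> chain_relations A ?R"
    by (intro rel_closed(3)[OF rel_closed(3)] bc R.N.chD_chD[OF t2] R.N.chD_rel[OF z(3)])
  then have zc: "chD A ?R z \<in> chain_relations A ?R" by simp
  interpret dg_duality A \<epsilon> s N z d
    by (intro dg_duality.intro contraction_dg.intro dg_duality_axioms.intro s assms(9) z(2) zc)
  have zcyc: "z \<in> cycles (hochschild_chains A ?R) d" using z_part zc by (simp add: R.N.cycle_iff)
  have "(z0, z) \<in> homologous (hochschild_chains A ?R) d"
  proof (rule CR.homologousI[OF z0(1) zcyc, of "t1 + t2"])
    show "t1 + t2 \<in> part (hochschild_chains A ?R) (d + 1)" using b(1) t2 by (simp add: chain_part_eq)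
    have "(z0 - chD A ?R t1 - b) + (b - chD A ?R t2 - z) \<in> chain_relations A ?R" by (rule rel_closed(2)[OF b(3) z(3)])
    then show "z0 - z - bd (hochschild_chains A ?R) (d + 1) (t1 + t2) \<in> rel (hochschild_chains A ?R)"
      by (simp add: algebra_simps)
  qed
  then have cz: "c = homologous (hochschild_chains A ?R) d `` {z}" using z0(2) CR.class_eq_iff[OF z0(1) zcyc] by simp
  \<comment> \<open>The class over the ground field is represented by the image of the same cycle
    \<open>z\<close>, which ties its cap product to the one over \<open>N\<close>.\<close>
  have mu: "\<mu> = homologous (tor_complex A \<epsilon>) d `` {EC z}"
    unfolding assms(5) cz hmap_def
  proof (rule CR.UN_class[OF zcyc])
    interpret CT: lin_complex "hochschild_chains A T" by (rule chains_lin)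
    fix x' assume "(z, x') \<in> homologous (hochschild_chains A ?R) d"
    from EC_homologous[OF this] show "homologous (tor_complex A \<epsilon>) d `` {EC x'} = homologous (tor_complex A \<epsilon>) d `` {EC z}"
      unfolding tor_complex_def using CT.homologous_sym CT.homologous_trans by blast
  qed
  interpret DT: dg_duality A \<epsilon> s T z d
    by (intro dg_duality.intro contraction_dg.intro dg_duality_axioms.intro s trivial_dg_bimodule z(2) zc)
  \<comment> \<open>Exactness over the ground field is first restricted to negative letters, since
    the passage to \<open>N\<close> uses the filtration available there; afterwards all letters are
    readmitted.\<close>
  have "cone_exact A (\<lambda>a i. a \<in> gr A i) T z d" by (rule cone_exact_of_iso) (use assms(8) mu in simp)
  then have "cone_exact A b_letter T z d" by (rule DT.cone_exact_all_to_b)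
  then have "cone_exact A b_letter N z d"
    by (rule cone_exact_from_trivial) (use assms(10) in \<open>simp add: nonneg_upper_graded_def\<close>)
  then have "cone_exact A (\<lambda>a i. a \<in> gr A i) N z d" by (rule cone_exact_b_to_all)
  then show ?thesis unfolding cz using iso_of_cone_exact by blast
qed

end
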